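(* We have \[ N^{\mathrm{tw}}_7(X)=c^{\mathrm{tw}}_7X^{1/6}+O(X^{1/12}\log^5X) \] for $X\ge2$, where $c^{\mathrm{tw}}_7=Q_7R_7/\zeta(2)$.
   Context: Two elliptic curves over $\mathbb{Q}$ are twist equivalent if one is $\mathbb{Q}$-isomorphic to a quadratic twist $y^2=x^3+c^2Ax+c^3B$ ($c\in\mathbb{Q}^\times$) of the other $y^2=x^3+Ax+B$. For integers $A,B$ with $4A^3+27B^2\ne0$ let $H(A,B)=\max(|4A^3|,|27B^2|)$, $\mathrm{tmd}(A,B)$ the largest positive integer $e$ with $e^2\mid A$, $e^3\mid B$, and $\mathrm{twht}(A,B)=H(A,B)/\mathrm{tmd}(A,B)^6$; the twist height of an elliptic curve is $\mathrm{twht}$ of any integral model, and is an invariant of its twist class. $N^{\mathrm{tw}}_7(X)$ is the number of twist equivalence classes of elliptic curves over $\mathbb{Q}$ with twist height $\le X$ admitting a cyclic $7$-isogeny defined over $\mathbb{Q}$. Let $f_7(t)=-3(t^2+t+7)(t^2-231t+735)$, $g_7(t)=2(t^2+t+7)(t^4+518t^3-11025t^2+6174t-64827)$, $A_7(a,b)=b^4f_7(a/b)$, $B_7(a,b)=b^6g_7(a/b)$. $R_7$ is the area of $\{(a,b)\in\mathbb{R}^2: H(A_7(a,b),B_7(a,b))\le1,\ b\ge0\}$. For $n\ge1$, $T_7(n)$ is the number of residues $t\in\mathbb{Z}/n^3\mathbb{Z}$ with $n^2\mid f_7(t)$ and $n^3\mid g_7(t)$, and \[ Q_7=\sum_{n\ge1}\frac{\varphi(n)T_7(n)}{n^3\prod_{\ell\mid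 n}(1+1/\ell)} \] (product over primes $\ell$ dividing $n$; $\varphi$ Euler's totient). *)

theory Defs
  imports "HOL-Analysis.Analysis" "HOL-Number_Theory.Number_Theory"
begin

section \<open>Elliptic curves over the rationals\<close>

text \<open>The pair \<open>(A, B)\<close> stands for the curve \<open>y\<^sup>2 = x\<^sup>3 + A x + B\<close> over the rationals.\<close>

type_synonym curve = "rat \<times> rat"

definition elliptic_curves :: "curve set" where
  "elliptic_curves = {(A, B). 4 * A ^ 3 + 27 * B ^ 2 \<noteq> 0}"

text \<open>Geometric points, with coordinates in the algebraically closed field of complex numbers.\<close>

datatype point = Infinity | Affine complex complex

fun points :: "curve \<Rightarrow> point set" where
  "points (A, B) =
     insert Infinity {Affine x y | x y. y ^ 2 = x ^ 3 + of_rat A * x + of_rat B}"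

text \<open>The chord-and-tangent group law.\<close>

fun ec_add :: "curve \<Rightarrow> point \<Rightarrow> point \<Rightarrow> point" where
  "ec_add E Infinity Q = Q"
| "ec_add E P Infinity = P"
| "ec_add (A, B) (Affine x1 y1) (Affine x2 y2) =
     (if x1 = x2 \<and> y1 = - y2 then Infinity
      else let m = (if x1 = x2 then (3 * x1 ^ 2 + of_rat A) / (2 * y1)
                    else (y2 - y1) / (x2 - x1));
               x3 = m ^ 2 - x1 - x2
           in Affine x3 (m * (x1 - x3) - y1))"

definition ec_mult :: "curve \<Rightarrow> nat \<Rightarrow> point \<Rightarrow> point" where
  "ec_mult E m P = (ec_add E P ^^ m) Infinity"

subsection \<open>Morphisms defined over the rationals\<close>

fun hcoords :: "point \<Rightarrow> complex \<times> complex \<times> complex" where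
  "hcoords Infinity = (0, 1, 0)"
| "hcoords (Affine x y) = (x, y, 1)"

text \<open>The ternary form of degree \<open>d\<close> in which \<open>X\<^sup>i Y\<^sup>j Z\<^sup>k\<close> (with \<open>i + j + k = d\<close>)
  has the rational coefficient \<open>c i j\<close>; other values of \<open>c\<close> are irrelevant.\<close>

fun eval_form :: "nat \<Rightarrow> (nat \<Rightarrow> nat \<Rightarrow> rat) \<Rightarrow> complex \<times> complex \<times> complex \<Rightarrow> complex" where
  "eval_form d c (x, y, z) =
     (\<Sum>i\<le>d. \<Sum>j\<le>d - i. of_rat (c i j) * x ^ i * y ^ j * z ^ (d - i - j))"

definition eval_forms ::
  "nat \<Rightarrow> (nat \<Rightarrow> nat \<Rightarrow> rat) \<Rightarrow> (nat \<Rightarrow> nat \<Rightarrow> rat) \<Rightarrow> (nat \<Rightarrow> nat \<Rightarrow> rat) \<Rightarrow> point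
     \<Rightarrow> complex \<times> complex \<times> complex" where
  "eval_forms d F G H P =
     (eval_form d F (hcoords P), eval_form d G (hcoords P), eval_form d H (hcoords P))"

text \<open>A morphism of projective curves over the rationals: around every point it is given by
  three rational forms of a common degree that do not all vanish there.\<close>

definition morphism_over_Q :: "curve \<Rightarrow> curve \<Rightarrow> (point \<Rightarrow> point) \<Rightarrow> bool" where
  "morphism_over_Q E E' \<phi> \<longleftrightarrow>
     \<phi> ` points E \<subseteq> points E' \<and>
     (\<forall>P\<in>points E. \<exists>d F G H.
        eval_forms d F G H P \<noteq> (0, 0, 0) \<and>
        (\<forall>Q\<in>points E. eval_forms d F G H Q \<noteq> (0, 0, 0) \<longrightarrow>
           (\<exists>s. s \<noteq> 0 \<and>
              (case hcoords (\<phi> Q) of (x, y, z) \<Rightarrow>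
                 eval_forms d F G H Q = (s * x, s * y, s * z)))))"

definition isomorphic_over_Q :: "curve \<Rightarrow> curve \<Rightarrow> bool" where
  "isomorphic_over_Q E E' \<longleftrightarrow>
     E \<in> elliptic_curves \<and> E' \<in> elliptic_curves \<and>
     (\<exists>\<phi> \<psi>. morphism_over_Q E E' \<phi> \<and> morphism_over_Q E' E \<psi> \<and>
        \<phi> Infinity = Infinity \<and>
        (\<forall>P\<in>points E. \<psi> (\<phi> P) = P) \<and> (\<forall>P\<in>points E'. \<phi> (\<psi> P) = P))"

definition isogeny_over_Q :: "curve \<Rightarrow> curve \<Rightarrow> (point \<Rightarrow> point) \<Rightarrow> bool" where
  "isogeny_over_Q E E' \<phi> \<longleftrightarrow>
     E \<in> elliptic_curves \<and> E' \<in> elliptic_curves \<and>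
     morphism_over_Q E E' \<phi> \<and> \<phi> Infinity = Infinity \<and>
     (\<exists>P\<in>points E. \<phi> P \<noteq> Infinity)"

definition isogeny_kernel :: "curve \<Rightarrow> (point \<Rightarrow> point) \<Rightarrow> point set" where
  "isogeny_kernel E \<phi> = {P \<in> points E. \<phi> P = Infinity}"

definition cyclic_of_order :: "curve \<Rightarrow> nat \<Rightarrow> point set \<Rightarrow> bool" where
  "cyclic_of_order E n K \<longleftrightarrow>
     (\<exists>P\<in>points E. K = range (\<lambda>m. ec_mult E m P)) \<and> finite K \<and> card K = n"

definition admits_cyclic_isogeny :: "nat \<Rightarrow> curve \<Rightarrow> bool" where
  "admits_cyclic_isogeny n E \<longleftrightarrow>
     (\<exists>E' \<phi>. isogeny_over_Q E E' \<phi> \<and> cyclic_of_order E n (isogeny_kernel E \<phi>))"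

section \<open>Twist classes and twist height\<close>

fun quadratic_twist :: "rat \<Rightarrow> curve \<Rightarrow> curve" where
  "quadratic_twist c (A, B) = (c ^ 2 * A, c ^ 3 * B)"

definition twist_equivalence :: "(curve \<times> curve) set" where
  "twist_equivalence =
     {(E, E'). E \<in> elliptic_curves \<and> E' \<in> elliptic_curves \<and>
        (\<exists>c. c \<noteq> 0 \<and> isomorphic_over_Q E' (quadratic_twist c E))}"

definition HH :: "'a::linordered_idom \<Rightarrow> 'a \<Rightarrow> 'a" where
  "HH A B = max \<bar>4 * A ^ 3\<bar> \<bar>27 * B ^ 2\<bar>"

definition tmd :: "int \<Rightarrow> int \<Rightarrow> nat" where
  "tmd A B = Max {e. e > 0 \<and> int e ^ 2 dvd A \<and> int e ^ 3 dvd B}"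

definition twht :: "int \<Rightarrow> int \<Rightarrow> real" where
  "twht A B = real_of_int (HH A B) / real (tmd A B) ^ 6"

text \<open>All integral models of a curve have the same \<open>twht\<close>, and one always exists,
  so the description is proper for every elliptic curve.\<close>

definition twist_height :: "curve \<Rightarrow> real" where
  "twist_height E =
     (THE h. \<exists>A B :: int. isomorphic_over_Q E (of_int A, of_int B) \<and> h = twht A B)"

definition N_tw :: "nat \<Rightarrow> real \<Rightarrow> nat" where
  "N_tw n X =
     card ({E \<in> elliptic_curves. twist_height E \<le> X \<and> admits_cyclic_isogeny n E}
             // twist_equivalence)"

section \<open>The leading constant\<close>

definition f7 :: "'a::comm_ring_1 \<Rightarrow> 'a" where
  "f7 t = - 3 * (t ^ 2 + t + 7) * (t ^ 2 - 231 * t + 735)"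

definition g7 :: "'a::comm_ring_1 \<Rightarrow> 'a" where
  "g7 t = 2 * (t ^ 2 + t + 7) *
     (t ^ 4 + 518 * t ^ 3 - 11025 * t ^ 2 + 6174 * t - 64827)"

text \<open>The homogenizations \<open>b\<^sup>4 f7 (a / b)\<close> and \<open>b\<^sup>6 g7 (a / b)\<close>, written as polynomials so
  that they also have the intended values at \<open>b = 0\<close>.\<close>

definition A7 :: "real \<Rightarrow> real \<Rightarrow> real" where
  "A7 a b = - 3 * (a ^ 2 + a * b + 7 * b ^ 2) * (a ^ 2 - 231 * a * b + 735 * b ^ 2)"

definition B7 :: "real \<Rightarrow> real \<Rightarrow> real" where
  "B7 a b = 2 * (a ^ 2 + a * b + 7 * b ^ 2) *
     (a ^ 4 + 518 * a ^ 3 * b - 11025 * a ^ 2 * b ^ 2 + 6174 * a * b ^ 3 - 64827 * b ^ 4)"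

lemma A7_eq: "b \<noteq> 0 \<Longrightarrow> A7 a b = b ^ 4 * f7 (a / b)"
  by (simp add: A7_def f7_def field_simps power2_eq_square power4_eq_xxxx)

lemma B7_eq:
  assumes "b \<noteq> 0"
  shows "B7 a b = b ^ 6 * g7 (a / b)"
proof -
  define t where "t = a / b"
  have a: "a = t * b"
    using assms by (simp add: t_def)
  show ?thesis
    unfolding t_def[symmetric] unfolding a B7_def g7_def
    by (simp add: eval_nat_numeral algebra_simps)
qed

definition R7 :: real where
  "R7 = measure lborel {(a, b). HH (A7 a b) (B7 a b) \<le> 1 \<and> b \<ge> 0}"

definition T7 :: "nat \<Rightarrow> nat" where
  "T7 n = card {t :: int. t \<in> {0..<int n ^ 3} \<and> int n ^ 2 dvd f7 t \<and> int n ^ 3 dvd g7 t}"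

definition Q7 :: real where
  "Q7 = (\<Sum>\<^sub>\<infinity>n\<in>{1..}. real (totient n) * real (T7 n) /
           (real n ^ 3 * (\<Prod>l\<in>prime_factors n. 1 + 1 / real l)))"

definition zeta2 :: real where
  "zeta2 = (\<Sum>\<^sub>\<infinity>n\<in>{1::nat..}. 1 / real n ^ 2)"

definition c7_tw :: real where
  "c7_tw = Q7 * R7 / zeta2"

end

theory Submission
  imports Defs "HOL-Computational_Algebra.Computational_Algebra"
begin

text \<open>A cyclic subgroup of order 7 that is the kernel of a rational isogeny is stable under
  conjugation, and Tate's normal form of a point of order 7 shows that up to a quadratic twist the
  curve belongs to a family with one rational parameter; conversely Velu's formulas give the isogeny
  for every member. So twist classes correspond, up to few collisions of the parameter, to coprime
  pairs \<open>(a, b)\<close> whose height is at most \<open>X e\<^sup>6\<close>, where \<open>e\<close> is the twist minimality defect of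
  \<open>(A\<^sub>7(a, b), B\<^sub>7(a, b))\<close>. Moebius inversion turns the count into a sum over lattices
  \<open>{(a, b). d | a, d | b, n\<^sup>3 | a - t b}\<close> with \<open>n\<^sup>2 | f\<^sub>7(t)\<close> and \<open>n\<^sup>3 | g\<^sub>7(t)\<close>. Resultants show that \<open>n\<^sup>3\<close> divides
  a constant multiple of the positive definite form \<open>a\<^sup>2 + a b + 7 b\<^sup>2\<close> on such a lattice. Hence these
  lattices are never skew, the number of lattice points in the region is its area over the
  determinant with an error of the order of the square root, and the errors can be summed.\<close>

text \<open>The definition of morphism is local and geometric, so the arithmetic enters through two
  derived facts. Growth rates at infinity, which play the role of pole orders, show that a rational
  isomorphism is a scaling. Conjugation is expressed through minimal polynomials: the rational
  duplication formula recovers the orbit of Tate's parameter \<open>d\<close> from any x-coordinate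
  of the kernel, and the sum \<open>s\<close> of that orbit has the same value at all conjugates,
  hence is rational.

  The obstacle in the count is that infinitely many lattices contribute, so an error bound with an
  additive constant would be useless. The lower bound for the quadratic form empties the sparse
  lattices altogether and turns every error into a power of the main term. The fifth power of the
  logarithm is the order of a pole: \<open>T7 n\<close> is bounded by a multiple of the number of
  divisors of \<open>n ^ 3\<close>, whose Dirichlet series has a pole of order 4 at 1, and the
  coprimality condition adds one.\<close>

definition rp :: "rat poly \<Rightarrow> complex \<Rightarrow> complex" where
 "rp p x = poly (map_poly of_rat p) x"

lemma rp_0 [simp]: "rp 0 x = 0"
 by (simp add: rp_def)

lemma rp_pCons [simp]: "rp (pCons a p) x = of_rat a + x * rp p x"
 by (simp add: rp_def map_poly_pCons)

lemma rp_1 [simp]: "rp 1 x = 1"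
 using rp_pCons[of 1 0 x] by (simp add: one_pCons)

lemma rp_add [simp]: "rp (p + q) x = rp p x + rp q x"
 by (induction p q rule: poly_induct2) (auto simp: of_rat_add algebra_simps)

lemma rp_smult [simp]: "rp (Polynomial.smult c p) x = of_rat c * rp p x"
 by (induction p) (auto simp: of_rat_mult algebra_simps)

lemma rp_minus [simp]: "rp (- p) x = - rp p x"
 using rp_smult[of "-1" p x] by simp

lemma rp_diff [simp]: "rp (p - q) x = rp p x - rp q x"
 using rp_add[of p "- q" x] by simp

lemma rp_mult [simp]: "rp (p * q) x = rp p x * rp q x"
 by (induction p) (auto simp: algebra_simps)

lemma rp_power [simp]: "rp (p ^ n) x = rp p x ^ n"
 by (induction n) auto

lemma rp_pcompose [simp]: "rp (pcompose p q) x = rp p (rp q x)"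
 by (induction p) (auto simp: pcompose_pCons)

lemma map_poly_of_rat_0 [simp]: "map_poly (of_rat :: rat \<Rightarrow> complex) p = 0 \<longleftrightarrow> p = 0"
 by (simp add: map_poly_eq_0_iff)

lemma degree_map_poly_of_rat [simp]: "degree (map_poly (of_rat :: rat \<Rightarrow> complex) p) = degree p"
 by (rule degree_map_poly) auto

lemma rp_finite_roots: "p \<noteq> 0 \<Longrightarrow> finite {x. rp p x = 0}"
 unfolding rp_def by (rule poly_roots_finite) simp

lemma rp_root_exists:
 assumes "degree p > 0" shows "\<exists>x. rp p x = 0"
 unfolding rp_def
 by (rule fundamental_theorem_of_algebra) (use assms in \<open>simp add: constant_degree\<close>)

subsection \<open>Regular functions on the affine curve\<close>

definition on_curve :: "curve \<Rightarrow> complex \<Rightarrow> complex \<Rightarrow> bool" where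
 "on_curve E x y \<longleftrightarrow> y ^ 2 = x ^ 3 + of_rat (fst E) * x + of_rat (snd E)"

definition cubic :: "curve \<Rightarrow> rat poly" where
 "cubic E = [:snd E, fst E, 0, 1:]"

lemma rp_cubic: "rp (cubic E) x = x ^ 3 + of_rat (fst E) * x + of_rat (snd E)"
 by (simp add: cubic_def algebra_simps eval_nat_numeral)

lemma on_curve_iff: "on_curve E x y \<longleftrightarrow> y ^ 2 = rp (cubic E) x"
 by (simp add: on_curve_def rp_cubic)

lemma points_iff [simp]: "Affine x y \<in> points E \<longleftrightarrow> on_curve E x y" "Infinity \<in> points E"
 by (cases E; auto simp: on_curve_def)+

lemma on_curve_uminus [simp]: "on_curve E x (- y) \<longleftrightarrow> on_curve E x y"
 by (simp add: on_curve_def)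

lemma on_curve_csqrt: "on_curve E x (csqrt (rp (cubic E) x))"
 by (simp add: on_curve_iff)

text \<open>The coordinate ring of the affine curve, as functions on complex points:
  \<open>y ^ 2\<close> reduces to a polynomial in \<open>x\<close>, so \<open>p + q y\<close> is its
  general element. Values off the curve are irrelevant.\<close>

definition rfun :: "curve \<Rightarrow> (complex \<Rightarrow> complex \<Rightarrow> complex) \<Rightarrow> bool" where
 "rfun E F \<longleftrightarrow> (\<exists>p q. \<forall>x y. on_curve E x y \<longrightarrow> F x y = rp p x + rp q x * y)"

lemma rfunI: "(\<And>x y. on_curve E x y \<Longrightarrow> F x y = rp p x + rp q x * y) \<Longrightarrow> rfun E F"
 unfolding rfun_def by blast

lemma rfun_rp: "rfun E (\<lambda>x y. rp p x)"
 by (rule rfunI[of _ _ p 0]) auto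

lemma rfun_x: "rfun E (\<lambda>x y. x)"
 by (rule rfunI[of _ _ "[:0,1:]" 0]) auto

lemma rfun_y: "rfun E (\<lambda>x y. y)"
 by (rule rfunI[of _ _ 0 1]) auto

lemma rfun_const: "rfun E (\<lambda>x y. of_rat c)"
 by (rule rfunI[of _ _ "[:c:]" 0]) auto

lemma rfun_add: "rfun E F \<Longrightarrow> rfun E G \<Longrightarrow> rfun E (\<lambda>x y. F x y + G x y)"
proof -
 assume "rfun E F" "rfun E G"
 then obtain p q p' q' where "\<And>x y. on_curve E x y \<Longrightarrow> F x y = rp p x + rp q x * y"
  "\<And>x y. on_curve E x y \<Longrightarrow> G x y = rp p' x + rp q' x * y"
  unfolding rfun_def by metis
 then show ?thesis
  by (intro rfunI[of _ _ "p + p'" "q + q'"]) (auto simp: algebra_simps)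
qed

lemma rfun_mult: "rfun E F \<Longrightarrow> rfun E G \<Longrightarrow> rfun E (\<lambda>x y. F x y * G x y)"
proof -
 assume "rfun E F" "rfun E G"
 then obtain p q p' q' where *: "\<And>x y. on_curve E x y \<Longrightarrow> F x y = rp p x + rp q x * y"
  "\<And>x y. on_curve E x y \<Longrightarrow> G x y = rp p' x + rp q' x * y"
  unfolding rfun_def by metis
 show ?thesis
 proof (rule rfunI[of _ _ "p * p' + q * q' * cubic E" "p * q' + q * p'"])
  fix x y assume xy: "on_curve E x y"
  have "F x y * G x y = rp p x * rp p' x + rp q x * rp q' x * y ^ 2 + (rp p x * rp q' x + rp q x * rp p' x) * y"
   by (simp add: * xy algebra_simps power2_eq_square)
  then show "F x y * G x y = rp (p * p' + q * q' * cubic E) x + rp (p * q' + q * p') x * y"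
   using xy by (simp add: on_curve_iff)
 qed
qed

lemma rfun_power: "rfun E F \<Longrightarrow> rfun E (\<lambda>x y. F x y ^ n)"
proof (induction n)
 case 0
 show ?case using rfun_const[of E 1] by simp
qed (auto intro: rfun_mult)

lemma rfun_sum: "finite I \<Longrightarrow> (\<And>i. i \<in> I \<Longrightarrow> rfun E (F i)) \<Longrightarrow> rfun E (\<lambda>x y. \<Sum>i\<in>I. F i x y)"
proof (induction I rule: finite_induct)
 case empty
 show ?case using rfun_const[of E 0] by simp
qed (auto intro: rfun_add)

lemma rfun_form: "rfun E (\<lambda>x y. eval_form d c (x, y, 1))"
 by (auto intro!: rfun_sum rfun_mult rfun_power rfun_x rfun_y rfun_const)

text \<open>A function that is locally a quotient of regular functions is regular: a generator of
 its ideal of denominators in \<open>\<rat>[x]\<close> cannot have a root, since the norm of a local denominator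
 lies in that ideal.\<close>

lemma rfun_local:
 assumes loc: "\<And>x0 y0. on_curve E x0 y0 \<Longrightarrow> \<exists>F H. rfun E F \<and> rfun E H \<and> H x0 y0 \<noteq> 0 \<and>
   (\<forall>x y. on_curve E x y \<longrightarrow> F x y = X x y * H x y)"
 shows "rfun E X"
proof -
 define J where "J m \<longleftrightarrow> m \<noteq> 0 \<and> rfun E (\<lambda>x y. rp m x * X x y)" for m
 have norm: "\<exists>N. J N \<and> rp N x0 \<noteq> 0" for x0
 proof -
  define y0 where "y0 = csqrt (rp (cubic E) x0)"
  have on: "on_curve E x0 y0" "on_curve E x0 (- y0)"
   by (simp_all add: y0_def on_curve_csqrt)
  obtain F1 H1 where 1: "rfun E F1" "rfun E H1" "H1 x0 y0 \<noteq> 0"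
   "\<And>x y. on_curve E x y \<Longrightarrow> F1 x y = X x y * H1 x y" using loc[OF on(1)] by blast
  obtain F2 H2 where 2: "rfun E F2" "rfun E H2" "H2 x0 (- y0) \<noteq> 0"
   "\<And>x y. on_curve E x y \<Longrightarrow> F2 x y = X x y * H2 x y" using loc[OF on(2)] by blast
  \<comment> \<open>One denominator has to be nonzero at both points over \<open>x0\<close>. If
    \<open>H1\<close> and \<open>H2\<close> each vanish at the other point, their sum vanishes at
    neither.\<close>
  have "\<exists>F H. rfun E F \<and> rfun E H \<and> H x0 y0 \<noteq> 0 \<and> H x0 (- y0) \<noteq> 0 \<and>
   (\<forall>x y. on_curve E x y \<longrightarrow> F x y = X x y * H x y)"
  proof (cases "H1 x0 (- y0) \<noteq> 0 \<or> H2 x0 y0 \<noteq> 0")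
   case True
   then show ?thesis using 1 2 by blast
  next
   case False
   show ?thesis
    by (intro exI[of _ "\<lambda>x y. F1 x y + F2 x y"] exI[of _ "\<lambda>x y. H1 x y + H2 x y"])
      (use False 1 2 in \<open>auto intro: rfun_add simp: algebra_simps\<close>)
  qed
  then obtain F H where FH: "rfun E F" "rfun E H" "H x0 y0 \<noteq> 0" "H x0 (- y0) \<noteq> 0"
   "\<And>x y. on_curve E x y \<Longrightarrow> F x y = X x y * H x y" by blast
  obtain p q where pq: "\<And>x y. on_curve E x y \<Longrightarrow> H x y = rp p x + rp q x * y"
   using FH(2) unfolding rfun_def by blast
  \<comment> \<open>The norm of \<open>H\<close> to the rational polynomials in \<open>x\<close>:
    the product of \<open>H\<close> with its conjugate under \<open>y\<close> to
    \<open>- y\<close>.\<close>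
  define N where "N = p\<^sup>2 - q\<^sup>2 * cubic E"
  have N: "rp N x = H x y * (rp p x - rp q x * y)" if "on_curve E x y" for x y
  proof -
   have "rp N x = rp p x ^ 2 - rp q x ^ 2 * y ^ 2"
    using that by (simp add: N_def on_curve_iff)
   also have "\<dots> = (rp p x + rp q x * y) * (rp p x - rp q x * y)"
    by (simp add: algebra_simps power2_eq_square)
   finally show ?thesis using pq[OF that] by simp
  qed
  have "rp N x0 = H x0 y0 * H x0 (- y0)"
   using N[OF on(1)] pq[OF on(2)] by simp
  then have N0: "rp N x0 \<noteq> 0" using FH by simp
  have "rfun E (\<lambda>x y. (rp p x + (- 1) * (rp q x * y)) * F x y)"
   using rfun_const[of E "-1"]
   by (intro rfun_mult rfun_add rfun_rp rfun_y FH) auto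
  moreover have "(rp p x + (- 1) * (rp q x * y)) * F x y = rp N x * X x y" if "on_curve E x y" for x y
   by (simp add: FH(5)[OF that] N[OF that] algebra_simps)
  ultimately have "rfun E (\<lambda>x y. rp N x * X x y)"
   unfolding rfun_def by fastforce
  then show ?thesis using N0 unfolding J_def by (intro exI[of _ N]) auto
 qed
 then have "\<exists>m. J m" by blast
 then obtain m where m: "J m" "\<And>m'. J m' \<Longrightarrow> degree m \<le> degree m'"
  using ex_has_least_nat[of J _ degree] by blast
 have "degree m = 0"
 proof (rule ccontr)
  assume "degree m \<noteq> 0"
  then obtain x0 where x0: "rp m x0 = 0" using rp_root_exists[of m] by auto
  obtain N where N: "J N" "rp N x0 \<noteq> 0" using norm by blast
  define r where "r = N mod m"
  have r: "r = N - (N div m) * m" by (simp add: r_def minus_div_mult_eq_mod)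
  have "rfun E (\<lambda>x y. rp N x * X x y)" and mX: "rfun E (\<lambda>x y. rp m x * X x y)"
   using N m(1) unfolding J_def by auto
  from rfun_add[OF this(1) rfun_mult[OF rfun_rp mX]]
  have "rfun E (\<lambda>x y. rp N x * X x y + rp (- (N div m)) x * (rp m x * X x y))" .
  then have "rfun E (\<lambda>x y. rp r x * X x y)"
   unfolding r by (simp add: algebra_simps)
  moreover have "r \<noteq> 0"
  proof
   assume "r = 0"
   then have "rp N x0 = rp (N div m) x0 * rp m x0" using r by (metis eq_iff_diff_eq_0 rp_mult)
   then show False using x0 N by simp
  qed
  ultimately have "degree m \<le> degree r" using m(2) unfolding J_def by blast
  moreover have "degree r < degree m"
   using degree_mod_less[of m N] \<open>r \<noteq> 0\<close> m(1) unfolding r_def J_def by auto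
  ultimately show False by simp
 qed
 then obtain c where c: "m = [:c:]" by (metis degree_eq_zeroE)
 have "rfun E (\<lambda>x y. of_rat (inverse c) * (rp m x * X x y))"
  using m(1) unfolding J_def by (intro rfun_mult[OF rfun_const]) auto
 moreover have "of_rat (inverse c) * (rp m x * X x y) = X x y" for x y
  using m(1) unfolding J_def c by (simp add: of_rat_inverse)
 ultimately show ?thesis by simp
qed

subsection \<open>Growth at infinity\<close>

lemma rp_growth:
 assumes "p \<noteq> 0"
 shows "\<exists>R K1 K2. R \<ge> 1 \<and> K1 > 0 \<and> K2 > 0 \<and>
  (\<forall>x. norm x \<ge> R \<longrightarrow> K1 * norm x ^ degree p \<le> norm (rp p x) \<and> norm (rp p x) \<le> K2 * norm x ^ degree p)"
 using assms
proof (induction p)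
 case (pCons a p)
 show ?case
 proof (cases "p = 0")
  case True
  then show ?thesis using pCons
   by (intro exI[of _ 1] exI[of _ "norm (of_rat a :: complex)"]) auto
 next
  case False
  then obtain R K1 K2 where R: "R \<ge> 1" "K1 > 0" "K2 > 0"
   "\<And>x. norm x \<ge> R \<Longrightarrow> K1 * norm x ^ degree p \<le> norm (rp p x)"
   "\<And>x. norm x \<ge> R \<Longrightarrow> norm (rp p x) \<le> K2 * norm x ^ degree p"
   using pCons by blast
  define c where "c = norm (of_rat a :: complex)"
  define R' where "R' = max R (2 * c / K1)"
  have "K1 / 2 * norm x ^ degree (pCons a p) \<le> norm (rp (pCons a p) x) \<and>
     norm (rp (pCons a p) x) \<le> (K2 + c) * norm x ^ degree (pCons a p)" if "norm x \<ge> R'" for x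
  proof -
   have x: "norm x \<ge> R" "norm x \<ge> 1" "K1 * norm x \<ge> 2 * c"
    using that R(1,2) by (auto simp: R'_def field_simps)
   have p1: "norm x ^ degree p \<ge> 1" using x by simp
   have d: "norm x ^ degree (pCons a p) = norm x * norm x ^ degree p"
    using False by simp
   have "2 * c * 1 \<le> (K1 * norm x) * norm x ^ degree p"
    using x p1 R(2) mult_mono[of "2 * c" "K1 * norm x" 1 "norm x ^ degree p"] by (auto simp: c_def)
   then have c1: "c \<le> K1 / 2 * (norm x * norm x ^ degree p)" by simp
   have "c * 1 \<le> c * (norm x * norm x ^ degree p)"
    using x p1 mult_mono[of 1 "norm x" 1 "norm x ^ degree p"] by (intro mult_left_mono) (auto simp: c_def)
   then have c2: "c \<le> c * (norm x * norm x ^ degree p)" by simp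
   have m1: "K1 * (norm x * norm x ^ degree p) \<le> norm (x * rp p x)"
    using mult_left_mono[OF R(4)[OF x(1)], of "norm x"] by (simp add: norm_mult mult_ac)
   have m2: "norm (x * rp p x) \<le> K2 * (norm x * norm x ^ degree p)"
    using mult_left_mono[OF R(5)[OF x(1)], of "norm x"] by (simp add: norm_mult mult_ac)
   have "norm (rp (pCons a p) x) \<ge> norm (x * rp p x) - c"
    using norm_diff_ineq[of "x * rp p x" "of_rat a"] by (simp add: c_def add.commute)
   moreover have "norm (rp (pCons a p) x) \<le> norm (x * rp p x) + c"
    using norm_triangle_ineq[of "x * rp p x" "of_rat a"] by (simp add: c_def add.commute)
   ultimately show ?thesis
    using c1 c2 m1 m2 unfolding d by (simp add: algebra_simps)
  qed
  moreover have "R' \<ge> 1" "K1 / 2 > 0" "K2 + c > 0" using R by (auto simp: R'_def c_def add_pos_nonneg)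
  ultimately show ?thesis by blast
 qed
qed simp

text \<open>\<open>ord_growth E F n\<close>: at infinity the function grows like \<open>|x|\<close> to the power \<open>n / 2\<close>.\<close>

definition ord_growth :: "curve \<Rightarrow> (complex \<Rightarrow> complex \<Rightarrow> complex) \<Rightarrow> nat \<Rightarrow> bool" where
 "ord_growth E F n \<longleftrightarrow> (\<exists>R K1 K2. R \<ge> 1 \<and> K1 > 0 \<and> K2 > 0 \<and>
   (\<forall>x y. on_curve E x y \<longrightarrow> norm x \<ge> R \<longrightarrow>
    K1 * norm x ^ n \<le> norm (F x y) ^ 2 \<and> norm (F x y) ^ 2 \<le> K2 * norm x ^ n))"

lemma ord_growthI:
 assumes "R \<ge> 1" "K1 > 0" "K2 > 0"
  "\<And>x y. on_curve E x y \<Longrightarrow> norm x \<ge> R \<Longrightarrow> K1 * norm x ^ n \<le> norm (F x y) ^ 2"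
  "\<And>x y. on_curve E x y \<Longrightarrow> norm x \<ge> R \<Longrightarrow> norm (F x y) ^ 2 \<le> K2 * norm x ^ n"
 shows "ord_growth E F n"
 using assms unfolding ord_growth_def by blast

lemma ord_growthE:
 assumes "ord_growth E F n"
 obtains R K1 K2 where "R \<ge> 1" "K1 > 0" "K2 > 0"
  "\<And>x y. on_curve E x y \<Longrightarrow> norm x \<ge> R \<Longrightarrow> K1 * norm x ^ n \<le> norm (F x y) ^ 2"
  "\<And>x y. on_curve E x y \<Longrightarrow> norm x \<ge> R \<Longrightarrow> norm (F x y) ^ 2 \<le> K2 * norm x ^ n"
 using assms unfolding ord_growth_def by blast

lemma ord_growth_lowerE:
 assumes "ord_growth E F n"
 obtains R K1 where "R \<ge> 1" "K1 > 0"
  "\<And>x y. on_curve E x y \<Longrightarrow> norm x \<ge> R \<Longrightarrow> K1 * norm x ^ n \<le> norm (F x y) ^ 2"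
 by (rule ord_growthE[OF assms], rule that)

lemma ord_growth_upperE:
 assumes "ord_growth E F n"
 obtains R K2 where "R \<ge> 1" "K2 > 0"
  "\<And>x y. on_curve E x y \<Longrightarrow> norm x \<ge> R \<Longrightarrow> norm (F x y) ^ 2 \<le> K2 * norm x ^ n"
 by (rule ord_growthE[OF assms], rule that)

lemma ord_growth_rp:
 assumes "p \<noteq> 0" shows "ord_growth E (\<lambda>x y. rp p x) (2 * degree p)"
proof -
 obtain R K1 K2 where R: "R \<ge> 1" "K1 > 0" "K2 > 0"
   "\<And>x. norm x \<ge> R \<Longrightarrow> K1 * norm x ^ degree p \<le> norm (rp p x)"
   "\<And>x. norm x \<ge> R \<Longrightarrow> norm (rp p x) \<le> K2 * norm x ^ degree p"
  using rp_growth[OF assms] by blast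
 have "K1\<^sup>2 * norm x ^ (2 * degree p) \<le> norm (rp p x) ^ 2 \<and> norm (rp p x) ^ 2 \<le> K2\<^sup>2 * norm x ^ (2 * degree p)"
  if "norm x \<ge> R" for x
 proof
  have "0 \<le> K1 * norm x ^ degree p" using R by simp
  then have "(K1 * norm x ^ degree p) ^ 2 \<le> norm (rp p x) ^ 2"
   using R(4)[OF that] by (intro power_mono)
  then show "K1\<^sup>2 * norm x ^ (2 * degree p) \<le> norm (rp p x) ^ 2"
   by (simp add: power_mult_distrib power_mult[symmetric] mult.commute)
  have "norm (rp p x) ^ 2 \<le> (K2 * norm x ^ degree p) ^ 2"
   using R(5)[OF that] by (intro power_mono) auto
  then show "norm (rp p x) ^ 2 \<le> K2\<^sup>2 * norm x ^ (2 * degree p)"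
   by (simp add: power_mult_distrib power_mult[symmetric] mult.commute)
 qed
 then show ?thesis using R by (intro ord_growthI[of R "K1\<^sup>2" "K2\<^sup>2"]) auto
qed

lemma ord_growth_mult:
 assumes "ord_growth E F n" "ord_growth E G m"
 shows "ord_growth E (\<lambda>x y. F x y * G x y) (n + m)"
proof -
 obtain R K1 K2 where R: "R \<ge> 1" "K1 > 0" "K2 > 0"
  "\<And>x y. on_curve E x y \<Longrightarrow> norm x \<ge> R \<Longrightarrow> K1 * norm x ^ n \<le> norm (F x y) ^ 2"
  "\<And>x y. on_curve E x y \<Longrightarrow> norm x \<ge> R \<Longrightarrow> norm (F x y) ^ 2 \<le> K2 * norm x ^ n"
  by (rule ord_growthE[OF assms(1)], rule that)
 obtain S L1 L2 where S: "S \<ge> 1" "L1 > 0" "L2 > 0"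
  "\<And>x y. on_curve E x y \<Longrightarrow> norm x \<ge> S \<Longrightarrow> L1 * norm x ^ m \<le> norm (G x y) ^ 2"
  "\<And>x y. on_curve E x y \<Longrightarrow> norm x \<ge> S \<Longrightarrow> norm (G x y) ^ 2 \<le> L2 * norm x ^ m"
  by (rule ord_growthE[OF assms(2)], rule that)
 show ?thesis
 proof (rule ord_growthI[of "max R S" "K1 * L1" "K2 * L2"])
  fix x y assume xy: "on_curve E x y" and "max R S \<le> norm x"
  then have x: "norm x \<ge> R" "norm x \<ge> S" by auto
  have "(K1 * norm x ^ n) * (L1 * norm x ^ m) \<le> norm (F x y) ^ 2 * norm (G x y) ^ 2"
   using R S x xy by (intro mult_mono) auto
  then show "K1 * L1 * norm x ^ (n + m) \<le> norm (F x y * G x y) ^ 2"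
   by (simp add: power_add norm_mult power_mult_distrib mult_ac)
  have "norm (F x y) ^ 2 * norm (G x y) ^ 2 \<le> (K2 * norm x ^ n) * (L2 * norm x ^ m)"
   using R S x xy by (intro mult_mono) auto
  then show "norm (F x y * G x y) ^ 2 \<le> K2 * L2 * norm x ^ (n + m)"
   by (simp add: power_add norm_mult power_mult_distrib mult_ac)
 qed (use R S in auto)
qed

lemma ord_growth_y: "ord_growth E (\<lambda>x y. y) 3"
proof -
 have ne: "cubic E \<noteq> 0" and deg: "degree (cubic E) = 3" by (auto simp: cubic_def)
 obtain R K1 K2 where R: "R \<ge> 1" "K1 > 0" "K2 > 0"
   "\<And>x. norm x \<ge> R \<Longrightarrow> K1 * norm x ^ 3 \<le> norm (rp (cubic E) x)"
   "\<And>x. norm x \<ge> R \<Longrightarrow> norm (rp (cubic E) x) \<le> K2 * norm x ^ 3"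
  using rp_growth[OF ne] unfolding deg by blast
 have "norm y ^ 2 = norm (rp (cubic E) x)" if "on_curve E x y" for x y
  using that by (simp add: on_curve_iff norm_power[symmetric])
 then show ?thesis using R by (intro ord_growthI[of R K1 K2]) auto
qed

text \<open>Beyond the radius \<open>T\<close> the term of lower order is at most half of the other
  in norm, so the sum lies between 1/2 and 3/2 of the dominant term; squaring gives the factors 1/4
  and 9/4.\<close>

lemma ord_growth_add:
 assumes "ord_growth E F n" "ord_growth E G m" "m < n"
 shows "ord_growth E (\<lambda>x y. F x y + G x y) n"
proof -
 obtain R K1 K2 where R: "R \<ge> 1" "K1 > 0" "K2 > 0"
  "\<And>x y. on_curve E x y \<Longrightarrow> norm x \<ge> R \<Longrightarrow> K1 * norm x ^ n \<le> norm (F x y) ^ 2"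
  "\<And>x y. on_curve E x y \<Longrightarrow> norm x \<ge> R \<Longrightarrow> norm (F x y) ^ 2 \<le> K2 * norm x ^ n"
  by (rule ord_growthE[OF assms(1)], rule that)
 obtain S L1 L2 where S: "S \<ge> 1" "L1 > 0" "L2 > 0"
  "\<And>x y. on_curve E x y \<Longrightarrow> norm x \<ge> S \<Longrightarrow> L1 * norm x ^ m \<le> norm (G x y) ^ 2"
  "\<And>x y. on_curve E x y \<Longrightarrow> norm x \<ge> S \<Longrightarrow> norm (G x y) ^ 2 \<le> L2 * norm x ^ m"
  by (rule ord_growthE[OF assms(2)], rule that)
 define T where "T = max (max R S) (4 * L2 / K1)"
 show ?thesis
 proof (rule ord_growthI[of T "K1 / 4" "9 / 4 * K2"])
  fix x y assume xy: "on_curve E x y" and "T \<le> norm x"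
  then have x: "norm x \<ge> R" "norm x \<ge> S" "4 * L2 \<le> K1 * norm x" "norm x \<ge> 1"
   using R by (auto simp: T_def field_simps)
  have "4 * norm (G x y) ^ 2 \<le> (4 * L2) * norm x ^ m" using S(5)[OF xy x(2)] by simp
  also have "\<dots> \<le> (K1 * norm x) * norm x ^ m" by (intro mult_right_mono x) auto
  also have "\<dots> = K1 * norm x ^ Suc m" by simp
  also have "\<dots> \<le> K1 * norm x ^ n" using R x assms(3) by (intro mult_left_mono power_increasing) auto
  also have "\<dots> \<le> norm (F x y) ^ 2" using R(4)[OF xy x(1)] .
  finally have "(2 * norm (G x y)) ^ 2 \<le> norm (F x y) ^ 2" by (simp add: power_mult_distrib)
  then have g: "2 * norm (G x y) \<le> norm (F x y)" by (rule power2_le_imp_le) simp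
  have l: "norm (F x y) / 2 \<le> norm (F x y + G x y)"
   using norm_diff_ineq[of "F x y" "G x y"] g by simp
  have u: "norm (F x y + G x y) \<le> 3 / 2 * norm (F x y)"
   using norm_triangle_ineq[of "F x y" "G x y"] g by simp
  show "K1 / 4 * norm x ^ n \<le> norm (F x y + G x y) ^ 2"
   using power_mono[OF l, of 2] R(4)[OF xy x(1)] by (simp add: power_divide)
  show "norm (F x y + G x y) ^ 2 \<le> 9 / 4 * K2 * norm x ^ n"
   using power_mono[OF u, of 2] R(5)[OF xy x(1)] by (simp add: power_mult_distrib power_divide)
 qed (use R S in \<open>auto simp: T_def\<close>)
qed

text \<open>The two summands have growth orders \<open>2 * degree p\<close> and
  \<open>2 * degree q + 3\<close>. These differ in parity, so no cancellation is possible and the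
  larger one is the order of the sum. This is the pole order at infinity, with \<open>x\<close> of
  order 2 and \<open>y\<close> of order 3.\<close>

lemma ord_growth_regular:
 assumes "\<not> (p = 0 \<and> q = 0)"
 shows "\<exists>n. ord_growth E (\<lambda>x y. rp p x + rp q x * y) n \<and>
   (n = 0 \<longrightarrow> degree p = 0 \<and> q = 0) \<and> (n = 2 \<longrightarrow> degree p = 1 \<and> q = 0) \<and> (n = 3 \<longrightarrow> degree p \<le> 1 \<and> degree q = 0)"
proof (cases "p = 0 \<or> q = 0")
 case True
 have q: "ord_growth E (\<lambda>x y. rp q x * y) (2 * degree q + 3)" if "q \<noteq> 0"
  by (rule ord_growth_mult[OF ord_growth_rp[OF that] ord_growth_y])
 show ?thesis
 proof (cases "q = 0")
  case q0: True
  then show ?thesis using assms ord_growth_rp[of p E]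
   by (intro exI[of _ "2 * degree p"]) (auto, presburger?)
 next
  case False
  then have "p = 0" using True by auto
  then show ?thesis using q[OF False]
   by (intro exI[of _ "2 * degree q + 3"]) auto
 qed
next
 case False
 have p: "ord_growth E (\<lambda>x y. rp p x) (2 * degree p)"
  using False by (intro ord_growth_rp) auto
 have q: "ord_growth E (\<lambda>x y. rp q x * y) (2 * degree q + 3)"
  using False by (intro ord_growth_mult ord_growth_rp ord_growth_y) auto
 show ?thesis
 proof (cases "2 * degree q + 3 < 2 * degree p")
  case True
  then show ?thesis using ord_growth_add[OF p q] by (intro exI[of _ "2 * degree p"]) auto
 next
  case False
  then have "2 * degree p < 2 * degree q + 3" by presburger
  then show ?thesis using ord_growth_add[OF q p]
   by (intro exI[of _ "2 * degree q + 3"]) (auto simp: add.commute)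
 qed
qed

lemma ord_growth_unique:
 assumes "ord_growth E F n" "ord_growth E F m"
 shows "n = m"
proof -
 have False if o1: "ord_growth E F n" and o2: "ord_growth E F m" and lt: "m < n" for n m
 proof -
  obtain R K1 where R: "R \<ge> 1" "K1 > 0"
   "\<And>x y. on_curve E x y \<Longrightarrow> norm x \<ge> R \<Longrightarrow> K1 * norm x ^ n \<le> norm (F x y) ^ 2"
   by (rule ord_growth_lowerE[OF o1], rule that)
  obtain S L2 where S: "S \<ge> 1" "L2 > 0"
   "\<And>x y. on_curve E x y \<Longrightarrow> norm x \<ge> S \<Longrightarrow> norm (F x y) ^ 2 \<le> L2 * norm x ^ m"
   by (rule ord_growth_upperE[OF o2], rule that)
  define t where "t = max (max R S) (2 * L2 / K1)"
  have "t \<ge> 2 * L2 / K1" by (simp add: t_def)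
  then have "K1 * t \<ge> 2 * L2" using R by (simp add: field_simps)
  then have t: "t \<ge> 1" "t \<ge> R" "t \<ge> S" "K1 * t \<ge> 2 * L2"
   using R by (auto simp: t_def)
  define x where "x = complex_of_real t"
  have nx: "norm x = t" using t by (simp add: x_def)
  define y where "y = csqrt (rp (cubic E) x)"
  have xy: "on_curve E x y" unfolding y_def by (rule on_curve_csqrt)
  have "K1 * t ^ n \<le> L2 * t ^ m"
   using R(3)[OF xy] S(3)[OF xy] t unfolding nx by linarith
  moreover have "K1 * t ^ n \<ge> K1 * t ^ Suc m" using R t lt by (intro mult_left_mono power_increasing) auto
  moreover have "K1 * t ^ Suc m \<ge> 2 * L2 * t ^ m" using mult_right_mono[OF t(4), of "t ^ m"] t by (simp add: mult_ac)
  moreover have "L2 * t ^ m > 0" using S t by simp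
  ultimately show False by linarith
 qed
 from this[OF assms] this[OF assms(2,1)] show ?thesis by fastforce
qed

text \<open>A nonzero combination has a growth order, so it is bounded away from zero at every point
  far enough out.\<close>

lemma regular_unique:
 assumes "\<And>x y. on_curve E x y \<Longrightarrow> rp p x + rp q x * y = 0"
 shows "p = 0 \<and> q = 0"
proof (rule ccontr)
 assume "\<not> (p = 0 \<and> q = 0)"
 then obtain n where n: "ord_growth E (\<lambda>x y. rp p x + rp q x * y) n"
  using ord_growth_regular by blast
 obtain R K1 where R: "R \<ge> 1" "K1 > 0"
  "\<And>x y. on_curve E x y \<Longrightarrow> norm x \<ge> R \<Longrightarrow> K1 * norm x ^ n \<le> norm (rp p x + rp q x * y) ^ 2"
  by (rule ord_growth_lowerE[OF n], rule that)
 have "K1 * norm (complex_of_real R) ^ n \<le> 0"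
  using R(3)[OF on_curve_csqrt[of E "complex_of_real R"]] assms[OF on_curve_csqrt[of E "complex_of_real R"]] R(1)
  by simp
 moreover have "norm (complex_of_real R) ^ n > 0" using R(1) by simp
 ultimately show False using mult_pos_pos[OF R(2), of "norm (complex_of_real R) ^ n"] by linarith
qed

text \<open>If \<open>X, Y\<close> are the coordinates of a map of curves, then the growth of a regular function
 composed with the map is determined by the growth of \<open>X\<close>.\<close>

lemma ord_growth_comp:
 assumes X: "ord_growth E X n" and n: "n > 0"
  and map: "\<And>x y. on_curve E x y \<Longrightarrow> on_curve E' (X x y) (Y x y)"
  and F: "ord_growth E' F m" and G: "ord_growth E (\<lambda>x y. F (X x y) (Y x y)) k"
 shows "2 * k = n * m"
proof -
 obtain R K1 K2 where R: "R \<ge> 1" "K1 > 0" "K2 > 0"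
  "\<And>x y. on_curve E x y \<Longrightarrow> norm x \<ge> R \<Longrightarrow> K1 * norm x ^ n \<le> norm (X x y) ^ 2"
  "\<And>x y. on_curve E x y \<Longrightarrow> norm x \<ge> R \<Longrightarrow> norm (X x y) ^ 2 \<le> K2 * norm x ^ n"
  by (rule ord_growthE[OF X], rule that)
 obtain S L1 L2 where S: "S \<ge> 1" "L1 > 0" "L2 > 0"
  "\<And>x y. on_curve E' x y \<Longrightarrow> norm x \<ge> S \<Longrightarrow> L1 * norm x ^ m \<le> norm (F x y) ^ 2"
  "\<And>x y. on_curve E' x y \<Longrightarrow> norm x \<ge> S \<Longrightarrow> norm (F x y) ^ 2 \<le> L2 * norm x ^ m"
  by (rule ord_growthE[OF F], rule that)
 define T where "T = max R (S\<^sup>2 / K1)"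
 \<comment> \<open>The order of the composition is half of \<open>n * m\<close>, perhaps not an
   integer a priori; its square has the integral order \<open>n * m\<close>.\<close>
 have "ord_growth E (\<lambda>x y. F (X x y) (Y x y) ^ 2) (n * m)"
 proof (rule ord_growthI[of T "L1\<^sup>2 * K1 ^ m" "L2\<^sup>2 * K2 ^ m"])
  fix x y assume xy: "on_curve E x y" and "T \<le> norm x"
  then have x: "norm x \<ge> R" "S\<^sup>2 \<le> K1 * norm x" "norm x \<ge> 1"
   using R by (auto simp: T_def field_simps)
  have "S\<^sup>2 \<le> K1 * norm x ^ 1" using x by simp
  also have "\<dots> \<le> K1 * norm x ^ n" using R x n by (intro mult_left_mono power_increasing) auto
  also have "\<dots> \<le> norm (X x y) ^ 2" using R(4)[OF xy x(1)] .
  finally have Xl: "S \<le> norm (X x y)" by (rule power2_le_imp_le) simp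
  note XY = map[OF xy]
  have e: "(L * norm (X x y) ^ m) ^ 2 = L\<^sup>2 * (norm (X x y) ^ 2) ^ m" for L
   by (simp add: power_mult_distrib) (simp flip: power_mult add: mult.commute)
  have e': "L\<^sup>2 * (K * norm x ^ n) ^ m = L\<^sup>2 * K ^ m * norm x ^ (n * m)" for L K :: real
   by (simp only: power_mult_distrib power_mult mult.assoc)
  have e'': "norm (c ^ 2) ^ 2 = (norm c ^ 2) ^ 2" for c :: complex
   by (simp add: norm_power)
  have "L1\<^sup>2 * (K1 * norm x ^ n) ^ m \<le> L1\<^sup>2 * (norm (X x y) ^ 2) ^ m"
   using R x R(4)[OF xy x(1)] by (intro mult_left_mono power_mono) auto
  also have "\<dots> = (L1 * norm (X x y) ^ m) ^ 2" by (rule e[symmetric])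
  also have "\<dots> \<le> (norm (F (X x y) (Y x y)) ^ 2) ^ 2"
   using S(4)[OF XY Xl] S(2) by (intro power_mono) auto
  finally show "L1\<^sup>2 * K1 ^ m * norm x ^ (n * m) \<le> norm (F (X x y) (Y x y) ^ 2) ^ 2"
   unfolding e' e'' .
  have "(norm (F (X x y) (Y x y)) ^ 2) ^ 2 \<le> (L2 * norm (X x y) ^ m) ^ 2"
   using S(5)[OF XY Xl] by (intro power_mono) auto
  also have "\<dots> = L2\<^sup>2 * (norm (X x y) ^ 2) ^ m" by (rule e)
  also have "\<dots> \<le> L2\<^sup>2 * (K2 * norm x ^ n) ^ m"
   using R x R(5)[OF xy x(1)] by (intro mult_left_mono power_mono) auto
  finally show "norm (F (X x y) (Y x y) ^ 2) ^ 2 \<le> L2\<^sup>2 * K2 ^ m * norm x ^ (n * m)"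
   unfolding e' e'' .
 qed (use R S in \<open>auto simp: T_def\<close>)
 from ord_growth_unique[OF this, of "k + k"] have "ord_growth E (\<lambda>x y. F (X x y) (Y x y) ^ 2) (k + k) \<Longrightarrow> n * m = k + k" .
 moreover have "ord_growth E (\<lambda>x y. F (X x y) (Y x y) ^ 2) (k + k)"
  unfolding power2_eq_square by (rule ord_growth_mult[OF G G])
 ultimately show ?thesis by simp
qed

text \<open>Where the image is affine, the third local form is nonzero, and dividing by it exhibits
  both coordinates of the image as local quotients of regular functions. Then
  \<open>rfun_local\<close> makes them regular on the whole affine curve.\<close>

lemma affine_image:
 assumes \<phi>: "morphism_over_Q E E' \<phi>" and aff: "\<And>x y. on_curve E x y \<Longrightarrow> \<phi> (Affine x y) \<noteq> Infinity"
 obtains p q p' q' where "\<And>x y. on_curve E x y \<Longrightarrow>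
   \<phi> (Affine x y) = Affine (rp p x + rp q x * y) (rp p' x + rp q' x * y) \<and>
   on_curve E' (rp p x + rp q x * y) (rp p' x + rp q' x * y)"
proof -
 define X where "X x y = (case \<phi> (Affine x y) of Affine u v \<Rightarrow> u | Infinity \<Rightarrow> 0)" for x y
 define Y where "Y x y = (case \<phi> (Affine x y) of Affine u v \<Rightarrow> v | Infinity \<Rightarrow> 0)" for x y
 have XY: "\<phi> (Affine x y) = Affine (X x y) (Y x y)" if "on_curve E x y" for x y
  using aff[OF that] by (auto simp: X_def Y_def split: point.splits)
 have on: "on_curve E' (X x y) (Y x y)" if "on_curve E x y" for x y
 proof -
  have "\<phi> (Affine x y) \<in> points E'" using \<phi> that unfolding morphism_over_Q_def by (auto simp: image_subset_iff)
  then show ?thesis using XY[OF that] by simp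
 qed
 have loc: "\<exists>d F G H. eval_form d H (x0, y0, 1) \<noteq> 0 \<and> (\<forall>x y. on_curve E x y \<longrightarrow>
   eval_form d F (x, y, 1) = X x y * eval_form d H (x, y, 1) \<and>
   eval_form d G (x, y, 1) = Y x y * eval_form d H (x, y, 1))" if xy0: "on_curve E x0 y0" for x0 y0
 proof -
  have P: "Affine x0 y0 \<in> points E" using xy0 by simp
  obtain d F G H where 1: "eval_forms d F G H (Affine x0 y0) \<noteq> (0, 0, 0)" and
   2: "\<And>Q. Q \<in> points E \<Longrightarrow> eval_forms d F G H Q \<noteq> (0, 0, 0) \<Longrightarrow>
      (\<exists>s. s \<noteq> 0 \<and> (case hcoords (\<phi> Q) of (x, y, z) \<Rightarrow> eval_forms d F G H Q = (s * x, s * y, s * z)))"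
   using bspec[OF conjunct2[OF \<phi>[unfolded morphism_over_Q_def]] P] by (elim exE conjE) (rule that, assumption, blast)
  have 3: "\<exists>s. (eval_forms d F G H (Affine x y) \<noteq> (0, 0, 0) \<longrightarrow> s \<noteq> 0) \<and>
    eval_form d F (x, y, 1) = s * X x y \<and> eval_form d G (x, y, 1) = s * Y x y \<and> eval_form d H (x, y, 1) = s"
   if "on_curve E x y" for x y
  proof (cases "eval_forms d F G H (Affine x y) = (0, 0, 0)")
   case True
   then show ?thesis by (intro exI[of _ 0]) (simp add: eval_forms_def del: eval_form.simps)
  next
   case False
   then show ?thesis using 2[of "Affine x y"] that by (auto simp: XY[OF that] eval_forms_def simp del: eval_form.simps)
  qed
  show ?thesis
  proof (rule exI[of _ d], rule exI[of _ F], rule exI[of _ G], rule exI[of _ H], intro conjI allI impI)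
   show "eval_form d H (x0, y0, 1) \<noteq> 0" using 3[OF xy0] 1 by auto
  next
   fix x y assume "on_curve E x y"
   from 3[OF this] show "eval_form d F (x, y, 1) = X x y * eval_form d H (x, y, 1)"
    "eval_form d G (x, y, 1) = Y x y * eval_form d H (x, y, 1)" by (auto simp del: eval_form.simps)
  qed
 qed
 have rfX: "rfun E X"
 proof (rule rfun_local)
  fix x0 y0 assume "on_curve E x0 y0"
  from loc[OF this] obtain d F G H where *: "eval_form d H (x0, y0, 1) \<noteq> 0" "\<forall>x y. on_curve E x y \<longrightarrow>
   eval_form d F (x, y, 1) = X x y * eval_form d H (x, y, 1) \<and>
   eval_form d G (x, y, 1) = Y x y * eval_form d H (x, y, 1)" by (elim exE conjE) (rule that)
  show "\<exists>F H. rfun E F \<and> rfun E H \<and> H x0 y0 \<noteq> 0 \<and> (\<forall>x y. on_curve E x y \<longrightarrow> F x y = X x y * H x y)"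
   by (rule exI[of _ "\<lambda>x y. eval_form d F (x, y, 1)"], rule exI[of _ "\<lambda>x y. eval_form d H (x, y, 1)"])
     (use * in \<open>simp add: rfun_form del: eval_form.simps\<close>)
 qed
 have rfY: "rfun E Y"
 proof (rule rfun_local)
  fix x0 y0 assume "on_curve E x0 y0"
  from loc[OF this] obtain d F G H where *: "eval_form d H (x0, y0, 1) \<noteq> 0" "\<forall>x y. on_curve E x y \<longrightarrow>
   eval_form d F (x, y, 1) = X x y * eval_form d H (x, y, 1) \<and>
   eval_form d G (x, y, 1) = Y x y * eval_form d H (x, y, 1)" by (elim exE conjE) (rule that)
  show "\<exists>F H. rfun E F \<and> rfun E H \<and> H x0 y0 \<noteq> 0 \<and> (\<forall>x y. on_curve E x y \<longrightarrow> F x y = Y x y * H x y)"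
   by (rule exI[of _ "\<lambda>x y. eval_form d G (x, y, 1)"], rule exI[of _ "\<lambda>x y. eval_form d H (x, y, 1)"])
     (use * in \<open>simp add: rfun_form del: eval_form.simps\<close>)
 qed
 obtain p q where pq: "\<And>x y. on_curve E x y \<Longrightarrow> X x y = rp p x + rp q x * y"
  using rfX unfolding rfun_def by (elim exE) (rule that, blast)
 obtain p' q' where pq': "\<And>x y. on_curve E x y \<Longrightarrow> Y x y = rp p' x + rp q' x * y"
  using rfY unfolding rfun_def by (elim exE) (rule that, blast)
 show thesis
 proof (rule that)
  fix x y assume xy: "on_curve E x y"
  show "\<phi> (Affine x y) = Affine (rp p x + rp q x * y) (rp p' x + rp q' x * y) \<and>
   on_curve E' (rp p x + rp q x * y) (rp p' x + rp q' x * y)"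
   using XY[OF xy] on[OF xy] unfolding pq[OF xy] pq'[OF xy] by simp
 qed
qed

section \<open>Rational isomorphisms are scalings\<close>

text \<open>Composing with the inverse returns \<open>x\<close>, whose order is 2, so the orders
  \<open>n\<close> and \<open>m\<close> of the two first coordinates satisfy
  \<open>n * m = 4\<close>. The curve equation ties the order \<open>k\<close> of the second
  coordinate to \<open>n\<close>, and \<open>2 * k = 3 * n\<close> forces \<open>n\<close> to be
  even.\<close>

lemma iso_growth:
 assumes map: "\<And>x y. on_curve E x y \<Longrightarrow> on_curve E' (rp p x + rp q x * y) (rp p' x + rp q' x * y)"
  and inv: "\<And>x y. on_curve E x y \<Longrightarrow> x = rp r (rp p x + rp q x * y) + rp s (rp p x + rp q x * y) * (rp p' x + rp q' x * y)"
 obtains n k m where "even n" "n > 0" "n * m = 4" "ord_growth E (\<lambda>x y. rp p x + rp q x * y) n"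
   "ord_growth E' (\<lambda>x y. rp r x + rp s x * y) m" "ord_growth E (\<lambda>x y. rp p' x + rp q' x * y) k"
   "2 * k = 3 * n"
proof -
 let ?X = "\<lambda>x y. rp p x + rp q x * y" and ?Y = "\<lambda>x y. rp p' x + rp q' x * y"
 \<comment> \<open>A constant first coordinate leaves at most two values for the second one, hence
   by the inverse formula at most two values of \<open>x\<close>, while \<open>x\<close> ranges over
   all complex numbers.\<close>
 have const: "\<not> (\<forall>x y. on_curve E x y \<longrightarrow> ?X x y = c)" for c
 proof
  assume c: "\<forall>x y. on_curve E x y \<longrightarrow> ?X x y = c"
  define w where "w = csqrt (rp (cubic E') c)"
  have "x \<in> {rp r c + rp s c * w, rp r c - rp s c * w}" for x
  proof -
   obtain y where xy: "on_curve E x y" using on_curve_csqrt by blast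
   have X: "?X x y = c" using c xy by blast
   have "?Y x y ^ 2 = w ^ 2" using map[OF xy] X by (simp add: on_curve_iff w_def)
   then have "?Y x y = w \<or> ?Y x y = - w" by (simp add: power2_eq_iff)
   then show ?thesis using inv[OF xy] unfolding X by auto
  qed
  then have "UNIV \<subseteq> {rp r c + rp s c * w, rp r c - rp s c * w}" by blast
  then have "finite (UNIV :: complex set)" by (rule finite_subset) simp
  then show False by (simp add: infinite_UNIV_char_0)
 qed
 have "\<not> (p = 0 \<and> q = 0)" using const[of 0] by auto
 then obtain n where n: "ord_growth E ?X n" "n = 0 \<longrightarrow> degree p = 0 \<and> q = 0"
  using ord_growth_regular by blast
 have "n > 0"
 proof (rule ccontr)
  assume "\<not> n > 0"
  then have "degree p = 0" "q = 0" using n by auto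
  then obtain c where "p = [:c:]" by (metis degree_eq_zeroE)
  then show False using const[of "of_rat c"] \<open>q = 0\<close> by simp
 qed
 have "\<not> (r = 0 \<and> s = 0)"
 proof
  assume "r = 0 \<and> s = 0"
  then show False using inv[OF on_curve_csqrt, of 1] by simp
 qed
 then obtain m where m: "ord_growth E' (\<lambda>x y. rp r x + rp s x * y) m"
  using ord_growth_regular by blast
 have gx: "ord_growth E (\<lambda>x y. x) 2"
  using ord_growth_rp[of "[:0,1:]" E] by simp
 have "ord_growth E (\<lambda>x y. rp r (?X x y) + rp s (?X x y) * ?Y x y) 2"
 proof -
  obtain R K1 K2 where R: "R \<ge> 1" "K1 > 0" "K2 > 0"
   "\<And>x y. on_curve E x y \<Longrightarrow> norm x \<ge> R \<Longrightarrow> K1 * norm x ^ 2 \<le> norm x ^ 2"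
   "\<And>x y. on_curve E x y \<Longrightarrow> norm x \<ge> R \<Longrightarrow> norm x ^ 2 \<le> K2 * norm x ^ 2"
   by (rule ord_growthE[OF gx], rule that)
  show ?thesis
  proof (rule ord_growthI[OF R(1-3)])
   fix x y assume "on_curve E x y" "R \<le> norm x"
   then show "K1 * norm x ^ 2 \<le> norm (rp r (?X x y) + rp s (?X x y) * ?Y x y) ^ 2"
    "norm (rp r (?X x y) + rp s (?X x y) * ?Y x y) ^ 2 \<le> K2 * norm x ^ 2"
    using inv[of x y, symmetric] R(4,5) by simp_all
  qed
 qed
 from ord_growth_comp[OF n(1) \<open>n > 0\<close> map m this] have nm: "n * m = 4" by simp
 have "\<not> (p' = 0 \<and> q' = 0)"
 proof
  assume "p' = 0 \<and> q' = 0"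
  then have z: "?Y x y = 0" for x y by simp
  obtain R K1 where R: "R \<ge> 1" "K1 > 0"
   "\<And>x y. on_curve E x y \<Longrightarrow> norm x \<ge> R \<Longrightarrow> K1 * norm x ^ n \<le> norm (?X x y) ^ 2"
   by (rule ord_growth_lowerE[OF n(1)], rule that)
  have ne: "cubic E' \<noteq> 0" by (simp add: cubic_def)
  have "x = 0 \<or> x \<in> rp r ` {x. rp (cubic E') x = 0}" for x
   using inv[OF on_curve_csqrt, of x] map[OF on_curve_csqrt, of x] z by (auto simp: on_curve_iff)
  then have "UNIV \<subseteq> insert 0 (rp r ` {x. rp (cubic E') x = 0})" by blast
  then have "finite (UNIV :: complex set)" using rp_finite_roots[OF ne] by (meson finite.insertI finite_imageI finite_subset)
  then show False by (simp add: infinite_UNIV_char_0)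
 qed
 then obtain k where k: "ord_growth E ?Y k"
  using ord_growth_regular by blast
 have "2 * k = n * 3"
  by (rule ord_growth_comp[OF n(1) \<open>n > 0\<close> map ord_growth_y k])
 then have "2 * k = 3 * n" by simp
 moreover from this have "even n" by presburger
 ultimately show thesis by (intro that[OF _ \<open>n > 0\<close> nm n(1) m k])
qed

lemma degree_le_1E:
 assumes "degree p \<le> 1" obtains a b where "p = [:a, b:]"
proof -
 obtain a q where p: "p = pCons a q" by (cases p)
 have "degree q = 0" using assms p by (cases "q = 0") auto
 then obtain b where "q = [:b:]" by (rule degree_eq_zeroE)
 then show thesis using that p by blast
qed

text \<open>The orders of the map and of its inverse are both even with product 4, so both are 2.
  Hence the first coordinate is linear in \<open>x\<close> and the second is a combination of 1,
  \<open>x\<close> and \<open>y\<close>. Comparing coefficients in the curve equation leaves only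
  \<open>u ^ 2 * x\<close> and \<open>u ^ 3 * y\<close>.\<close>

lemma isomorphic_scaling:
 assumes "isomorphic_over_Q E E'"
 shows "\<exists>u. u \<noteq> 0 \<and> fst E' = u ^ 4 * fst E \<and> snd E' = u ^ 6 * snd E"
proof -
 obtain \<phi> \<psi> where \<phi>: "morphism_over_Q E E' \<phi>" and \<psi>: "morphism_over_Q E' E \<psi>" and
  inf: "\<phi> Infinity = Infinity" and inv: "\<And>P. P \<in> points E \<Longrightarrow> \<psi> (\<phi> P) = P" "\<And>P. P \<in> points E' \<Longrightarrow> \<phi> (\<psi> P) = P"
  using assms unfolding isomorphic_over_Q_def by blast
 have aff: "\<phi> (Affine x y) \<noteq> Infinity" if "on_curve E x y" for x y
  using inv(1)[of "Affine x y"] inv(1)[of Infinity] that inf by auto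
 have aff': "\<psi> (Affine x y) \<noteq> Infinity" if "on_curve E' x y" for x y
  using inv(2)[of "Affine x y"] that inf by auto
 obtain p q p' q' where X: "\<And>x y. on_curve E x y \<Longrightarrow>
   \<phi> (Affine x y) = Affine (rp p x + rp q x * y) (rp p' x + rp q' x * y) \<and>
   on_curve E' (rp p x + rp q x * y) (rp p' x + rp q' x * y)"
  using affine_image[OF \<phi> aff] by blast
 obtain r s r' s' where U: "\<And>x y. on_curve E' x y \<Longrightarrow>
   \<psi> (Affine x y) = Affine (rp r x + rp s x * y) (rp r' x + rp s' x * y) \<and>
   on_curve E (rp r x + rp s x * y) (rp r' x + rp s' x * y)"
  using affine_image[OF \<psi> aff'] by blast
 have mX: "on_curve E' (rp p x + rp q x * y) (rp p' x + rp q' x * y)" if "on_curve E x y" for x y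
  using X[OF that] by blast
 have mU: "on_curve E (rp r x + rp s x * y) (rp r' x + rp s' x * y)" if "on_curve E' x y" for x y
  using U[OF that] by blast
 have i1: "x = rp r (rp p x + rp q x * y) + rp s (rp p x + rp q x * y) * (rp p' x + rp q' x * y)"
  if "on_curve E x y" for x y
  using inv(1)[of "Affine x y"] X[OF that] U that by auto
 have i2: "x = rp p (rp r x + rp s x * y) + rp q (rp r x + rp s x * y) * (rp r' x + rp s' x * y)"
  if "on_curve E' x y" for x y
  using inv(2)[of "Affine x y"] U[OF that] X that by auto
 obtain n k m where n: "even n" "n > 0" "n * m = 4" "ord_growth E (\<lambda>x y. rp p x + rp q x * y) n"
   "ord_growth E' (\<lambda>x y. rp r x + rp s x * y) m" "ord_growth E (\<lambda>x y. rp p' x + rp q' x * y) k"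
   "2 * k = 3 * n"
  by (rule iso_growth[OF mX i1], assumption, assumption, rule that)
 obtain n' where n': "even n'" "ord_growth E' (\<lambda>x y. rp r x + rp s x * y) n'"
  by (rule iso_growth[OF mU i2], assumption, assumption, rule that)
 have "even m" using ord_growth_unique[OF n(5) n'(2)] n'(1) by simp
 obtain n1 m1 where nm1: "n = 2 * n1" "m = 2 * m1" using n(1) \<open>even m\<close> by (auto elim!: evenE)
 then have "n1 * m1 = 1" using n(3) by simp
 then have n2: "n = 2" and k3: "k = 3" using nm1 n(7) by auto
 have pq0: "\<not> (p = 0 \<and> q = 0)"
 proof -
  obtain R K1 where R: "R \<ge> 1" "K1 > 0"
   "\<And>x y. on_curve E x y \<Longrightarrow> norm x \<ge> R \<Longrightarrow> K1 * norm x ^ n \<le> norm (rp p x + rp q x * y) ^ 2"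
   by (rule ord_growth_lowerE[OF n(4)], rule that)
  have "\<bar>R\<bar> = R" using R(1) by simp
  then have "p = 0 \<and> q = 0 \<Longrightarrow> K1 * R ^ n \<le> 0"
   using R(3)[OF on_curve_csqrt, of "complex_of_real R"] by simp
  moreover have "K1 * R ^ n > 0" using R by simp
  ultimately show ?thesis by linarith
 qed
 obtain nn where nn: "ord_growth E (\<lambda>x y. rp p x + rp q x * y) nn" "nn = 2 \<longrightarrow> degree p = 1 \<and> q = 0"
  using ord_growth_regular[OF pq0, of E] by (elim exE conjE) (rule that)
 have p1: "degree p = 1" "q = 0" using ord_growth_unique[OF n(4) nn(1)] n2 nn(2) by auto
 have pq0': "\<not> (p' = 0 \<and> q' = 0)"
 proof -
  obtain R K1 where R: "R \<ge> 1" "K1 > 0"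
   "\<And>x y. on_curve E x y \<Longrightarrow> norm x \<ge> R \<Longrightarrow> K1 * norm x ^ k \<le> norm (rp p' x + rp q' x * y) ^ 2"
   by (rule ord_growth_lowerE[OF n(6)], rule that)
  have "\<bar>R\<bar> = R" using R(1) by simp
  then have "p' = 0 \<and> q' = 0 \<Longrightarrow> K1 * R ^ k \<le> 0"
   using R(3)[OF on_curve_csqrt, of "complex_of_real R"] by simp
  moreover have "K1 * R ^ k > 0" using R by simp
  ultimately show ?thesis by linarith
 qed
 obtain nk where nk: "ord_growth E (\<lambda>x y. rp p' x + rp q' x * y) nk" "nk = 3 \<longrightarrow> degree p' \<le> 1 \<and> degree q' = 0"
  using ord_growth_regular[OF pq0', of E] by (elim exE conjE) (rule that)
 have p2: "degree p' \<le> 1" "degree q' = 0" using ord_growth_unique[OF n(6) nk(1)] k3 nk(2) by auto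
 have "degree p \<le> 1" using p1(1) by simp
 then obtain \<beta> \<alpha> where pe: "p = [:\<beta>, \<alpha>:]" by (rule degree_le_1E)
 then have "\<alpha> \<noteq> 0" using p1(1) by auto
 note pe = pe this
 obtain \<gamma> where qe: "q' = [:\<gamma>:]" using p2(2) by (rule degree_eq_zeroE)
 obtain \<epsilon> \<delta> where pe': "p' = [:\<epsilon>, \<delta>:]" using p2(1) by (rule degree_le_1E)
 obtain A B A' B' where E: "E = (A, B)" "E' = (A', B')" by fastforce
 let ?c = "[:B, A, 0, 1:]" and ?c' = "[:B', A', 0, 1:]"
 \<comment> \<open>The equation of \<open>E'\<close> at the image point, with \<open>y ^ 2\<close>
   eliminated by the equation of \<open>E\<close>. The parts without and with \<open>y\<close>
   vanish separately by \<open>regular_unique\<close>.\<close>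
 have "rp ([:\<epsilon>, \<delta>:]^2 + Polynomial.smult (\<gamma>^2) ?c - pcompose ?c' p) x + rp (Polynomial.smult (2 * \<gamma>) [:\<epsilon>, \<delta>:]) x * y = 0"
  if "on_curve E x y" for x y
 proof -
  have "rp ?c x = y ^ 2" "rp ?c' (rp p x) = (rp p' x + of_rat \<gamma> * y) ^ 2"
   using that X[OF that] p1(2) by (simp_all add: on_curve_iff cubic_def E qe del: rp_pCons) (simp_all add: algebra_simps)
  then show ?thesis
   unfolding rp_diff rp_add rp_pcompose rp_power rp_smult pe' by (simp add: of_rat_mult of_rat_power algebra_simps power2_eq_square del: rp_pCons)
 qed
 from regular_unique[OF this]
 have 1: "[:\<epsilon>, \<delta>:]^2 + Polynomial.smult (\<gamma>^2) ?c = pcompose ?c' p" and 2: "Polynomial.smult (2 * \<gamma>) [:\<epsilon>, \<delta>:] = 0" by auto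
 have "\<gamma> \<noteq> 0"
 proof
  assume "\<gamma> = 0"
  have "degree (pcompose ?c' p) = 3" using p1 by (simp add: degree_pcompose)
  moreover have "degree ([:\<epsilon>, \<delta>:]^2) \<le> 2"
   by (rule order_trans[OF degree_power_le]) auto
  ultimately show False using 1 \<open>\<gamma> = 0\<close> by simp
 qed
 with 2 have "\<epsilon> = 0" "\<delta> = 0" by auto
 with 1 have 3: "Polynomial.smult (\<gamma>^2) ?c = pcompose ?c' [:\<beta>, \<alpha>:]" by (simp add: pe)
 then have e: "\<gamma>^2 = \<alpha>^3" "3 * \<alpha>^2 * \<beta> = 0" "\<gamma>^2 * A = 3 * \<alpha> * \<beta>^2 + A' * \<alpha>" "\<gamma>^2 * B = \<beta>^3 + A' * \<beta> + B'"
  by (auto simp: pcompose_pCons algebra_simps power2_eq_square power3_eq_cube)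
 then have "\<beta> = 0" using pe by simp
 define u where "u = \<gamma> / \<alpha>"
 have u2: "u ^ 2 = \<alpha>" using e(1) pe by (simp add: u_def power_divide power2_eq_square power3_eq_cube field_simps)
 have "u ^ 4 = (u ^ 2) ^ 2" "u ^ 6 = (u ^ 2) ^ 3" by simp_all
 then have "u ^ 4 = \<alpha> ^ 2" "u ^ 6 = \<gamma> ^ 2" using u2 e(1) by simp_all
 moreover have "A' = \<alpha> ^ 2 * A" "B' = \<gamma> ^ 2 * B"
  using e \<open>\<beta> = 0\<close> pe by (auto simp: power2_eq_square power3_eq_cube)
 moreover have "u \<noteq> 0" using \<open>\<gamma> \<noteq> 0\<close> pe by (simp add: u_def)
 ultimately show ?thesis using E by auto
qed

subsection \<open>Polynomial identities in two variables by computation\<close>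

text \<open>Reflected expressions: identities of high degree are decided by evaluation on integer
  coefficient lists and then hold in every commutative ring.\<close>

datatype pexp = PX | PY | PC int | PAdd pexp pexp | PSub pexp pexp | PMul pexp pexp | PPow pexp nat

primrec pval :: "'a::comm_ring_1 \<Rightarrow> 'a \<Rightarrow> pexp \<Rightarrow> 'a" where
 "pval x y PX = x" | "pval x y PY = y" | "pval x y (PC c) = of_int c"
| "pval x y (PAdd p q) = pval x y p + pval x y q"
| "pval x y (PSub p q) = pval x y p - pval x y q"
| "pval x y (PMul p q) = pval x y p * pval x y q"
| "pval x y (PPow p n) = pval x y p ^ n"

text \<open>Normal forms are coefficient lists in \<open>y\<close> whose entries are coefficient lists in \<open>x\<close>.\<close>

fun ladd :: "int list \<Rightarrow> int list \<Rightarrow> int list" where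
 "ladd [] q = q" | "ladd p [] = p" | "ladd (a # p) (b # q) = (a + b) # ladd p q"

fun lmul :: "int list \<Rightarrow> int list \<Rightarrow> int list" where
 "lmul [] q = []" | "lmul (a # p) q = ladd (map ((*) a) q) (0 # lmul p q)"

fun lladd :: "int list list \<Rightarrow> int list list \<Rightarrow> int list list" where
 "lladd [] q = q" | "lladd p [] = p" | "lladd (a # p) (b # q) = ladd a b # lladd p q"

fun llmul :: "int list list \<Rightarrow> int list list \<Rightarrow> int list list" where
 "llmul [] q = []" | "llmul (a # p) q = lladd (map (lmul a) q) ([] # llmul p q)"

primrec llpow :: "int list list \<Rightarrow> nat \<Rightarrow> int list list" where
 "llpow p 0 = [[1]]" | "llpow p (Suc n) = llmul p (llpow p n)"

primrec pnorm :: "pexp \<Rightarrow> int list list" where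
 "pnorm PX = [[0, 1]]" | "pnorm PY = [[], [1]]" | "pnorm (PC c) = [[c]]"
| "pnorm (PAdd p q) = lladd (pnorm p) (pnorm q)"
| "pnorm (PSub p q) = lladd (pnorm p) (llmul [[-1]] (pnorm q))"
| "pnorm (PMul p q) = llmul (pnorm p) (pnorm q)"
| "pnorm (PPow p n) = llpow (pnorm p) n"

primrec lev :: "'a::comm_ring_1 \<Rightarrow> int list \<Rightarrow> 'a" where
 "lev x [] = 0" | "lev x (a # p) = of_int a + x * lev x p"

primrec llev :: "'a::comm_ring_1 \<Rightarrow> 'a \<Rightarrow> int list list \<Rightarrow> 'a" where
 "llev x y [] = 0" | "llev x y (a # p) = lev x a + y * llev x y p"

lemma lev_ladd: "lev x (ladd p q) = lev x p + lev x q"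
 by (induction p q rule: ladd.induct) (auto simp: algebra_simps)

lemma lev_map: "lev x (map ((*) a) q) = of_int a * lev x q"
 by (induction q) (auto simp: algebra_simps)

lemma lev_lmul: "lev x (lmul p q) = lev x p * lev x q"
 by (induction p) (auto simp: lev_ladd lev_map algebra_simps)

lemma llev_lladd: "llev x y (lladd p q) = llev x y p + llev x y q"
 by (induction p q rule: lladd.induct) (auto simp: lev_ladd algebra_simps)

lemma llev_map: "llev x y (map (lmul a) q) = lev x a * llev x y q"
 by (induction q) (auto simp: lev_lmul algebra_simps)

lemma llev_llmul: "llev x y (llmul p q) = llev x y p * llev x y q"
 by (induction p) (auto simp: llev_lladd llev_map algebra_simps)

lemma llev_llpow: "llev x y (llpow p n) = llev x y p ^ n"
 by (induction n) (auto simp: llev_llmul)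

lemma llev_pnorm: "llev x y (pnorm p) = pval x y p"
 by (induction p) (auto simp: llev_lladd llev_llmul llev_llpow llev_map)

text \<open>Coefficient lists may end in zeros, so normal forms are not unique; therefore the
  difference is tested for being zero entry by entry.\<close>

definition pexp_eq :: "pexp \<Rightarrow> pexp \<Rightarrow> bool" where
 "pexp_eq p q \<longleftrightarrow> list_all (list_all (\<lambda>c. c = 0)) (pnorm (PSub p q))"

lemma lev_0: "list_all (\<lambda>c. c = 0) p \<Longrightarrow> lev x p = 0"
 by (induction p) auto

lemma llev_0: "list_all (list_all (\<lambda>c. c = 0)) p \<Longrightarrow> llev x y p = 0"
 by (induction p) (auto simp: lev_0)

lemma pexp_eq: "pexp_eq p q \<Longrightarrow> pval x y p = pval x y q"
 using llev_0[of "pnorm (PSub p q)" x y] llev_pnorm[of x y "PSub p q"] unfolding pexp_eq_def by simp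

text \<open>The factors of the family in its parameter \<open>s\<close>: the curve has coefficients
  \<open>- 3 C Q\<close> and \<open>2 C R\<close>.\<close>

definition eC :: pexp where "eC = PAdd (PSub (PPow PX 2) (PMul (PC 3) PX)) (PC 9)"
definition eQ :: pexp where "eQ = PAdd (PSub (PPow PX 2) (PMul (PC 11) PX)) (PC 25)"
definition eR :: pexp where "eR = PAdd (PSub (PAdd (PSub (PPow PX 4) (PMul (PC 18) (PPow PX 3))) (PMul (PC 111) (PPow PX 2))) (PMul (PC 298) PX)) (PC 393)"

lemma disc_eq: "pexp_eq (PSub (PPow eR 2) (PMul eC (PPow eQ 3))) (PMul (PC 1728) (PSub (PC 8) PX))"
 by code_simp

section \<open>Invariants of the Tate normal form\<close>

definition tc :: pexp where "tc = PSub (PPow PX 2) PX"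
definition tb :: pexp where "tb = PSub (PPow PX 3) (PPow PX 2)"
definition tN :: pexp where "tN = PAdd (PSub (PPow PX 3) (PMul (PC 3) PX)) (PC 1)"
definition tw :: pexp where "tw = PAdd (PSub (PPow PX 2) PX) (PC 1)"
definition te :: pexp where "te = PSub (PPow (PSub (PC 1) tc) 2) (PMul (PC 4) tb)"

text \<open>The curve \<open>y ^ 2 + (1 - c) x y - b y = x ^ 3 - b x ^ 2\<close> with
  \<open>c = d ^ 2 - d\<close> and \<open>b = d ^ 3 - d ^ 2\<close> carries a point of order 7. Here
  \<open>te\<close> is its invariant b2, and the last two identities express c4 and - c6 in the
  parameter \<open>s = N / c\<close>; the first one does the same for the common factor
  \<open>C\<close>.\<close>

lemma tate_eq:
 "pexp_eq (PAdd (PSub (PPow tN 2) (PMul (PMul (PC 3) tN) tc)) (PMul (PC 9) (PPow tc 2))) (PPow tw 3)"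
 "pexp_eq (PAdd (PMul (PMul (PC 24) (PSub (PC 1) tc)) tb) (PPow te 2))
   (PMul tw (PAdd (PSub (PPow tN 2) (PMul (PMul (PC 11) tN) tc)) (PMul (PC 25) (PPow tc 2))))"
 "pexp_eq (PAdd (PSub (PAdd (PSub (PPow tN 4) (PMul (PMul (PC 18) (PPow tN 3)) tc)) (PMul (PMul (PC 111) (PPow tN 2)) (PPow tc 2)))
    (PMul (PMul (PC 298) tN) (PPow tc 3))) (PMul (PC 393) (PPow tc 4)))
   (PAdd (PAdd (PMul (PC 216) (PPow tb 2)) (PPow te 3)) (PMul (PMul (PMul (PC 36) (PSub (PC 1) tc)) tb) te))"
 by code_simp+

lemma tate_identities:
 fixes d :: "'a::comm_ring_1"
 defines "c \<equiv> d ^ 2 - d" and "b \<equiv> d ^ 3 - d ^ 2" and "N \<equiv> d ^ 3 - 3 * d + 1" and "w \<equiv> d ^ 2 - d + 1"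
 defines "e \<equiv> (1 - c) ^ 2 - 4 * b"
 shows "N ^ 2 - 3 * N * c + 9 * c ^ 2 = w ^ 3"
  "24 * (1 - c) * b + e ^ 2 = w * (N ^ 2 - 11 * N * c + 25 * c ^ 2)"
  "N ^ 4 - 18 * N ^ 3 * c + 111 * N ^ 2 * c ^ 2 - 298 * N * c ^ 3 + 393 * c ^ 4 = 216 * b ^ 2 + e ^ 3 + 36 * (1 - c) * b * e"
proof -
 have v: "pval d d tc = c" "pval d d tb = b" "pval d d tN = N" "pval d d tw = w" "pval d d te = e"
  by (simp_all add: tc_def tb_def tN_def tw_def te_def assms)
 note id = tate_eq[THEN pexp_eq, of d d, unfolded pval.simps v of_int_1 of_int_numeral]
 show "N ^ 2 - 3 * N * c + 9 * c ^ 2 = w ^ 3" by (rule id(1))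
 show "24 * (1 - c) * b + e ^ 2 = w * (N ^ 2 - 11 * N * c + 25 * c ^ 2)" by (rule id(2))
 show "N ^ 4 - 18 * N ^ 3 * c + 111 * N ^ 2 * c ^ 2 - 298 * N * c ^ 3 + 393 * c ^ 4 = 216 * b ^ 2 + e ^ 3 + 36 * (1 - c) * b * e"
  by (rule id(3))
qed

subsection \<open>Rational forms\<close>

definition rform :: "nat \<Rightarrow> (complex \<Rightarrow> complex \<Rightarrow> complex \<Rightarrow> complex) \<Rightarrow> bool" where
 "rform d F \<longleftrightarrow> (\<exists>c. \<forall>x y z. F x y z = eval_form d c (x, y, z))"

lemma rformI: "(\<And>x y z. F x y z = (\<Sum>i\<le>d. \<Sum>j\<le>d - i. of_rat (c i j) * x ^ i * y ^ j * z ^ (d - i - j))) \<Longrightarrow> rform d F"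
 unfolding rform_def by (intro exI[of _ c]) simp

lemma rformE:
 assumes "rform d F"
 obtains c where "\<And>x y z. F x y z = (\<Sum>i\<le>d. \<Sum>j\<le>d - i. of_rat (c i j) * x ^ i * y ^ j * z ^ (d - i - j))"
proof -
 obtain c where "\<forall>x y z. F x y z = eval_form d c (x, y, z)" using assms unfolding rform_def ..
 then show thesis by (intro that[of c]) simp
qed

lemma rform_0: "rform d (\<lambda>x y z. 0)"
 by (rule rformI[where c = "\<lambda>i j. 0"]) simp

lemma rform_add:
 assumes "rform d F" "rform d G" shows "rform d (\<lambda>x y z. F x y z + G x y z)"
proof -
 obtain c where c: "\<And>x y z. F x y z = (\<Sum>i\<le>d. \<Sum>j\<le>d - i. of_rat (c i j) * x ^ i * y ^ j * z ^ (d - i - j))"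
  by (rule rformE[OF assms(1)], rule that)
 obtain c' where c': "\<And>x y z. G x y z = (\<Sum>i\<le>d. \<Sum>j\<le>d - i. of_rat (c' i j) * x ^ i * y ^ j * z ^ (d - i - j))"
  by (rule rformE[OF assms(2)], rule that)
 show ?thesis
  by (rule rformI[where c = "\<lambda>i j. c i j + c' i j"]) (simp add: c c' of_rat_add ring_distribs sum.distrib)
qed

lemma rform_scale:
 assumes "rform d F" shows "rform d (\<lambda>x y z. of_rat q * F x y z)"
proof -
 obtain c where c: "\<And>x y z. F x y z = (\<Sum>i\<le>d. \<Sum>j\<le>d - i. of_rat (c i j) * x ^ i * y ^ j * z ^ (d - i - j))"
  by (rule rformE[OF assms(1)], rule that)
 show ?thesis
  by (rule rformI[where c = "\<lambda>i j. q * c i j"]) (simp add: c of_rat_mult sum_distrib_left mult.assoc)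
qed

lemma rform_x:
 assumes "rform d F" shows "rform (Suc d) (\<lambda>x y z. x * F x y z)"
proof -
 obtain c where c: "\<And>x y z. F x y z = (\<Sum>i\<le>d. \<Sum>j\<le>d - i. of_rat (c i j) * x ^ i * y ^ j * z ^ (d - i - j))"
  by (rule rformE[OF assms(1)], rule that)
 show ?thesis
  by (rule rformI[where c = "\<lambda>i j. if i = 0 then 0 else c (i - 1) j"], subst sum.atMost_Suc_shift)
    (simp add: c sum_distrib_left mult_ac)
qed

lemma rform_y:
 assumes "rform d F" shows "rform (Suc d) (\<lambda>x y z. y * F x y z)"
proof -
 obtain c where c: "\<And>x y z. F x y z = (\<Sum>i\<le>d. \<Sum>j\<le>d - i. of_rat (c i j) * x ^ i * y ^ j * z ^ (d - i - j))"
  by (rule rformE[OF assms(1)], rule that)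
 define c' where "c' i j = (if j = 0 then 0 else c i (j - 1))" for i j
 have 1: "(\<Sum>j\<le>Suc d - i. of_rat (c' i j) * x ^ i * y ^ j * z ^ (Suc d - i - j)) =
    y * (\<Sum>j\<le>d - i. of_rat (c i j) * x ^ i * y ^ j * z ^ (d - i - j))" if "i \<le> d" for x y z :: complex and i
 proof -
  have "Suc d - i = Suc (d - i)" using that by simp
  then show ?thesis
   by (simp only: sum.atMost_Suc_shift) (simp add: c'_def sum_distrib_left mult_ac)
 qed
 show ?thesis
 proof (rule rformI[where c = c'])
  fix x y z :: complex
  have "c' (Suc d) 0 = 0" by (simp add: c'_def)
  then have a: "(\<Sum>j\<le>Suc d - Suc d. of_rat (c' (Suc d) j) * x ^ Suc d * y ^ j * z ^ (Suc d - Suc d - j)) = 0" by simp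
  have b: "(\<Sum>i\<le>d. \<Sum>j\<le>Suc d - i. of_rat (c' i j) * x ^ i * y ^ j * z ^ (Suc d - i - j)) =
   (\<Sum>i\<le>d. y * (\<Sum>j\<le>d - i. of_rat (c i j) * x ^ i * y ^ j * z ^ (d - i - j)))"
   by (rule sum.cong[OF refl], rule 1) simp
  have "(\<Sum>i\<le>Suc d. \<Sum>j\<le>Suc d - i. of_rat (c' i j) * x ^ i * y ^ j * z ^ (Suc d - i - j)) =
   (\<Sum>i\<le>d. y * (\<Sum>j\<le>d - i. of_rat (c i j) * x ^ i * y ^ j * z ^ (d - i - j)))"
   by (subst sum.atMost_Suc, subst a, subst b) (rule add_0_right)
  then show "y * F x y z = (\<Sum>i\<le>Suc d. \<Sum>j\<le>Suc d - i. of_rat (c' i j) * x ^ i * y ^ j * z ^ (Suc d - i - j))"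
   unfolding c sum_distrib_left[symmetric] by simp
 qed
qed

lemma rform_z:
 assumes "rform d F" shows "rform (Suc d) (\<lambda>x y z. z * F x y z)"
proof -
 obtain c where c: "\<And>x y z. F x y z = (\<Sum>i\<le>d. \<Sum>j\<le>d - i. of_rat (c i j) * x ^ i * y ^ j * z ^ (d - i - j))"
  by (rule rformE[OF assms(1)], rule that)
 \<comment> \<open>The coefficients outside the triangle \<open>i + j \<le> d\<close> are ignored in
   degree \<open>d\<close>, but one more diagonal becomes visible in degree \<open>Suc d\<close>, so
   they are set to zero.\<close>
 define c' where "c' i j = (if i + j \<le> d then c i j else 0)" for i j
 have 1: "(\<Sum>j\<le>Suc d - i. of_rat (c' i j) * x ^ i * y ^ j * z ^ (Suc d - i - j)) =
    z * (\<Sum>j\<le>d - i. of_rat (c i j) * x ^ i * y ^ j * z ^ (d - i - j))" if "i \<le> d" for x y z :: complex and i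
 proof -
  have e: "Suc d - i = Suc (d - i)" using that by simp
  have "of_rat (c' i j) * x ^ i * y ^ j * z ^ (Suc d - i - j) = z * (of_rat (c i j) * x ^ i * y ^ j * z ^ (d - i - j))"
   if "j \<le> d - i" for j
  proof -
   have "Suc d - i - j = Suc (d - i - j)" "i + j \<le> d" using that \<open>i \<le> d\<close> by auto
   then show ?thesis by (simp add: c'_def)
  qed
  moreover have "c' i (Suc (d - i)) = 0" using that by (simp add: c'_def)
  ultimately have "(\<Sum>j\<le>Suc (d - i). of_rat (c' i j) * x ^ i * y ^ j * z ^ (Suc d - i - j)) =
    (\<Sum>j\<le>d - i. z * (of_rat (c i j) * x ^ i * y ^ j * z ^ (d - i - j)))"
   by (subst sum.atMost_Suc) (auto intro: sum.cong)
  then show ?thesis unfolding e sum_distrib_left .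
 qed
 show ?thesis
 proof (rule rformI[where c = c'])
  fix x y z :: complex
  have "c' (Suc d) 0 = 0" by (simp add: c'_def)
  then have a: "(\<Sum>j\<le>Suc d - Suc d. of_rat (c' (Suc d) j) * x ^ Suc d * y ^ j * z ^ (Suc d - Suc d - j)) = 0" by simp
  have b: "(\<Sum>i\<le>d. \<Sum>j\<le>Suc d - i. of_rat (c' i j) * x ^ i * y ^ j * z ^ (Suc d - i - j)) =
   (\<Sum>i\<le>d. z * (\<Sum>j\<le>d - i. of_rat (c i j) * x ^ i * y ^ j * z ^ (d - i - j)))"
   by (rule sum.cong[OF refl], rule 1) simp
  have "(\<Sum>i\<le>Suc d. \<Sum>j\<le>Suc d - i. of_rat (c' i j) * x ^ i * y ^ j * z ^ (Suc d - i - j)) =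
   (\<Sum>i\<le>d. z * (\<Sum>j\<le>d - i. of_rat (c i j) * x ^ i * y ^ j * z ^ (d - i - j)))"
   by (subst sum.atMost_Suc, subst a, subst b) (rule add_0_right)
  then show "z * F x y z = (\<Sum>i\<le>Suc d. \<Sum>j\<le>Suc d - i. of_rat (c' i j) * x ^ i * y ^ j * z ^ (Suc d - i - j))"
   unfolding c sum_distrib_left[symmetric] by simp
 qed
qed

lemma rform_sum: "finite I \<Longrightarrow> (\<And>i. i \<in> I \<Longrightarrow> rform d (F i)) \<Longrightarrow> rform d (\<lambda>x y z. \<Sum>i\<in>I. F i x y z)"
 by (induction I rule: finite_induct) (auto intro: rform_0 rform_add)

lemma rform_monom_mult: "rform d F \<Longrightarrow> rform (i + (j + (k + d))) (\<lambda>x y z. x ^ i * (y ^ j * (z ^ k * F x y z)))"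
proof (induction i)
 case 0
 then show ?case
 proof (induction j)
  case 0
  then show ?case
  proof (induction k)
   case (Suc k)
   then show ?case using rform_z[of "k + d" "\<lambda>x y z. z ^ k * F x y z"] by (simp add: mult.assoc)
  qed simp
 next
  case (Suc j)
  then show ?case using rform_y[of "j + (k + d)" "\<lambda>x y z. y ^ j * (z ^ k * F x y z)"] by (simp add: mult.assoc)
 qed
next
 case (Suc i)
 then show ?case using rform_x[of "i + (j + (k + d))" "\<lambda>x y z. x ^ i * (y ^ j * (z ^ k * F x y z))"] by (simp add: mult.assoc)
qed

lemma rform_mult:
 assumes "rform d F" "rform e G" shows "rform (d + e) (\<lambda>x y z. F x y z * G x y z)"
proof -
 obtain c where c: "\<And>x y z. F x y z = (\<Sum>i\<le>d. \<Sum>j\<le>d - i. of_rat (c i j) * x ^ i * y ^ j * z ^ (d - i - j))"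
  by (rule rformE[OF assms(1)], rule that)
 have "rform (d + e) (\<lambda>x y z. \<Sum>i\<le>d. \<Sum>j\<le>d - i. of_rat (c i j) * (x ^ i * (y ^ j * (z ^ (d - i - j) * G x y z))))"
 proof (intro rform_sum finite_atMost rform_scale)
  fix i j assume "i \<in> {..d}" "j \<in> {..d - i}"
  then have "i + (j + (d - i - j + e)) = d + e" by simp
  with rform_monom_mult[OF assms(2), of i j "d - i - j"]
  show "rform (d + e) (\<lambda>x y z. x ^ i * (y ^ j * (z ^ (d - i - j) * G x y z)))" by simp
 qed
 then show ?thesis by (simp add: c sum_distrib_right mult.assoc)
qed

lemma rform_const: "rform 0 (\<lambda>x y z. of_rat c)"
 by (rule rformI[where c = "\<lambda>i j. c"]) simp

lemma rform_vars: "rform 1 (\<lambda>x y z. x)" "rform 1 (\<lambda>x y z. y)" "rform 1 (\<lambda>x y z. z)"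
 using rform_x[OF rform_const[of 1]] rform_y[OF rform_const[of 1]] rform_z[OF rform_const[of 1]] by simp_all

lemma rform_power: "rform d F \<Longrightarrow> rform (d * n) (\<lambda>x y z. F x y z ^ n)"
proof (induction n)
 case 0
 show ?case using rform_const[of 1] by simp
qed (auto dest: rform_mult)

definition homog :: "nat \<Rightarrow> rat poly \<Rightarrow> complex \<Rightarrow> complex \<Rightarrow> complex" where
 "homog n p x z = (\<Sum>i\<le>n. of_rat (Polynomial.coeff p i) * (x ^ i * z ^ (n - i)))"

lemma rp_altdef: "degree p \<le> n \<Longrightarrow> rp p x = (\<Sum>i\<le>n. of_rat (Polynomial.coeff p i) * x ^ i)"
 unfolding rp_def poly_altdef
 by (intro sum.mono_neutral_cong_left) (auto simp: coeff_map_poly coeff_eq_0)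

lemma rform_homog: "rform n (\<lambda>x y z. homog n p x z)"
 unfolding homog_def
proof (intro rform_sum rform_scale)
 fix i assume "i \<in> {..n}"
 then show "rform n (\<lambda>x y z. x ^ i * z ^ (n - i))"
  using rform_monom_mult[OF rform_const[of 1], of i 0 "n - i"] by simp
qed simp

lemma homog_1: "degree p \<le> n \<Longrightarrow> homog n p x 1 = rp p x"
 by (simp add: homog_def rp_altdef[of p n])

lemma homog_0: "n > 0 \<Longrightarrow> homog n p 0 0 = 0"
 unfolding homog_def by (intro sum.neutral ballI) (auto simp: power_0_left)

text \<open>On the curve \<open>x\<^sup>3 = z w\<close> with the following \<open>w\<close>, so that forms can be divided by powers of \<open>z\<close>.\<close>

definition wform :: "curve \<Rightarrow> complex \<Rightarrow> complex \<Rightarrow> complex \<Rightarrow> complex" where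
 "wform E x y z = y ^ 2 + (of_rat (- fst E) * (x * z) + of_rat (- snd E) * z ^ 2)"

text \<open>Each \<open>x ^ i\<close> is replaced by \<open>x ^ (i mod 3) * w ^ (i div 3)\<close>.
  As \<open>w\<close> has degree 2 where \<open>x ^ 3\<close> has degree 3, this lowers the degree
  of the form without changing its values at affine points of the curve, and \<open>w\<close> is 1
  at the point at infinity.\<close>

definition redform :: "curve \<Rightarrow> nat \<Rightarrow> nat \<Rightarrow> rat poly \<Rightarrow> complex \<Rightarrow> complex \<Rightarrow> complex \<Rightarrow> complex" where
 "redform E n e p x y z = (\<Sum>i\<le>n. of_rat (Polynomial.coeff p i) * (x ^ (i mod 3) * (z ^ (e - (i mod 3 + 2 * (i div 3))) * wform E x y z ^ (i div 3))))"

lemma rform_wform: "rform 2 (wform E)"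
 unfolding wform_def
 using rform_power[OF rform_vars(2), of 2] rform_power[OF rform_vars(3), of 2] rform_mult[OF rform_vars(1,3)]
 by (intro rform_add rform_scale) (simp_all add: numeral_2_eq_2)

lemma rform_redform:
 assumes "\<And>i. i \<le> n \<Longrightarrow> i mod 3 + 2 * (i div 3) \<le> e"
 shows "rform e (redform E n e p)"
 unfolding redform_def
proof (intro rform_sum rform_scale)
 fix i assume "i \<in> {..n}"
 then have *: "i mod 3 + (e - (i mod 3 + 2 * (i div 3)) + 2 * (i div 3)) = e" using assms[of i] by simp
 from rform_monom_mult[OF rform_power[OF rform_wform[of E], of "i div 3"], of "i mod 3" 0 "e - (i mod 3 + 2 * (i div 3))"]
 show "rform e (\<lambda>x y z. x ^ (i mod 3) * (z ^ (e - (i mod 3 + 2 * (i div 3))) * wform E x y z ^ (i div 3)))"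
  unfolding add_0 * by simp
qed simp

lemma redform_1:
 assumes "on_curve E x y" "degree p \<le> n"
 shows "redform E n e p x y 1 = rp p x"
proof -
 have w: "wform E x y 1 = x ^ 3"
  using assms(1) by (simp add: wform_def on_curve_def of_rat_minus)
 have "x ^ (i mod 3) * (x ^ 3) ^ (i div 3) = x ^ i" for i
  by (simp flip: power_mult power_add)
 then show ?thesis unfolding rp_altdef[OF assms(2)] redform_def w by simp
qed

section \<open>Isogeny formulas as morphisms\<close>

definition velu_map :: "rat poly \<Rightarrow> rat poly \<Rightarrow> rat poly \<Rightarrow> point \<Rightarrow> point" where
 "velu_map N M h P = (case P of Infinity \<Rightarrow> Infinity | Affine x y \<Rightarrow>
   if rp h x = 0 then Infinity else Affine (rp N x / rp h x ^ 2) (y * rp M x / rp h x ^ 3))"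

text \<open>Cleared of denominators the map is \<open>(N h : y M : h ^ 3)\<close>. In degree 10
  these forms serve all affine points, kernel points included because \<open>y M\<close> is nonzero
  there, but they all vanish at infinity. There the same functions are represented in degree 7
  through \<open>redform\<close>, and the middle form takes the leading coefficient of
  \<open>M\<close> as its value.\<close>

lemma velu_morphism:
 assumes deg: "degree N \<le> 7" "degree h \<le> 3" "degree M \<le> 9" "Polynomial.coeff M 9 \<noteq> 0"
  and img: "\<And>x y. on_curve E x y \<Longrightarrow> rp h x \<noteq> 0 \<Longrightarrow> on_curve E' (rp N x / rp h x ^ 2) (y * rp M x / rp h x ^ 3)"
  and ker: "\<And>x y. on_curve E x y \<Longrightarrow> rp h x = 0 \<Longrightarrow> y * rp M x \<noteq> 0"
 shows "morphism_over_Q E E' (velu_map N M h)"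
 unfolding morphism_over_Q_def
proof (intro conjI ballI)
 show "velu_map N M h ` points E \<subseteq> points E'"
 proof (rule image_subsetI)
  fix P assume "P \<in> points E"
  then show "velu_map N M h P \<in> points E'"
   using img by (cases P) (auto simp: velu_map_def)
 qed
next
 fix P assume P: "P \<in> points E"
 have dN: "degree (N * h) \<le> 10" using degree_mult_le[of N h] deg by simp
 have dh: "degree (h ^ 3) \<le> 9" using degree_power_le[of h 3] deg by simp
 have aff: "\<exists>s. s \<noteq> 0 \<and> (case hcoords (velu_map N M h (Affine x y)) of (u, v, w) \<Rightarrow>
   (rp (N * h) x, y * rp M x, rp (h ^ 3) x) = (s * u, s * v, s * w))" if "on_curve E x y" for x y
 proof (cases "rp h x = 0")
  case True
  then show ?thesis using ker[OF that True] by (intro exI[of _ "y * rp M x"]) (simp add: velu_map_def)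
 next
  case False
  then show ?thesis by (intro exI[of _ "rp h x ^ 3"]) (simp add: velu_map_def power2_eq_square power3_eq_cube)
 qed
 show "\<exists>d F G H. eval_forms d F G H P \<noteq> (0, 0, 0) \<and>
    (\<forall>Q\<in>points E. eval_forms d F G H Q \<noteq> (0, 0, 0) \<longrightarrow>
      (\<exists>s. s \<noteq> 0 \<and> (case hcoords (velu_map N M h Q) of (x, y, z) \<Rightarrow>
         eval_forms d F G H Q = (s * x, s * y, s * z))))"
 proof (cases P)
  case (Affine x0 y0)
  obtain F where F: "\<And>x y z. homog 10 (N * h) x z = eval_form 10 F (x, y, z)"
   using rform_homog[of 10 "N * h"] unfolding rform_def by blast
  have "rform (1 + 9) (\<lambda>x y z. y * homog 9 M x z)" by (intro rform_mult rform_vars rform_homog)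
  then have "rform 10 (\<lambda>x y z. y * homog 9 M x z)" by simp
  then obtain G where G: "\<And>x y z. y * homog 9 M x z = eval_form 10 G (x, y, z)"
   unfolding rform_def by blast
  have "rform (1 + 9) (\<lambda>x y z. z * homog 9 (h ^ 3) x z)" by (intro rform_mult rform_vars rform_homog)
  then have "rform 10 (\<lambda>x y z. z * homog 9 (h ^ 3) x z)" by simp
  then obtain H where H: "\<And>x y z. z * homog 9 (h ^ 3) x z = eval_form 10 H (x, y, z)"
   unfolding rform_def by blast
  have e: "eval_forms 10 F G H (Affine x y) = (rp (N * h) x, y * rp M x, rp (h ^ 3) x)" for x y
   unfolding eval_forms_def hcoords.simps F[symmetric] G[symmetric] H[symmetric]
   using dN dh deg by (simp add: homog_1 del: rp_mult rp_power)
  have i: "eval_forms 10 F G H Infinity = (0, 0, 0)"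
   unfolding eval_forms_def hcoords.simps F[symmetric] G[symmetric] H[symmetric] by (simp add: homog_0)
  have nz: "eval_forms 10 F G H P \<noteq> (0, 0, 0)"
   unfolding Affine e using ker[of x0 y0] P Affine by auto
  show ?thesis
  proof (rule exI[of _ 10], rule exI[of _ F], rule exI[of _ G], rule exI[of _ H], intro conjI nz ballI impI)
   fix Q assume Q: "Q \<in> points E" "eval_forms 10 F G H Q \<noteq> (0, 0, 0)"
   then obtain x y where xy: "Q = Affine x y" using i by (cases Q) auto
   then have "on_curve E x y" using Q by simp
   from aff[OF this] show "\<exists>s. s \<noteq> 0 \<and> (case hcoords (velu_map N M h Q) of (x, y, z) \<Rightarrow>
         eval_forms 10 F G H Q = (s * x, s * y, s * z))"
    unfolding xy e .
  qed
 next
  case Infinity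
  have b10: "i mod 3 + 2 * (i div 3) \<le> 7" if "i \<le> 10" for i :: nat using that by presburger
  have b9: "i mod 3 + 2 * (i div 3) \<le> 6" if "i \<le> 9" for i :: nat using that by presburger
  have "rform 7 (redform E 10 7 (N * h))" by (rule rform_redform) (rule b10)
  then obtain F where F: "\<And>x y z. redform E 10 7 (N * h) x y z = eval_form 7 F (x, y, z)"
   unfolding rform_def by blast
  have r6: "rform 6 (redform E 9 6 p)" for p by (rule rform_redform) (rule b9)
  have "rform (1 + 6) (\<lambda>x y z. y * redform E 9 6 M x y z)" by (intro rform_mult rform_vars r6)
  then have "rform 7 (\<lambda>x y z. y * redform E 9 6 M x y z)" by simp
  then obtain G where G: "\<And>x y z. y * redform E 9 6 M x y z = eval_form 7 G (x, y, z)"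
   unfolding rform_def by blast
  have "rform (1 + 6) (\<lambda>x y z. z * redform E 9 6 (h ^ 3) x y z)" by (intro rform_mult rform_vars r6)
  then have "rform 7 (\<lambda>x y z. z * redform E 9 6 (h ^ 3) x y z)" by simp
  then obtain H where H: "\<And>x y z. z * redform E 9 6 (h ^ 3) x y z = eval_form 7 H (x, y, z)"
   unfolding rform_def by blast
  have e: "eval_forms 7 F G H (Affine x y) = (rp (N * h) x, y * rp M x, rp (h ^ 3) x)" if "on_curve E x y" for x y
   unfolding eval_forms_def hcoords.simps F[symmetric] G[symmetric] H[symmetric]
   using dN dh deg that by (simp add: redform_1 del: rp_mult rp_power)
  have w1: "wform E 0 1 0 = 1" by (simp add: wform_def)
  have r0: "redform E 10 7 p 0 1 0 = 0" for p
   unfolding redform_def w1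
  proof (intro sum.neutral ballI)
   fix i :: nat assume "i \<in> {..10}"
   then have "i mod 3 \<noteq> 0 \<or> 7 - (i mod 3 + 2 * (i div 3)) \<noteq> 0" by auto
   then show "of_rat (Polynomial.coeff p i) * (0 ^ (i mod 3) * (0 ^ (7 - (i mod 3 + 2 * (i div 3))) * 1 ^ (i div 3))) = (0 :: complex)"
    by (auto simp: power_0_left)
  qed
  \<comment> \<open>At infinity only \<open>x ^ 9\<close>, rewritten as \<open>w ^ 3\<close>,
    survives; every other term keeps a factor \<open>x\<close> or \<open>z\<close>.\<close>
  have "redform E 9 6 M 0 1 0 = (\<Sum>i\<le>(9::nat). if i = 9 then of_rat (Polynomial.coeff M 9) else 0)"
   unfolding redform_def w1
  proof (intro sum.cong refl)
   fix i :: nat assume i: "i \<in> {..9}"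
   show "of_rat (Polynomial.coeff M i) * (0 ^ (i mod 3) * (0 ^ (6 - (i mod 3 + 2 * (i div 3))) * 1 ^ (i div 3))) =
    (if i = 9 then of_rat (Polynomial.coeff M 9) else (0 :: complex))"
   proof (cases "i = 9")
    case False
    then have "i mod 3 \<noteq> 0 \<or> 6 - (i mod 3 + 2 * (i div 3)) \<noteq> 0" using i by auto
    then show ?thesis using False by (auto simp: power_0_left)
   qed simp
  qed
  then have r1: "redform E 9 6 M 0 1 0 = of_rat (Polynomial.coeff M 9)" by simp
  have i: "eval_forms 7 F G H Infinity = (0, of_rat (Polynomial.coeff M 9), 0)"
   unfolding eval_forms_def hcoords.simps F[symmetric] G[symmetric] H[symmetric] by (simp add: r0 r1)
  have nz: "eval_forms 7 F G H P \<noteq> (0, 0, 0)"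
   unfolding Infinity i using deg by simp
  show ?thesis
  proof (rule exI[of _ 7], rule exI[of _ F], rule exI[of _ G], rule exI[of _ H], intro conjI nz ballI impI)
   fix Q assume Q: "Q \<in> points E" "eval_forms 7 F G H Q \<noteq> (0, 0, 0)"
   show "\<exists>s. s \<noteq> 0 \<and> (case hcoords (velu_map N M h Q) of (x, y, z) \<Rightarrow>
         eval_forms 7 F G H Q = (s * x, s * y, s * z))"
   proof (cases Q)
    case Infinity
    show ?thesis unfolding Infinity i
     by (intro exI[of _ "of_rat (Polynomial.coeff M 9)"]) (use deg in \<open>simp add: velu_map_def\<close>)
   next
    case (Affine x y)
    then have on: "on_curve E x y" using Q by simp
    from aff[OF this] show ?thesis unfolding Affine e[OF on] .
   qed
  qed
 qed
qed

section \<open>Scalings are rational isomorphisms\<close>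

lemma isomorphic_of_scaling:
 assumes E: "E \<in> elliptic_curves" and u: "u \<noteq> 0"
 shows "isomorphic_over_Q E (u ^ 4 * fst E, u ^ 6 * snd E)"
proof -
 define sc where "sc u P = (case P of Infinity \<Rightarrow> Infinity | Affine x y \<Rightarrow> Affine (of_rat (u ^ 2) * x) (of_rat (u ^ 3) * y))"
  for u :: rat and P
 have mor: "morphism_over_Q E (u ^ 4 * fst E, u ^ 6 * snd E) (sc u)" if u: "u \<noteq> 0" for u E
  unfolding morphism_over_Q_def
 proof (intro conjI ballI)
  show "sc u ` points E \<subseteq> points (u ^ 4 * fst E, u ^ 6 * snd E)"
  proof (rule image_subsetI)
   fix P assume P: "P \<in> points E"
   show "sc u P \<in> points (u ^ 4 * fst E, u ^ 6 * snd E)"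
   proof (cases P)
    case (Affine x y)
    then have "y ^ 2 = x ^ 3 + of_rat (fst E) * x + of_rat (snd E)" using P by (simp add: on_curve_def)
    then have "(of_rat u ^ 3 * y) ^ 2 = of_rat u ^ 6 * (x ^ 3 + of_rat (fst E) * x + of_rat (snd E))"
     by (simp add: power_mult_distrib flip: power_mult)
    also have "\<dots> = (of_rat u ^ 2 * x) ^ 3 + of_rat u ^ 4 * of_rat (fst E) * (of_rat u ^ 2 * x) + of_rat u ^ 6 * of_rat (snd E)"
     by (simp add: algebra_simps eval_nat_numeral)
    finally show ?thesis unfolding Affine
     by (simp add: sc_def on_curve_def of_rat_mult of_rat_power)
   qed (simp add: sc_def)
  qed
 next
  fix P assume "P \<in> points E"
  obtain F where F: "\<And>x y z. of_rat (u ^ 2) * x = eval_form 1 F (x, y, z)"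
   using rform_scale[OF rform_vars(1), of "u ^ 2"] unfolding rform_def by blast
  obtain G where G: "\<And>x y z. of_rat (u ^ 3) * y = eval_form 1 G (x, y, z)"
   using rform_scale[OF rform_vars(2), of "u ^ 3"] unfolding rform_def by blast
  obtain H where H: "\<And>x y z. z = eval_form 1 H (x, y, z)"
   using rform_vars(3) unfolding rform_def by blast
  have e: "eval_forms 1 F G H P = (case hcoords P of (x, y, z) \<Rightarrow> (of_rat (u ^ 2) * x, of_rat (u ^ 3) * y, z))" for P
   unfolding eval_forms_def by (cases "hcoords P") (simp only: prod.case F[symmetric] G[symmetric] H[symmetric])
  have u': "(of_rat u :: complex) \<noteq> 0" using u by simp
  show "\<exists>d F G H. eval_forms d F G H P \<noteq> (0, 0, 0) \<and>
    (\<forall>Q\<in>points E. eval_forms d F G H Q \<noteq> (0, 0, 0) \<longrightarrow>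
      (\<exists>s. s \<noteq> 0 \<and> (case hcoords (sc u Q) of (x, y, z) \<Rightarrow>
         eval_forms d F G H Q = (s * x, s * y, s * z))))"
  proof (rule exI[of _ 1], rule exI[of _ F], rule exI[of _ G], rule exI[of _ H], intro conjI ballI impI)
   show "eval_forms 1 F G H P \<noteq> (0, 0, 0)" unfolding e using u' by (cases P) (auto simp: of_rat_power)
  next
   fix Q
   show "\<exists>s. s \<noteq> 0 \<and> (case hcoords (sc u Q) of (x, y, z) \<Rightarrow> eval_forms 1 F G H Q = (s * x, s * y, s * z))"
   proof (cases Q)
    case Infinity
    then show ?thesis unfolding e using u' by (intro exI[of _ "of_rat (u ^ 3)"]) (simp add: sc_def of_rat_power)
   next
    case (Affine x y)
    then show ?thesis unfolding e by (intro exI[of _ 1]) (simp add: sc_def)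
   qed
  qed
 qed
 have inv: "sc (inverse u) (sc u P) = P" if "u \<noteq> 0" for u P
 proof -
  have "of_rat (inverse u ^ n) * of_rat (u ^ n) = (1 :: complex)" for n
   using that by (simp add: power_inverse flip: of_rat_mult)
  then show ?thesis by (cases P) (simp_all only: sc_def point.case mult.assoc[symmetric] mult_1_left)
 qed
 let ?E = "(u ^ 4 * fst E, u ^ 6 * snd E)"
 have E_eq: "(inverse u ^ 4 * fst ?E, inverse u ^ 6 * snd ?E) = E"
  using u by (cases E) (simp add: power_inverse field_simps)
 have "4 * (u ^ 4 * fst E) ^ 3 + 27 * (u ^ 6 * snd E) ^ 2 = u ^ 12 * (4 * fst E ^ 3 + 27 * snd E ^ 2)"
  by (simp add: power_mult_distrib algebra_simps flip: power_mult)
 then have E': "?E \<in> elliptic_curves"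
  using E u by (auto simp: elliptic_curves_def)
 have m2: "morphism_over_Q ?E E (sc (inverse u))"
  using mor[of "inverse u" ?E] u unfolding E_eq by simp
 show ?thesis unfolding isomorphic_over_Q_def
 proof (intro conjI E E' exI)
  show "morphism_over_Q E ?E (sc u)" by (rule mor[OF u])
  show "morphism_over_Q ?E E (sc (inverse u))" by (rule m2)
  show "sc u Infinity = Infinity" by (simp add: sc_def)
  show "\<forall>P\<in>points E. sc (inverse u) (sc u P) = P" using inv[OF u] by blast
  show "\<forall>P\<in>points ?E. sc u (sc (inverse u) P) = P" using inv[of "inverse u"] u by simp
 qed
qed

lemma isomorphic_over_Q_iff:
 assumes "E \<in> elliptic_curves"
 shows "isomorphic_over_Q E E' \<longleftrightarrow> (\<exists>u. u \<noteq> 0 \<and> fst E' = u ^ 4 * fst E \<and> snd E' = u ^ 6 * snd E)"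
proof
 assume "\<exists>u. u \<noteq> 0 \<and> fst E' = u ^ 4 * fst E \<and> snd E' = u ^ 6 * snd E"
 then obtain u where "u \<noteq> 0" "E' = (u ^ 4 * fst E, u ^ 6 * snd E)" by (metis prod.collapse)
 then show "isomorphic_over_Q E E'" using isomorphic_of_scaling[OF assms] by simp
qed (rule isomorphic_scaling)

subsection \<open>The group law\<close>

fun ec_neg :: "point \<Rightarrow> point" where
 "ec_neg Infinity = Infinity" | "ec_neg (Affine x y) = Affine x (- y)"

lemma ec_neg_neg [simp]: "ec_neg (ec_neg P) = P"
 by (cases P) auto

lemma ec_neg_points [simp]: "ec_neg P \<in> points E \<longleftrightarrow> P \<in> points E"
 by (cases P) (auto simp del: points.simps)

text \<open>The two equations for \<open>m\<close> describe the slope of the chord and of the tangent uniformly.\<close>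

lemma ec_add_slope:
 assumes "\<not> (x1 = x2 \<and> y1 = - y2)" "y2 = y1 + m * (x2 - x1)"
  "of_rat A = m * (y1 + y2) - (x1 ^ 2 + x1 * x2 + x2 ^ 2)"
 shows "ec_add (A, B) (Affine x1 y1) (Affine x2 y2) =
   Affine (m ^ 2 - x1 - x2) (m * (x1 - (m ^ 2 - x1 - x2)) - y1)"
proof (cases "x1 = x2")
 case True
 then have "y2 = y1" "y1 \<noteq> 0" using assms by auto
 moreover have "3 * x1 ^ 2 + of_rat A = m * (2 * y1)"
  using assms(3) True \<open>y2 = y1\<close> by (simp add: power2_eq_square algebra_simps)
 ultimately show ?thesis using True by (simp add: Let_def)
next
 case False
 then have "(y2 - y1) / (x2 - x1) = m" using assms(2) by simp
 then show ?thesis using False by (simp add: Let_def)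
qed

text \<open>For a chord the second equation is the difference of the two curve equations divided by
  \<open>x2 - x1\<close>; for a tangent it defines the slope.\<close>

lemma slope_exists:
 assumes "on_curve (A, B) x1 y1" "on_curve (A, B) x2 y2" "\<not> (x1 = x2 \<and> y1 = - y2)"
 obtains m where "y2 = y1 + m * (x2 - x1)" "of_rat A = m * (y1 + y2) - (x1 ^ 2 + x1 * x2 + x2 ^ 2)"
proof (cases "x1 = x2")
 case True
 have "y2 ^ 2 = y1 ^ 2" using assms(1,2) True by (simp add: on_curve_def)
 then have y: "y2 = y1" using assms(3) True by (auto simp: power2_eq_iff)
 then have "y1 \<noteq> 0" using assms(3) True by auto
 then show thesis using that[of "(3 * x1 ^ 2 + of_rat A) / (2 * y1)"] True y by (simp add: power2_eq_square)
next
 case False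
 define m where "m = (y2 - y1) / (x2 - x1)"
 have 1: "y2 = y1 + m * (x2 - x1)" using False by (simp add: m_def)
 have "(x2 - x1) * (m * (y1 + y2)) = (y2 - y1) * (y1 + y2)" using 1 by simp
 also have "\<dots> = y2 ^ 2 - y1 ^ 2" by (simp add: power2_eq_square algebra_simps)
 also have "\<dots> = (x2 - x1) * (of_rat A + (x1 ^ 2 + x1 * x2 + x2 ^ 2))"
  using assms(1,2) by (simp add: on_curve_def power2_eq_square power3_eq_cube algebra_simps)
 finally have "m * (y1 + y2) = of_rat A + (x1 ^ 2 + x1 * x2 + x2 ^ 2)" using False by simp
 then show thesis using that[of m] 1 by simp
qed

lemma chord_on_curve:
 assumes "on_curve (A, B) x1 y1" "y2 = y1 + m * (x2 - x1)"
  "of_rat A = m * (y1 + y2) - (x1 ^ 2 + x1 * x2 + x2 ^ 2)" "x3 = m ^ 2 - x1 - x2" "y3 = m * (x1 - x3) - y1"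
 shows "on_curve (A, B) x3 y3"
proof -
 have B: "of_rat B = y1 ^ 2 - x1 ^ 3 - of_rat A * x1" using assms(1) by (simp add: on_curve_def)
 show ?thesis unfolding on_curve_def fst_conv snd_conv B assms(3) assms(2) assms(5) assms(4)
  by (simp add: power2_eq_square power3_eq_cube algebra_simps)
qed

text \<open>The line through - P and P + Q is the mirror image of the line through P and Q, hence
  has slope \<open>- m\<close>, and the uniform slope equations give Q as the third point. With this
  cancellation the multiples of a point can be run backwards.\<close>

lemma ec_add_cancel:
 assumes "(A, B) \<in> elliptic_curves" "on_curve (A, B) x1 y1" "Q \<in> points (A, B)"
 shows "ec_add (A, B) (Affine x1 y1) Q \<in> points (A, B)"
  "ec_add (A, B) (Affine x1 (- y1)) (ec_add (A, B) (Affine x1 y1) Q) = Q"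
proof -
 have "ec_add (A, B) (Affine x1 y1) Q \<in> points (A, B) \<and>
  ec_add (A, B) (Affine x1 (- y1)) (ec_add (A, B) (Affine x1 y1) Q) = Q"
 proof (cases Q)
  case Infinity
  then show ?thesis using assms by (simp del: points.simps)
 next
  case (Affine x2 y2)
  have on2: "on_curve (A, B) x2 y2" using assms(3) Affine by (simp del: points.simps)
  show ?thesis
  proof (cases "x1 = x2 \<and> y1 = - y2")
   case True
   then show ?thesis using Affine by (simp del: points.simps)
  next
   case False
   obtain m where m: "y2 = y1 + m * (x2 - x1)" "of_rat A = m * (y1 + y2) - (x1 ^ 2 + x1 * x2 + x2 ^ 2)"
    by (rule slope_exists[OF assms(2) on2 False], rule that)
   define x3 where "x3 = m ^ 2 - x1 - x2"
   define y3 where "y3 = m * (x1 - x3) - y1"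
   have R: "ec_add (A, B) (Affine x1 y1) (Affine x2 y2) = Affine x3 y3"
    unfolding x3_def y3_def by (rule ec_add_slope[OF False m])
   have on3: "on_curve (A, B) x3 y3" by (rule chord_on_curve[OF assms(2) m x3_def y3_def])
   have m': "y3 = - y1 + (- m) * (x3 - x1)" by (simp add: y3_def algebra_simps)
   have a': "of_rat A = (- m) * (- y1 + y3) - (x1 ^ 2 + x1 * x3 + x3 ^ 2)"
    unfolding m(2) m(1) y3_def x3_def by (simp add: power2_eq_square algebra_simps)
   \<comment> \<open>The excluded case is P + Q = P with Q affine. It makes \<open>x1\<close> a
     double root of the cubic, with \<open>A = - 3 x1 ^ 2\<close> and \<open>B = 2 x1 ^ 3\<close>,
     contrary to the nonzero discriminant.\<close>
   have nz: "\<not> (x1 = x3 \<and> - y1 = - y3)"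
   proof
    assume h: "x1 = x3 \<and> - y1 = - y3"
    then have y: "y1 = 0" and m2: "m ^ 2 = 2 * x1 + x2" using y3_def x3_def by auto
    have "of_rat A = m ^ 2 * (x2 - x1) - (x1 ^ 2 + x1 * x2 + x2 ^ 2)"
     unfolding m(2) m(1) y by (simp add: power2_eq_square)
    then have a: "(of_rat A :: complex) = - (3 * x1 ^ 2)" unfolding m2 by (simp add: power2_eq_square algebra_simps)
    have "of_rat B = - (x1 ^ 3) - of_rat A * x1" using assms(2) y by (simp add: on_curve_def eq_neg_iff_add_eq_0 algebra_simps)
    then have b: "(of_rat B :: complex) = 2 * x1 ^ 3" unfolding a by (simp add: power2_eq_square power3_eq_cube)
    have "(of_rat (4 * A ^ 3 + 27 * B ^ 2) :: complex) = 4 * of_rat A ^ 3 + 27 * of_rat B ^ 2"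
     by (simp add: of_rat_add of_rat_mult of_rat_power)
    also have "\<dots> = 0" unfolding a b by (simp add: power_mult_distrib flip: power_mult)
    finally show False using assms(1) by (simp add: elliptic_curves_def)
   qed
   have "ec_add (A, B) (Affine x1 (- y1)) (Affine x3 y3) = Affine x2 y2"
   proof -
    have "ec_add (A, B) (Affine x1 (- y1)) (Affine x3 y3) =
     Affine ((- m) ^ 2 - x1 - x3) (- m * (x1 - ((- m) ^ 2 - x1 - x3)) - - y1)"
     by (rule ec_add_slope[OF nz m' a'])
    moreover have "(- m) ^ 2 - x1 - x3 = x2" by (simp add: x3_def)
    moreover have "- m * (x1 - x2) - - y1 = y2" using m(1) by (simp add: algebra_simps)
    ultimately show ?thesis by (simp only:)
   qed
   then show ?thesis using R on3 Affine by (simp del: points.simps)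
  qed
 qed
 then show "ec_add (A, B) (Affine x1 y1) Q \<in> points (A, B)"
  "ec_add (A, B) (Affine x1 (- y1)) (ec_add (A, B) (Affine x1 y1) Q) = Q" by auto
qed

subsection \<open>Points of order 7\<close>

lemma ec_mult_0 [simp]: "ec_mult E 0 P = Infinity"
 and ec_mult_Suc: "ec_mult E (Suc m) P = ec_add E P (ec_mult E m P)"
 by (simp_all add: ec_mult_def)

lemma ec_mult_points:
 assumes "E \<in> elliptic_curves" "P \<in> points E"
 shows "ec_mult E m P \<in> points E"
proof (induction m)
 case (Suc m)
 obtain A B where E: "E = (A, B)" by fastforce
 show ?case
 proof (cases P)
  case Infinity
  then show ?thesis using Suc by (simp add: ec_mult_Suc del: points.simps)
 next
  case (Affine x y)
  then show ?thesis using ec_add_cancel(1)[of A B x y "ec_mult E m P"] assms Suc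
   by (simp add: ec_mult_Suc E del: points.simps)
 qed
qed simp

lemma ec_mult_inj:
 assumes "E \<in> elliptic_curves" "P \<in> points E" "ec_mult E (Suc m) P = ec_mult E (Suc n) P"
 shows "ec_mult E m P = ec_mult E n P"
proof (cases P)
 case Infinity
 then show ?thesis using assms(3) by (simp add: ec_mult_Suc)
next
 case (Affine x y)
 obtain A B where E: "E = (A, B)" by fastforce
 have "ec_add E (Affine x (- y)) (ec_mult E (Suc k) P) = ec_mult E k P" for k
  using ec_add_cancel(2)[of A B x y "ec_mult E k P"] assms(1,2) ec_mult_points[OF assms(1,2)] Affine
  by (simp add: ec_mult_Suc E del: points.simps)
 then show ?thesis using assms(3) by metis
qed

text \<open>Cancellation shifts any coincidence of two multiples back to the zeroth one. So the
  sequence is purely periodic, and its least period equals the number of its values.\<close>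

lemma ec_mult_period:
 assumes "E \<in> elliptic_curves" "P \<in> points E" "finite (range (\<lambda>m. ec_mult E m P))"
 defines "n \<equiv> card (range (\<lambda>m. ec_mult E m P))"
 shows "ec_mult E n P = Infinity" "inj_on (\<lambda>m. ec_mult E m P) {..<n}"
proof -
 let ?S = "\<lambda>m. ec_mult E m P"
 have shift: "?S (i + k) = ?S i \<Longrightarrow> ?S k = Infinity" for i k
  by (induction i) (auto dest: ec_mult_inj[OF assms(1,2)])
 have "\<not> inj ?S" using assms(3) finite_imageD infinite_UNIV_nat by blast
 then obtain i j where ij: "?S i = ?S j" "i < j" unfolding inj_def by (metis nat_neq_iff)
 then have "j - i > 0 \<and> ?S (j - i) = Infinity" using shift[of i "j - i"] by simp
 then obtain p where p: "p > 0 \<and> ?S p = Infinity" and min: "\<And>q. q > 0 \<and> ?S q = Infinity \<Longrightarrow> p \<le> q"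
  using ex_has_least_nat[of "\<lambda>p. p > 0 \<and> ?S p = Infinity" "j - i" id] by auto
 have inj: "inj_on ?S {..<p}"
 proof (rule inj_onI)
  have False if "?S a = ?S b" "a < b" "b < p" for a b
  proof -
   have "?S (b - a) = Infinity" using shift[of a "b - a"] that by simp
   then show False using min[of "b - a"] that by simp
  qed
  then show "a = b" if "a \<in> {..<p}" "b \<in> {..<p}" "?S a = ?S b" for a b
   using that by (metis lessThan_iff linorder_neqE_nat)
 qed
 have per: "?S (m + p) = ?S m" for m
  by (induction m) (use p in \<open>auto simp: ec_mult_Suc\<close>)
 have "?S m \<in> ?S ` {..<p}" for m
 proof (induction m rule: less_induct)
  case (less m)
  show ?case
  proof (cases "m < p")
   case False
   then show ?thesis using less[of "m - p"] per[of "m - p"] p by auto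
  qed auto
 qed
 then have "range ?S = ?S ` {..<p}" by auto
 then have "n = p" unfolding n_def using card_image[OF inj] by simp
 then show "ec_mult E n P = Infinity" "inj_on ?S {..<n}" using p inj by auto
qed

lemma ec_add_neg:
 "ec_add E (ec_neg P) (ec_neg Q) = ec_neg (ec_add E P Q)"
proof (cases P)
 case (Affine x1 y1)
 note P = this
 show ?thesis
 proof (cases Q)
  case (Affine x2 y2)
  obtain A B where E: "E = (A, B)" by fastforce
  have s: "(- y2 - - y1) / (x2 - x1) = - ((y2 - y1) / (x2 - x1))" by (simp add: minus_divide_left)
  have t: "(3 * x1 ^ 2 + of_rat A) / (2 * (- y1)) = - ((3 * x1 ^ 2 + of_rat A) / (2 * y1))" by simp
  define m where "m = (if x1 = x2 then (3 * x1 ^ 2 + of_rat A) / (2 * y1) else (y2 - y1) / (x2 - x1))"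
  have "ec_add E P Q = (if x1 = x2 \<and> y1 = - y2 then Infinity
    else Affine (m ^ 2 - x1 - x2) (m * (x1 - (m ^ 2 - x1 - x2)) - y1))"
   by (simp add: P Affine E Let_def m_def)
  moreover have "ec_add E (ec_neg P) (ec_neg Q) = (if x1 = x2 \<and> - y1 = - (- y2) then Infinity
    else Affine ((- m) ^ 2 - x1 - x2) ((- m) * (x1 - ((- m) ^ 2 - x1 - x2)) - - y1))"
   unfolding P Affine E ec_neg.simps ec_add.simps Let_def s t m_def by simp
  ultimately show ?thesis by (auto simp: equation_minus_iff)
 qed (simp add: P)
qed simp

text \<open>Cancelling backwards from 7P = O gives 6P = - P, 5P = - 2P and 4P = - 3P. So the
  subgroup consists of O and the six points over three distinct x-coordinates, and P + 3P = - 3P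
  records that the order is 7.\<close>

lemma order7_points:
 assumes E: "(A, B) \<in> elliptic_curves" and P: "P \<in> points (A, B)"
  and K: "finite (range (\<lambda>m. ec_mult (A, B) m P))" "card (range (\<lambda>m. ec_mult (A, B) m P)) = 7"
 obtains x1 y1 x2 y2 x3 y3 where
  "on_curve (A, B) x1 y1" "on_curve (A, B) x2 y2" "on_curve (A, B) x3 y3"
  "y1 \<noteq> 0" "y2 \<noteq> 0" "y3 \<noteq> 0" "x1 \<noteq> x2" "x1 \<noteq> x3" "x2 \<noteq> x3" "P = Affine x1 y1"
  "ec_add (A, B) (Affine x1 y1) (Affine x1 y1) = Affine x2 y2"
  "ec_add (A, B) (Affine x1 y1) (Affine x2 y2) = Affine x3 y3"
  "ec_add (A, B) (Affine x1 y1) (Affine x3 y3) = Affine x3 (- y3)"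
  "range (\<lambda>m. ec_mult (A, B) m P) = {Infinity, Affine x1 y1, Affine x1 (- y1), Affine x2 y2, Affine x2 (- y2), Affine x3 y3, Affine x3 (- y3)}"
proof -
 let ?S = "\<lambda>m. ec_mult (A, B) m P"
 have S7: "?S 7 = Infinity" and inj: "inj_on ?S {..<7}"
  using ec_mult_period[OF E P K(1)] unfolding K(2) by auto
 have ne: "?S i \<noteq> ?S j" if "i < 7" "j < 7" "i \<noteq> j" for i j
  using inj_onD[OF inj, of i j] that by auto
 note pt = ec_mult_points[OF E P]
 have "P \<noteq> Infinity"
 proof
  assume "P = Infinity"
  then have "?S 1 = ?S 0" by (simp add: ec_mult_Suc)
  then show False using ne[of 1 0] by simp
 qed
 then obtain x1 y1 where P1: "P = Affine x1 y1" by (cases P) auto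
 have on1: "on_curve (A, B) x1 y1" using P P1 by (simp del: points.simps)
 have rec: "?S (Suc m) = ec_add (A, B) P (?S m)" for m by (simp add: ec_mult_Suc)
 have ec_cancel: "ec_add (A, B) (ec_neg P) (?S (Suc m)) = ?S m" for m
  using ec_add_cancel(2)[OF E on1 pt[of m]] rec[of m] unfolding P1 ec_neg.simps by simp
 have S1: "?S 1 = P" using rec[of 0] by (cases P) simp_all
 have S6: "?S 6 = ec_neg P" using ec_cancel[of 6] S7 by (cases P) (simp_all add: eval_nat_numeral)
 have S5: "?S 5 = ec_neg (?S 2)"
  using ec_cancel[of 5] S6 rec[of 1] S1 ec_add_neg[of "(A, B)" P P] by (simp add: eval_nat_numeral)
 have S4: "?S 4 = ec_neg (?S 3)"
  using ec_cancel[of 4] S5 rec[of 2] ec_add_neg[of "(A, B)" P "?S 2"] by (simp add: eval_nat_numeral)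
 have aff: "\<exists>x y. ?S m = Affine x y \<and> on_curve (A, B) x y" if "0 < m" "m < 7" for m
  using ne[of m 0] pt[of m] that by (cases "?S m") (auto simp del: points.simps)
 obtain x2 y2 where P2: "?S 2 = Affine x2 y2" "on_curve (A, B) x2 y2" using aff[of 2] by auto
 obtain x3 y3 where P3: "?S 3 = Affine x3 y3" "on_curve (A, B) x3 y3" using aff[of 3] by auto
 have S4': "?S 4 = Affine x3 (- y3)" and S5': "?S 5 = Affine x2 (- y2)" and S6': "?S 6 = Affine x1 (- y1)"
  using S4 S5 S6 P1 P2 P3 by auto
 have S1': "?S 1 = Affine x1 y1" by (rule trans[OF S1 P1])
 have sq: "x = x' \<Longrightarrow> on_curve (A, B) x y \<Longrightarrow> on_curve (A, B) x' y' \<Longrightarrow> y = y' \<or> y = - y'" for x x' y y'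
  by (auto simp: on_curve_def power2_eq_iff[symmetric])
 have n0: "y1 \<noteq> 0" "y2 \<noteq> 0" "y3 \<noteq> 0"
  using ne[of 1 6] ne[of 2 5] ne[of 3 4] S1' P2(1) P3(1) S4' S5' S6' P1 by auto
 have nx: "x1 \<noteq> x2" "x1 \<noteq> x3" "x2 \<noteq> x3"
  using sq[OF _ on1 P2(2)] sq[OF _ on1 P3(2)] sq[OF _ P2(2) P3(2)]
   ne[of 1 2] ne[of 2 6] ne[of 1 3] ne[of 3 6] ne[of 2 3] ne[of 2 4] S1' P2(1) P3(1) S4' S5' S6' P1 by auto
 have a1: "ec_add (A, B) (Affine x1 y1) (Affine x1 y1) = Affine x2 y2"
  using rec[of 1] S1' P2(1) P1 by (simp add: eval_nat_numeral)
 have a2: "ec_add (A, B) (Affine x1 y1) (Affine x2 y2) = Affine x3 y3"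
  using rec[of 2] P2(1) P3(1) P1 by (simp add: eval_nat_numeral)
 have a3: "ec_add (A, B) (Affine x1 y1) (Affine x3 y3) = Affine x3 (- y3)"
  using rec[of 3] S4' P3(1) P1 by (simp add: eval_nat_numeral)
 have c7: "card (?S ` {..<7}) = 7" using card_image[OF inj] by simp
 have "?S ` {..<7} = range ?S" by (rule card_subset_eq[OF K(1)]) (use K(2) c7 in auto)
 moreover have "{..<7} = {0, 1, 2, 3, 4, 5, 6 :: nat}" by auto
 ultimately have "range ?S = ?S ` {0, 1, 2, 3, 4, 5, 6}" by simp
 also have "\<dots> = {Infinity, Affine x1 y1, Affine x1 (- y1), Affine x2 y2, Affine x2 (- y2), Affine x3 y3, Affine x3 (- y3)}"
  unfolding image_insert image_empty S1' P2(1) P3(1) S4' S5' S6' ec_mult_0 by auto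
 finally show thesis by (rule that[OF on1 P2(2) P3(2) n0 nx P1 a1 a2 a3])
qed

text \<open>Tate normal form: \<open>l\<close> is the quotient \<open>a\<^sub>3 / a\<^sub>2\<close> after moving the point to the origin
 with a horizontal tangent, and \<open>d = b / c\<close>.\<close>

lemma order7_tate:
 fixes x1 :: complex
 assumes on: "on_curve (A, B) x1 y1" "on_curve (A, B) x2 y2" "on_curve (A, B) x3 y3"
  and y: "y1 \<noteq> 0" "y3 \<noteq> 0" and x: "x1 \<noteq> x2" "x1 \<noteq> x3" "x2 \<noteq> x3"
  and add: "ec_add (A, B) (Affine x1 y1) (Affine x1 y1) = Affine x2 y2"
   "ec_add (A, B) (Affine x1 y1) (Affine x2 y2) = Affine x3 y3"
   "ec_add (A, B) (Affine x1 y1) (Affine x3 y3) = Affine x3 (- y3)"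
 obtains l d where "l \<noteq> 0" "d \<noteq> 0" "d \<noteq> 1"
  "12 * x1 = l ^ 2 * ((1 - (d ^ 2 - d)) ^ 2 - 4 * (d ^ 3 - d ^ 2))"
  "x2 = x1 + l ^ 2 * (d ^ 3 - d ^ 2)" "x3 = x1 + l ^ 2 * (d ^ 2 - d)"
  "2 * y1 = - (l ^ 3 * (d ^ 3 - d ^ 2))" "2 * y2 = l ^ 3 * ((d ^ 3 - d ^ 2) * (d ^ 2 - d))"
  "2 * y3 = l ^ 3 * ((d ^ 3 - d ^ 2) - (d ^ 2 - d) - (d ^ 2 - d) ^ 2)"
  "of_rat A = l * (1 - (d ^ 2 - d)) * y1 - 3 * x1 ^ 2"
proof -
 have n1: "\<not> (x1 = x1 \<and> y1 = - y1)" using y by auto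
 obtain m where m: "y1 = y1 + m * (x1 - x1)" "of_rat A = m * (y1 + y1) - (x1 ^ 2 + x1 * x1 + x1 ^ 2)"
  by (rule slope_exists[OF on(1,1) n1], rule that)
 have e1: "x2 = m ^ 2 - x1 - x1" "y2 = m * (x1 - x2) - y1"
  using add(1) unfolding ec_add_slope[OF n1 m] by auto
 have n2: "\<not> (x1 = x2 \<and> y1 = - y2)" using x by auto
 obtain n where n: "y2 = y1 + n * (x2 - x1)" "of_rat A = n * (y1 + y2) - (x1 ^ 2 + x1 * x2 + x2 ^ 2)"
  by (rule slope_exists[OF on(1,2) n2], rule that)
 have e2: "x3 = n ^ 2 - x1 - x2" "y3 = n * (x1 - x3) - y1"
  using add(2) unfolding ec_add_slope[OF n2 n] by auto
 have n3: "\<not> (x1 = x3 \<and> y1 = - y3)" using x by auto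
 obtain k where k: "y3 = y1 + k * (x3 - x1)" "of_rat A = k * (y1 + y3) - (x1 ^ 2 + x1 * x3 + x3 ^ 2)"
  by (rule slope_exists[OF on(1,3) n3], rule that)
 have e3: "x3 = k ^ 2 - x1 - x3"
  using add(3) unfolding ec_add_slope[OF n3 k] by auto
 \<comment> \<open>\<open>m\<close>, \<open>n\<close>, \<open>k\<close> are the slopes of the lines
   from P to P, 2P and 3P. The first two give two expressions for \<open>y2\<close>, and equating
   them makes the sum of the slopes appear: \<open>l * p = - 2 y1\<close>.\<close>
 define l where "l = m + n"
 define p where "p = x2 - x1"
 define q where "q = x3 - x1"
 define d where "d = p / q"
 have p0: "p \<noteq> 0" "q \<noteq> 0" "p \<noteq> q" using x by (auto simp: p_def q_def)
 have r1: "l * p = - (2 * y1)"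
  using e1(2) n(1) unfolding l_def p_def by (simp add: algebra_simps)
 have l0: "l \<noteq> 0" using r1 y by auto
 have r2: "(k + n) * q = - (2 * y1)"
  using e2(2) k(1) unfolding q_def by (simp add: algebra_simps)
 have m2: "m ^ 2 = x1 + x1 + x2" using e1(1) by simp
 have "x3 - x1 = n ^ 2 - (x1 + x1 + x2)" using e2(1) by simp
 then have r3: "q = n ^ 2 - m ^ 2" unfolding m2 q_def .
 have r4: "k ^ 2 = m ^ 2 - p + 2 * q" using e1(1) e3 unfolding p_def q_def m2 by (simp add: algebra_simps)
 define c where "c = (n - m) / l"
 have nm: "n - m = c * l" using l0 by (simp add: c_def)
 have "q = (n - m) * (m + n)" unfolding r3 by (simp add: power2_eq_square algebra_simps)
 then have q: "q = c * l ^ 2" unfolding nm l_def[symmetric] by (simp add: power2_eq_square)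
 have c0: "c \<noteq> 0" using q p0 by auto
 have pd: "p = d * q" using p0 by (simp add: d_def)
 have "(k + n) * q = (l * d) * q" using r1 r2 pd by (simp add: mult.assoc)
 then have kd: "k + n = l * d" using p0 by simp
 have m2: "2 * m = l * (1 - c)" and n2: "2 * n = l * (1 + c)"
  using nm by (simp_all add: l_def algebra_simps)
 have "k = l * d - n" using kd by (simp add: eq_diff_eq)
 then have "2 * k = 2 * l * d - 2 * n" by simp
 then have k2: "2 * k = l * (2 * d - (1 + c))" unfolding n2 by (simp add: algebra_simps)
 \<comment> \<open>The relation P + 3P = - 3P in the variables \<open>c\<close> and
   \<open>d\<close>; after division by \<open>l ^ 2\<close> it collapses to
   \<open>c = d ^ 2 - d\<close>.\<close>
 have "l ^ 2 * (2 * d - (1 + c)) ^ 2 = (2 * k) ^ 2" unfolding k2 by (simp add: power_mult_distrib)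
 also have "\<dots> = 4 * k ^ 2" by (simp add: power_mult_distrib)
 also have "\<dots> = (2 * m) ^ 2 - 4 * p + 8 * q" unfolding r4 by (simp add: power_mult_distrib)
 also have "\<dots> = l ^ 2 * ((1 - c) ^ 2 - 4 * (d * c) + 8 * c)"
  unfolding m2 pd q power_mult_distrib by (simp add: algebra_simps)
 finally have "(2 * d - (1 + c)) ^ 2 = (1 - c) ^ 2 - 4 * (d * c) + 8 * c" using l0 by simp
 then have "4 * c = 4 * (d ^ 2 - d)" by (simp add: power2_eq_square algebra_simps)
 then have c: "c = d ^ 2 - d" by (rule mult_left_cancel[THEN iffD1, rotated]) simp
 have bq: "d * c = d ^ 3 - d ^ 2" by (simp add: c power2_eq_square power3_eq_cube algebra_simps)
 have pb: "p = l ^ 2 * (d ^ 3 - d ^ 2)" unfolding pd q bq[symmetric] by simp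
 show thesis
 proof (rule that[of l d])
  show "l \<noteq> 0" by (rule l0)
  show "d \<noteq> 0" "d \<noteq> 1" using c0 c by auto
  have "12 * x1 = 4 * (m ^ 2 - p)" using e1(1) by (simp add: p_def)
  also have "\<dots> = (2 * m) ^ 2 - 4 * p" by (simp add: power_mult_distrib)
  finally show "12 * x1 = l ^ 2 * ((1 - (d ^ 2 - d)) ^ 2 - 4 * (d ^ 3 - d ^ 2))"
   unfolding m2 pb c power_mult_distrib by (simp add: algebra_simps)
  show "x2 = x1 + l ^ 2 * (d ^ 3 - d ^ 2)" using pb by (simp add: p_def algebra_simps)
  show "x3 = x1 + l ^ 2 * (d ^ 2 - d)" using q c by (simp add: q_def algebra_simps)
  show "2 * y1 = - (l ^ 3 * (d ^ 3 - d ^ 2))" using r1 pb by (simp add: eval_nat_numeral algebra_simps)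
  have "2 * y2 = - ((2 * m) * p) + l * p" unfolding r1 e1(2) by (simp add: p_def algebra_simps)
  then show "2 * y2 = l ^ 3 * ((d ^ 3 - d ^ 2) * (d ^ 2 - d))"
   unfolding m2 c pb by (simp add: eval_nat_numeral algebra_simps)
  have "2 * y3 = - ((2 * n) * q) + l * p" unfolding r1 e2(2) q_def by (simp add: algebra_simps)
  then show "2 * y3 = l ^ 3 * ((d ^ 3 - d ^ 2) - (d ^ 2 - d) - (d ^ 2 - d) ^ 2)"
   unfolding n2 q c pb by (simp add: eval_nat_numeral algebra_simps)
  have "of_rat A = (2 * m) * y1 - 3 * x1 ^ 2" using m(2) by (simp add: power2_eq_square algebra_simps)
  then show "of_rat A = l * (1 - (d ^ 2 - d)) * y1 - 3 * x1 ^ 2" unfolding m2 c .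
 qed
qed

subsection \<open>Conjugates over the rationals\<close>

text \<open>A minimal polynomial over the rationals, determined up to a constant factor since it is
  not normalised to be monic.\<close>

definition minimal_for :: "rat poly \<Rightarrow> complex \<Rightarrow> bool" where
 "minimal_for M x \<longleftrightarrow> M \<noteq> 0 \<and> rp M x = 0 \<and> (\<forall>p. p \<noteq> 0 \<longrightarrow> rp p x = 0 \<longrightarrow> degree M \<le> degree p)"

lemma minimal_for_exists:
 assumes "p \<noteq> 0" "rp p x = 0"
 obtains M where "minimal_for M x"
proof -
 obtain M where "M \<noteq> 0 \<and> rp M x = 0" "\<And>p. p \<noteq> 0 \<and> rp p x = 0 \<Longrightarrow> degree M \<le> degree p"
  using ex_has_least_nat[of "\<lambda>p. p \<noteq> 0 \<and> rp p x = 0" p degree] assms by auto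
 then have "minimal_for M x" unfolding minimal_for_def by blast
 then show thesis by (rule that)
qed

lemma rp_mod: "rp M x = 0 \<Longrightarrow> rp (p mod M) x = rp p x"
proof -
 assume "rp M x = 0"
 moreover have "p = (p div M) * M + p mod M" by simp
 then have "rp p x = rp (p div M) x * rp M x + rp (p mod M) x" by (metis rp_add rp_mult)
 ultimately show ?thesis by simp
qed

lemma minimal_for_dvd:
 assumes "minimal_for M x" "rp p x = 0" shows "M dvd p"
proof -
 have "p mod M = 0"
 proof (rule ccontr)
  assume nz: "p mod M \<noteq> 0"
  have "rp (p mod M) x = 0" using rp_mod[of M x p] assms unfolding minimal_for_def by simp
  then have "degree M \<le> degree (p mod M)" using assms(1) nz unfolding minimal_for_def by blast
  moreover have "degree (p mod M) < degree M"
   using degree_mod_less[of M p] nz assms(1) unfolding minimal_for_def by auto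
  ultimately show False by simp
 qed
 then show ?thesis by auto
qed

lemma rp_dvd: "M dvd p \<Longrightarrow> rp M x = 0 \<Longrightarrow> rp p x = 0"
 by (auto elim!: dvdE)

lemma minimal_for_degree:
 assumes "minimal_for M x" shows "degree M > 0"
proof (rule ccontr)
 assume "\<not> degree M > 0"
 then obtain c where "M = [:c:]" by (metis degree_eq_zeroE gr_zeroI)
 then show False using assms by (simp add: minimal_for_def)
qed

text \<open>This is irreducibility: the minimal polynomial of \<open>x'\<close> divides
  \<open>M\<close>, and \<open>x\<close> is a root of it or of the cofactor. Minimality for
  \<open>x\<close> then forces the degrees to agree.\<close>

lemma minimal_for_root:
 assumes M: "minimal_for M x" and r: "rp M x' = 0"
 shows "minimal_for M x'"
proof -
 obtain M' where M': "minimal_for M' x'" using minimal_for_exists[of M x'] M r unfolding minimal_for_def by blast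
 have "M' dvd M" by (rule minimal_for_dvd[OF M' r])
 then obtain S where S: "M = M' * S" by (rule dvdE)
 have nz: "M' \<noteq> 0" "S \<noteq> 0" using M S unfolding minimal_for_def by auto
 then have deg: "degree M = degree M' + degree S" using S by (simp add: degree_mult_eq)
 have "rp M' x = 0 \<or> rp S x = 0" using M S unfolding minimal_for_def by auto
 then have "degree M \<le> degree M'"
 proof
  assume "rp M' x = 0"
  then show ?thesis using M nz unfolding minimal_for_def by blast
 next
  assume "rp S x = 0"
  then have "degree M \<le> degree S" using M nz unfolding minimal_for_def by blast
  then show ?thesis using deg minimal_for_degree[OF M'] by simp
 qed
 then show ?thesis using M M' r unfolding minimal_for_def by (meson order_trans)
qed

text \<open>The substitute for a Galois automorphism taking \<open>x\<close> to \<open>x'\<close>: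
  rational polynomial relations, and their negations, transfer between the two roots.\<close>

lemma minimal_for_conj:
 assumes "minimal_for M x" "rp M x' = 0"
 shows "rp R x = 0 \<longleftrightarrow> rp R x' = 0"
proof
 show "rp R x = 0 \<Longrightarrow> rp R x' = 0"
  using minimal_for_dvd[OF assms(1)] rp_dvd assms(2) by blast
 assume "rp R x' = 0"
 then have "M dvd R" by (rule minimal_for_dvd[OF minimal_for_root[OF assms]])
 then show "rp R x = 0" using rp_dvd assms(1) unfolding minimal_for_def by blast
qed

lemma card_simple_roots:
 fixes p :: "complex poly"
 assumes "p \<noteq> 0" "\<And>z. poly p z = 0 \<Longrightarrow> poly (pderiv p) z \<noteq> 0"
 shows "degree p \<le> card {z. poly p z = 0}"
 using assms
proof (induction "degree p" arbitrary: p)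
 case (Suc n)
 have "\<not> constant (poly p)" using Suc(2) by (simp add: constant_degree)
 then obtain a where a: "poly p a = 0" using fundamental_theorem_of_algebra by blast
 then obtain q where q: "p = [:- a, 1:] * q" by (metis dvdE poly_eq_0_iff_dvd)
 have q0: "q \<noteq> 0" using Suc(3) q by auto
 have "degree p = 1 + degree q" using q q0 by (subst q, subst degree_mult_eq) auto
 then have dq: "n = degree q" using Suc(2) by simp
 have pd: "poly (pderiv p) z = poly q z + (z - a) * poly (pderiv q) z" for z
  unfolding q pderiv_mult by (simp add: pderiv_pCons algebra_simps)
 have qa: "poly q a \<noteq> 0" using Suc(4)[OF a] pd[of a] by simp
 have "poly (pderiv q) z \<noteq> 0" if "poly q z = 0" for z
 proof -
  have "poly p z = 0" using that q by simp
  then show ?thesis using Suc(4)[of z] pd[of z] that by auto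
 qed
 then have IH: "degree q \<le> card {z. poly q z = 0}" using Suc(1)[OF dq q0] by blast
 have "{z. poly p z = 0} = insert a {z. poly q z = 0}" using q by auto
 then have "card {z. poly p z = 0} = Suc (card {z. poly q z = 0})"
  using qa poly_roots_finite[OF q0] by simp
 then show ?case using IH dq Suc(2) by simp
qed simp

lemma rp_pderiv: "poly (pderiv (map_poly of_rat p)) x = rp (pderiv p) x"
proof -
 have "pderiv (map_poly of_rat p) = map_poly (of_rat :: rat \<Rightarrow> complex) (pderiv p)"
  by (rule poly_eqI) (simp add: coeff_pderiv coeff_map_poly of_rat_mult of_rat_add)
 then show ?thesis by (simp add: rp_def)
qed

text \<open>Separability in characteristic zero: a root shared with the derivative would satisfy a
  nonzero polynomial of smaller degree.\<close>

lemma minimal_for_card: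
 assumes "minimal_for M x"
 shows "degree M \<le> card {z. rp M z = 0}"
proof -
 have "poly (pderiv (map_poly of_rat M)) z \<noteq> 0" if "rp M z = 0" for z
 proof
  assume "poly (pderiv (map_poly of_rat M)) z = 0"
  then have "rp (pderiv M) z = 0" by (simp add: rp_pderiv)
  moreover have "pderiv M \<noteq> 0" using minimal_for_degree[OF assms] by (simp add: pderiv_eq_0_iff)
  ultimately have "degree M \<le> degree (pderiv M)"
   using minimal_for_root[OF assms that] unfolding minimal_for_def by blast
  then show False using minimal_for_degree[OF assms] by (simp add: degree_pderiv)
 qed
 then show ?thesis
  using card_simple_roots[of "map_poly of_rat M"] assms unfolding minimal_for_def rp_def by simp
qed

section \<open>Rational functions and descent to the rationals\<close>

definition ratfun :: "complex set \<Rightarrow> (complex \<Rightarrow> complex) \<Rightarrow> bool" where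
 "ratfun Z F \<longleftrightarrow> (\<exists>n e. \<forall>x\<in>Z. rp e x \<noteq> 0 \<and> F x * rp e x = rp n x)"

lemma ratfun_rp: "ratfun Z (rp p)"
 unfolding ratfun_def by (intro exI[of _ p] exI[of _ 1]) auto

lemma ratfun_id: "ratfun Z (\<lambda>x. x)"
 unfolding ratfun_def by (intro exI[of _ "[:0, 1:]"] exI[of _ 1]) auto

lemma ratfun_1: "ratfun Z (\<lambda>x. 1)"
 unfolding ratfun_def by (intro exI[of _ 1]) auto

lemma ratfun_add:
 assumes "ratfun Z F" "ratfun Z G" shows "ratfun Z (\<lambda>x. F x + G x)"
proof -
 obtain n e n' e' where *: "\<forall>x\<in>Z. rp e x \<noteq> 0 \<and> F x * rp e x = rp n x" "\<forall>x\<in>Z. rp e' x \<noteq> 0 \<and> G x * rp e' x = rp n' x"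
  using assms unfolding ratfun_def by auto
 show ?thesis unfolding ratfun_def
 proof (rule exI[of _ "n * e' + n' * e"], rule exI[of _ "e * e'"], intro ballI conjI)
  fix x assume x: "x \<in> Z"
  show "rp (e * e') x \<noteq> 0" using * x by simp
  have "rp n x = F x * rp e x" "rp n' x = G x * rp e' x" using * x by simp_all
  then show "(F x + G x) * rp (e * e') x = rp (n * e' + n' * e) x" by (simp add: algebra_simps)
 qed
qed

lemma ratfun_mult:
 assumes "ratfun Z F" "ratfun Z G" shows "ratfun Z (\<lambda>x. F x * G x)"
proof -
 obtain n e n' e' where *: "\<forall>x\<in>Z. rp e x \<noteq> 0 \<and> F x * rp e x = rp n x" "\<forall>x\<in>Z. rp e' x \<noteq> 0 \<and> G x * rp e' x = rp n' x"
  using assms unfolding ratfun_def by auto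
 show ?thesis unfolding ratfun_def
 proof (rule exI[of _ "n * n'"], rule exI[of _ "e * e'"], intro ballI conjI)
  fix x assume x: "x \<in> Z"
  show "rp (e * e') x \<noteq> 0" using * x by simp
  have "rp n x = F x * rp e x" "rp n' x = G x * rp e' x" using * x by simp_all
  then show "(F x * G x) * rp (e * e') x = rp (n * n') x" by (simp add: algebra_simps)
 qed
qed

lemma ratfun_inverse:
 assumes "ratfun Z F" "\<And>x. x \<in> Z \<Longrightarrow> F x \<noteq> 0" shows "ratfun Z (\<lambda>x. 1 / F x)"
proof -
 obtain n e where *: "\<forall>x\<in>Z. rp e x \<noteq> 0 \<and> F x * rp e x = rp n x"
  using assms unfolding ratfun_def by auto
 show ?thesis unfolding ratfun_def
 proof (rule exI[of _ e], rule exI[of _ n], intro ballI conjI)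
  fix x assume x: "x \<in> Z"
  have n: "rp n x = F x * rp e x" using * x by simp
  have "rp e x \<noteq> 0" using * x by blast
  then show "rp n x \<noteq> 0" unfolding n using assms(2)[OF x] by simp
  show "1 / F x * rp n x = rp e x" unfolding n using assms(2)[OF x] by simp
 qed
qed

lemma ratfun_rp_comp:
 assumes "ratfun Z F" shows "ratfun Z (\<lambda>x. rp p (F x))"
proof (induction p)
 case 0
 show ?case unfolding ratfun_def by (intro exI[of _ 0] exI[of _ 1]) auto
next
 case (pCons a p)
 have "ratfun Z (\<lambda>x. rp [:a:] x + F x * rp p (F x))"
  by (intro ratfun_add ratfun_mult ratfun_rp assms pCons)
 then show ?case by simp
qed

text \<open>The numerator minus \<open>s\<close> times the denominator vanishes at all roots of
  \<open>M\<close>. Reduced modulo \<open>M\<close> it has degree below \<open>degree M\<close> but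
  at least \<open>degree M\<close> roots, so it is zero as a complex polynomial, and any nonzero
  coefficient of the reduced denominator displays \<open>s\<close> as a quotient of
  rationals.\<close>

lemma ratfun_constant:
 assumes M: "minimal_for M x1" and Z: "\<And>z. rp M z = 0 \<Longrightarrow> z \<in> Z"
  and F: "ratfun Z F" "\<And>z. z \<in> Z \<Longrightarrow> F z = s"
 shows "\<exists>q. s = of_rat q"
proof -
 obtain n e where ne: "\<And>z. z \<in> Z \<Longrightarrow> rp e z \<noteq> 0 \<and> F z * rp e z = rp n z"
  using F(1) unfolding ratfun_def by auto
 note md = rp_mod[of M]
 define P where "P = map_poly of_rat (n mod M) - Polynomial.smult s (map_poly of_rat (e mod M))"
 have M0: "M \<noteq> 0" and dM: "degree M > 0" using M minimal_for_degree[OF M] unfolding minimal_for_def by auto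
 have dm: "degree (p mod M) < degree M" for p
  using degree_mod_less[of M p] M0 dM by (cases "p mod M = 0") auto
 have dP: "degree P < degree M"
  unfolding P_def using dm by (intro degree_diff_less degree_smult_le[THEN le_less_trans]) simp_all
 have root: "poly P z = 0" if "rp M z = 0" for z
 proof -
  have "poly P z = rp n z - s * rp e z"
   using md[OF that, of n] md[OF that, of e] by (simp add: P_def rp_def)
  then show ?thesis using ne[OF Z[OF that]] F(2)[OF Z[OF that]] by simp
 qed
 have P0: "P = 0"
 proof (rule ccontr)
  assume "P \<noteq> 0"
  have "degree M \<le> card {z. rp M z = 0}" by (rule minimal_for_card[OF M])
  also have "\<dots> \<le> card {z. poly P z = 0}" using root poly_roots_finite[OF \<open>P \<noteq> 0\<close>] by (intro card_mono) auto
  also have "\<dots> \<le> degree P" by (rule card_poly_roots_bound[OF \<open>P \<noteq> 0\<close>])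
  finally show False using dP by simp
 qed
 have x1: "rp M x1 = 0" using M unfolding minimal_for_def by simp
 have "e mod M \<noteq> 0"
  using md[OF x1, of e] ne[OF Z[OF x1]] by auto
 then have i: "Polynomial.coeff (e mod M) (degree (e mod M)) \<noteq> 0" by (simp add: leading_coeff_neq_0)
 define i where "i = degree (e mod M)"
 note i = i[folded i_def]
 have "Polynomial.coeff P i = 0" using P0 by simp
 then have "of_rat (Polynomial.coeff (n mod M) i) = s * of_rat (Polynomial.coeff (e mod M) i)"
  by (simp add: P_def coeff_map_poly)
 then have "s = of_rat (Polynomial.coeff (n mod M) i / Polynomial.coeff (e mod M) i)"
  using i by (simp add: of_rat_divide)
 then show ?thesis by blast
qed

subsection \<open>The kernel of a rational isogeny\<close>

text \<open>If both terms are nonzero, the first has even degree and the second odd degree, so they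
  cannot be equal.\<close>

lemma regular_norm:
 assumes "\<not> (p = 0 \<and> q = 0)" shows "p\<^sup>2 - q\<^sup>2 * cubic E \<noteq> 0"
proof
 assume "p\<^sup>2 - q\<^sup>2 * cubic E = 0"
 then have eq: "p\<^sup>2 = q\<^sup>2 * cubic E" by simp
 have c0: "cubic E \<noteq> 0" "degree (cubic E) = 3" by (simp_all add: cubic_def)
 then have "p \<noteq> 0" "q \<noteq> 0" using assms eq by auto
 then have "2 * degree p = 2 * degree q + 3"
  using arg_cong[OF eq, of degree] c0 by (simp add: degree_mult_eq degree_power_eq)
 then show False by presburger
qed

lemma rp_norm: "on_curve E x y \<Longrightarrow> rp (p\<^sup>2 - q\<^sup>2 * cubic E) x = (rp p x + rp q x * y) * (rp p x - rp q x * y)"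
 by (simp add: on_curve_iff[symmetric] flip: on_curve_iff) (simp add: on_curve_iff algebra_simps power2_eq_square)

text \<open>Near a kernel point the kernel is cut out by \<open>F = H = 0\<close> and
  \<open>G \<noteq> 0\<close>, conditions with rational coefficients, which therefore pass to the
  conjugates of \<open>x1\<close>. Only x-coordinates are followed, because \<open>y1\<close> may
  generate a further quadratic extension.\<close>

lemma kernel_conj:
 assumes iso: "morphism_over_Q E E' \<phi>" and fin: "finite (isogeny_kernel E \<phi>)"
  and P: "Affine x1 y1 \<in> isogeny_kernel E \<phi>"
 obtains M where "minimal_for M x1" "\<And>z. rp M z = 0 \<Longrightarrow> \<exists>y. Affine z y \<in> isogeny_kernel E \<phi>"
proof -
 have on1: "on_curve E x1 y1" and Pp: "Affine x1 y1 \<in> points E" and \<phi>P: "\<phi> (Affine x1 y1) = Infinity"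
  using P unfolding isogeny_kernel_def by (simp_all del: points.simps)
 obtain d F G H where 1: "eval_forms d F G H (Affine x1 y1) \<noteq> (0, 0, 0)" and
   2: "\<And>Q. Q \<in> points E \<Longrightarrow> eval_forms d F G H Q \<noteq> (0, 0, 0) \<Longrightarrow>
      (\<exists>s. s \<noteq> 0 \<and> (case hcoords (\<phi> Q) of (x, y, z) \<Rightarrow> eval_forms d F G H Q = (s * x, s * y, s * z)))"
  using bspec[OF conjunct2[OF iso[unfolded morphism_over_Q_def]] Pp] by (elim exE conjE) (rule that, assumption, blast)
 obtain f0 f1 where f: "\<And>x y. on_curve E x y \<Longrightarrow> eval_form d F (x, y, 1) = rp f0 x + rp f1 x * y"
  using rfun_form[of E d F] unfolding rfun_def by (elim exE) (rule that, blast)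
 obtain g0 g1 where g: "\<And>x y. on_curve E x y \<Longrightarrow> eval_form d G (x, y, 1) = rp g0 x + rp g1 x * y"
  using rfun_form[of E d G] unfolding rfun_def by (elim exE) (rule that, blast)
 obtain h0 h1 where h: "\<And>x y. on_curve E x y \<Longrightarrow> eval_form d H (x, y, 1) = rp h0 x + rp h1 x * y"
  using rfun_form[of E d H] unfolding rfun_def by (elim exE) (rule that, blast)
 have ev: "eval_forms d F G H (Affine x y) = (rp f0 x + rp f1 x * y, rp g0 x + rp g1 x * y, rp h0 x + rp h1 x * y)"
  if "on_curve E x y" for x y
  unfolding eval_forms_def hcoords.simps f[OF that] g[OF that] h[OF that] ..
 have z1: "rp f0 x1 + rp f1 x1 * y1 = 0" "rp h0 x1 + rp h1 x1 * y1 = 0" "rp g0 x1 + rp g1 x1 * y1 \<noteq> 0"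
  using 2[OF Pp 1] 1 unfolding ev[OF on1] \<phi>P by auto
 have inK: "Affine x y \<in> isogeny_kernel E \<phi>"
  if "on_curve E x y" "rp f0 x + rp f1 x * y = 0" "rp h0 x + rp h1 x * y = 0" "rp g0 x + rp g1 x * y \<noteq> 0" for x y
 proof -
  have p: "Affine x y \<in> points E" using that by (simp del: points.simps)
  have nz: "eval_forms d F G H (Affine x y) \<noteq> (0, 0, 0)" unfolding ev[OF that(1)] using that by simp
  have "\<phi> (Affine x y) = Infinity"
   using 2[OF p nz] that unfolding ev[OF that(1)] by (cases "\<phi> (Affine x y)") auto
  then show ?thesis using p by (simp add: isogeny_kernel_def del: points.simps)
 qed
 \<comment> \<open>For transcendental \<open>x1\<close> the norms of \<open>F\<close> and
   \<open>H\<close> would be zero polynomials. Then \<open>F\<close> and \<open>H\<close> vanish on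
   the whole curve, and all points where \<open>G\<close> is nonzero lie in the kernel, which is
   finite.\<close>
 have alg: "\<exists>p. p \<noteq> 0 \<and> rp p x1 = 0"
 proof (rule ccontr)
  assume na: "\<not> (\<exists>p. p \<noteq> 0 \<and> rp p x1 = 0)"
  have f00: "f0 = 0 \<and> f1 = 0"
  proof (rule ccontr)
   assume "\<not> (f0 = 0 \<and> f1 = 0)"
   from regular_norm[OF this, of E] rp_norm[OF on1, of f0 f1] show False using z1(1) na by (metis mult_zero_left)
  qed
  have h00: "h0 = 0 \<and> h1 = 0"
  proof (rule ccontr)
   assume "\<not> (h0 = 0 \<and> h1 = 0)"
   from regular_norm[OF this, of E] rp_norm[OF on1, of h0 h1] show False using z1(2) na by (metis mult_zero_left)
  qed
  have "\<not> (g0 = 0 \<and> g1 = 0)" using z1(3) by auto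
  then have N: "g0\<^sup>2 - g1\<^sup>2 * cubic E \<noteq> 0" by (rule regular_norm)
  define pr where "pr P = (case P of Affine x y \<Rightarrow> x | Infinity \<Rightarrow> 0)" for P
  have "UNIV \<subseteq> {x. rp (g0\<^sup>2 - g1\<^sup>2 * cubic E) x = 0} \<union> pr ` isogeny_kernel E \<phi>"
  proof
   fix x :: complex
   let ?y = "csqrt (rp (cubic E) x)"
   have on: "on_curve E x ?y" by (rule on_curve_csqrt)
   show "x \<in> {x. rp (g0\<^sup>2 - g1\<^sup>2 * cubic E) x = 0} \<union> pr ` isogeny_kernel E \<phi>"
   proof (cases "rp g0 x + rp g1 x * ?y = 0")
    case True
    then show ?thesis using rp_norm[OF on, of g0 g1] by simp
   next
    case False
    then have "Affine x ?y \<in> isogeny_kernel E \<phi>" using inK[OF on] f00 h00 by simp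
    then have "pr (Affine x ?y) \<in> pr ` isogeny_kernel E \<phi>" by (rule imageI)
    then show ?thesis by (simp add: pr_def)
   qed
  qed
  then have "finite (UNIV :: complex set)"
   using rp_finite_roots[OF N] fin by (meson finite_UnI finite_imageI finite_subset)
  then show False by (simp add: infinite_UNIV_char_0)
 qed
 then obtain M where M: "minimal_for M x1" using minimal_for_exists by blast
 have "\<exists>y. Affine z y \<in> isogeny_kernel E \<phi>" if z: "rp M z = 0" for z
 proof -
  note cj = minimal_for_conj[OF M z]
  show ?thesis
  \<comment> \<open>The cases are whether \<open>y1\<close> is a rational function of
    \<open>x1\<close>. If so, the same function defines \<open>y\<close> over \<open>z\<close>. If
    not, a relation \<open>p + q y1 = 0\<close> kills both coefficients at \<open>x1\<close>, so
    \<open>F\<close> and \<open>H\<close> vanish over \<open>z\<close> for both signs of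
    \<open>y\<close>, and \<open>G\<close> is nonzero for at least one sign.\<close>
  proof (cases "\<exists>r e. rp e x1 \<noteq> 0 \<and> y1 * rp e x1 = rp r x1")
   case True
   then obtain r e where re: "rp e x1 \<noteq> 0" "y1 * rp e x1 = rp r x1" by blast
   have ez: "rp e z \<noteq> 0" using cj re by blast
   define y where "y = rp r z / rp e z"
   have yz: "y * rp e z = rp r z" using ez by (simp add: y_def)
   have tr: "rp p x1 + rp q x1 * y1 = 0 \<longleftrightarrow> rp p z + rp q z * y = 0" for p q
   proof -
    have a: "rp (p * e + q * r) x1 = (rp p x1 + rp q x1 * y1) * rp e x1" using re by (simp add: algebra_simps)
    have b: "rp (p * e + q * r) z = (rp p z + rp q z * y) * rp e z" using yz by (simp add: algebra_simps)
    show ?thesis using cj[of "p * e + q * r"] re(1) ez unfolding a b by simp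
   qed
   have "rp (r ^ 2 - e ^ 2 * cubic E) x1 = (y1 ^ 2 - rp (cubic E) x1) * rp e x1 ^ 2"
    by (simp add: re(2)[symmetric] power_mult_distrib algebra_simps)
   then have "rp (r ^ 2 - e ^ 2 * cubic E) x1 = 0" using on1 by (simp add: on_curve_iff)
   then have "rp (r ^ 2 - e ^ 2 * cubic E) z = 0" using cj by blast
   moreover have "rp (r ^ 2 - e ^ 2 * cubic E) z = (y ^ 2 - rp (cubic E) z) * rp e z ^ 2"
    by (simp add: yz[symmetric] power_mult_distrib algebra_simps)
   ultimately have "on_curve E z y" using ez by (simp add: on_curve_iff)
   then show ?thesis using inK[of z y] z1 tr by blast
  next
   case False
   have van: "rp p z = 0 \<and> rp q z = 0" if "rp p x1 + rp q x1 * y1 = 0" for p q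
   proof -
    have "rp q x1 = 0"
    proof (rule ccontr)
     assume "rp q x1 \<noteq> 0"
     moreover have "y1 * rp q x1 = rp (- p) x1" using that by (simp add: eq_neg_iff_add_eq_0 algebra_simps)
     ultimately show False using False by blast
    qed
    then have "rp p x1 = 0" "rp q x1 = 0" using that by auto
    then show ?thesis using cj by blast
   qed
   have y0: "rp (cubic E) z \<noteq> 0"
   proof
    assume "rp (cubic E) z = 0"
    then have "y1 = 0" using cj[of "cubic E"] on1 by (simp add: on_curve_iff)
    then have "rp 1 x1 \<noteq> 0 \<and> y1 * rp 1 x1 = rp 0 x1" by simp
    then show False using False by blast
   qed
   define y where "y = csqrt (rp (cubic E) z)"
   have on: "on_curve E z y" "on_curve E z (- y)" by (simp_all add: y_def on_curve_csqrt)
   have yn: "y \<noteq> 0" using y0 by (simp add: y_def)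
   have "rp g0 z + rp g1 z * y \<noteq> 0 \<or> rp g0 z + rp g1 z * (- y) \<noteq> 0"
   proof (rule ccontr)
    assume "\<not> ?thesis"
    then have a: "rp g0 z + rp g1 z * y = 0" "rp g0 z - rp g1 z * y = 0" by auto
    have "2 * rp g0 z = (rp g0 z + rp g1 z * y) + (rp g0 z - rp g1 z * y)" by simp
    then have "rp g0 z = 0" using a by simp
    moreover from this have "rp g1 z = 0" using a yn by simp
    ultimately have "rp g0 x1 = 0" "rp g1 x1 = 0" using cj by blast+
    then show False using z1 by simp
   qed
   then show ?thesis using inK[OF on(1)] inK[OF on(2)] van[OF z1(1)] van[OF z1(2)] by auto
  qed
 qed
 with M show thesis by (rule that)
qed

subsection \<open>The family of curves\<close>

text \<open>The parameter \<open>s\<close> is the sum of the orbit of Tate's \<open>d\<close> under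
  \<open>d\<close> to \<open>1 / (1 - d)\<close>, a rational coordinate on the modular curve of
  level 7. The polynomials \<open>f7\<close> and \<open>g7\<close> describe the same family after a
  fractional linear change of parameter and a twist.\<close>

definition sC :: "'a::comm_ring_1 \<Rightarrow> 'a" where "sC s = s ^ 2 - 3 * s + 9"
definition sQ :: "'a::comm_ring_1 \<Rightarrow> 'a" where "sQ s = s ^ 2 - 11 * s + 25"
definition sR :: "'a::comm_ring_1 \<Rightarrow> 'a" where "sR s = s ^ 4 - 18 * s ^ 3 + 111 * s ^ 2 - 298 * s + 393"
definition sA :: "'a::comm_ring_1 \<Rightarrow> 'a" where "sA s = - (3 * sC s * sQ s)"
definition sB :: "'a::comm_ring_1 \<Rightarrow> 'a" where "sB s = 2 * sC s * sR s"

lemma of_rat_sCQR: "of_rat (sC s) = sC (of_rat s :: 'a::field_char_0)" "of_rat (sQ s) = sQ (of_rat s :: 'a)"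
 "of_rat (sR s) = sR (of_rat s :: 'a)"
 by (simp_all add: sC_def sQ_def sR_def of_rat_add of_rat_diff of_rat_mult of_rat_power)

lemma of_rat_sAB: "of_rat (sA s) = sA (of_rat s :: 'a::field_char_0)" "of_rat (sB s) = sB (of_rat s :: 'a)"
 by (simp_all add: sA_def sB_def of_rat_mult of_rat_minus of_rat_sCQR)

text \<open>Since \<open>sC\<close> has no rational zero, \<open>s = 8\<close> is the only rational
  parameter with a singular curve.\<close>

lemma sAB_disc: "4 * sA s ^ 3 + 27 * sB s ^ 2 = 186624 * sC s ^ 2 * (8 - s)" for s :: "'a::comm_ring_1"
proof -
 have e1: "sR s ^ 2 - sC s * sQ s ^ 3 = 1728 * (8 - s)"
  using pexp_eq[OF disc_eq, of s s] by (simp add: sR_def sC_def sQ_def eR_def eC_def eQ_def)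
 have e2: "4 * sA s ^ 3 + 27 * sB s ^ 2 = 108 * sC s ^ 2 * (sR s ^ 2 - sC s * sQ s ^ 3)"
  unfolding sA_def sB_def by (simp add: power_mult_distrib algebra_simps eval_nat_numeral)
 show ?thesis unfolding e2 e1 by (simp add: algebra_simps)
qed

text \<open>For integers that are not both even, the homogenized values are odd.\<close>

lemma sCQR_nonzero: "sC s \<noteq> 0" "sQ s \<noteq> 0" "sR s \<noteq> 0" for s :: rat
proof -
 obtain m n where q: "quotient_of s = (m, n)" by fastforce
 have n: "n > 0" "coprime m n" and s: "s = of_int m / of_int n"
  using quotient_of_denom_pos[OF q] quotient_of_coprime[OF q] quotient_of_div[OF q] by auto
 have par: "odd m \<or> odd n" using n(2) by (meson coprime_common_divisor dvd_refl odd_one)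
 have n0: "(of_int n :: rat) \<noteq> 0" using n by simp
 have hC: "sC s * of_int n ^ 2 = of_int (m ^ 2 - 3 * m * n + 9 * n ^ 2)"
  using n0 by (simp add: sC_def s field_simps power2_eq_square)
 have hQ: "sQ s * of_int n ^ 2 = of_int (m ^ 2 - 11 * m * n + 25 * n ^ 2)"
  using n0 by (simp add: sQ_def s field_simps power2_eq_square)
 have sn: "s * of_int n = of_int m" using n0 by (simp add: s)
 have "sR s * of_int n ^ 4 = (s * of_int n) ^ 4 - 18 * (s * of_int n) ^ 3 * of_int n + 111 * (s * of_int n) ^ 2 * of_int n ^ 2
   - 298 * (s * of_int n) * of_int n ^ 3 + 393 * of_int n ^ 4"
  unfolding sR_def by (simp add: eval_nat_numeral algebra_simps)
 then have hR: "sR s * of_int n ^ 4 = of_int (m ^ 4 - 18 * m ^ 3 * n + 111 * m ^ 2 * n ^ 2 - 298 * m * n ^ 3 + 393 * n ^ 4)"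
  unfolding sn by simp
 have "odd (m ^ 2 - 3 * m * n + 9 * n ^ 2)" "odd (m ^ 2 - 11 * m * n + 25 * n ^ 2)"
  "odd (m ^ 4 - 18 * m ^ 3 * n + 111 * m ^ 2 * n ^ 2 - 298 * m * n ^ 3 + 393 * n ^ 4)"
  using par by (auto simp: even_power)
 then have o: "m ^ 2 - 3 * m * n + 9 * n ^ 2 \<noteq> 0" "m ^ 2 - 11 * m * n + 25 * n ^ 2 \<noteq> 0"
  "m ^ 4 - 18 * m ^ 3 * n + 111 * m ^ 2 * n ^ 2 - 298 * m * n ^ 3 + 393 * n ^ 4 \<noteq> 0"
  by (metis even_zero)+
 show "sC s \<noteq> 0"
 proof
  assume "sC s = 0"
  then have "(of_int (m ^ 2 - 3 * m * n + 9 * n ^ 2) :: rat) = 0" using hC by (simp only: mult_zero_left)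
  then show False using o by (simp only: of_int_eq_0_iff)
 qed
 show "sQ s \<noteq> 0"
 proof
  assume "sQ s = 0"
  then have "(of_int (m ^ 2 - 11 * m * n + 25 * n ^ 2) :: rat) = 0" using hQ by (simp only: mult_zero_left)
  then show False using o by (simp only: of_int_eq_0_iff)
 qed
 show "sR s \<noteq> 0"
 proof
  assume "sR s = 0"
  then have "(of_int (m ^ 4 - 18 * m ^ 3 * n + 111 * m ^ 2 * n ^ 2 - 298 * m * n ^ 3 + 393 * n ^ 4) :: rat) = 0"
   using hR by (simp only: mult_zero_left)
  then show False using o by (simp only: of_int_eq_0_iff)
 qed
qed

lemma sAB_nonzero: "sA s \<noteq> 0" "sB s \<noteq> 0" for s :: rat
 using sCQR_nonzero[of s] by (simp_all add: sA_def sB_def)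

text \<open>The Weierstrass coefficients of the Tate curve in terms of \<open>d\<close>, and the invariant \<open>s\<close>
 of the cyclic group of order 3 acting on \<open>d\<close>.\<close>

lemma tate_coeffs:
 fixes d l a b' x1 y1 :: "'a::field_char_0"
 assumes "12 * x1 = l ^ 2 * ((1 - (d ^ 2 - d)) ^ 2 - 4 * (d ^ 3 - d ^ 2))"
  "2 * y1 = - (l ^ 3 * (d ^ 3 - d ^ 2))" "a = l * (1 - (d ^ 2 - d)) * y1 - 3 * x1 ^ 2"
  "b' = y1 ^ 2 - x1 ^ 3 - a * x1" "d \<noteq> 0" "d \<noteq> 1"
  "s = (d ^ 3 - 3 * d + 1) / (d ^ 2 - d)" "sC s \<noteq> 0"
 defines "g \<equiv> l ^ 2 * (d ^ 2 - d) ^ 2 / (12 * (d ^ 2 - d + 1))"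
 shows "a = g ^ 2 * sA s" "b' = g ^ 3 * sB s" "d ^ 2 - d + 1 \<noteq> 0"
proof -
 define c b N w where defs: "c = d ^ 2 - d" "b = d ^ 3 - d ^ 2" "N = d ^ 3 - 3 * d + 1" "w = d ^ 2 - d + 1"
 define e where "e = (1 - c) ^ 2 - 4 * b"
 note id = tate_identities[of d, folded defs, folded e_def]
 have "c = d * (d - 1)" by (simp add: defs algebra_simps power2_eq_square)
 then have c0: "c \<noteq> 0" using assms by simp
 have sN: "s = N / c" using assms by (simp add: defs)
 have sc: "s * c = N" using sN c0 by simp
 have C: "sC s * c ^ 2 = w ^ 3"
  unfolding id(1)[symmetric] sC_def sc[symmetric] by (simp add: algebra_simps power2_eq_square)
 have Q: "w * (sQ s * c ^ 2) = 24 * (1 - c) * b + e ^ 2"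
  unfolding id(2) sQ_def sc[symmetric] by (simp add: algebra_simps power2_eq_square)
 have R: "sR s * c ^ 4 = 216 * b ^ 2 + e ^ 3 + 36 * (1 - c) * b * e"
  unfolding id(3)[symmetric] sR_def sc[symmetric] by (simp add: algebra_simps eval_nat_numeral)
 have w0: "w \<noteq> 0" using C c0 assms(8) by auto
 then show "d ^ 2 - d + 1 \<noteq> 0" by (simp add: defs)
 have x: "x1 = l ^ 2 * e / 12" and y: "y1 = - (l ^ 3 * b) / 2"
  using assms(1,2) by (simp_all add: defs e_def field_simps)
 have "a = - (l ^ 4 * (24 * (1 - c) * b + e ^ 2)) / 48"
  unfolding assms(3) x y defs(1)[symmetric] by (simp add: field_simps eval_nat_numeral)
 then have a: "a = - (l ^ 4 * (w * (sQ s * c ^ 2))) / 48" unfolding Q .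
 have g: "g = l ^ 2 * c ^ 2 / (12 * w)" by (simp add: g_def defs)
 have "g ^ 2 * sA s = - (3 * (l ^ 4 * c ^ 2 * (sC s * c ^ 2) * sQ s) / (144 * w ^ 2))"
  unfolding g sA_def by (simp add: power_divide power_mult_distrib eval_nat_numeral field_simps)
 also have "\<dots> = a" unfolding C a using w0 by (simp add: field_simps eval_nat_numeral)
 finally show "a = g ^ 2 * sA s" ..
 have "b' = l ^ 6 * (2 * (216 * b ^ 2 + e ^ 3 + 36 * (1 - c) * b * e)) / 1728"
  unfolding assms(4) unfolding \<open>a = - (l ^ 4 * (24 * (1 - c) * b + e ^ 2)) / 48\<close> x y
  by (simp add: field_simps eval_nat_numeral)
 then have b': "b' = l ^ 6 * (2 * (sR s * c ^ 4)) / 1728" unfolding R .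
 have "g ^ 3 * sB s = l ^ 6 * (c ^ 4 * (2 * (sC s * c ^ 2) * sR s)) / (1728 * w ^ 3)"
  unfolding g sB_def by (simp add: power_divide power_mult_distrib eval_nat_numeral field_simps)
 also have "\<dots> = b'" unfolding C b' using w0 by (simp add: field_simps)
 finally show "b' = g ^ 3 * sB s" ..
qed

text \<open>Doubling permutes the three \<open>x\<close>-coordinates of the kernel cyclically, and the
 slopes of the tangents are polynomials in \<open>l\<close> and \<open>d\<close>.\<close>

lemma tate_doubling:
 fixes l d x1 x2 x3 y1 y2 y3 a :: "'a::field_char_0"
 assumes d: "d \<noteq> 0" "d \<noteq> 1"
  and x1: "12 * x1 = l ^ 2 * ((1 - (d ^ 2 - d)) ^ 2 - 4 * (d ^ 3 - d ^ 2))"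
  and x2: "x2 = x1 + l ^ 2 * (d ^ 3 - d ^ 2)" and x3: "x3 = x1 + l ^ 2 * (d ^ 2 - d)"
  and y: "2 * y1 = - (l ^ 3 * (d ^ 3 - d ^ 2))" "2 * y2 = l ^ 3 * ((d ^ 3 - d ^ 2) * (d ^ 2 - d))"
   "2 * y3 = l ^ 3 * ((d ^ 3 - d ^ 2) - (d ^ 2 - d) - (d ^ 2 - d) ^ 2)"
  and a: "a = l * (1 - (d ^ 2 - d)) * y1 - 3 * x1 ^ 2"
 shows "(3 * x1 ^ 2 + a) ^ 2 = (2 * y1) ^ 2 * (x2 + 2 * x1)"
  "(3 * x2 ^ 2 + a) ^ 2 = (2 * y2) ^ 2 * (x3 + 2 * x2)"
  "(3 * x3 ^ 2 + a) ^ 2 = (2 * y3) ^ 2 * (x1 + 2 * x3)"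
proof -
 define e where "e = (1 - (d ^ 2 - d)) ^ 2 - 4 * (d ^ 3 - d ^ 2)"
 have "12 * x1 = l ^ 2 * e" using x1 unfolding e_def .
 then have x1': "x1 = l ^ 2 * e / 12" by (simp add: eq_divide_eq mult.commute)
 have a': "a = - (l ^ 4 * ((1 - (d ^ 2 - d)) * (d ^ 3 - d ^ 2))) / 2 - 3 * x1 ^ 2"
 proof -
  have "2 * a = l * (1 - (d ^ 2 - d)) * (2 * y1) - 6 * x1 ^ 2" unfolding a by (simp add: algebra_simps)
  then have "2 * a = - (l ^ 4 * ((1 - (d ^ 2 - d)) * (d ^ 3 - d ^ 2))) - 6 * x1 ^ 2"
   unfolding y(1) by (simp add: eval_nat_numeral algebra_simps)
  then show ?thesis by (simp add: field_simps)
 qed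
 have s1: "2 * (3 * x1 ^ 2 + a) = l * (1 - (d ^ 2 - d)) * (2 * y1)"
  unfolding a by (simp add: algebra_simps)
 have q1: "4 * (x2 + 2 * x1) = (l * (1 - (d ^ 2 - d))) ^ 2"
  unfolding x2 x1' e_def by (simp add: eval_nat_numeral field_simps)
 have s2: "2 * (3 * x2 ^ 2 + a) = l * (d ^ 2 - d - 1 + 2 * d) * (2 * y2)"
  unfolding y a' x2 x1' e_def by (simp add: eval_nat_numeral field_simps)
 have q2: "4 * (x3 + 2 * x2) = (l * (d ^ 2 - d - 1 + 2 * d)) ^ 2"
  unfolding x2 x3 x1' e_def by (simp add: eval_nat_numeral field_simps)
 have s3: "2 * (3 * x3 ^ 2 + a) = - l * (d ^ 2 - 3 * d + 1) * (2 * y3)"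
  unfolding y a' x3 x1' e_def by (simp add: eval_nat_numeral field_simps)
 have q3: "4 * (x1 + 2 * x3) = (- l * (d ^ 2 - 3 * d + 1)) ^ 2"
  unfolding x3 x1' e_def by (simp add: eval_nat_numeral field_simps)
 have fin: "u ^ 2 = v ^ 2 * x" if "2 * u = m * v" "4 * x = m ^ 2" for u v x m :: 'a
 proof -
  have "4 * u ^ 2 = (2 * u) ^ 2" by (simp add: power_mult_distrib)
  also have "\<dots> = 4 * (v ^ 2 * x)" unfolding that(1) power_mult_distrib that(2)[symmetric] by (simp add: mult_ac)
  finally show ?thesis by (rule mult_left_cancel[THEN iffD1, rotated]) simp
 qed
 show "(3 * x1 ^ 2 + a) ^ 2 = (2 * y1) ^ 2 * (x2 + 2 * x1)" by (rule fin[OF s1 q1])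
 show "(3 * x2 ^ 2 + a) ^ 2 = (2 * y2) ^ 2 * (x3 + 2 * x2)" by (rule fin[OF s2 q2])
 show "(3 * x3 ^ 2 + a) ^ 2 = (2 * y3) ^ 2 * (x1 + 2 * x3)" by (rule fin[OF s3 q3])
qed

text \<open>Replacing the generator P by 2P or 3P permutes \<open>d\<close>,
  \<open>1 - 1 / d\<close> and \<open>1 / (1 - d)\<close>, so their sum \<open>s\<close> depends
  only on the subgroup. Written through the duplication formula it is a rational function of the
  x-coordinate that takes one value on the whole kernel, and \<open>ratfun_constant\<close>
  applies.\<close>

lemma isogeny7_family:
 assumes "admits_cyclic_isogeny 7 E"
 shows "\<exists>s c. s \<noteq> 8 \<and> c \<noteq> 0 \<and> fst E = c ^ 2 * sA s \<and> snd E = c ^ 3 * sB s"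
proof -
 obtain A B where AB: "E = (A, B)" by fastforce
 obtain E' \<phi> where iso: "isogeny_over_Q (A, B) E' \<phi>" and cyc: "cyclic_of_order (A, B) 7 (isogeny_kernel (A, B) \<phi>)"
  using assms unfolding admits_cyclic_isogeny_def AB by blast
 have ell: "(A, B) \<in> elliptic_curves" and mor: "morphism_over_Q (A, B) E' \<phi>"
  using iso unfolding isogeny_over_Q_def by blast+
 obtain P where P: "P \<in> points (A, B)" and K: "isogeny_kernel (A, B) \<phi> = range (\<lambda>m. ec_mult (A, B) m P)"
  and fin: "finite (isogeny_kernel (A, B) \<phi>)" and c7: "card (isogeny_kernel (A, B) \<phi>) = 7"
  using cyc unfolding cyclic_of_order_def by blast
 obtain x1 y1 x2 y2 x3 y3 where on: "on_curve (A, B) x1 y1" "on_curve (A, B) x2 y2" "on_curve (A, B) x3 y3"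
  and y0: "y1 \<noteq> 0" "y2 \<noteq> 0" "y3 \<noteq> 0" and x0: "x1 \<noteq> x2" "x1 \<noteq> x3" "x2 \<noteq> x3" and P1: "P = Affine x1 y1"
  and add: "ec_add (A, B) (Affine x1 y1) (Affine x1 y1) = Affine x2 y2"
  "ec_add (A, B) (Affine x1 y1) (Affine x2 y2) = Affine x3 y3"
  "ec_add (A, B) (Affine x1 y1) (Affine x3 y3) = Affine x3 (- y3)"
  and R: "range (\<lambda>m. ec_mult (A, B) m P) = {Infinity, Affine x1 y1, Affine x1 (- y1), Affine x2 y2, Affine x2 (- y2), Affine x3 y3, Affine x3 (- y3)}"
  by (rule order7_points[OF ell P fin[unfolded K] c7[unfolded K]], rule that)
 obtain l d where l0: "l \<noteq> 0" and d0: "d \<noteq> 0" "d \<noteq> 1" and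
  t: "12 * x1 = l ^ 2 * ((1 - (d ^ 2 - d)) ^ 2 - 4 * (d ^ 3 - d ^ 2))"
  "x2 = x1 + l ^ 2 * (d ^ 3 - d ^ 2)" "x3 = x1 + l ^ 2 * (d ^ 2 - d)"
  "2 * y1 = - (l ^ 3 * (d ^ 3 - d ^ 2))" "2 * y2 = l ^ 3 * ((d ^ 3 - d ^ 2) * (d ^ 2 - d))"
  "2 * y3 = l ^ 3 * ((d ^ 3 - d ^ 2) - (d ^ 2 - d) - (d ^ 2 - d) ^ 2)"
  and tA: "of_rat A = l * (1 - (d ^ 2 - d)) * y1 - 3 * x1 ^ 2"
  by (rule order7_tate[OF on y0(1,3) x0 add], rule that)
 note dbl = tate_doubling[OF d0 t tA]
 define s where "s = (d ^ 3 - 3 * d + 1) / (d ^ 2 - d)"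
 define Z where "Z = {x1, x2, x3}"
 \<comment> \<open>The duplication formula: the x-coordinate of 2P as a rational function of that of
   P. It permutes the three x-coordinates cyclically.\<close>
 define D where "D x = (3 * x ^ 2 + of_rat A) ^ 2 * (1 / rp (Polynomial.smult 4 (cubic (A, B))) x) + rp [:0, -2:] x" for x
 have c4: "rp (Polynomial.smult 4 (cubic (A, B))) x = (2 * y) ^ 2" if "on_curve (A, B) x y" for x y
  using that by (simp add: on_curve_iff power_mult_distrib)
 have D: "D x1 = x2" "D x2 = x3" "D x3 = x1"
  unfolding D_def c4[OF on(1)] c4[OF on(2)] c4[OF on(3)] dbl using y0 by (simp_all add: field_simps)
 have ratD: "ratfun Z D"
  unfolding D_def
 proof (intro ratfun_add ratfun_mult ratfun_inverse ratfun_rp)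
  show "ratfun Z (\<lambda>x. (3 * x ^ 2 + of_rat A) ^ 2)"
  proof -
   have e: "(3 * x ^ 2 + of_rat A) ^ 2 = rp ([:A, 0, 3:] ^ 2) x" for x
    by (simp add: algebra_simps power2_eq_square of_rat_mult)
   show ?thesis unfolding e by (rule ratfun_rp)
  qed
  show "rp (Polynomial.smult 4 (cubic (A, B))) x \<noteq> 0" if "x \<in> Z" for x
   using that c4[OF on(1)] c4[OF on(2)] c4[OF on(3)] y0 unfolding Z_def by auto
 qed
 have DZ: "D x \<in> Z" if "x \<in> Z" for x using that D unfolding Z_def by auto
 have ratDD: "ratfun Z (\<lambda>x. D (D x))"
 proof -
  have "ratfun Z (\<lambda>x. rp ([:A, 0, 3:] ^ 2) (D x) * (1 / rp (Polynomial.smult 4 (cubic (A, B))) (D x)) + rp [:0, -2:] (D x))"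
  proof (intro ratfun_add ratfun_mult ratfun_inverse ratfun_rp_comp ratD)
   show "rp (Polynomial.smult 4 (cubic (A, B))) (D x) \<noteq> 0" if "x \<in> Z" for x
    using DZ[OF that] c4[OF on(1)] c4[OF on(2)] c4[OF on(3)] y0 unfolding Z_def by auto
  qed
  moreover have "rp ([:A, 0, 3:] ^ 2) y = (3 * y ^ 2 + of_rat A) ^ 2" for y
   by (simp add: algebra_simps power2_eq_square of_rat_mult)
  ultimately show ?thesis unfolding D_def[of "D _"] by simp
 qed
 \<comment> \<open>This is \<open>(x - D x) / (x - D (D x))\<close>, which recovers \<open>d\<close>
   at \<open>x1\<close> and the other two members of its orbit at \<open>x2\<close> and
   \<open>x3\<close>. Differences are written as sums with a factor \<open>rp [:-1:] x\<close> to
   fit the closure rules of \<open>ratfun\<close>.\<close>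
 define u where "u x = (x + rp [:-1:] x * D x) * (1 / (x + rp [:-1:] x * D (D x)))" for x
 have m1: "rp [:-1:] x = - 1" for x by (simp add: of_rat_minus)
 have u1: "u x1 = d" "u x2 = 1 - 1 / d" "u x3 = 1 / (1 - d)"
 proof -
  define k where "k = l ^ 2 * (d * (d - 1))"
  have d1: "d - 1 \<noteq> 0" using d0 by simp
  then have k0: "k \<noteq> 0" using l0 d0 by (simp add: k_def)
  have e: "x1 - x2 = - (k * d)" "x1 - x3 = - k" "x2 - x3 = k * (d - 1)"
   "x2 - x1 = k * d" "x3 - x1 = k" "x3 - x2 = - (k * (d - 1))"
   unfolding t(2,3) k_def by (simp_all add: eval_nat_numeral algebra_simps)
  have u: "u x = (x - D x) / (x - D (D x))" for x unfolding u_def m1 by simp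
  show "u x1 = d" unfolding u D e using k0 by simp
  show "u x2 = 1 - 1 / d" unfolding u D e using k0 d0 by (simp add: diff_divide_distrib)
  have "u x3 = - (1 / (d - 1))" unfolding u D e using k0 d1 by simp
  also have "\<dots> = 1 / (1 - d)" by (metis minus_diff_eq minus_divide_right)
  finally show "u x3 = 1 / (1 - d)" .
 qed
 have uZ: "u x \<in> {d, 1 - 1 / d, 1 / (1 - d)}" if "x \<in> Z" for x using that u1 unfolding Z_def by auto
 have d1: "1 - d \<noteq> 0" "d - 1 \<noteq> 0" using d0 by auto
 have unz: "u x \<noteq> 0" "1 + rp [:-1:] x * u x \<noteq> 0" if "x \<in> Z" for x
  using uZ[OF that] d0 d1 unfolding m1 by (auto simp: field_simps)
 have xne: "x + rp [:-1:] x * D (D x) \<noteq> 0" if "x \<in> Z" for x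
  using that D x0 unfolding Z_def m1 by auto
 have ratu: "ratfun Z u" unfolding u_def
  by (intro ratfun_mult ratfun_inverse ratfun_add ratfun_rp ratfun_id ratD ratDD xne)
 \<comment> \<open>The orbit sum of \<open>u\<close> under \<open>u\<close> to
   \<open>1 / (1 - u)\<close>, hence the same at all three points.\<close>
 define F where "F x = u x + (1 / (1 + rp [:-1:] x * u x)) + (1 + rp [:-1:] x * (1 / u x))" for x
 have ratF: "ratfun Z F" unfolding F_def
  by (intro ratfun_mult ratfun_inverse ratfun_add ratfun_rp ratfun_1 ratu unz)
 have dd: "d ^ 2 - d = d * (d - 1)" by (simp add: power2_eq_square algebra_simps)
 have Fs: "F x = s" if "x \<in> Z" for x
 proof -
  have "F x1 = s" unfolding F_def u1 m1 s_def dd using d0 d1 by (simp add: field_simps eval_nat_numeral)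
  moreover have "F x2 = s" unfolding F_def u1 m1 s_def dd using d0 d1 by (simp add: field_simps eval_nat_numeral)
  moreover have "F x3 = s" unfolding F_def u1 m1 s_def dd using d0 d1 by (simp add: field_simps eval_nat_numeral)
  ultimately show ?thesis using that unfolding Z_def by auto
 qed
 have inK: "Affine x1 y1 \<in> isogeny_kernel (A, B) \<phi>" unfolding K R by simp
 obtain M where M: "minimal_for M x1" and Mr: "\<And>z. rp M z = 0 \<Longrightarrow> \<exists>y. Affine z y \<in> isogeny_kernel (A, B) \<phi>"
  by (rule kernel_conj[OF mor fin inK], rule that)
 have MZ: "z \<in> Z" if "rp M z = 0" for z using Mr[OF that] unfolding K R Z_def by auto
 obtain q where q: "s = of_rat q" using ratfun_constant[OF M MZ ratF Fs] by blast
 have Bc: "of_rat B = y1 ^ 2 - x1 ^ 3 - of_rat A * x1" using on(1) by (simp add: on_curve_def)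
 have sC0: "sC s \<noteq> 0" unfolding q of_rat_sCQR[symmetric] using sCQR_nonzero(1)[of q] by simp
 define g where "g = l ^ 2 * (d ^ 2 - d) ^ 2 / (12 * (d ^ 2 - d + 1))"
 note tc = tate_coeffs[OF t(1,4) tA Bc d0 s_def sC0, folded g_def]
 have "d ^ 2 - d \<noteq> 0" unfolding dd using d0 by simp
 then have "l ^ 2 * (d ^ 2 - d) ^ 2 \<noteq> 0" using l0 by simp
 moreover have "12 * (d ^ 2 - d + 1) \<noteq> 0" using tc(3) by (simp only: mult_eq_0_iff) simp
 ultimately have g0: "g \<noteq> 0" by (simp only: g_def divide_eq_0_iff) blast
 have Aq: "of_rat A = g ^ 2 * of_rat (sA q)" and Bq: "of_rat B = g ^ 3 * of_rat (sB q)"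
  using tc(1,2) unfolding of_rat_sAB q by auto
 have nz: "(of_rat (sA q) :: complex) \<noteq> 0" "(of_rat (sB q) :: complex) \<noteq> 0" using sAB_nonzero[of q] by simp_all
 \<comment> \<open>Dividing the formula for \<open>B\<close> by that for \<open>A\<close> leaves a
   single factor \<open>g\<close>, which is thereby rational.\<close>
 have "g * (of_rat A * of_rat (sB q)) = of_rat B * of_rat (sA q)"
  unfolding Aq Bq by (simp add: power2_eq_square power3_eq_cube)
 moreover have "of_rat A * of_rat (sB q) \<noteq> (0 :: complex)" unfolding Aq using g0 nz by simp
 ultimately have gq: "g = of_rat (B * sA q / (A * sB q))"
  by (simp add: of_rat_divide of_rat_mult field_simps)
 define c where "c = B * sA q / (A * sB q)"
 have gc: "g = of_rat c" using gq by (simp add: c_def)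
 have "(of_rat A :: complex) = of_rat (c ^ 2 * sA q)" "(of_rat B :: complex) = of_rat (c ^ 3 * sB q)"
  unfolding Aq Bq gc by (simp_all add: of_rat_mult of_rat_power)
 then have e: "A = c ^ 2 * sA q" "B = c ^ 3 * sB q" by (simp_all only: of_rat_eq_iff)
 have "c \<noteq> 0" using g0 gc by auto
 moreover have "q \<noteq> 8"
 proof
  assume "q = 8"
  have "4 * A ^ 3 + 27 * B ^ 2 = c ^ 6 * (4 * sA q ^ 3 + 27 * sB q ^ 2)"
   unfolding e by (simp add: power_mult_distrib algebra_simps flip: power_mult)
  then show False using ell \<open>q = 8\<close> unfolding sAB_disc by (simp add: elliptic_curves_def)
 qed
 ultimately show ?thesis using e AB by auto
qed

subsection \<open>Velu's formulas in the variable \<open>(x - C) / 4\<close>\<close>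

text \<open>Coefficients of Velu's numerator \<open>vn\<close>; all of them except the leading one
  carry the factor \<open>sC s\<close>, which is split off.\<close>

definition vc0 :: "'a::comm_ring_1 \<Rightarrow> 'a" where "vc0 s = 9 * s ^ 6 - 63 * s ^ 5 + 351 * s ^ 4 - 1053 * s ^ 3 + 2673 * s ^ 2 - 3645 * s + 4374"
definition vc1 :: "'a::comm_ring_1 \<Rightarrow> 'a" where "vc1 s = 45 * s ^ 5 - 311 * s ^ 4 + 1299 * s ^ 3 - 3078 * s ^ 2 + 4482 * s - 3564"
definition vc2 :: "'a::comm_ring_1 \<Rightarrow> 'a" where "vc2 s = 90 * s ^ 4 - 537 * s ^ 3 + 1809 * s ^ 2 - 2997 * s + 1782"
definition vc3 :: "'a::comm_ring_1 \<Rightarrow> 'a" where "vc3 s = 90 * s ^ 3 - 378 * s ^ 2 + 1134 * s - 972"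
definition vc4 :: "'a::comm_ring_1 \<Rightarrow> 'a" where "vc4 s = 45 * s ^ 2 - 76 * s + 276"
definition vc5 :: "'a::comm_ring_1 \<Rightarrow> 'a" where "vc5 s = 9 * s + 12"

text \<open>\<open>vh\<close> is the kernel polynomial h, \<open>vn\<close> the numerator n of the
  x-coordinate n / h^2, \<open>vdh\<close> and \<open>vdn\<close> are the derivatives, and
  \<open>vm\<close> is h^3 times the derivative of n / h^2. \<open>vf\<close> is the curve's cubic
  divided by 16 in the shifted variable.\<close>

definition vh :: "'a::comm_ring_1 \<Rightarrow> 'a \<Rightarrow> 'a" where
 "vh s x = x ^ 3 - 3 * sC s * x + sC s * (3 - 2 * s)"
definition vdh :: "'a::comm_ring_1 \<Rightarrow> 'a \<Rightarrow> 'a" where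
 "vdh s x = 3 * x ^ 2 - 3 * sC s"
definition vn :: "'a::comm_ring_1 \<Rightarrow> 'a \<Rightarrow> 'a" where
 "vn s x = x ^ 7 + sC s * (vc5 s * x ^ 5 + vc4 s * x ^ 4 + vc3 s * x ^ 3 + vc2 s * x ^ 2 + vc1 s * x + vc0 s)"
definition vdn :: "'a::comm_ring_1 \<Rightarrow> 'a \<Rightarrow> 'a" where
 "vdn s x = 7 * x ^ 6 + sC s * (5 * vc5 s * x ^ 4 + 4 * vc4 s * x ^ 3 + 3 * vc3 s * x ^ 2 + 2 * vc2 s * x + vc1 s)"
definition vm :: "'a::comm_ring_1 \<Rightarrow> 'a \<Rightarrow> 'a" where
 "vm s x = vdn s x * vh s x - 2 * vn s x * vdh s x"
definition vf :: "'a::comm_ring_1 \<Rightarrow> 'a \<Rightarrow> 'a" where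
 "vf s x = 4 * x ^ 3 + 3 * sC s * x ^ 2 + 6 * sC s * (s - 2) * x + sC s * (3 * s ^ 2 - 8 * s + 12)"

definition eh :: pexp where "eh = PAdd (PSub (PPow PY 3) (PMul (PMul (PC 3) eC) PY)) (PMul eC (PSub (PC 3) (PMul (PC 2) PX)))"
definition edh :: pexp where "edh = PSub (PMul (PC 3) (PPow PY 2)) (PMul (PC 3) eC)"
definition ec0 :: pexp where "ec0 = PAdd (PAdd (PAdd (PAdd (PAdd (PAdd (PC 4374) (PMul (PC (-3645)) PX)) (PMul (PC 2673) (PPow PX 2))) (PMul (PC (-1053)) (PPow PX 3))) (PMul (PC 351) (PPow PX 4))) (PMul (PC (-63)) (PPow PX 5))) (PMul (PC 9) (PPow PX 6))"
definition ec1 :: pexp where "ec1 = PAdd (PAdd (PAdd (PAdd (PAdd (PC (-3564)) (PMul (PC 4482) PX)) (PMul (PC (-3078)) (PPow PX 2))) (PMul (PC 1299) (PPow PX 3))) (PMul (PC (-311)) (PPow PX 4))) (PMul (PC 45) (PPow PX 5))"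
definition ec2 :: pexp where "ec2 = PAdd (PAdd (PAdd (PAdd (PC 1782) (PMul (PC (-2997)) PX)) (PMul (PC 1809) (PPow PX 2))) (PMul (PC (-537)) (PPow PX 3))) (PMul (PC 90) (PPow PX 4))"
definition ec3 :: pexp where "ec3 = PAdd (PAdd (PAdd (PC (-972)) (PMul (PC 1134) PX)) (PMul (PC (-378)) (PPow PX 2))) (PMul (PC 90) (PPow PX 3))"
definition ec4 :: pexp where "ec4 = PAdd (PAdd (PC 276) (PMul (PC (-76)) PX)) (PMul (PC 45) (PPow PX 2))"
definition ec5 :: pexp where "ec5 = PAdd (PC 12) (PMul (PC 9) PX)"
definition en :: pexp where "en = PAdd (PPow PY 7) (PMul eC (PAdd (PAdd (PAdd (PAdd (PAdd (PMul ec5 (PPow PY 5)) (PMul ec4 (PPow PY 4))) (PMul ec3 (PPow PY 3))) (PMul ec2 (PPow PY 2))) (PMul ec1 PY)) (ec0)))"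
definition edn :: pexp where "edn = PAdd (PMul (PC 7) (PPow PY 6)) (PMul eC (PAdd (PAdd (PAdd (PAdd (PMul (PMul (PC 5) ec5) (PPow PY 4)) (PMul (PMul (PC 4) ec4) (PPow PY 3))) (PMul (PMul (PC 3) ec3) (PPow PY 2))) (PMul (PMul (PC 2) ec2) PY)) (ec1)))"
definition em :: pexp where "em = PSub (PMul edn eh) (PMul (PMul (PC 2) en) edh)"
definition ef :: pexp where "ef = PAdd (PAdd (PAdd (PMul (PC 4) (PPow PY 3)) (PMul (PMul (PC 3) eC) (PPow PY 2)))
 (PMul (PMul (PMul (PC 6) eC) (PSub PX (PC 2))) PY)) (PMul eC (PAdd (PSub (PMul (PC 3) (PPow PX 2)) (PMul (PC 8) PX)) (PC 12)))"
text \<open>The quotient of n - f h'^2 by h, found by division; it certifies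
  \<open>velu_eq2\<close>.\<close>

definition eg :: pexp where "eg = PAdd (PAdd (PAdd (PAdd (PMul (PC (- 35)) (PPow PY 4)) (PMul (PMul eC (PC (-27))) (PPow PY 3))) (PMul (PMul eC (PAdd (PC 87) (PMul (PC (-45)) PX))) (PPow PY 2))) (PMul (PMul eC (PAdd (PAdd (PC 30) (PMul (PC 7) PX)) (PMul (PC (-9)) (PPow PX 2)))) PY)) (PMul eC (PAdd (PAdd (PAdd (PC (-162)) (PMul (PC 135) PX)) (PMul (PC (-45)) (PPow PX 2))) (PMul (PC 9) (PPow PX 3))))"

text \<open>Velu's isogeny is normalised: it multiplies \<open>y\<close> by the derivative of the
  new x-coordinate. The identity is the equation of the image curve for this map, multiplied by the
  sixth power of h.\<close>

lemma velu_eq1: "pexp_eq (PMul ef (PPow em 2))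
 (PAdd (PSub (PAdd (PMul (PC 4) (PPow en 3)) (PMul (PMul (PMul (PC 3) eC) (PPow en 2)) (PPow eh 2)))
   (PMul (PMul (PMul (PMul (PC 6) eC) (PAdd (PC 62) (PMul (PC 29) PX))) en) (PPow eh 4)))
   (PMul (PMul eC (PSub (PSub (PAdd (PC (- 9492)) (PMul (PC 1684) PX)) (PMul (PC 1149) (PPow PX 2))) (PMul (PC 108) (PPow PX 3)))) (PPow eh 6)))"
 by code_simp

lemma velu_eq2: "pexp_eq en (PAdd (PMul ef (PPow edh 2)) (PMul eh eg))"
 by code_simp

lemma pval_velu:
 "pval s x eC = sC s" "pval s x eh = vh s x" "pval s x edh = vdh s x" "pval s x ef = vf s x"
 "pval s x en = vn s x" "pval s x em = vm s x"
proof -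
 show C: "pval s x eC = sC s" by (simp add: eC_def sC_def)
 show h: "pval s x eh = vh s x" by (simp add: eh_def vh_def C)
 show dh: "pval s x edh = vdh s x" by (simp add: edh_def vdh_def C)
 show "pval s x ef = vf s x" by (simp add: ef_def vf_def C)
 have c: "pval s x ec0 = vc0 s" "pval s x ec1 = vc1 s" "pval s x ec2 = vc2 s" "pval s x ec3 = vc3 s" "pval s x ec4 = vc4 s" "pval s x ec5 = vc5 s"
  by (simp_all add: ec0_def vc0_def ec1_def vc1_def ec2_def vc2_def ec3_def vc3_def ec4_def vc4_def ec5_def vc5_def)
 show n: "pval s x en = vn s x" by (simp add: en_def vn_def C c)
 show "pval s x em = vm s x" by (simp add: em_def vm_def edn_def vdn_def C c h n dh)
qed

lemma velu_identity:
 "vf s x * vm s x ^ 2 = 4 * vn s x ^ 3 + 3 * sC s * vn s x ^ 2 * vh s x ^ 2 - 6 * sC s * (62 + 29 * s) * vn s x * vh s x ^ 4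
  + sC s * (- 9492 + 1684 * s - 1149 * s ^ 2 - 108 * s ^ 3) * vh s x ^ 6"
 using pexp_eq[OF velu_eq1, of s x] unfolding pval.simps pval_velu by simp

text \<open>Shows that the numerator does not vanish at the kernel, where \<open>vf\<close> is
  nonzero and the roots of \<open>vh\<close> are simple.\<close>

lemma velu_at_kernel: "vh s x = 0 \<Longrightarrow> vn s x = vf s x * vdh s x ^ 2"
 using pexp_eq[OF velu_eq2, of s x] unfolding pval.simps pval_velu by simp

text \<open>Coefficients of the isogenous curve. Its discriminant contains
  \<open>(8 - s) ^ 7\<close> where that of the source contains \<open>8 - s\<close>, so both are
  nonsingular for the same parameters.\<close>

definition sA' :: "'a::comm_ring_1 \<Rightarrow> 'a" where "sA' s = - (sC s * (3 * s ^ 2 + 687 * s + 1515))"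
definition sB' :: "'a::comm_ring_1 \<Rightarrow> 'a" where "sB' s = sC s * (2 * s ^ 4 - 1044 * s ^ 3 - 18930 * s ^ 2 + 28636 * s - 138318)"

definition eA' :: pexp where "eA' = PSub (PC 0) (PMul eC (PAdd (PAdd (PMul (PC 3) (PPow PX 2)) (PMul (PC 687) PX)) (PC 1515)))"
definition eB' :: pexp where "eB' = PMul eC (PAdd (PAdd (PSub (PSub (PMul (PC 2) (PPow PX 4)) (PMul (PC 1044) (PPow PX 3))) (PMul (PC 18930) (PPow PX 2))) (PMul (PC 28636) PX)) (PC (- 138318)))"
definition eA :: pexp where "eA = PSub (PC 0) (PMul (PMul (PC 3) eC) eQ)"
definition eB :: pexp where "eB = PMul (PMul (PC 2) eC) eR"
definition eX :: pexp where "eX = PAdd eC (PMul (PC 4) PY)"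

lemma curve_eqs:
 "pexp_eq (PAdd (PMul (PC 4) (PPow eA' 3)) (PMul (PC 27) (PPow eB' 2))) (PMul (PMul (PC 186624) (PPow eC 2)) (PPow (PSub (PC 8) PX) 7))"
 "pexp_eq (PAdd (PAdd (PPow eX 3) (PMul eA eX)) eB) (PMul (PC 16) ef)"
 "pexp_eq (PAdd (PAdd (PPow eX 3) (PMul eA' eX)) eB')
   (PMul (PC 16) (PAdd (PSub (PAdd (PMul (PC 4) (PPow PY 3)) (PMul (PMul (PC 3) eC) (PPow PY 2)))
    (PMul (PMul (PMul (PC 6) eC) (PAdd (PC 62) (PMul (PC 29) PX))) PY))
    (PMul eC (PSub (PSub (PAdd (PC (- 9492)) (PMul (PC 1684) PX)) (PMul (PC 1149) (PPow PX 2))) (PMul (PC 108) (PPow PX 3))))))"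
 by code_simp+

lemma pval_curve: "pval s x eA' = sA' s" "pval s x eB' = sB' s" "pval s x eA = sA s" "pval s x eB = sB s" "pval s x eX = sC s + 4 * x"
 by (simp_all add: eA'_def eB'_def eA_def eB_def eX_def sA'_def sB'_def sA_def sB_def pval_velu eQ_def eR_def sQ_def sR_def)

lemma sAB'_disc: "4 * sA' s ^ 3 + 27 * sB' s ^ 2 = 186624 * sC s ^ 2 * (8 - s) ^ 7"
 using pexp_eq[OF curve_eqs(1), of s s] unfolding pval.simps pval_velu pval_curve by simp

lemma curve_shift: "(sC s + 4 * x) ^ 3 + sA s * (sC s + 4 * x) + sB s = 16 * vf s x"
 using pexp_eq[OF curve_eqs(2), of s x] unfolding pval.simps pval_velu pval_curve by simp

lemma curve_shift': "(sC s + 4 * x) ^ 3 + sA' s * (sC s + 4 * x) + sB' s =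
 16 * (4 * x ^ 3 + 3 * sC s * x ^ 2 - 6 * sC s * (62 + 29 * s) * x + sC s * (- 9492 + 1684 * s - 1149 * s ^ 2 - 108 * s ^ 3))"
 using pexp_eq[OF curve_eqs(3), of s x] unfolding pval.simps pval_velu pval_curve by simp

lemma velu_image:
 fixes s x y :: "'a::field_char_0"
 assumes on: "y ^ 2 = (sC s + 4 * x) ^ 3 + sA s * (sC s + 4 * x) + sB s" and h: "vh s x \<noteq> 0"
 defines "v \<equiv> vn s x / vh s x ^ 2"
 shows "(y * vm s x / vh s x ^ 3) ^ 2 = (sC s + 4 * v) ^ 3 + sA' s * (sC s + 4 * v) + sB' s"
proof -
 have n: "vn s x = v * vh s x ^ 2" using h by (simp add: v_def)
 define T where "T = 4 * v ^ 3 + 3 * sC s * v ^ 2 - 6 * sC s * (62 + 29 * s) * v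
   + sC s * (- 9492 + 1684 * s - 1149 * s ^ 2 - 108 * s ^ 3)"
 have "vf s x * vm s x ^ 2 = T * vh s x ^ 6"
  unfolding velu_identity n T_def by (simp add: power_mult_distrib ring_distribs eval_nat_numeral mult_ac)
 then have "(16 * vf s x) * vm s x ^ 2 = ((sC s + 4 * v) ^ 3 + sA' s * (sC s + 4 * v) + sB' s) * vh s x ^ 6"
  unfolding curve_shift' T_def[symmetric] by (simp add: mult.assoc)
 then have "y ^ 2 * vm s x ^ 2 = ((sC s + 4 * v) ^ 3 + sA' s * (sC s + 4 * v) + sB' s) * vh s x ^ 6"
  unfolding on curve_shift .
 moreover have "(vh s x ^ 3) ^ 2 = vh s x ^ 6" by simp
 ultimately show ?thesis using h by (simp add: power_divide power_mult_distrib field_simps)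
qed

subsection \<open>The isogeny\<close>

definition pC :: "rat \<Rightarrow> rat poly" where "pC s = [:- sC s / 4, 1 / 4:]"

definition ph0 :: "rat \<Rightarrow> rat poly" where "ph0 s = [:sC s * (3 - 2 * s), - (3 * sC s), 0, 1:]"

definition pn0 :: "rat \<Rightarrow> rat poly" where
 "pn0 s = [:sC s * vc0 s, sC s * vc1 s, sC s * vc2 s, sC s * vc3 s, sC s * vc4 s, sC s * vc5 s, 0, 1:]"

definition pm0 :: "rat \<Rightarrow> rat poly" where
 "pm0 s = [:sC s * vc1 s, sC s * (2 * vc2 s), sC s * (3 * vc3 s), sC s * (4 * vc4 s), sC s * (5 * vc5 s), 0, 7:] * ph0 s
   - pn0 s * [:- (6 * sC s), 0, 6:]"

lemma of_rat_vc: "of_rat (vc0 s) = vc0 (of_rat s :: complex)" "of_rat (vc1 s) = vc1 (of_rat s :: complex)"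
 "of_rat (vc2 s) = vc2 (of_rat s :: complex)" "of_rat (vc3 s) = vc3 (of_rat s :: complex)"
 "of_rat (vc4 s) = vc4 (of_rat s :: complex)" "of_rat (vc5 s) = vc5 (of_rat s :: complex)"
 by (simp_all add: vc0_def vc1_def vc2_def vc3_def vc4_def vc5_def of_rat_add of_rat_diff of_rat_mult of_rat_power of_rat_minus)

lemma rp_velu:
 "rp (ph0 s) x = vh (of_rat s) x" "rp (pn0 s) x = vn (of_rat s) x" "rp (pm0 s) x = vm (of_rat s) x"
proof -
 show h: "rp (ph0 s) x = vh (of_rat s) x"
  by (simp add: ph0_def vh_def of_rat_mult of_rat_diff of_rat_minus of_rat_sCQR eval_nat_numeral algebra_simps)
 show n: "rp (pn0 s) x = vn (of_rat s) x"
  by (simp add: pn0_def vn_def of_rat_mult of_rat_sCQR of_rat_vc eval_nat_numeral algebra_simps)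
 have d: "rp [:sC s * vc1 s, sC s * (2 * vc2 s), sC s * (3 * vc3 s), sC s * (4 * vc4 s), sC s * (5 * vc5 s), 0, 7:] x = vdn (of_rat s) x"
  by (simp add: vdn_def of_rat_mult of_rat_sCQR of_rat_vc eval_nat_numeral algebra_simps)
 have e: "rp [:- (6 * sC s), 0, 6:] x = 2 * vdh (of_rat s) x"
  by (simp add: vdh_def of_rat_mult of_rat_minus of_rat_sCQR eval_nat_numeral algebra_simps)
 show "rp (pm0 s) x = vm (of_rat s) x"
  unfolding pm0_def rp_diff rp_mult h n d e vm_def by simp
qed

text \<open>The two products of degree 9 have leading coefficients 7 and 6.\<close>

lemma pm0_degree: "degree (pm0 s) = 9" "Polynomial.coeff (pm0 s) 9 = 1"
proof -
 let ?a = "[:sC s * vc1 s, sC s * (2 * vc2 s), sC s * (3 * vc3 s), sC s * (4 * vc4 s), sC s * (5 * vc5 s), 0, 7:]"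
 let ?b = "[:- (6 * sC s), 0, 6:]"
 have dg: "degree ?a = 6" "degree ?b = 2" "degree (ph0 s) = 3" "degree (pn0 s) = 7"
  by (simp_all add: ph0_def pn0_def)
 have l: "Polynomial.coeff ?a 6 = 7" "Polynomial.coeff ?b 2 = 6" "Polynomial.coeff (ph0 s) 3 = 1" "Polynomial.coeff (pn0 s) 7 = 1"
  by (simp_all add: ph0_def pn0_def eval_nat_numeral)
 have "Polynomial.coeff (?a * ph0 s) (6 + 3) = 7 * 1"
  using coeff_mult_degree_sum[of ?a "ph0 s"] unfolding dg l .
 moreover have "Polynomial.coeff (pn0 s * ?b) (7 + 2) = 1 * 6"
  using coeff_mult_degree_sum[of "pn0 s" ?b] unfolding dg l .
 ultimately show c: "Polynomial.coeff (pm0 s) 9 = 1" by (simp add: pm0_def)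
 have "degree (?a * ph0 s) \<le> 9" "degree (pn0 s * ?b) \<le> 9"
  using degree_mult_le[of ?a "ph0 s"] degree_mult_le[of "pn0 s" ?b] unfolding dg by simp_all
 then have "degree (pm0 s) \<le> 9" unfolding pm0_def by (rule degree_diff_le)
 moreover have "9 \<le> degree (pm0 s)" using c by (intro le_degree) simp
 ultimately show "degree (pm0 s) = 9" by simp
qed

lemma add_four_quarters: "C + 4 * ((x - C) / 4) = x" for C x :: "'a::field_char_0"
proof -
 have q: "4 * ((x - C) / 4) = x - C" by (subst times_divide_eq_right, rule nonzero_mult_div_cancel_left) simp
 show ?thesis unfolding q by simp
qed

lemma ec_add_neg_right:
 assumes "(A, B) \<in> elliptic_curves" "on_curve (A, B) x1 y1" "Q \<in> points (A, B)"
  "ec_add (A, B) (Affine x1 y1) Q = R"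
 shows "ec_add (A, B) (Affine x1 y1) (ec_neg R) = ec_neg Q"
 using ec_add_cancel(2)[OF assms(1-3)] ec_add_neg[of "(A, B)" "Affine x1 (- y1)" R] assms(4) by simp

text \<open>The slope at the last step and the \<open>x\<close>-coordinate of \<open>4P\<close> only agree because \<open>c = d\<^sup>2 - d\<close>.\<close>

lemma tate_order7:
 fixes l d :: complex
 assumes ell: "(A, B) \<in> elliptic_curves" and l0: "l \<noteq> 0" and d0: "d \<noteq> 0" "d \<noteq> 1"
  and x1: "12 * x1 = l ^ 2 * ((1 - (d ^ 2 - d)) ^ 2 - 4 * (d ^ 3 - d ^ 2))"
  and x2: "x2 = x1 + l ^ 2 * (d ^ 3 - d ^ 2)" and x3: "x3 = x1 + l ^ 2 * (d ^ 2 - d)"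
  and y1: "2 * y1 = - (l ^ 3 * (d ^ 3 - d ^ 2))" and on: "on_curve (A, B) x1 y1"
  and A: "of_rat A = l * (1 - (d ^ 2 - d)) * y1 - 3 * x1 ^ 2"
 obtains y2 y3 where "on_curve (A, B) x2 y2" "on_curve (A, B) x3 y3" "y1 \<noteq> 0" "y2 \<noteq> 0" "y3 \<noteq> 0"
  "x1 \<noteq> x2" "x1 \<noteq> x3" "x2 \<noteq> x3"
  "range (\<lambda>m. ec_mult (A, B) m (Affine x1 y1)) =
   {Infinity, Affine x1 y1, Affine x1 (- y1), Affine x2 y2, Affine x2 (- y2), Affine x3 y3, Affine x3 (- y3)}"
proof -
 define c where "c = d ^ 2 - d"
 define b where "b = d ^ 3 - d ^ 2"
 have cd: "c = d * (d - 1)" and b: "b = d * c"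
  by (simp_all add: c_def b_def power2_eq_square power3_eq_cube algebra_simps)
 have c0: "c \<noteq> 0" using cd d0 by simp
 have b0: "b \<noteq> 0" using b c0 d0 by simp
 note x1 = x1[folded c_def b_def] and x2 = x2[folded b_def] and x3 = x3[folded c_def]
  and y1 = y1[folded b_def] and A = A[folded c_def]
 define m n k where mnk: "m = l * (1 - c) / 2" "n = l * (1 + c) / 2" "k = l * (2 * d - (1 + c)) / 2"
 have y1': "y1 = - (l ^ 3 * b) / 2" using y1 by (simp add: field_simps)
 define y2 y3 where y23: "y2 = l ^ 3 * (b * c) / 2" "y3 = l ^ 3 * (b - c - c ^ 2) / 2"
 have bc: "b - c - c ^ 2 = - (c * (d - 1) ^ 2)" unfolding b cd by (simp add: power2_eq_square algebra_simps)
 have ny: "y1 \<noteq> 0" "y2 \<noteq> 0" "y3 \<noteq> 0" unfolding y1' y23 bc using l0 b0 c0 d0 by simp_all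
 have nx: "x1 \<noteq> x2" "x1 \<noteq> x3" using x2 x3 l0 b0 c0 by auto
 have "x2 - x3 = l ^ 2 * (c * (d - 1))" unfolding x2 x3 b by (simp add: algebra_simps)
 then have nx3: "x2 \<noteq> x3" using l0 c0 d0 by auto
 have m4: "4 * m ^ 2 = l ^ 2 * (1 - c) ^ 2" unfolding mnk by (simp add: power_divide power_mult_distrib)
 have "4 * (3 * x1) = 12 * x1" by simp
 also have "\<dots> = l ^ 2 * (1 - c) ^ 2 - 4 * (l ^ 2 * b)" unfolding x1 right_diff_distrib by (simp only: mult.left_commute)
 also have "\<dots> = 4 * (m ^ 2 - l ^ 2 * b)" unfolding m4[symmetric] right_diff_distrib ..
 finally have x1': "3 * x1 = m ^ 2 - l ^ 2 * b" by (rule mult_left_cancel[THEN iffD1, rotated]) simp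
 have s1: "y1 = y1 + m * (x1 - x1)" "of_rat A = m * (y1 + y1) - (x1 ^ 2 + x1 * x1 + x1 ^ 2)"
  using A by (simp_all add: mnk power2_eq_square)
 have e2: "x2 = m ^ 2 - x1 - x1" using x1' x2 by (simp add: algebra_simps)
 have f2: "y2 = m * (x1 - x2) - y1" unfolding x2 y23 y1' mnk by (simp add: field_simps eval_nat_numeral)
 have n1: "\<not> (x1 = x1 \<and> y1 = - y1)" using ny by auto
 have P2: "ec_add (A, B) (Affine x1 y1) (Affine x1 y1) = Affine x2 y2"
  unfolding ec_add_slope[OF n1 s1] e2[symmetric] f2[symmetric] ..
 have on2: "on_curve (A, B) x2 y2" by (rule chord_on_curve[OF on s1 e2 f2])
 \<comment> \<open>For a proper chord the second slope equation follows from both points lying on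
   the curve, so only the linear equation has to be verified for \<open>n\<close> and
   \<open>k\<close>.\<close>
 have slope: "of_rat A = m * (y1 + y) - (x1 ^ 2 + x1 * x + x ^ 2)"
  if xy: "on_curve (A, B) x y" "x1 \<noteq> x" "y = y1 + m * (x - x1)" for x y m
 proof -
  obtain m' where m': "y = y1 + m' * (x - x1)" "of_rat A = m' * (y1 + y) - (x1 ^ 2 + x1 * x + x ^ 2)"
   using slope_exists[OF on xy(1)] xy(2) by blast
  then have "m' = m" using xy by simp
  then show ?thesis using m' by simp
 qed
 have s2: "y2 = y1 + n * (x2 - x1)" unfolding x2 y23 y1' mnk by (simp add: field_simps eval_nat_numeral)
 note s2 = s2 slope[OF on2 nx(1) s2]
 have n2: "\<not> (x1 = x2 \<and> y1 = - y2)" using nx by auto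
 have nm: "n ^ 2 = m ^ 2 + l ^ 2 * c" unfolding mnk by (simp add: power_divide power_mult_distrib field_simps power2_eq_square)
 have e3: "x3 = n ^ 2 - x1 - x2" unfolding nm x3 using e2 by (simp add: algebra_simps)
 have f3: "y3 = n * (x1 - x3) - y1" unfolding x3 y23 y1' mnk by (simp add: field_simps eval_nat_numeral)
 have P3: "ec_add (A, B) (Affine x1 y1) (Affine x2 y2) = Affine x3 y3"
  unfolding ec_add_slope[OF n2 s2] e3[symmetric] f3[symmetric] ..
 have on3: "on_curve (A, B) x3 y3" by (rule chord_on_curve[OF on s2 e3 f3])
 have s3: "y3 = y1 + k * (x3 - x1)" unfolding x3 y23 y1' mnk b by (simp add: field_simps eval_nat_numeral)
 note s3 = s3 slope[OF on3 nx(2) s3]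
 have n3: "\<not> (x1 = x3 \<and> y1 = - y3)" using nx by auto
 have "(2 * d - (1 + c)) ^ 2 = (1 - c) ^ 2 - 4 * b + 8 * c"
  unfolding b by (simp add: c_def power2_eq_square algebra_simps)
 then have km: "4 * k ^ 2 = l ^ 2 * ((1 - c) ^ 2 - 4 * b + 8 * c)"
  unfolding mnk by (simp add: power_divide power_mult_distrib)
 have "4 * k ^ 2 = 4 * m ^ 2 - 4 * (l ^ 2 * b) + 8 * (l ^ 2 * c)"
  unfolding km m4 by (simp add: algebra_simps)
 also have "m ^ 2 = 3 * x1 + l ^ 2 * b" using x1' by simp
 also have "4 * (3 * x1 + l ^ 2 * b) - 4 * (l ^ 2 * b) + 8 * (l ^ 2 * c) = 4 * (x3 + x1 + x3)"
  unfolding x3 by (simp add: algebra_simps)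
 finally have "k ^ 2 = x3 + x1 + x3" by (rule mult_left_cancel[THEN iffD1, rotated]) simp
 then have e4: "x3 = k ^ 2 - x1 - x3" by simp
 have f4: "- y3 = k * (x1 - x3) - y1" using s3(1) by (simp add: algebra_simps)
 have P4: "ec_add (A, B) (Affine x1 y1) (Affine x3 y3) = Affine x3 (- y3)"
  unfolding ec_add_slope[OF n3 s3] e4[symmetric] f4[symmetric] ..
 have p: "Affine x1 y1 \<in> points (A, B)" "Affine x2 y2 \<in> points (A, B)"
  using on on2 by (simp_all del: points.simps)
 have P5: "ec_add (A, B) (Affine x1 y1) (Affine x3 (- y3)) = Affine x2 (- y2)"
  using ec_add_neg_right[OF ell on p(2) P3] by simp
 have P6: "ec_add (A, B) (Affine x1 y1) (Affine x2 (- y2)) = Affine x1 (- y1)"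
  using ec_add_neg_right[OF ell on p(1) P2] by simp
 let ?S = "\<lambda>m. ec_mult (A, B) m (Affine x1 y1)"
 let ?K = "{Infinity, Affine x1 y1, Affine x1 (- y1), Affine x2 y2, Affine x2 (- y2), Affine x3 y3, Affine x3 (- y3)}"
 note S = ec_mult_Suc[of "(A, B)" _ "Affine x1 y1"]
 have S1: "?S 1 = Affine x1 y1" by (simp add: S)
 have S2: "?S 2 = Affine x2 y2" using S[of 1] S1 P2 by (simp add: numeral_2_eq_2)
 have S3: "?S 3 = Affine x3 y3" using S[of 2] S2 P3 by (simp add: eval_nat_numeral)
 have S4: "?S 4 = Affine x3 (- y3)" using S[of 3] S3 P4 by (simp add: eval_nat_numeral)
 have S5: "?S 5 = Affine x2 (- y2)" using S[of 4] S4 P5 by (simp add: eval_nat_numeral)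
 have S6: "?S 6 = Affine x1 (- y1)" using S[of 5] S5 P6 by (simp add: eval_nat_numeral)
 have "?S m \<in> ?K" for m
 proof (induction m)
  case (Suc m)
  have "ec_add (A, B) (Affine x1 y1) Q \<in> ?K" if "Q \<in> ?K" for Q
  proof -
   have "ec_add (A, B) (Affine x1 y1) (Affine x1 (- y1)) = Infinity" "ec_add (A, B) (Affine x1 y1) Infinity = Affine x1 y1"
    by simp_all
   then show ?thesis using that P2 P3 P4 P5 P6 by (elim insertE emptyE) (simp_all only: insert_iff simp_thms)
  qed
  then show ?case using Suc unfolding S by blast
 qed simp
 moreover have r: "?S i \<in> range ?S" for i by (rule rangeI)
 have "?K \<subseteq> range ?S"
  using r[of 0, unfolded ec_mult_0] r[of 1, unfolded S1] r[of 2, unfolded S2] r[of 3, unfolded S3]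
   r[of 4, unfolded S4] r[of 5, unfolded S5] r[of 6, unfolded S6] by blast
 ultimately have "range ?S = ?K" by blast
 then show thesis by (rule that[OF on2 on3 ny nx nx3])
qed

text \<open>The condition on \<open>l\<close> makes the twisting factor of
  \<open>tate_coeffs\<close> equal to 1, so Tate's curve is exactly the member with parameter
  \<open>s\<close>. With \<open>r = w / c\<close> the roots in the variable
  \<open>(x - C) / 4\<close> are \<open>- r (1 + d)\<close>, \<open>r (2 d - 1)\<close> and
  \<open>r (2 - d)\<close>; they add up to zero, and their product matches because
  \<open>3 c - 2 N\<close> factors accordingly.\<close>

lemma tate_velu_roots:
 fixes l d x1 x2 x3 :: "'a::field_char_0"
 assumes d0: "d \<noteq> 0" "d \<noteq> 1" and s: "s = (d ^ 3 - 3 * d + 1) / (d ^ 2 - d)"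
  and l: "l ^ 2 * (d ^ 2 - d) ^ 2 = 12 * (d ^ 2 - d + 1)"
  and x1: "12 * x1 = l ^ 2 * ((1 - (d ^ 2 - d)) ^ 2 - 4 * (d ^ 3 - d ^ 2))"
  and x2: "x2 = x1 + l ^ 2 * (d ^ 3 - d ^ 2)" and x3: "x3 = x1 + l ^ 2 * (d ^ 2 - d)"
 shows "64 * vh s ((x - sC s) / 4) = (x - x1) * (x - x2) * (x - x3)"
proof -
 define c b N w where defs: "c = d ^ 2 - d" "b = d ^ 3 - d ^ 2" "N = d ^ 3 - 3 * d + 1" "w = d ^ 2 - d + 1"
 define e where "e = (1 - c) ^ 2 - 4 * b"
 note id = tate_identities[of d, folded defs, folded e_def]
 have cd: "c = d * (d - 1)" and b: "b = d * c"
  by (simp_all add: defs power2_eq_square power3_eq_cube algebra_simps)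
 have c0: "c \<noteq> 0" using d0 cd by simp
 have sc: "s * c = N" using s c0 by (simp add: defs)
 have C: "sC s * c ^ 2 = w ^ 3"
  unfolding id(1)[symmetric] sC_def sc[symmetric] by (simp add: algebra_simps power2_eq_square)
 have l': "l ^ 2 = 12 * w / c ^ 2" using l c0 by (simp add: defs field_simps)
 have w: "w = c + 1" by (simp add: defs)
 define C where "C = w ^ 3 / c ^ 2"
 have sC: "sC s = C" using C c0 by (simp add: C_def field_simps)
 define r where "r = w / c"
 have C_r: "C = w * r ^ 2" by (simp add: C_def r_def power2_eq_square power3_eq_cube)
 have "12 * x1 = 12 * w / c ^ 2 * e" using x1 unfolding defs[symmetric] l' e_def[symmetric] .
 then have "12 * x1 = 12 * (w / c ^ 2 * e)" by simp
 then have "x1 = w / c ^ 2 * e" by (rule mult_left_cancel[THEN iffD1, rotated]) simp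
 moreover have "e = w ^ 2 - 4 * (1 + d) * c" unfolding e_def w b by (simp add: power2_eq_square algebra_simps)
 ultimately have x1': "x1 = C - 4 * (r * (1 + d))"
  using c0 by (simp add: C_def r_def field_simps eval_nat_numeral)
 have x2': "x2 = C + 4 * (r * (2 * d - 1))"
  unfolding x2 x1' l' defs[symmetric] b r_def using c0 by (simp add: field_simps eval_nat_numeral)
 have x3': "x3 = C + 4 * (r * (2 - d))"
  unfolding x3 x1' l' defs[symmetric] r_def using c0 by (simp add: field_simps eval_nat_numeral)
 define z where "z = (x - C) / 4"
 have x: "x = C + 4 * z" unfolding z_def by (rule add_four_quarters[symmetric])
 have "C * (3 - 2 * s) = w * r ^ 2 * ((3 * c - 2 * N) / c)"
  unfolding C_r using sc c0 by (simp add: field_simps)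
 also have "\<dots> = r ^ 3 * (3 * c - 2 * N)" by (simp add: r_def power2_eq_square power3_eq_cube)
 also have "3 * c - 2 * N = (1 + d) * (2 * d - 1) * (2 - d)"
  by (simp add: defs power2_eq_square power3_eq_cube algebra_simps)
 finally have C3: "C * (3 - 2 * s) = r ^ 3 * ((1 + d) * (2 * d - 1) * (2 - d))" .
 have "vh s z = z ^ 3 - 3 * (w * r ^ 2) * z + r ^ 3 * ((1 + d) * (2 * d - 1) * (2 - d))"
  unfolding vh_def sC C3 unfolding C_r ..
 also have "\<dots> = (z + r * (1 + d)) * (z - r * (2 * d - 1)) * (z - r * (2 - d))"
  unfolding defs by (simp add: eval_nat_numeral algebra_simps)
 finally have v: "vh s z = (z + r * (1 + d)) * (z - r * (2 * d - 1)) * (z - r * (2 - d))" .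
 have x123: "x - x1 = 4 * (z + r * (1 + d))" "x - x2 = 4 * (z - r * (2 * d - 1))" "x - x3 = 4 * (z - r * (2 - d))"
  unfolding x1' x2' x3' x by (simp_all add: algebra_simps)
 have "64 * (u * v * t) = (4 * u) * (4 * v) * (4 * t)" for u v t :: 'a by simp
 then show ?thesis unfolding sC z_def[symmetric] v x123 .
qed

lemma family_admits_isogeny:
 fixes s :: rat
 assumes s8: "s \<noteq> 8"
 shows "(sA s, sB s) \<in> elliptic_curves" "admits_cyclic_isogeny 7 (sA s, sB s)"
proof -
 let ?E = "(sA s, sB s)" and ?E' = "(sA' s, sB' s)"
 let ?s = "of_rat s :: complex"
 show ell: "?E \<in> elliptic_curves"
  using sAB_disc[of s] s8 sCQR_nonzero(1)[of s] by (simp add: elliptic_curves_def)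
 have ell': "?E' \<in> elliptic_curves"
  using sAB'_disc[of s] s8 sCQR_nonzero(1)[of s] by (simp add: elliptic_curves_def)
 \<comment> \<open>The defining relation of \<open>s\<close>, read as a cubic equation for a complex
   \<open>d\<close>. The scale \<open>l\<close> is afterwards chosen so that no twist is
   left.\<close>
 have "\<not> constant (poly [:1, ?s - 3, - ?s, 1:])" by (simp add: constant_degree)
 then obtain d where "poly [:1, ?s - 3, - ?s, 1:] d = 0" using fundamental_theorem_of_algebra by blast
 then have dz: "d ^ 3 - 3 * d + 1 = ?s * (d ^ 2 - d)"
  by (simp add: algebra_simps power2_eq_square power3_eq_cube)
 have d0: "d \<noteq> 0" "d \<noteq> 1" using dz by auto
 define c where "c = d ^ 2 - d"
 define w where "w = d ^ 2 - d + 1"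
 have "c = d * (d - 1)" by (simp add: c_def power2_eq_square algebra_simps)
 then have c0: "c \<noteq> 0" using d0 by simp
 have sd: "?s = (d ^ 3 - 3 * d + 1) / (d ^ 2 - d)" using dz c0 by (simp add: c_def)
 define l where "l = csqrt (12 * w / c ^ 2)"
 have l2: "l ^ 2 = 12 * w / c ^ 2" by (simp add: l_def)
 define x1 where "x1 = l ^ 2 * ((1 - (d ^ 2 - d)) ^ 2 - 4 * (d ^ 3 - d ^ 2)) / 12"
 define y1 where "y1 = - (l ^ 3 * (d ^ 3 - d ^ 2)) / 2"
 define x2 where "x2 = x1 + l ^ 2 * (d ^ 3 - d ^ 2)"
 define x3 where "x3 = x1 + l ^ 2 * (d ^ 2 - d)"
 have x1: "12 * x1 = l ^ 2 * ((1 - (d ^ 2 - d)) ^ 2 - 4 * (d ^ 3 - d ^ 2))" by (simp add: x1_def)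
 have y1: "2 * y1 = - (l ^ 3 * (d ^ 3 - d ^ 2))" by (simp add: y1_def)
 have sC0: "sC ?s \<noteq> 0" unfolding of_rat_sCQR[symmetric] using sCQR_nonzero(1)[of s] by simp
 note tc = tate_coeffs[OF x1 y1 refl refl d0 sd sC0]
 have w0: "w \<noteq> 0" using tc(3) by (simp add: w_def)
 have l0: "l \<noteq> 0" using l2 w0 c0 by auto
 have lw: "l ^ 2 * (d ^ 2 - d) ^ 2 = 12 * (d ^ 2 - d + 1)" using l2 c0 by (simp add: c_def w_def)
 have g1: "l ^ 2 * (d ^ 2 - d) ^ 2 / (12 * (d ^ 2 - d + 1)) = 1"
  unfolding lw by (rule divide_self) (use w0 in \<open>simp only: w_def[symmetric] mult_eq_0_iff, simp\<close>)
 have A: "of_rat (sA s) = l * (1 - (d ^ 2 - d)) * y1 - 3 * x1 ^ 2"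
  using tc(1) unfolding g1 by (simp add: of_rat_sAB)
 have "y1 ^ 2 - x1 ^ 3 - of_rat (sA s) * x1 = of_rat (sB s)"
  using tc(2) unfolding g1 A[symmetric] by (simp add: of_rat_sAB)
 then have on1: "on_curve ?E x1 y1" by (simp add: on_curve_def algebra_simps)
 obtain y2 y3 where on: "on_curve ?E x2 y2" "on_curve ?E x3 y3" and ny: "y1 \<noteq> 0" "y2 \<noteq> 0" "y3 \<noteq> 0"
  and nx: "x1 \<noteq> x2" "x1 \<noteq> x3" "x2 \<noteq> x3"
  and R: "range (\<lambda>m. ec_mult ?E m (Affine x1 y1)) =
   {Infinity, Affine x1 y1, Affine x1 (- y1), Affine x2 y2, Affine x2 (- y2), Affine x3 y3, Affine x3 (- y3)}"
  by (rule tate_order7[OF ell l0 d0 x1 x2_def x3_def y1 on1 A], rule that)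
 define X where "X = pC s"
 have rX: "rp X x = (x - sC ?s) / 4" for x
  by (simp add: X_def pC_def of_rat_minus of_rat_divide of_rat_sCQR field_simps)
 have dX: "degree X = 1" "lead_coeff X = 1 / 4" by (simp_all add: X_def pC_def)
 define h where "h = pcompose (ph0 s) X"
 \<comment> \<open>The new x-coordinate is \<open>C + 4 n / h ^ 2\<close>, the shift of variable
   being undone on the target curve as well.\<close>
 define N where "N = Polynomial.smult 4 (pcompose (pn0 s) X) + Polynomial.smult (sC s) (h ^ 2)"
 define M where "M = pcompose (pm0 s) X"
 have rh: "rp h x = vh ?s ((x - sC ?s) / 4)" for x by (simp add: h_def rX rp_velu)
 have rM: "rp M x = vm ?s ((x - sC ?s) / 4)" for x by (simp add: M_def rX rp_velu)
 have rN: "rp N x = 4 * vn ?s ((x - sC ?s) / 4) + sC ?s * rp h x ^ 2" for x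
  by (simp add: N_def rX rp_velu of_rat_sCQR)
 have h64: "64 * rp h x = (x - x1) * (x - x2) * (x - x3)" for x
  unfolding rh by (rule tate_velu_roots[OF d0 sd lw x1 x2_def x3_def])
 have hz: "rp h x = 0 \<longleftrightarrow> x = x1 \<or> x = x2 \<or> x = x3" for x
  using h64[of x] by (metis mult_eq_0_iff right_minus_eq zero_neq_numeral)
 have dh: "degree h \<le> 3" by (simp add: h_def degree_pcompose dX ph0_def)
 have "degree (h ^ 2) \<le> 6" using degree_power_le[of h 2] dh by simp
 then have dN: "degree N \<le> 7"
  unfolding N_def by (intro degree_add_le degree_smult_le[THEN order_trans])
   (simp_all add: degree_pcompose dX pn0_def)
 have dM: "degree M = 9" by (simp add: M_def degree_pcompose dX pm0_degree)
 have "lead_coeff M = lead_coeff (pm0 s) * lead_coeff X ^ degree (pm0 s)"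
  unfolding M_def by (rule lead_coeff_comp) (simp add: dX)
 then have M9: "Polynomial.coeff M 9 \<noteq> 0" using dM dX by (simp add: pm0_degree)
 have curve: "y ^ 2 = (sC ?s + 4 * z) ^ 3 + sA ?s * (sC ?s + 4 * z) + sB ?s" if "on_curve ?E x y" "z = (x - sC ?s) / 4" for x y z
  using that(1) unfolding that(2) add_four_quarters by (simp add: on_curve_def of_rat_sAB)
 have kerx: "\<exists>y'\<in>{y1, y2, y3}. y ^ 2 = y' ^ 2" if "on_curve ?E x y" "rp h x = 0" for x y
  using that(1) on1 on hz[of x] that(2) unfolding on_curve_iff by auto
 have ker: "y * rp M x \<noteq> 0" if xy: "on_curve ?E x y" "rp h x = 0" for x y
 proof -
  have y0: "y \<noteq> 0" using kerx[OF xy] ny by auto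
  define z where "z = (x - sC ?s) / 4"
  have "16 * vf ?s z = y ^ 2" using curve[OF xy(1) z_def] curve_shift[of ?s z] by simp
  then have f0: "vf ?s z \<noteq> 0" using y0 by auto
  have h0: "vh ?s z = 0" using xy(2) by (simp add: rh z_def)
  have der: "16 * vdh ?s z = (x - x2) * (x - x3) + (x - x1) * (x - x3) + (x - x1) * (x - x2)"
  proof (rule DERIV_unique)
   have "((\<lambda>u. 64 * vh ?s ((u - sC ?s) / 4)) has_field_derivative 16 * vdh ?s z) (at x)"
    unfolding vh_def vdh_def z_def by (auto intro!: derivative_eq_intros simp: field_simps)
   then show "((\<lambda>u. (u - x1) * (u - x2) * (u - x3)) has_field_derivative 16 * vdh ?s z) (at x)"
    unfolding rh[symmetric] h64 .
   show "((\<lambda>u. (u - x1) * (u - x2) * (u - x3)) has_field_derivative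
    (x - x2) * (x - x3) + (x - x1) * (x - x3) + (x - x1) * (x - x2)) (at x)"
    by (auto intro!: derivative_eq_intros simp: algebra_simps)
  qed
  have "vdh ?s z \<noteq> 0" using der hz[of x] xy(2) nx by auto
  then have n0: "vn ?s z \<noteq> 0" using velu_at_kernel[OF h0] f0 by simp
  have "vf ?s z * vm ?s z ^ 2 = 4 * vn ?s z ^ 3" using velu_identity[of ?s z] h0 by simp
  then have "vm ?s z \<noteq> 0" using n0 by auto
  then show ?thesis using y0 by (simp add: rM z_def)
 qed
 have img: "on_curve ?E' (rp N x / rp h x ^ 2) (y * rp M x / rp h x ^ 3)" if xy: "on_curve ?E x y" "rp h x \<noteq> 0" for x y
 proof -
  define z where "z = (x - sC ?s) / 4"
  have h0: "vh ?s z \<noteq> 0" using xy(2) by (simp add: rh z_def)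
  have "rp N x / rp h x ^ 2 = sC ?s + 4 * (vn ?s z / vh ?s z ^ 2)"
   using h0 unfolding rN rh z_def[symmetric] by (simp add: field_simps)
  moreover have "y * rp M x / rp h x ^ 3 = y * vm ?s z / vh ?s z ^ 3" unfolding rM rh z_def[symmetric] ..
  moreover have "of_rat (sA' s) = sA' ?s" "of_rat (sB' s) = sB' ?s"
   by (simp_all add: sA'_def sB'_def of_rat_minus of_rat_mult of_rat_add of_rat_diff of_rat_power of_rat_sCQR)
  ultimately show ?thesis
   using velu_image[OF curve[OF xy(1) z_def] h0] unfolding on_curve_def fst_conv snd_conv by simp
 qed
 have mor: "morphism_over_Q ?E ?E' (velu_map N M h)"
  by (rule velu_morphism[OF dN dh _ M9 img ker]) (simp_all add: dM)
 have K: "isogeny_kernel ?E (velu_map N M h) = range (\<lambda>m. ec_mult ?E m (Affine x1 y1))"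
 proof (intro equalityI subsetI)
  fix P assume "P \<in> isogeny_kernel ?E (velu_map N M h)"
  then have P: "P \<in> points ?E" "velu_map N M h P = Infinity" by (simp_all add: isogeny_kernel_def del: points.simps)
  show "P \<in> range (\<lambda>m. ec_mult ?E m (Affine x1 y1))"
  proof (cases P)
   case Infinity
   then show ?thesis unfolding R by simp
  next
   case (Affine x y)
   then have xy: "on_curve ?E x y" "rp h x = 0" using P by (auto simp: velu_map_def simp del: points.simps split: if_splits)
   then consider "x = x1" "y ^ 2 = y1 ^ 2" | "x = x2" "y ^ 2 = y2 ^ 2" | "x = x3" "y ^ 2 = y3 ^ 2"
    using hz[of x] on1 on unfolding on_curve_iff by auto
   then show ?thesis unfolding R Affine power2_eq_iff by cases auto
  qed
 next
  fix P assume "P \<in> range (\<lambda>m. ec_mult ?E m (Affine x1 y1))"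
  then show "P \<in> isogeny_kernel ?E (velu_map N M h)"
   unfolding R using on1 on hz by (auto simp: isogeny_kernel_def velu_map_def simp del: points.simps)
 qed
 have card: "card {Infinity, Affine x1 y1, Affine x1 (- y1), Affine x2 y2, Affine x2 (- y2), Affine x3 y3, Affine x3 (- y3)} = 7"
  using nx ny by (simp add: eq_neg_iff_add_eq_0)
 have "cyclic_of_order ?E 7 (isogeny_kernel ?E (velu_map N M h))"
  unfolding cyclic_of_order_def K
 proof (intro conjI bexI)
  show "range (\<lambda>m. ec_mult ?E m (Affine x1 y1)) = range (\<lambda>m. ec_mult ?E m (Affine x1 y1))" ..
  show "Affine x1 y1 \<in> points ?E" using on1 by (simp del: points.simps)
  show "finite (range (\<lambda>m. ec_mult ?E m (Affine x1 y1)))" unfolding R by simp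
  show "card (range (\<lambda>m. ec_mult ?E m (Affine x1 y1))) = 7" unfolding R by (rule card)
 qed
 moreover have "isogeny_over_Q ?E ?E' (velu_map N M h)"
  unfolding isogeny_over_Q_def
 proof (intro conjI ell ell' mor)
  show "velu_map N M h Infinity = Infinity" by (simp add: velu_map_def)
  obtain x where x: "x \<notin> {x1, x2, x3}" by (metis ex_new_if_finite finite.emptyI finite_insert infinite_UNIV_char_0)
  have "Affine x (csqrt (rp (cubic ?E) x)) \<in> points ?E" using on_curve_csqrt by (simp del: points.simps)
  moreover have "velu_map N M h (Affine x (csqrt (rp (cubic ?E) x))) \<noteq> Infinity"
   using hz[of x] x by (simp add: velu_map_def)
  ultimately show "\<exists>P\<in>points ?E. velu_map N M h P \<noteq> Infinity" by blast
 qed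
 ultimately show "admits_cyclic_isogeny 7 ?E" unfolding admits_cyclic_isogeny_def by blast
qed

subsection \<open>Counting integers in sets with few boundary points\<close>

text \<open>Bounds the complexity of \<open>S\<close>: membership changes at no more than
  \<open>N\<close> places. Stated through intervals, it follows directly from the intermediate value
  theorem for polynomial inequalities.\<close>

definition const_off :: "real set \<Rightarrow> nat \<Rightarrow> bool" where
 "const_off S N \<longleftrightarrow> (\<exists>F. finite F \<and> card F \<le> N \<and> (\<forall>x y. x \<le> y \<longrightarrow> {x..y} \<inter> F = {} \<longrightarrow> (x \<in> S \<longleftrightarrow> y \<in> S)))"

text \<open>Over a unit interval without exceptional points, membership of the left endpoint equals
  the length covered by \<open>S\<close>. Elsewhere the error is at most 1, and a point lies in at
  most two closed unit intervals with integer ends.\<close>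

lemma int_count_1d:
 fixes S :: "real set"
 assumes S: "S \<in> sets borel" and bd: "S \<subseteq> {-c..c}" and off: "const_off S N"
 shows "\<bar>real (card {m::int. of_int m \<in> S}) - measure lborel S\<bar> \<le> 2 * real N"
proof -
 obtain F where F: "finite F" "card F \<le> N"
  "\<And>x y. x \<le> y \<Longrightarrow> {x..y} \<inter> F = {} \<Longrightarrow> (x \<in> S \<longleftrightarrow> y \<in> S)"
  using off unfolding const_off_def by auto
 define L where "L = \<lceil>c\<rceil> + 1"
 define I where "I = {-L..L}"
 have inI: "m \<in> I" if "of_int m \<le> x" "x < of_int m + 1" "x \<in> S" for m x
 proof -
  have "-c \<le> x" "x \<le> c" using bd that by auto
  then have "of_int m \<le> c" "-c < of_int m + 1" using that by linarith+
  then show ?thesis unfolding I_def L_def by (simp add: le_ceiling_iff) linarith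
 qed
 define T where "T m = S \<inter> {of_int m..<of_int m + 1}" for m :: int
 have ST: "S = (\<Union>m\<in>I. T m)"
 proof
  show "S \<subseteq> (\<Union>m\<in>I. T m)"
  proof
   fix x assume x: "x \<in> S"
   have f: "of_int \<lfloor>x\<rfloor> \<le> x" "x < of_int \<lfloor>x\<rfloor> + 1" by linarith+
   then show "x \<in> (\<Union>m\<in>I. T m)" using inI[OF f x] x by (intro UN_I[of "\<lfloor>x\<rfloor>"]) (simp_all add: T_def)
  qed
 qed (auto simp: T_def)
 have Tm: "T m \<in> sets borel" for m using S by (simp add: T_def)
 have Tle: "emeasure lborel (T m) \<le> 1" for m
 proof -
  have "emeasure lborel (T m) \<le> emeasure lborel {of_int m..<of_int m + (1::real)}"
   by (rule emeasure_mono) (auto simp: T_def)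
  then show ?thesis by simp
 qed
 have fin: "emeasure lborel (T m) \<noteq> \<infinity>" for m using Tle[of m] by (metis ennreal_one_neq_top infinity_ennreal_def top.extremum_uniqueI)
 have disj: "disjoint_family_on T I"
  unfolding disjoint_family_on_def T_def
 proof (intro ballI impI)
  fix m n :: int assume "m \<noteq> n"
  then have "m + 1 \<le> n \<or> n + 1 \<le> m" by linarith
  then have "real_of_int m + 1 \<le> real_of_int n \<or> real_of_int n + 1 \<le> real_of_int m"
   by (metis of_int_1 of_int_add of_int_le_iff)
  then show "S \<inter> {of_int m..<of_int m + 1} \<inter> (S \<inter> {of_int n..<of_int n + 1}) = {}" by auto
 qed
 have mS: "measure lborel S = (\<Sum>m\<in>I. measure lborel (T m))"
  unfolding ST by (rule measure_finite_Union) (use Tm disj fin in \<open>auto simp: I_def\<close>)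
 have "{m::int. of_int m \<in> S} \<subseteq> I" using inI by fastforce
 then have "{m::int. of_int m \<in> S} = {m \<in> I. of_int m \<in> S}" by auto
 moreover have "(\<Sum>m\<in>I. if of_int m \<in> S then 1 else 0 :: real) = (\<Sum>m\<in>{m \<in> I. of_int m \<in> S}. 1)"
  by (rule sum.inter_filter[symmetric]) (simp add: I_def)
 ultimately have cS: "real (card {m::int. of_int m \<in> S}) = (\<Sum>m\<in>I. if of_int m \<in> S then 1 else 0)" by simp
 define B where "B = {m \<in> I. {of_int m..of_int m + 1} \<inter> F \<noteq> {}}"
 have Bsub: "B \<subseteq> (\<lambda>f. \<lfloor>f\<rfloor>) ` F \<union> (\<lambda>f. \<lceil>f\<rceil> - 1) ` F"
 proof
  fix m assume "m \<in> B"
  then obtain f where f: "f \<in> F" "of_int m \<le> f" "f \<le> of_int m + 1" by (auto simp: B_def)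
  then have "m = \<lfloor>f\<rfloor> \<or> m = \<lceil>f\<rceil> - 1" by linarith
  then show "m \<in> (\<lambda>f. \<lfloor>f\<rfloor>) ` F \<union> (\<lambda>f. \<lceil>f\<rceil> - 1) ` F" using f(1) by auto
 qed
 have "card B \<le> card ((\<lambda>f. \<lfloor>f\<rfloor>) ` F \<union> (\<lambda>f. \<lceil>f\<rceil> - 1) ` F)"
  using Bsub F(1) by (intro card_mono) auto
 also have "\<dots> \<le> card ((\<lambda>f. \<lfloor>f\<rfloor>) ` F) + card ((\<lambda>f. \<lceil>f\<rceil> - 1) ` F)" by (rule card_Un_le)
 also have "\<dots> \<le> card F + card F" using F(1) by (intro add_mono card_image_le) auto
 finally have cB: "card B \<le> 2 * N" using F(2) by simp
 have term_le: "\<bar>(if of_int m \<in> S then 1 else 0) - measure lborel (T m)\<bar> \<le> (if m \<in> B then 1 else 0)" if m: "m \<in> I" for m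
 proof (cases "m \<in> B")
  case True
  define t where "t = measure lborel (T m)"
  have "t \<le> 1" "0 \<le> t" using Tle[of m] by (simp_all add: t_def measure_def enn2real_leI)
  then show ?thesis unfolding t_def[symmetric] using True by (auto simp: abs_if)
 next
  case False
  then have e: "{of_int m..of_int m + 1} \<inter> F = {}" using m by (auto simp: B_def)
  have *: "x \<in> S \<longleftrightarrow> of_int m \<in> S" if "of_int m \<le> x" "x < of_int m + 1" for x
  proof -
   have "{of_int m..x} \<subseteq> {of_int m..of_int m + 1}" using that by auto
   then have "{of_int m..x} \<inter> F = {}" using e by blast
   then show ?thesis using F(3)[of "of_int m" x] that by simp
  qed
  have Teq: "T m = {x. of_int m \<le> x \<and> x < of_int m + 1 \<and> of_int m \<in> S}"
   unfolding T_def by (rule Set.set_eqI) (metis * Int_iff atLeastLessThan_iff mem_Collect_eq)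
  show ?thesis
  proof (cases "of_int m \<in> S")
   case True
   then have "T m = {of_int m..<of_int m + 1}" unfolding Teq by auto
   then show ?thesis using True by simp
  next
   case False
   then have "T m = {}" unfolding Teq by simp
   then show ?thesis using False by simp
  qed
 qed
 have "\<bar>real (card {m::int. of_int m \<in> S}) - measure lborel S\<bar> =
   \<bar>\<Sum>m\<in>I. (if of_int m \<in> S then 1 else 0) - measure lborel (T m)\<bar>"
  unfolding cS mS sum_subtractf ..
 also have "\<dots> \<le> (\<Sum>m\<in>I. \<bar>(if of_int m \<in> S then 1 else 0) - measure lborel (T m)\<bar>)" by (rule sum_abs)
 also have "\<dots> \<le> (\<Sum>m\<in>I. if m \<in> B then 1 else 0)" by (intro sum_mono term_le)
 also have "\<dots> = real (card (I \<inter> B))" by (simp add: I_def sum.If_cases)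
 also have "I \<inter> B = B" by (auto simp: B_def)
 finally show ?thesis using cB by linarith
qed

lemma sets_lborel_pair: "sets (lborel \<Otimes>\<^sub>M lborel) = sets (borel :: (real \<times> real) measure)"
proof -
 have "sets (lborel \<Otimes>\<^sub>M lborel) = sets (borel \<Otimes>\<^sub>M (borel :: real measure) :: (real \<times> real) measure)"
  by (intro sets_pair_measure_cong) simp_all
 then show ?thesis by (simp only: borel_prod)
qed

text \<open>Davenport's argument: count along horizontal lines, and compare the sum of the lengths
 of the slices with the area by counting along vertical lines.\<close>

lemma int_count_2d:
 fixes G :: "(real \<times> real) set"
 assumes G: "G \<in> sets borel" and bd: "G \<subseteq> {-a..a} \<times> {-b..b}" and ab: "a \<ge> 0" "b \<ge> 0"
  and hor: "\<And>y. const_off {x. (x, y) \<in> G} N" and ver: "\<And>x. const_off {y. (x, y) \<in> G} N"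
 shows "finite {(m::int, n::int). (of_int m, of_int n) \<in> G}"
  "\<bar>real (card {(m::int, n::int). (of_int m, of_int n) \<in> G}) - measure lborel G\<bar> \<le> 2 * real N * (2 * b + 1) + 4 * real N * a"
proof -
 let ?P = "{(m::int, n::int). (of_int m, of_int n) \<in> G}"
 define J where "J = {- \<lfloor>b\<rfloor>..\<lfloor>b\<rfloor>}"
 define C where "C n = {m::int. (of_int m, of_int n) \<in> G}" for n :: int
 have inJ: "n \<in> J" if "(x, of_int n) \<in> G" for x n
 proof -
  have "- b \<le> of_int n" "of_int n \<le> b" using bd that by auto
  then show ?thesis unfolding J_def by (simp add: le_floor_iff) linarith
 qed
 have finC: "finite (C n)" for n
 proof (rule finite_subset)
  show "C n \<subseteq> {- \<lceil>a\<rceil>..\<lceil>a\<rceil>}"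
  proof
   fix m assume "m \<in> C n"
   then have "- a \<le> of_int m" "of_int m \<le> a" using bd by (auto simp: C_def)
   then show "m \<in> {- \<lceil>a\<rceil>..\<lceil>a\<rceil>}" by (simp add: le_ceiling_iff) linarith
  qed
 qed simp
 have P: "?P = (\<lambda>(n, m). (m, n)) ` (SIGMA n:J. C n)" using inJ by (auto simp: C_def image_iff)
 then show "finite ?P" using finC by (simp add: J_def)
 have "card ?P = card (SIGMA n:J. C n)" unfolding P by (rule card_image) (auto simp: inj_on_def)
 also have "\<dots> = (\<Sum>n\<in>J. card (C n))" using finC by (simp add: J_def)
 finally have cP: "real (card ?P) = (\<Sum>n\<in>J. real (card (C n)))" by simp
 have slice: "(\<lambda>x. (x, y)) -` G \<in> sets borel" "Pair x -` G \<in> sets borel" for x y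
 proof -
  have "(\<lambda>x. (x, y)) -` G \<inter> space borel \<in> sets borel"
   by (rule measurable_sets[OF _ G]) (simp add: borel_prod[symmetric])
  then show "(\<lambda>x. (x, y)) -` G \<in> sets borel" by simp
  have "Pair x -` G \<inter> space borel \<in> sets borel"
   by (rule measurable_sets[OF _ G]) (simp add: borel_prod[symmetric])
  then show "Pair x -` G \<in> sets borel" by simp
 qed
 define S where "S y = {x. (x, y) \<in> G}" for y
 define V where "V x = {y. (x, y) \<in> G}" for x
 have Sb: "S y \<in> sets borel" and Vb: "V x \<in> sets borel" for x y
  using slice(1)[of y] slice(2)[of x] by (simp_all add: S_def V_def vimage_def)
 have Ssub: "S y \<subseteq> {-a..a}" and Vsub: "V x \<subseteq> {-b..b}" for x y using bd by (auto simp: S_def V_def)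
 have 1: "\<bar>real (card (C n)) - measure lborel (S (of_int n))\<bar> \<le> 2 * real N" for n
  using int_count_1d[OF Sb Ssub, of "of_int n" N] hor[of "of_int n"] unfolding C_def S_def by simp
 have 2: "\<bar>real (card {n::int. of_int n \<in> V x}) - measure lborel (V x)\<bar> \<le> 2 * real N" for x
  using int_count_1d[OF Vb Vsub, of x N] ver[of x] unfolding V_def by simp
 have emS: "emeasure lborel (S y) = ennreal (measure lborel (S y))" for y
 proof (rule emeasure_eq_ennreal_measure)
  have "emeasure lborel (S y) \<le> emeasure lborel {-a..a}" using Ssub by (intro emeasure_mono) auto
  then show "emeasure lborel (S y) \<noteq> top_class.top" using ab by (auto simp: top_unique)
 qed
 have emV: "emeasure lborel (V x) = ennreal (measure lborel (V x))" for x
 proof (rule emeasure_eq_ennreal_measure)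
  have "emeasure lborel (V x) \<le> emeasure lborel {-b..b}" using Vsub by (intro emeasure_mono) auto
  then show "emeasure lborel (V x) \<noteq> top_class.top" using ab by (auto simp: top_unique)
 qed
 have G': "G \<in> sets (lborel \<Otimes>\<^sub>M lborel)"
  using G unfolding sets_lborel_pair .
 have area: "emeasure lborel G = (\<integral>\<^sup>+x. emeasure lborel (V x) \<partial>lborel)"
  unfolding lborel_prod[symmetric] lborel.emeasure_pair_measure_alt[OF G'] by (simp add: V_def vimage_def)
 have emG: "emeasure lborel G = ennreal (measure lborel G)"
 proof (rule emeasure_eq_ennreal_measure)
  have "emeasure lborel G \<le> emeasure lborel ({-a..a} \<times> {-b..b})"
   using bd by (intro emeasure_mono) (auto simp: borel_prod[symmetric] intro!: pair_measureI)
  also have "\<dots> = ennreal (2 * a) * ennreal (2 * b)"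
   unfolding lborel_prod[symmetric] using ab by (subst lborel.emeasure_pair_measure_Times) auto
  finally show "emeasure lborel G \<noteq> top_class.top" by (auto simp: top_unique ennreal_mult_eq_top_iff)
 qed
 \<comment> \<open>\<open>c x\<close> counts the points of integer height in the vertical slice at
   \<open>x\<close>. Its integral is the sum of the lengths of the horizontal slices, while the
   integral of the slice lengths is the area.\<close>
 define c where "c x = (\<Sum>n\<in>J. indicator (S (of_int n)) x :: ennreal)" for x
 have c: "c x = ennreal (real (card {n::int. of_int n \<in> V x}))" for x
 proof -
  have e: "{n::int. of_int n \<in> V x} = {n \<in> J. x \<in> S (of_int n)}" using inJ by (auto simp: V_def S_def)
  have "c x = of_nat (card {n \<in> J. x \<in> S (of_int n)})"
   unfolding c_def indicator_def by (simp add: J_def sum.If_cases Int_def)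
  then show ?thesis unfolding e by (simp add: ennreal_of_nat_eq_real_of_nat)
 qed
 have cV: "c x \<le> emeasure lborel (V x) + ennreal (2 * real N) * indicator {-a..a} x"
  "emeasure lborel (V x) \<le> c x + ennreal (2 * real N) * indicator {-a..a} x" for x
 proof -
  have "c x \<le> emeasure lborel (V x) + ennreal (2 * real N) * indicator {-a..a} x \<and>
    emeasure lborel (V x) \<le> c x + ennreal (2 * real N) * indicator {-a..a} x"
  proof (cases "x \<in> {-a..a}")
   case True
   have "real (card {n::int. of_int n \<in> V x}) \<le> measure lborel (V x) + 2 * real N"
    "measure lborel (V x) \<le> real (card {n::int. of_int n \<in> V x}) + 2 * real N" using 2[of x] by linarith+
   then have "ennreal (real (card {n::int. of_int n \<in> V x})) \<le> ennreal (measure lborel (V x) + 2 * real N)"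
    "ennreal (measure lborel (V x)) \<le> ennreal (real (card {n::int. of_int n \<in> V x}) + 2 * real N)"
    by (simp_all only: ennreal_leI)
   then show ?thesis using True unfolding c emV by (simp add: ennreal_plus)
  next
   case False
   then have "V x = {}" using bd by (auto simp: V_def)
   then show ?thesis unfolding c by simp
  qed
  then show "c x \<le> emeasure lborel (V x) + ennreal (2 * real N) * indicator {-a..a} x"
  "emeasure lborel (V x) \<le> c x + ennreal (2 * real N) * indicator {-a..a} x" by auto
 qed
 have mV: "(\<lambda>x. emeasure lborel (V x)) \<in> borel_measurable lborel"
  using lborel.measurable_emeasure_Pair[OF G'] by (simp add: V_def vimage_def)
 have mc: "c \<in> borel_measurable lborel"
  unfolding c_def using Sb by (intro borel_measurable_sum) auto
 have Ic: "(\<integral>\<^sup>+x. c x \<partial>lborel) = ennreal (\<Sum>n\<in>J. measure lborel (S (of_int n)))"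
 proof -
  have "(\<integral>\<^sup>+x. c x \<partial>lborel) = (\<Sum>n\<in>J. \<integral>\<^sup>+x. indicator (S (of_int n)) x \<partial>lborel)"
   unfolding c_def by (rule nn_integral_sum) (use Sb in auto)
  also have "\<dots> = (\<Sum>n\<in>J. ennreal (measure lborel (S (of_int n))))"
   using Sb by (simp add: emS)
  finally show ?thesis by (simp add: sum_ennreal)
 qed
 have II: "(\<integral>\<^sup>+x. ennreal (2 * real N) * indicator {-a..a} x \<partial>lborel) = ennreal (4 * real N * a)"
 proof -
  have "(\<integral>\<^sup>+x. ennreal (2 * real N) * indicator {-a..a} x \<partial>lborel) = ennreal (2 * real N) * ennreal (2 * a)"
   using ab by (simp add: nn_integral_cmult_indicator)
  also have "\<dots> = ennreal ((2 * real N) * (2 * a))" using ab by (subst ennreal_mult) auto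
  finally show ?thesis by (simp add: algebra_simps)
 qed
 let ?Sum = "\<Sum>n\<in>J. measure lborel (S (of_int n))"
 have s0: "?Sum \<ge> 0" by (intro sum_nonneg) auto
 have "ennreal ?Sum \<le> (\<integral>\<^sup>+x. emeasure lborel (V x) + ennreal (2 * real N) * indicator {-a..a} x \<partial>lborel)"
  unfolding Ic[symmetric] by (intro nn_integral_mono cV)
 also have "\<dots> = ennreal (measure lborel G) + ennreal (4 * real N * a)"
  unfolding II[symmetric] emG[symmetric] area by (rule nn_integral_add) (use mV in auto)
 also have "\<dots> = ennreal (measure lborel G + 4 * real N * a)" using ab by (subst ennreal_plus) auto
 finally have u: "?Sum \<le> measure lborel G + 4 * real N * a" using ab by (subst (asm) ennreal_le_iff) auto
 have "ennreal (measure lborel G) \<le> (\<integral>\<^sup>+x. c x + ennreal (2 * real N) * indicator {-a..a} x \<partial>lborel)"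
  unfolding emG[symmetric] area by (intro nn_integral_mono cV)
 also have "\<dots> = ennreal ?Sum + ennreal (4 * real N * a)"
  unfolding II[symmetric] Ic[symmetric] by (rule nn_integral_add) (use mc in auto)
 also have "\<dots> = ennreal (?Sum + 4 * real N * a)" using ab s0 by (subst ennreal_plus) auto
 finally have l: "measure lborel G \<le> ?Sum + 4 * real N * a" using ab s0 by (subst (asm) ennreal_le_iff) auto
 have "\<bar>real (card ?P) - ?Sum\<bar> = \<bar>\<Sum>n\<in>J. real (card (C n)) - measure lborel (S (of_int n))\<bar>"
  unfolding cP sum_subtractf ..
 also have "\<dots> \<le> (\<Sum>n\<in>J. \<bar>real (card (C n)) - measure lborel (S (of_int n))\<bar>)" by (rule sum_abs)
 also have "\<dots> \<le> (\<Sum>n\<in>J. 2 * real N)" using 1 by (intro sum_mono) simp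
 also have "\<dots> = 2 * real N * real (card J)" by simp
 also have "\<dots> \<le> 2 * real N * (2 * b + 1)"
 proof (intro mult_left_mono)
  have "real (card J) = of_int (2 * \<lfloor>b\<rfloor> + 1)" using ab by (simp add: J_def)
  also have "\<dots> \<le> 2 * b + 1" by simp
  finally show "real (card J) \<le> 2 * b + 1" .
 qed simp
 finally show "\<bar>real (card ?P) - measure lborel G\<bar> \<le> 2 * real N * (2 * b + 1) + 4 * real N * a"
  using u l by linarith
qed

subsection \<open>Linear change of variables in the plane\<close>

lemma emeasure_plane:
 assumes "R \<in> sets (borel :: (real \<times> real) measure)"
 shows "emeasure lborel R = (\<integral>\<^sup>+y. \<integral>\<^sup>+x. indicator R (x, y) \<partial>lborel \<partial>lborel)"
proof -
 have R: "R \<in> sets (lborel \<Otimes>\<^sub>M lborel)"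
  using assms unfolding sets_lborel_pair .
 have "emeasure lborel R = (\<integral>\<^sup>+z. indicator R z \<partial>(lborel \<Otimes>\<^sub>M lborel))"
  using R by (simp add: lborel_prod[symmetric])
 also have "\<dots> = (\<integral>\<^sup>+y. \<integral>\<^sup>+x. indicator R (x, y) \<partial>lborel \<partial>lborel)"
  by (rule lborel_pair.nn_integral_snd[symmetric]) (use R in auto)
 finally show ?thesis .
qed

lemma nn_integral_scale:
 fixes f :: "real \<Rightarrow> ennreal"
 assumes "f \<in> borel_measurable borel" "c \<noteq> 0"
 shows "(\<integral>\<^sup>+x. f (t + c * x) \<partial>lborel) = ennreal (1 / \<bar>c\<bar>) * (\<integral>\<^sup>+x. f x \<partial>lborel)"
proof -
 have "ennreal (1 / \<bar>c\<bar>) * (\<integral>\<^sup>+x. f x \<partial>lborel) = ennreal (1 / \<bar>c\<bar>) * (ennreal \<bar>c\<bar> * (\<integral>\<^sup>+x. f (t + c * x) \<partial>lborel))"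
  using nn_integral_real_affine[OF assms(1,2), of t] by simp
 also have "\<dots> = (ennreal (1 / \<bar>c\<bar>) * ennreal \<bar>c\<bar>) * (\<integral>\<^sup>+x. f (t + c * x) \<partial>lborel)" by (simp only: mult.assoc)
 also have "ennreal (1 / \<bar>c\<bar>) * ennreal \<bar>c\<bar> = ennreal (1 / \<bar>c\<bar> * \<bar>c\<bar>)" by (rule ennreal_mult[symmetric]) auto
 also have "\<dots> = 1" using assms(2) by simp
 finally show ?thesis by simp
qed

text \<open>Fubini reduces the claim to affine substitutions on the line: a shear makes the map
  triangular, and the two remaining scalings contribute factors with product
  \<open>1 / \<bar>D\<bar>\<close>.\<close>

lemma emeasure_linear_plane:
 fixes p1 q1 p2 q2 :: real
 assumes R: "R \<in> sets (borel :: (real \<times> real) measure)" and D: "D = p1 * q2 - p2 * q1" "D \<noteq> 0"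
 shows "{(x, y). (x * p1 + y * p2, x * q1 + y * q2) \<in> R} \<in> sets borel"
  "emeasure lborel {(x, y). (x * p1 + y * p2, x * q1 + y * q2) \<in> R} = ennreal (1 / \<bar>D\<bar>) * emeasure lborel R"
proof -
 let ?S = "{(x, y). (x * p1 + y * p2, x * q1 + y * q2) \<in> R}"
 have lin: "(\<lambda>z. (fst z * a + snd z * b + e, fst z * c + snd z * d)) \<in> borel \<rightarrow>\<^sub>M (borel :: (real \<times> real) measure)" for a b c d e :: real
  by (intro borel_measurable_continuous_onI continuous_intros)
 have "(\<lambda>z. (fst z * p1 + snd z * p2 + 0, fst z * q1 + snd z * q2)) -` R \<inter> space borel \<in> sets borel"
  by (rule measurable_sets[OF lin R])
 also have "(\<lambda>z. (fst z * p1 + snd z * p2 + 0, fst z * q1 + snd z * q2)) -` R \<inter> space borel = ?S" by auto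
 finally show S: "?S \<in> sets borel" .
 define f where "f a b = (indicator R (a, b) :: ennreal)" for a b
 have fm: "(\<lambda>z. f (fst z * a + snd z * b + e) (fst z * c + snd z * d)) \<in> borel_measurable borel" for a b c d e
  unfolding f_def by (rule measurable_compose[OF lin borel_measurable_indicator[OF R]])
 have fpair: "(\<lambda>(x, y). f (x * a + y * b) (x * c + y * d)) \<in> borel_measurable (lborel \<Otimes>\<^sub>M lborel)" for a b c d
 proof -
  have "(\<lambda>(x, y). f (x * a + y * b) (x * c + y * d)) \<in> borel_measurable borel"
   using fm[of a b 0 c d] by (simp add: case_prod_beta')
  then show ?thesis by (simp add: lborel_prod)
 qed
 have f1: "(\<lambda>x. f (t + c * x) (u + d * x)) \<in> borel_measurable borel" for t c u d
  unfolding f_def by (rule measurable_compose[OF _ borel_measurable_indicator[OF R]])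
   (intro borel_measurable_continuous_onI continuous_intros)
 have i1: "(\<lambda>b. \<integral>\<^sup>+a. f a b \<partial>lborel) \<in> borel_measurable borel"
 proof -
  have "(\<lambda>(y, x). f x y) \<in> borel_measurable (lborel \<Otimes>\<^sub>M lborel)"
  proof -
   have "(\<lambda>(y, x). f (y * 0 + x * 1) (y * 1 + x * 0)) \<in> borel_measurable (lborel \<Otimes>\<^sub>M lborel)" by (rule fpair)
   then show ?thesis by simp
  qed
  from lborel.borel_measurable_nn_integral_fst[OF this] show ?thesis by simp
 qed
 have eR: "emeasure lborel R = (\<integral>\<^sup>+y. \<integral>\<^sup>+x. f x y \<partial>lborel \<partial>lborel)"
  unfolding emeasure_plane[OF R] f_def ..
 have eS: "emeasure lborel ?S = (\<integral>\<^sup>+y. \<integral>\<^sup>+x. f (x * p1 + y * p2) (x * q1 + y * q2) \<partial>lborel \<partial>lborel)"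
  unfolding emeasure_plane[OF S] f_def by (simp add: indicator_def)
 have em: "ennreal (1 / \<bar>a\<bar>) * (ennreal (1 / \<bar>b\<bar>) * w) = ennreal (1 / \<bar>a * b\<bar>) * w" for a b :: real and w
  unfolding mult.assoc[symmetric] by (subst ennreal_mult[symmetric]) (auto simp: abs_mult)
 show "emeasure lborel ?S = ennreal (1 / \<bar>D\<bar>) * emeasure lborel R"
 proof (cases "q1 = 0")
  case True
  then have pq: "p1 \<noteq> 0" "q2 \<noteq> 0" "D = q2 * p1" using D by auto
  have "(\<integral>\<^sup>+x. f (x * p1 + y * p2) (x * q1 + y * q2) \<partial>lborel) = ennreal (1 / \<bar>p1\<bar>) * (\<integral>\<^sup>+x. f x (0 + q2 * y) \<partial>lborel)" for y
   using nn_integral_scale[of "\<lambda>a. f a (0 + q2 * y)" p1 "y * p2"] f1[of 0 1 "0 + q2 * y" 0] pq True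
   by (simp add: algebra_simps)
  then have "emeasure lborel ?S = (\<integral>\<^sup>+y. ennreal (1 / \<bar>p1\<bar>) * (\<integral>\<^sup>+x. f x (0 + q2 * y) \<partial>lborel) \<partial>lborel)"
   unfolding eS by simp
  also have "\<dots> = ennreal (1 / \<bar>p1\<bar>) * (\<integral>\<^sup>+y. (\<integral>\<^sup>+x. f x (0 + q2 * y) \<partial>lborel) \<partial>lborel)"
   by (rule nn_integral_cmult) (use measurable_compose[OF _ i1, of "\<lambda>y. 0 + q2 * y" lborel] in simp)
  also have "\<dots> = ennreal (1 / \<bar>p1\<bar>) * (ennreal (1 / \<bar>q2\<bar>) * emeasure lborel R)"
   unfolding eR using nn_integral_scale[OF i1 pq(2), of 0] by simp
  finally show ?thesis unfolding em pq(3) by (simp add: mult.commute)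
 next
  case False
  \<comment> \<open>Translating \<open>x\<close> by \<open>- y * q2 / q1\<close> removes
    \<open>y\<close> from the second coordinate and turns its coefficient in the first into
    \<open>- D / q1\<close>.\<close>
  have e1: "(\<integral>\<^sup>+x. f (x * p1 + y * p2) (x * q1 + y * q2) \<partial>lborel) =
    (\<integral>\<^sup>+x. f (x * p1 + y * (- D / q1)) (x * q1 + y * 0) \<partial>lborel)" for y
  proof -
   have m: "(\<lambda>x. f (x * p1 + y * p2) (x * q1 + y * q2)) \<in> borel_measurable borel"
    using f1[of "y * p2" p1 "y * q2" q1] by (simp add: algebra_simps)
   have "(\<integral>\<^sup>+x. f (x * p1 + y * p2) (x * q1 + y * q2) \<partial>lborel) =
    (\<integral>\<^sup>+x. f ((- y * q2 / q1 + 1 * x) * p1 + y * p2) ((- y * q2 / q1 + 1 * x) * q1 + y * q2) \<partial>lborel)"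
    using nn_integral_scale[OF m, of 1 "- y * q2 / q1"] by simp
   moreover have "(- y * q2 / q1 + 1 * x) * p1 + y * p2 = x * p1 + y * (- D / q1)"
    "(- y * q2 / q1 + 1 * x) * q1 + y * q2 = x * q1 + y * 0" for x
    using False by (simp_all add: D field_simps)
   ultimately show ?thesis by simp
  qed
  have "emeasure lborel ?S = (\<integral>\<^sup>+y. \<integral>\<^sup>+x. f (x * p1 + y * (- D / q1)) (x * q1 + y * 0) \<partial>lborel \<partial>lborel)"
   unfolding eS e1 ..
  also have "\<dots> = (\<integral>\<^sup>+x. \<integral>\<^sup>+y. f (x * p1 + y * (- D / q1)) (x * q1 + y * 0) \<partial>lborel \<partial>lborel)"
   by (rule lborel_pair.Fubini'[OF fpair])
  also have "\<dots> = (\<integral>\<^sup>+x. ennreal (1 / \<bar>D / q1\<bar>) * (\<integral>\<^sup>+a. f a (0 + q1 * x) \<partial>lborel) \<partial>lborel)"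
  proof (rule nn_integral_cong)
   fix x
   have "(\<integral>\<^sup>+y. f (x * p1 + (- D / q1) * y) (x * q1) \<partial>lborel) = ennreal (1 / \<bar>- D / q1\<bar>) * (\<integral>\<^sup>+a. f a (x * q1) \<partial>lborel)"
    using D(2) False f1[of 0 1 "x * q1" 0] by (intro nn_integral_scale) auto
   then show "(\<integral>\<^sup>+y. f (x * p1 + y * (- D / q1)) (x * q1 + y * 0) \<partial>lborel) = ennreal (1 / \<bar>D / q1\<bar>) * (\<integral>\<^sup>+a. f a (0 + q1 * x) \<partial>lborel)"
    by (simp add: mult.commute)
  qed
  also have "\<dots> = ennreal (1 / \<bar>D / q1\<bar>) * (\<integral>\<^sup>+x. (\<integral>\<^sup>+a. f a (0 + q1 * x) \<partial>lborel) \<partial>lborel)"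
   by (rule nn_integral_cmult) (use measurable_compose[OF _ i1, of "\<lambda>y. 0 + q1 * y" lborel] in simp)
  also have "\<dots> = ennreal (1 / \<bar>D / q1\<bar>) * (ennreal (1 / \<bar>q1\<bar>) * emeasure lborel R)"
   unfolding eR using nn_integral_scale[OF i1 False, of 0] by simp
  finally show ?thesis unfolding em using False by simp
 qed
qed

subsection \<open>The region\<close>

text \<open>Polymorphic homogeneous factors: they are evaluated at integers, rationals and reals,
  and also at polynomials when the region is restricted to a line.\<close>

definition Cf :: "'a::comm_ring_1 \<Rightarrow> 'a \<Rightarrow> 'a" where "Cf a b = a ^ 2 + a * b + 7 * b ^ 2"
definition Qf :: "'a::comm_ring_1 \<Rightarrow> 'a \<Rightarrow> 'a" where "Qf a b = a ^ 2 - 231 * a * b + 735 * b ^ 2"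
definition Rf :: "'a::comm_ring_1 \<Rightarrow> 'a \<Rightarrow> 'a" where
 "Rf a b = a ^ 4 + 518 * a ^ 3 * b - 11025 * a ^ 2 * b ^ 2 + 6174 * a * b ^ 3 - 64827 * b ^ 4"
definition Af :: "'a::comm_ring_1 \<Rightarrow> 'a \<Rightarrow> 'a" where "Af a b = - (3 * Cf a b * Qf a b)"
definition Bf :: "'a::comm_ring_1 \<Rightarrow> 'a \<Rightarrow> 'a" where "Bf a b = 2 * Cf a b * Rf a b"

lemma A7_Af: "A7 a b = Af a b" and B7_Bf: "B7 a b = Bf a b"
 by (simp_all only: A7_def B7_def Af_def Bf_def Cf_def Qf_def Rf_def mult_minus_left)

definition eCf :: pexp where "eCf = PAdd (PAdd (PPow PX 2) (PMul PX PY)) (PMul (PC 7) (PPow PY 2))"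
definition eQf :: pexp where "eQf = PAdd (PSub (PPow PX 2) (PMul (PMul (PC 231) PX) PY)) (PMul (PC 735) (PPow PY 2))"
definition eRf :: pexp where
 "eRf = PSub (PAdd (PSub (PAdd (PPow PX 4) (PMul (PMul (PC 518) (PPow PX 3)) PY)) (PMul (PMul (PC 11025) (PPow PX 2)) (PPow PY 2)))
   (PMul (PMul (PC 6174) PX) (PPow PY 3))) (PMul (PC 64827) (PPow PY 4))"

lemma pval_forms: "pval a b eCf = Cf a b" "pval a b eQf = Qf a b" "pval a b eRf = Rf a b"
 by (simp_all add: eCf_def eQf_def eRf_def Cf_def Qf_def Rf_def)

lemma forms_disc_eq:
 "pexp_eq (PSub (PPow eRf 2) (PMul eCf (PPow eQf 3))) (PMul (PMul (PC 1728) PY) (PPow (PAdd PX (PMul (PC 7) PY)) 7))"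
 by code_simp

text \<open>The discriminant of the family without its factor \<open>Cf a b ^ 2\<close>, up to a
  constant. It vanishes exactly at the cusps \<open>b = 0\<close> and
  \<open>a = - 7 b\<close>.\<close>

lemma forms_disc: "Rf a b ^ 2 - Cf a b * Qf a b ^ 3 = 1728 * b * (a + 7 * b) ^ 7"
 using pexp_eq[OF forms_disc_eq, of a b] by (simp add: pval_forms)

lemma Cf_lower:
 fixes a b :: real
 shows "a ^ 2 + b ^ 2 \<le> 2 * Cf a b"
proof -
 have "0 \<le> (a + b) ^ 2 + 12 * b ^ 2" by simp
 also have "\<dots> = 2 * Cf a b - (a ^ 2 + b ^ 2)" by (simp add: Cf_def power2_eq_square algebra_simps)
 finally show ?thesis by simp
qed

lemma Cf_upper:
 fixes a b :: real
 shows "Cf a b \<le> 8 * (a ^ 2 + b ^ 2)"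
proof -
 have "0 \<le> (a - b) ^ 2 + 13 * a ^ 2 + b ^ 2" by simp
 also have "\<dots> = 2 * (8 * (a ^ 2 + b ^ 2) - Cf a b)" by (simp add: Cf_def power2_eq_square algebra_simps)
 finally show ?thesis by simp
qed

lemma Cf_zero:
 fixes a b :: real
 assumes "Cf a b = 0" shows "a = 0" "b = 0"
 using Cf_lower[of a b] assms by (auto simp: sum_power2_le_zero_iff)

definition Mh :: "real \<Rightarrow> real \<Rightarrow> real" where "Mh a b = HH (A7 a b) (B7 a b)"

text \<open>A common zero is either a zero of the definite form \<open>Cf\<close> or a common zero
  of \<open>Qf\<close> and \<open>Rf\<close>. In the latter case it lies at a cusp by
  \<open>forms_disc\<close>, where \<open>Qf\<close> is \<open>a ^ 2\<close> or
  \<open>2401 * b ^ 2\<close>.\<close>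

lemma Mh_zero:
 assumes "Mh a b = 0" shows "a = 0" "b = 0"
proof -
 have "\<bar>4 * A7 a b ^ 3\<bar> \<le> 0" "\<bar>27 * B7 a b ^ 2\<bar> \<le> 0"
  using assms max.cobounded1[of "\<bar>4 * A7 a b ^ 3\<bar>" "\<bar>27 * B7 a b ^ 2\<bar>"]
   max.cobounded2[of "\<bar>27 * B7 a b ^ 2\<bar>" "\<bar>4 * A7 a b ^ 3\<bar>"] unfolding Mh_def HH_def by linarith+
 then have "Af a b = 0" "Bf a b = 0" by (simp_all add: A7_Af B7_Bf)
 then have "Cf a b = 0 \<or> (Qf a b = 0 \<and> Rf a b = 0)" by (auto simp: Af_def Bf_def)
 then have "a = 0 \<and> b = 0"
 proof
  assume "Cf a b = 0" then show ?thesis using Cf_zero by blast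
 next
  assume qr: "Qf a b = 0 \<and> Rf a b = 0"
  then have "b * (a + 7 * b) ^ 7 = 0" using forms_disc[of a b] by simp
  then have "b = 0 \<or> a = - (7 * b)" by (simp add: eq_neg_iff_add_eq_0)
  then show ?thesis
  proof
   assume "b = 0"
   then show ?thesis using qr by (simp add: Qf_def)
  next
   assume "a = - (7 * b)"
   then have "Qf a b = 2401 * b ^ 2" by (simp add: Qf_def power2_eq_square algebra_simps)
   then show ?thesis using qr \<open>a = - (7 * b)\<close> by simp
  qed
 qed
 then show "a = 0" "b = 0" by auto
qed

lemma Mh_nonneg: "Mh a b \<ge> 0" by (simp add: Mh_def HH_def)

lemma AB_scale: "Af (r * a) (r * b) = r ^ 4 * Af a b" "Bf (r * a) (r * b) = r ^ 6 * Bf a b"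
proof -
 have "Cf (r * a) (r * b) = r ^ 2 * Cf a b" "Qf (r * a) (r * b) = r ^ 2 * Qf a b" "Rf (r * a) (r * b) = r ^ 4 * Rf a b"
  by (simp_all add: Cf_def Qf_def Rf_def algebra_simps power_mult_distrib eval_nat_numeral)
 then show "Af (r * a) (r * b) = r ^ 4 * Af a b" "Bf (r * a) (r * b) = r ^ 6 * Bf a b"
  by (simp_all add: Af_def Bf_def eval_nat_numeral)
qed

lemma Mh_scale: assumes "r \<ge> 0" shows "Mh (r * a) (r * b) = r ^ 12 * Mh a b"
proof -
 have "Mh (r * a) (r * b) = max (r ^ 12 * \<bar>4 * Af a b ^ 3\<bar>) (r ^ 12 * \<bar>27 * Bf a b ^ 2\<bar>)"
  unfolding Mh_def HH_def A7_Af B7_Bf AB_scale using assms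
  by (simp add: power_mult_distrib abs_mult power_abs flip: power_mult)
 also have "\<dots> = r ^ 12 * Mh a b"
  unfolding Mh_def HH_def A7_Af B7_Bf using assms by (simp add: max_mult_distrib_left)
 finally show ?thesis .
qed

lemma continuous_Mh: "continuous_on S (\<lambda>z. Mh (fst z) (snd z))"
 unfolding Mh_def HH_def A7_def B7_def by (intro continuous_intros)

text \<open>The minimum on the unit circle is positive by \<open>Mh_zero\<close>; homogeneity of
  degree 12 extends the bound to the plane.\<close>

lemma Mh_lower: "\<exists>c>0. \<forall>a b. c * (a ^ 2 + b ^ 2) ^ 6 \<le> Mh a b"
proof -
 let ?S = "sphere (0 :: real \<times> real) 1"
 have "?S \<noteq> {}" by simp
 then obtain z where z: "z \<in> ?S" "\<And>w. w \<in> ?S \<Longrightarrow> Mh (fst z) (snd z) \<le> Mh (fst w) (snd w)"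
  using continuous_attains_inf[OF compact_sphere _ continuous_Mh] by blast
 define c where "c = Mh (fst z) (snd z)"
 have "c \<noteq> 0"
 proof
  assume "c = 0"
  then have "z = 0" using Mh_zero[of "fst z" "snd z"] by (simp add: c_def prod_eq_iff)
  then show False using z(1) by simp
 qed
 then have c: "c > 0" using Mh_nonneg[of "fst z" "snd z"] by (simp add: c_def)
 have "c * (a ^ 2 + b ^ 2) ^ 6 \<le> Mh a b" for a b
 proof (cases "a = 0 \<and> b = 0")
  case True
  then show ?thesis using Mh_nonneg[of a b] by simp
 next
  case False
  define r where "r = sqrt (a ^ 2 + b ^ 2)"
  have p: "a ^ 2 + b ^ 2 > 0" using False by (simp add: sum_power2_gt_zero_iff)
  then have r: "r > 0" by (simp add: r_def)
  have "norm (a / r, b / r) = 1"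
   using r p unfolding norm_Pair by (simp add: power_divide add_divide_distrib[symmetric] r_def[symmetric] real_sqrt_divide)
  then have "c \<le> Mh (a / r) (b / r)" using z(2)[of "(a / r, b / r)"] by (simp add: c_def)
  then have "r ^ 12 * c \<le> r ^ 12 * Mh (a / r) (b / r)" using r by (intro mult_left_mono) auto
  also have "\<dots> = Mh a b" using Mh_scale[of r "a / r" "b / r"] r by simp
  also have "r ^ 12 = (a ^ 2 + b ^ 2) ^ 6"
  proof -
   have "r ^ 12 = (r ^ 2) ^ 6" by simp
   then show ?thesis using p by (simp add: r_def)
  qed
  finally show ?thesis by (simp add: mult.commute)
 qed
 then show ?thesis using c by blast
qed

definition Rg :: "real \<Rightarrow> (real \<times> real) set" where "Rg Z = {(a, b). Mh a b \<le> Z \<and> b \<ge> 0}"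

lemma R7_Rg: "R7 = measure lborel (Rg 1)"
 by (simp add: R7_def Rg_def Mh_def)

lemma Rg_borel: "Rg Z \<in> sets borel"
proof -
 have "Rg Z = {z. Mh (fst z) (snd z) \<le> Z} \<inter> {z. 0 \<le> snd z}" by (auto simp: Rg_def)
 moreover have "closed {z. Mh (fst z) (snd z) \<le> Z}"
  using continuous_Mh by (intro closed_Collect_le) auto
 moreover have "closed {z :: real \<times> real. 0 \<le> snd z}" by (intro closed_Collect_le continuous_intros)
 ultimately show ?thesis by auto
qed

text \<open>A name for the constant produced by the compactness argument, so that all later bounds
  share it.\<close>

definition Bd :: real where "Bd = (SOME c. c \<ge> 1 \<and> (\<forall>a b Z. Mh a b \<le> Z \<longrightarrow> Z > 0 \<longrightarrow> a ^ 2 + b ^ 2 \<le> c * Z powr (1 / 6)))"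

lemma Bd: "Bd \<ge> 1" "Mh a b \<le> Z \<Longrightarrow> Z > 0 \<Longrightarrow> a ^ 2 + b ^ 2 \<le> Bd * Z powr (1 / 6)"
proof -
 obtain c where c: "c > 0" "\<And>a b. c * (a ^ 2 + b ^ 2) ^ 6 \<le> Mh a b" using Mh_lower by blast
 define k where "k = max 1 ((1 / c) powr (1 / 6))"
 have "a ^ 2 + b ^ 2 \<le> k * Z powr (1 / 6)" if "Mh a b \<le> Z" "Z > 0" for a b Z
 proof -
  have "c * (a ^ 2 + b ^ 2) ^ 6 \<le> Z" using c(2)[of a b] that by simp
  then have "(a ^ 2 + b ^ 2) ^ 6 \<le> 1 / c * Z" using c(1) by (simp add: field_simps)
  also have "1 / c * Z = ((1 / c * Z) powr (1 / 6)) ^ 6"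
   using c(1) that by (subst powr_numeral[symmetric]) (auto simp: powr_powr)
  finally have "(a ^ 2 + b ^ 2) ^ Suc 5 \<le> ((1 / c * Z) powr (1 / 6)) ^ Suc 5" by simp
  then have "a ^ 2 + b ^ 2 \<le> (1 / c * Z) powr (1 / 6)" by (rule power_le_imp_le_base) simp
  also have "\<dots> = (1 / c) powr (1 / 6) * Z powr (1 / 6)" using c(1) that by (subst powr_mult) auto
  also have "\<dots> \<le> k * Z powr (1 / 6)" by (intro mult_right_mono) (auto simp: k_def)
  finally show ?thesis .
 qed
 then have "\<exists>c. c \<ge> 1 \<and> (\<forall>a b Z. Mh a b \<le> Z \<longrightarrow> Z > 0 \<longrightarrow> a ^ 2 + b ^ 2 \<le> c * Z powr (1 / 6))"
  by (intro exI[of _ k]) (auto simp: k_def)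
 from someI_ex[OF this, folded Bd_def]
 show "Bd \<ge> 1" "Mh a b \<le> Z \<Longrightarrow> Z > 0 \<Longrightarrow> a ^ 2 + b ^ 2 \<le> Bd * Z powr (1 / 6)" by auto
qed

text \<open>By homogeneity of degree 12 the region is the unit region scaled by
  \<open>Z powr (1 / 12)\<close>, which multiplies areas by the square of that factor.\<close>

lemma measure_Rg:
 assumes "Z > 0"
 shows "emeasure lborel (Rg Z) = ennreal (Z powr (1 / 6) * R7)"
proof -
 define r where "r = Z powr (1 / 12)"
 have r: "r > 0" using assms by (simp add: r_def)
 have r12: "r ^ 12 = Z" using assms unfolding r_def by (subst powr_numeral[symmetric]) (auto simp: powr_powr)
 have r2: "r ^ 2 = Z powr (1 / 6)" using assms unfolding r_def by (subst powr_numeral[symmetric]) (auto simp: powr_powr)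
 have "Rg Z = {(x, y). (x * (1 / r) + y * 0, x * 0 + y * (1 / r)) \<in> Rg 1}"
 proof (intro equalityI subsetI; clarify)
  fix x y
  have M: "Mh x y = Z * Mh (x / r) (y / r)"
   using Mh_scale[of r "x / r" "y / r"] r by (simp add: r12)
  have M': "Mh x y \<le> Z \<longleftrightarrow> Mh (x / r) (y / r) \<le> 1"
   unfolding M using assms by (simp add: mult_le_cancel_left2)
  show "(x * (1 / r) + y * 0, x * 0 + y * (1 / r)) \<in> Rg 1" if "(x, y) \<in> Rg Z"
   using that M' r by (auto simp: Rg_def)
  show "(x, y) \<in> Rg Z" if "(x * (1 / r) + y * 0, x * 0 + y * (1 / r)) \<in> Rg 1"
   using that M' r by (auto simp: Rg_def zero_le_divide_iff)
 qed
 then have e: "emeasure lborel (Rg Z) = ennreal (1 / \<bar>1 / r * (1 / r)\<bar>) * emeasure lborel (Rg 1)"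
  using emeasure_linear_plane(2)[OF Rg_borel, of "1 / r * (1 / r)" "1 / r" "1 / r" 0 0 1] r by simp
 have "Rg 1 \<subseteq> {-Bd..Bd} \<times> {-Bd..Bd}"
 proof clarify
  fix a b assume "(a, b) \<in> Rg 1"
  then have "a ^ 2 + b ^ 2 \<le> Bd" using Bd(2)[of a b 1] by (simp add: Rg_def)
  moreover have "Bd \<le> Bd ^ 2" using Bd(1) by (simp add: power2_eq_square)
  ultimately have "a ^ 2 \<le> Bd ^ 2" "b ^ 2 \<le> Bd ^ 2" using zero_le_power2[of a] zero_le_power2[of b] by linarith+
  then show "a \<in> {-Bd..Bd} \<and> b \<in> {-Bd..Bd}" using Bd(1) by (auto simp: abs_le_square_iff[symmetric])
 qed
 then have "emeasure lborel (Rg 1) \<le> emeasure lborel ({-Bd..Bd} \<times> {-Bd..Bd} :: (real \<times> real) set)"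
  by (intro emeasure_mono) (auto simp: borel_prod[symmetric] intro!: pair_measureI)
 also have "\<dots> = ennreal (2 * Bd) * ennreal (2 * Bd)"
  unfolding lborel_prod[symmetric] using Bd(1) by (subst lborel.emeasure_pair_measure_Times) auto
 finally have "emeasure lborel (Rg 1) \<noteq> top_class.top" by (auto simp: top_unique ennreal_mult_eq_top_iff)
 then have "emeasure lborel (Rg 1) = ennreal R7" unfolding R7_Rg by (rule emeasure_eq_ennreal_measure)
 then have "emeasure lborel (Rg Z) = ennreal (r ^ 2) * ennreal R7"
  using e r by (simp add: abs_mult power2_eq_square)
 also have "\<dots> = ennreal (r ^ 2 * R7)" by (rule ennreal_mult[symmetric]) (auto simp: R7_def)
 finally show ?thesis unfolding r2 .
qed

lemma const_off_polys:
 assumes "finite P" "\<And>p. p \<in> P \<Longrightarrow> degree p \<le> n" "card P \<le> m"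
 shows "const_off {x. \<forall>p\<in>P. poly p x \<ge> (0 :: real)} (m * n)"
proof -
 define F where "F = (\<Union>p\<in>P - {0}. {x. poly p x = 0})"
 have "card F \<le> (\<Sum>p\<in>P - {0}. card {x. poly p x = 0})" unfolding F_def using assms(1) by (intro card_UN_le) auto
 also have "\<dots> \<le> (\<Sum>p\<in>P - {0}. n)"
 proof (intro sum_mono)
  fix p assume p: "p \<in> P - {0}"
  then have "card {x. poly p x = 0} \<le> degree p" by (intro card_poly_roots_bound) auto
  then show "card {x. poly p x = 0} \<le> n" using assms(2)[of p] p by simp
 qed
 also have "\<dots> = card (P - {0}) * n" by simp
 also have "\<dots> \<le> m * n" using assms(1,3) card_mono[of P "P - {0}"] by (intro mult_right_mono) auto
 finally have cF: "card F \<le> m * n" .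
 have fF: "finite F" unfolding F_def using assms(1) by (auto intro: poly_roots_finite)
 have "(\<forall>p\<in>P. poly p x \<ge> 0) \<longleftrightarrow> (\<forall>p\<in>P. poly p y \<ge> 0)" if xy: "x \<le> y" "{x..y} \<inter> F = {}" for x y
 proof (intro ball_cong refl)
  fix p assume p: "p \<in> P"
  show "poly p x \<ge> 0 \<longleftrightarrow> poly p y \<ge> 0"
  proof (cases "p = 0 \<or> x = y")
   case False
   then have lt: "x < y" using xy by simp
   have nr: "poly p z \<noteq> 0" if "x \<le> z" "z \<le> y" for z using xy(2) that p False unfolding F_def by auto
   show ?thesis
   proof (rule ccontr)
    assume "\<not> ?thesis"
    then have "(poly p x > 0 \<and> poly p y < 0) \<or> (poly p x < 0 \<and> poly p y > 0)"
     using nr[of x] nr[of y] lt by (auto simp: not_le less_le)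
    then have "\<exists>z>x. z < y \<and> poly p z = 0" using poly_IVT_neg[OF lt] poly_IVT_pos[OF lt] by blast
    then show False using nr by fastforce
   qed
  qed auto
 qed
 then show ?thesis unfolding const_off_def using fF cF by (intro exI[of _ F]) auto
qed

text \<open>On a line the region is given by four polynomial inequalities of degree at most 12,
  hence 48. The bound is uniform in the line, so it survives every change of lattice basis.\<close>

lemma const_off_line: "const_off {x. (x * p + c, x * q + d) \<in> Rg Z} 48"
proof -
 define a b where "a = [:c, p:]" "b = [:d, q:]"
 define A B where "A = Af a b" "B = Bf a b"
 have dab: "degree a \<le> 1" "degree b \<le> 1" by (simp_all add: a_b_def)
 have dm: "degree u \<le> i \<Longrightarrow> degree v \<le> j \<Longrightarrow> i + j \<le> k \<Longrightarrow> degree (u * v) \<le> k" for u v :: "real poly" and i j k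
  using degree_mult_le[of u v] by simp
 have dp: "degree u \<le> i \<Longrightarrow> i * n \<le> k \<Longrightarrow> degree (u ^ n) \<le> k" for u :: "real poly" and i n k
  using degree_power_le[of u n] by (meson le_trans mult_le_mono1)
 have dn: "degree (numeral w :: real poly) \<le> 0" for w by simp
 have d2: "degree (a ^ 2) \<le> 2" "degree (b ^ 2) \<le> 2" "degree (a * b) \<le> 2"
  by (rule dp[OF dab(1)], simp, rule dp[OF dab(2)], simp, rule dm[OF dab], simp)
 have d4: "degree (a ^ 4) \<le> 4" "degree (b ^ 4) \<le> 4" by (rule dp[OF dab(1)], simp, rule dp[OF dab(2)], simp)
 have d3: "degree (a ^ 3) \<le> 3" "degree (b ^ 3) \<le> 3" by (rule dp[OF dab(1)], simp, rule dp[OF dab(2)], simp)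
 have n2: "degree (numeral w * u) \<le> k" if "degree u \<le> k" for w and u :: "real poly" and k
  by (rule dm[OF dn that]) simp
 have C: "degree (Cf a b) \<le> 2" unfolding Cf_def by (intro degree_add_le d2 n2)
 have Q: "degree (Qf a b) \<le> 2" unfolding Qf_def mult.assoc by (intro degree_add_le degree_diff_le d2 n2)
 have "degree (a ^ 3 * b) \<le> 4" "degree (a ^ 2 * b ^ 2) \<le> 4" "degree (a * b ^ 3) \<le> 4"
  by (rule dm[OF d3(1) dab(2)], simp, rule dm[OF d2(1,2)], simp, rule dm[OF dab(1) d3(2)], simp)
 then have R: "degree (Rf a b) \<le> 4" unfolding Rf_def mult.assoc by (intro degree_add_le degree_diff_le d4 n2)
 have dA: "degree A \<le> 4" unfolding A_B_def Af_def degree_minus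
  by (rule dm[OF n2[OF C] Q]) simp
 have dB: "degree B \<le> 6" unfolding A_B_def Bf_def
  by (rule dm[OF n2[OF C] R]) simp
 have pa: "poly a x = x * p + c" "poly b x = x * q + d" for x by (simp_all add: a_b_def algebra_simps)
 have pAB: "poly A x = A7 (x * p + c) (x * q + d)" "poly B x = B7 (x * p + c) (x * q + d)" for x
  by (simp_all add: A_B_def A7_Af B7_Bf Af_def Bf_def Cf_def Qf_def Rf_def pa)
 define P where "P = {[:Z:] - 4 * A ^ 3, [:Z:] + 4 * A ^ 3, [:Z:] - 27 * B ^ 2, b}"
 have "{x. (x * p + c, x * q + d) \<in> Rg Z} = {x. \<forall>r\<in>P. poly r x \<ge> 0}"
  unfolding P_def Rg_def Mh_def HH_def by (auto simp: pAB pa abs_le_iff)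
 moreover have "const_off {x. \<forall>r\<in>P. poly r x \<ge> (0 :: real)} (4 * 12)"
 proof (rule const_off_polys)
  show "card P \<le> 4" unfolding P_def by (intro order_trans[OF card_insert_le_m1[of 4]] card_insert_le_m1) auto
  have "degree (4 * A ^ 3) \<le> 12" "degree (27 * B ^ 2) \<le> 12"
   by (rule n2, rule dp[OF dA], simp, rule n2, rule dp[OF dB], simp)
  then have "degree ([:Z:] - 4 * A ^ 3) \<le> 12" "degree ([:Z:] + 4 * A ^ 3) \<le> 12" "degree ([:Z:] - 27 * B ^ 2) \<le> 12"
   by (auto intro!: degree_add_le degree_diff_le)
  then show "degree r \<le> 12" if "r \<in> P" for r using that dab unfolding P_def by auto
 qed (simp add: P_def)
 ultimately show ?thesis by simp
qed

subsection \<open>Lattice points in the region\<close>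

definition lat :: "int \<times> int \<Rightarrow> int \<times> int \<Rightarrow> (int \<times> int) set" where
 "lat u v = range (\<lambda>(x, y). (x * fst u + y * fst v, x * snd u + y * snd v))"

definition ldet :: "int \<times> int \<Rightarrow> int \<times> int \<Rightarrow> int" where
 "ldet u v = fst u * snd v - fst v * snd u"

abbreviation Cv :: "int \<times> int \<Rightarrow> int" where "Cv v \<equiv> Cf (fst v) (snd v)"

lemma Cv_nonneg: "Cv v \<ge> 0"
proof -
 have "0 \<le> (2 * fst v + snd v) ^ 2 + 27 * snd v ^ 2" by simp
 also have "\<dots> = 4 * Cv v" by (simp add: Cf_def power2_eq_square algebra_simps)
 finally show ?thesis by simp
qed

lemma lat_swap: "lat v u = lat u v"
proof -
 have "lat v u \<subseteq> lat u v" for u v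
 proof
  fix w assume "w \<in> lat v u"
  then obtain x y where "w = (x * fst v + y * fst u, x * snd v + y * snd u)" by (auto simp: lat_def)
  then show "w \<in> lat u v" unfolding lat_def by (intro image_eqI[of _ _ "(y, x)"]) auto
 qed
 then show ?thesis by blast
qed

lemma lat_shear: "lat u (fst v + k * fst u, snd v + k * snd u) = lat u v"
proof -
 have *: "lat u (fst v + k * fst u, snd v + k * snd u) \<subseteq> lat u v" for v k
 proof
  fix w assume "w \<in> lat u (fst v + k * fst u, snd v + k * snd u)"
  then obtain x y where "w = (x * fst u + y * (fst v + k * fst u), x * snd u + y * (snd v + k * snd u))" by (auto simp: lat_def)
  then show "w \<in> lat u v" unfolding lat_def by (intro image_eqI[of _ _ "(x + y * k, y)"]) (auto simp: algebra_simps)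
 qed
 have "lat u v = lat u (fst (fst v + k * fst u, snd v + k * snd u) + (- k) * fst u, snd (fst v + k * fst u, snd v + k * snd u) + (- k) * snd u)"
  by simp
 also have "\<dots> \<subseteq> lat u (fst v + k * fst u, snd v + k * snd u)" by (rule *)
 finally show ?thesis using * by blast
qed

text \<open>Gauss reduction with respect to the form \<open>Cf\<close>: a basis with the least sum
  of the two values has its mixed term \<open>B\<close> bounded by both of them. As 4 times the
  product of the values minus \<open>B ^ 2\<close> is 27 times the squared determinant, where - 27
  is the discriminant of the form, the bound 9 follows.\<close>

lemma reduced_basis:
 obtains u' v' where "lat u' v' = lat u v" "\<bar>ldet u' v'\<bar> = \<bar>ldet u v\<bar>" "Cv u' * Cv v' \<le> 9 * (ldet u v) ^ 2"
proof -
 define P where "P w \<longleftrightarrow> lat (fst w) (snd w) = lat u v \<and> \<bar>ldet (fst w) (snd w)\<bar> = \<bar>ldet u v\<bar>" for w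
 define sz where "sz w = nat (Cv (fst w) + Cv (snd w))" for w
 have "P (u, v)" by (simp add: P_def)
 then obtain w where w: "P w" and min: "\<And>w'. P w' \<Longrightarrow> sz w \<le> sz w'"
  using ex_has_least_nat[of P "(u, v)" sz] by blast
 obtain u' v' where uv: "w = (u', v')" by (cases w)
 define B where "B = 2 * fst u' * fst v' + fst u' * snd v' + fst v' * snd u' + 14 * snd u' * snd v'"
 have sh: "Cv (fst v' + k * fst u', snd v' + k * snd u') = Cv v' + k * B + k ^ 2 * Cv u'" for k
  by (simp add: Cf_def B_def power2_eq_square algebra_simps)
 have sh': "Cv (fst u' + k * fst v', snd u' + k * snd v') = Cv u' + k * B + k ^ 2 * Cv v'" for k
  by (simp add: Cf_def B_def power2_eq_square algebra_simps)
 have P1: "P (u', (fst v' + k * fst u', snd v' + k * snd u'))" for k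
 proof -
  have "ldet u' (fst v' + k * fst u', snd v' + k * snd u') = ldet u' v'" by (simp add: ldet_def algebra_simps)
  then show ?thesis using w unfolding uv P_def by (simp add: lat_shear)
 qed
 have P2: "P ((fst u' + k * fst v', snd u' + k * snd v'), v')" for k
 proof -
  have "ldet (fst u' + k * fst v', snd u' + k * snd v') v' = ldet u' v'" by (simp add: ldet_def algebra_simps)
  moreover have "lat (fst u' + k * fst v', snd u' + k * snd v') v' = lat u' v'"
   using lat_shear[of v' u' k] lat_swap by metis
  ultimately show ?thesis using w unfolding uv P_def by simp
 qed
 have a: "k * B + k ^ 2 * Cv u' \<ge> 0" for k
 proof -
  have "Cv u' + Cv v' \<le> Cv u' + Cv (fst v' + k * fst u', snd v' + k * snd u')"
   using min[OF P1[of k]] Cv_nonneg[of u'] Cv_nonneg[of v'] Cv_nonneg[of "(fst v' + k * fst u', snd v' + k * snd u')"]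
   unfolding sz_def uv by (simp add: nat_le_eq_zle)
  then show ?thesis unfolding sh by simp
 qed
 have b: "k * B + k ^ 2 * Cv v' \<ge> 0" for k
 proof -
  have "Cv u' + Cv v' \<le> Cv (fst u' + k * fst v', snd u' + k * snd v') + Cv v'"
   using min[OF P2[of k]] Cv_nonneg[of u'] Cv_nonneg[of v'] Cv_nonneg[of "(fst u' + k * fst v', snd u' + k * snd v')"]
   unfolding sz_def uv by (simp add: nat_le_eq_zle)
  then show ?thesis unfolding sh' by simp
 qed
 have Bu: "\<bar>B\<bar> \<le> Cv u'" and Bv: "\<bar>B\<bar> \<le> Cv v'"
  using a[of 1] a[of "-1"] b[of 1] b[of "-1"] by (auto simp: abs_le_iff)
 have "B ^ 2 = \<bar>B\<bar> * \<bar>B\<bar>" by (simp add: power2_eq_square)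
 also have "\<dots> \<le> Cv u' * Cv v'" using Bu Bv by (intro mult_mono) auto
 finally have "B ^ 2 \<le> Cv u' * Cv v'" .
 moreover have "4 * (Cv u' * Cv v') - B ^ 2 = 27 * (ldet u' v') ^ 2"
  by (simp add: Cf_def B_def ldet_def power2_eq_square algebra_simps)
 ultimately have "Cv u' * Cv v' \<le> 9 * (ldet u' v') ^ 2" by linarith
 moreover have "(ldet u' v') ^ 2 = (ldet u v) ^ 2" using w unfolding uv P_def by (simp add: power2_eq_iff abs_eq_iff)
 ultimately show thesis using that[of u' v'] w unfolding uv P_def by simp
qed

text \<open>The origin lies in every region and is left out, so that a sparse lattice can have count
  zero.\<close>

definition lcount :: "(int \<times> int) set \<Rightarrow> real \<Rightarrow> nat" where
 "lcount \<Lambda> Z = card {(a, b). (a, b) \<in> \<Lambda> \<and> (a, b) \<noteq> (0, 0) \<and> (of_int a, of_int b) \<in> Rg Z}"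

text \<open>The values of the form at the reduced basis have product at most
  \<open>9 * D ^ 2\<close>, and each is at least \<open>D / \<kappa>\<close>, so each is at most
  \<open>9 * \<kappa> * D\<close>. In the coordinates of this basis the region fits into a square of
  size about \<open>sqrt (X / D)\<close>, and \<open>int_count_2d\<close> with \<open>N = 48\<close>
  yields the constants 96 and 192. The summand 1 on the left is the origin.\<close>

lemma lattice_count_aux:
 fixes \<kappa> D Z :: real
 assumes \<kappa>: "\<kappa> \<ge> 1" and D: "D = \<bar>of_int (ldet u v)\<bar>" "D > 0" and Z: "Z > 0"
  and C: "Cv u * Cv v \<le> 9 * (ldet u v) ^ 2" "D \<le> \<kappa> * of_int (Cv u)" "D \<le> \<kappa> * of_int (Cv v)"
 shows "\<bar>real (lcount (lat u v) Z) + 1 - R7 * (Z powr (1 / 6) / D)\<bar> \<le>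
   96 + 192 * (6 * sqrt (Bd * \<kappa>) * sqrt (Z powr (1 / 6) / D)) + 192 * (6 * sqrt (Bd * \<kappa>) * sqrt (Z powr (1 / 6) / D))"
proof -
 define X where "X = Z powr (1 / 6)"
 have X: "X > 0" using Z by (simp add: X_def)
 obtain p1 q1 p2 q2 where uv: "u = (p1, q1)" "v = (p2, q2)" by fastforce
 define G where "G = {(x::real, y). (x * of_int p1 + y * of_int p2, x * of_int q1 + y * of_int q2) \<in> Rg Z}"
 define d where "d = (of_int p1 * of_int q2 - of_int p2 * of_int q1 :: real)"
 have d: "d \<noteq> 0" "\<bar>d\<bar> = D" using D by (auto simp: d_def ldet_def uv)
 have Cr: "of_int (Cv w) = (Cf (of_int (fst w)) (of_int (snd w)) :: real)" for w by (simp add: Cf_def)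
 have Cbd: "of_int (Cv w) \<le> 9 * \<kappa> * D" if "(w = u \<and> w' = v) \<or> (w = v \<and> w' = u)" for w w'
 proof -
  have "Cv w * Cv w' \<le> 9 * (ldet u v) ^ 2" using C(1) that by (auto simp: mult.commute)
  then have "real_of_int (Cv w * Cv w') \<le> real_of_int (9 * (ldet u v) ^ 2)" by (simp only: of_int_le_iff)
  also have "\<dots> = 9 * D ^ 2" using D by simp
  finally have 1: "real_of_int (Cv w) * real_of_int (Cv w') \<le> 9 * D ^ 2" by simp
  have "D \<le> \<kappa> * of_int (Cv w')" using C(2,3) that by auto
  then have "real_of_int (Cv w) * D \<le> real_of_int (Cv w) * (\<kappa> * of_int (Cv w'))"
   using Cv_nonneg[of w] by (intro mult_left_mono) auto
  also have "\<dots> = \<kappa> * (real_of_int (Cv w) * of_int (Cv w'))" by (simp add: mult_ac)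
  also have "\<dots> \<le> \<kappa> * (9 * D ^ 2)" using 1 \<kappa> by (intro mult_left_mono) auto
  finally have "real_of_int (Cv w) * D \<le> (9 * \<kappa> * D) * D" by (simp add: power2_eq_square mult_ac)
  then show ?thesis using D(2) by (simp add: mult_le_cancel_right)
 qed
 have vec: "p ^ 2 + q ^ 2 \<le> 18 * \<kappa> * D" if "(p = of_int p1 \<and> q = of_int q1) \<or> (p = of_int p2 \<and> q = of_int q2)" for p q :: real
 proof -
  have "p ^ 2 + q ^ 2 \<le> 2 * Cf p q" by (rule Cf_lower)
  also have "Cf p q \<le> 9 * \<kappa> * D" using that Cbd[of u v] Cbd[of v u] unfolding Cr uv by auto
  finally show ?thesis by simp
 qed
 \<comment> \<open>The coordinates satisfy \<open>d * t = a * q - b * p\<close>, so Cauchy-Schwarz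
   gives \<open>(d * t) ^ 2 \<le> (a ^ 2 + b ^ 2) * (p ^ 2 + q ^ 2)\<close>. The bounds on the
   factors leave \<open>18 * Bd * \<kappa> * X * D\<close>, and 18 is rounded up to the square
   36.\<close>
 define s where "s = 6 * sqrt (Bd * \<kappa>) * sqrt (X / D)"
 have s0: "s \<ge> 0" using Bd(1) \<kappa> X D by (simp add: s_def)
 have s2: "s ^ 2 = 36 * (Bd * \<kappa>) * (X / D)" using Bd(1) \<kappa> X D by (simp add: s_def power_mult_distrib)
 have bound: "t \<in> {-s..s}" if t: "d * t = a * q - b * p" and ab: "(a, b) \<in> Rg Z"
  and pq: "(p = of_int p1 \<and> q = of_int q1) \<or> (p = of_int p2 \<and> q = of_int q2)" for t a b p q
 proof -
  have "a ^ 2 + b ^ 2 \<le> Bd * X" using Bd(2)[of a b Z] ab Z by (simp add: Rg_def X_def)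
  have "(d * t) ^ 2 \<le> (a ^ 2 + b ^ 2) * (p ^ 2 + q ^ 2)"
  proof -
   have "0 \<le> (a * p + b * q) ^ 2" by simp
   also have "\<dots> = (a ^ 2 + b ^ 2) * (p ^ 2 + q ^ 2) - (d * t) ^ 2" unfolding t by (simp add: power2_eq_square algebra_simps)
   finally show ?thesis by simp
  qed
  also have "\<dots> \<le> (Bd * X) * (18 * \<kappa> * D)"
   using \<open>a ^ 2 + b ^ 2 \<le> Bd * X\<close> vec[OF pq] Bd(1) X by (intro mult_mono) auto
  also have "\<dots> \<le> (Bd * X) * (36 * \<kappa> * D)" using Bd(1) X \<kappa> D by (intro mult_left_mono) auto
  also have "\<dots> = D ^ 2 * s ^ 2" unfolding s2 using D by (simp add: power2_eq_square field_simps)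
  also have "D ^ 2 = d ^ 2" using d(2) by (metis power2_abs)
  finally have "d ^ 2 * t ^ 2 \<le> d ^ 2 * s ^ 2" by (simp add: power_mult_distrib)
  then have "t ^ 2 \<le> s ^ 2" using d(1) by (simp add: mult_le_cancel_left)
  then show ?thesis using s0 by (simp add: abs_le_square_iff[symmetric] abs_le_iff)
 qed
 have Gb: "G \<in> sets borel" and Ge: "emeasure lborel G = ennreal (1 / D) * ennreal (X * R7)"
  using emeasure_linear_plane[OF Rg_borel d_def d(1), of Z] measure_Rg[OF Z] unfolding G_def d(2) X_def by auto
 have "ennreal (1 / D) * ennreal (X * R7) = ennreal (1 / D * (X * R7))"
  using D X by (intro ennreal_mult[symmetric]) (auto simp: R7_def)
 then have Gm: "measure lborel G = R7 * (X / D)"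
  using Ge D X by (simp add: measure_def R7_def)
 have Gs: "G \<subseteq> {-s..s} \<times> {-s..s}"
 proof clarify
  fix x y assume "(x, y) \<in> G"
  then have *: "(x * of_int p1 + y * of_int p2, x * of_int q1 + y * of_int q2) \<in> Rg Z" by (simp add: G_def)
  have "x \<in> {-s..s}"
   by (rule bound[OF _ *, where t = x and p = "of_int p2" and q = "of_int q2"]) (auto simp: d_def algebra_simps)
  moreover have "- y \<in> {-s..s}"
   by (rule bound[OF _ *, where t = "- y" and p = "of_int p1" and q = "of_int q1"]) (auto simp: d_def algebra_simps)
  ultimately show "x \<in> {-s..s} \<and> y \<in> {-s..s}" by auto
 qed
 have hor: "const_off {x. (x, y) \<in> G} 48" for y
  using const_off_line[of "of_int p1" "y * of_int p2" "of_int q1" "y * of_int q2" Z] by (simp add: G_def)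
 have ver: "const_off {y. (x, y) \<in> G} 48" for x
  using const_off_line[of "of_int p2" "x * of_int p1" "of_int q2" "x * of_int q1" Z] by (simp add: G_def add.commute)
 note cnt = int_count_2d[OF Gb Gs s0 s0 hor ver]
 let ?P = "{(m::int, n::int). (of_int m, of_int n) \<in> G}"
 define f where "f = (\<lambda>(x, y). (x * p1 + y * p2, x * q1 + y * q2))"
 have inj: "inj f"
 proof (rule injI)
  fix z w assume "f z = f w"
  then have e: "(fst z - fst w) * p1 + (snd z - snd w) * p2 = 0" "(fst z - fst w) * q1 + (snd z - snd w) * q2 = 0"
   by (simp_all add: f_def case_prod_beta algebra_simps)
  have "(fst z - fst w) * ldet u v = ((fst z - fst w) * p1 + (snd z - snd w) * p2) * q2 - ((fst z - fst w) * q1 + (snd z - snd w) * q2) * p2"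
   by (simp add: ldet_def uv algebra_simps)
  moreover have "(snd z - snd w) * ldet u v = ((fst z - fst w) * q1 + (snd z - snd w) * q2) * p1 - ((fst z - fst w) * p1 + (snd z - snd w) * p2) * q1"
   by (simp add: ldet_def uv algebra_simps)
  ultimately have "(fst z - fst w) * ldet u v = 0" "(snd z - snd w) * ldet u v = 0" unfolding e by simp_all
  then show "z = w" using D by (auto simp: prod_eq_iff)
 qed
 have L: "lat u v = range f" by (simp add: lat_def f_def uv)
 have Gf: "(of_int m, of_int n) \<in> G \<longleftrightarrow> (of_int (fst (f (m, n))), of_int (snd (f (m, n)))) \<in> Rg Z" for m n
  by (simp add: G_def f_def)
 have "{(a, b). (a, b) \<in> lat u v \<and> (a, b) \<noteq> (0, 0) \<and> (of_int a, of_int b) \<in> Rg Z} = f ` (?P - {(0, 0)})"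
 proof (intro equalityI subsetI)
  fix z assume "z \<in> {(a, b). (a, b) \<in> lat u v \<and> (a, b) \<noteq> (0, 0) \<and> (of_int a, of_int b) \<in> Rg Z}"
  then have z: "z \<in> range f" "z \<noteq> (0, 0)" "(of_int (fst z), of_int (snd z)) \<in> Rg Z"
   unfolding L by (cases z; simp)+
  then obtain m n where mn: "z = f (m, n)" by auto
  then have "(m, n) \<in> ?P" using z Gf by simp
  moreover have "(m, n) \<noteq> (0, 0)" using mn z by (auto simp: f_def)
  ultimately show "z \<in> f ` (?P - {(0, 0)})" using mn by blast
 next
  fix z assume "z \<in> f ` (?P - {(0, 0)})"
  then obtain m n where mn: "z = f (m, n)" "(m, n) \<in> ?P" "(m, n) \<noteq> (0, 0)" by auto
  have "f (0, 0) = (0, 0)" by (simp add: f_def)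
  then have "z \<noteq> (0, 0)" using mn inj unfolding inj_def by metis
  moreover have "z \<in> range f" using mn by blast
  moreover have "(of_int (fst z), of_int (snd z)) \<in> Rg Z" using mn Gf[of m n] by simp
  ultimately show "z \<in> {(a, b). (a, b) \<in> lat u v \<and> (a, b) \<noteq> (0, 0) \<and> (of_int a, of_int b) \<in> Rg Z}"
   unfolding L by (simp add: case_prod_beta prod_eq_iff)
 qed
 then have "lcount (lat u v) Z = card (?P - {(0, 0)})"
  unfolding lcount_def by (simp add: card_image[OF inj_on_subset[OF inj]])
 moreover have "(0, 0) \<in> ?P" using Z by (simp add: G_def Rg_def Mh_def HH_def A7_def B7_def)
 ultimately have "real (lcount (lat u v) Z) + 1 = real (card ?P)"
  using cnt(1) card_Suc_Diff1[of ?P "(0, 0)"] by (metis of_nat_Suc add.commute)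
 then show ?thesis using cnt(2) unfolding Gm X_def[symmetric] s_def[symmetric] by (simp add: algebra_simps)
qed

text \<open>If the main term is small, the lower bound for the form leaves no nonzero lattice point
  in the region and the error is the main term itself; otherwise additive constants are absorbed
  into the power. The result has no additive constant, so it can be summed over infinitely many
  lattices.\<close>

lemma lattice_count:
 fixes \<kappa> :: real
 assumes \<kappa>: "\<kappa> \<ge> 1"
 shows "\<exists>K\<ge>0. \<forall>u v Z \<delta>. ldet u v \<noteq> 0 \<longrightarrow> Z > 0 \<longrightarrow> 0 \<le> \<delta> \<longrightarrow> \<delta> \<le> 1 / 2 \<longrightarrow>
   (\<forall>w \<in> lat u v. w \<noteq> (0, 0) \<longrightarrow> \<bar>of_int (ldet u v)\<bar> \<le> \<kappa> * of_int (Cv w)) \<longrightarrow>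
   \<bar>real (lcount (lat u v) Z) - R7 * (Z powr (1 / 6) / \<bar>of_int (ldet u v)\<bar>)\<bar> \<le>
    K * (Z powr (1 / 6) / \<bar>of_int (ldet u v)\<bar>) powr (1 / 2 + \<delta>)"
proof -
 define x0 where "x0 = 1 / (8 * \<kappa> * Bd)"
 have b: "Bd \<ge> 1" by (rule Bd)
 have kb: "8 * \<kappa> * Bd \<ge> 1" using mult_mono[of 1 \<kappa> 1 Bd] b \<kappa> by simp
 then have "8 * \<kappa> * Bd > 0" by linarith
 with kb have x0: "0 < x0" "x0 \<le> 1"
  unfolding x0_def by (simp_all only: divide_le_eq_1_pos zero_less_divide_1_iff)
 define S where "S = 192 * (6 * sqrt (Bd * \<kappa>)) + 192 * (6 * sqrt (Bd * \<kappa>))"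
 have S0: "S \<ge> 0" using b \<kappa> by (simp add: S_def)
 define K where "K = (97 + S) / x0 + R7"
 have R0: "R7 \<ge> 0" by (simp add: R7_def)
 have K0: "K \<ge> 0" using S0 R0 x0 by (simp add: K_def)
 show ?thesis
 proof (rule exI[of _ K], intro conjI K0 allI impI)
  fix u v Z \<delta>
  assume dd: "ldet u v \<noteq> 0" and Z: "(Z::real) > 0" and \<delta>: "(0::real) \<le> \<delta>" "\<delta> \<le> 1 / 2"
   and C: "\<forall>w \<in> lat u v. w \<noteq> (0, 0) \<longrightarrow> \<bar>of_int (ldet u v)\<bar> \<le> \<kappa> * of_int (Cv w)"
  define D where "D = \<bar>real_of_int (ldet u v)\<bar>"
  have D: "D > 0" using dd by (simp add: D_def)
  define X where "X = Z powr (1 / 6)"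
  have X: "X > 0" using Z by (simp add: X_def)
  define \<xi> where "\<xi> = X / D"
  have xi: "\<xi> > 0" using X D by (simp add: \<xi>_def)
  obtain u' v' where uv': "lat u' v' = lat u v" "\<bar>ldet u' v'\<bar> = \<bar>ldet u v\<bar>" "Cv u' * Cv v' \<le> 9 * (ldet u v) ^ 2"
   by (rule reduced_basis)
  have D': "D = \<bar>of_int (ldet u' v')\<bar>" using uv'(2) unfolding D_def by (metis of_int_abs)
  have l2: "(ldet u v) ^ 2 = (ldet u' v') ^ 2" using uv'(2) by (metis power2_abs)
  have "u' \<in> lat u' v'" unfolding lat_def by (intro image_eqI[of _ _ "(1, 0)"]) auto
  moreover have "v' \<in> lat u' v'" unfolding lat_def by (intro image_eqI[of _ _ "(0, 1)"]) auto
  moreover have "u' \<noteq> (0, 0)" "v' \<noteq> (0, 0)" using D D' by (auto simp: ldet_def)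
  ultimately have Cuv: "D \<le> \<kappa> * of_int (Cv u')" "D \<le> \<kappa> * of_int (Cv v')" using C uv'(1) unfolding D_def by auto
  have main: "\<bar>real (lcount (lat u v) Z) + 1 - R7 * \<xi>\<bar> \<le> 96 + S * sqrt \<xi>"
   using lattice_count_aux[OF \<kappa> D' D Z uv'(3)[unfolded l2] Cuv] unfolding uv'(1) \<xi>_def X_def S_def
   by (simp add: algebra_simps)
  have "\<bar>real (lcount (lat u v) Z) - R7 * \<xi>\<bar> \<le> K * \<xi> powr (1 / 2 + \<delta>)"
  proof (cases "\<xi> < x0")
   case True
   have "{(a, b). (a, b) \<in> lat u v \<and> (a, b) \<noteq> (0, 0) \<and> (of_int a, of_int b) \<in> Rg Z} = {}"
   proof (rule ccontr)
    assume "\<not> ?thesis"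
    then obtain a b where ab: "(a, b) \<in> lat u v" "(a, b) \<noteq> (0, 0)" "(of_int a, of_int b) \<in> Rg Z" by blast
    have "D \<le> \<kappa> * of_int (Cv (a, b))" using C ab(1,2) unfolding D_def by blast
    also have "real_of_int (Cv (a, b)) = Cf (of_int a) (of_int b)" by (simp add: Cf_def)
    also have "\<dots> \<le> 8 * (of_int a ^ 2 + of_int b ^ 2)" by (rule Cf_upper)
    also have "\<dots> \<le> 8 * (Bd * X)" using Bd(2)[of "of_int a" "of_int b" Z] ab(3) Z by (simp add: Rg_def X_def)
    finally have "D \<le> 8 * \<kappa> * Bd * X" using \<kappa> by (simp add: mult_ac)
    then have "x0 \<le> \<xi>" using D kb by (simp add: x0_def \<xi>_def field_simps)
    then show False using True by simp
   qed
   then have "lcount (lat u v) Z = 0" by (simp only: lcount_def card.empty)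
   moreover have "\<xi> \<le> \<xi> powr (1 / 2 + \<delta>)"
    using powr_mono'[of "1 / 2 + \<delta>" 1 \<xi>] xi True x0 \<delta> by simp
   then have "R7 * \<xi> \<le> K * \<xi> powr (1 / 2 + \<delta>)"
    using R0 S0 x0 xi by (intro mult_mono) (auto simp: K_def)
   ultimately show ?thesis using R0 xi by simp
  next
   case False
   then have xx: "x0 \<le> \<xi>" by simp
   have p1: "x0 \<le> \<xi> powr (1 / 2 + \<delta>)"
   proof -
    have "x0 \<le> x0 powr (1 / 2 + \<delta>)" using powr_mono'[of "1 / 2 + \<delta>" 1 x0] x0 \<delta> by simp
    also have "\<dots> \<le> \<xi> powr (1 / 2 + \<delta>)" using xx x0 \<delta> by (intro powr_mono2) auto
    finally show ?thesis .
   qed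
   have p2: "x0 * sqrt \<xi> \<le> \<xi> powr (1 / 2 + \<delta>)"
   proof -
    have "x0 \<le> x0 powr \<delta>" using powr_mono'[of \<delta> 1 x0] x0 \<delta> by simp
    also have "\<dots> \<le> \<xi> powr \<delta>" using xx x0 \<delta> by (intro powr_mono2) auto
    finally have "x0 * \<xi> powr (1 / 2) \<le> \<xi> powr \<delta> * \<xi> powr (1 / 2)" by (intro mult_right_mono) auto
    also have "\<dots> = \<xi> powr (1 / 2 + \<delta>)" by (simp only: powr_add[symmetric] add.commute)
    finally show ?thesis using xi by (simp add: powr_half_sqrt)
   qed
   have "\<bar>real (lcount (lat u v) Z) - R7 * \<xi>\<bar> \<le> 97 + S * sqrt \<xi>" using main by linarith
   also have "\<dots> \<le> 97 * (\<xi> powr (1 / 2 + \<delta>) / x0) + S * (\<xi> powr (1 / 2 + \<delta>) / x0)"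
    using p1 p2 x0 S0 by (intro add_mono mult_left_mono) (auto simp: field_simps)
   also have "\<dots> = (97 + S) / x0 * \<xi> powr (1 / 2 + \<delta>)" by (simp only: add_divide_distrib distrib_right times_divide_eq_right times_divide_eq_left)
   also have "\<dots> \<le> K * \<xi> powr (1 / 2 + \<delta>)" using R0 by (intro mult_right_mono) (auto simp: K_def)
   finally show ?thesis .
  qed
  then show "\<bar>real (lcount (lat u v) Z) - R7 * (Z powr (1 / 6) / \<bar>of_int (ldet u v)\<bar>)\<bar> \<le>
    K * (Z powr (1 / 6) / \<bar>of_int (ldet u v)\<bar>) powr (1 / 2 + \<delta>)"
   unfolding \<xi>_def X_def D_def .
 qed
qed

subsection \<open>Common divisors of the two forms\<close>

text \<open>The product of the constants from the two eliminations in \<open>cube_dvd_Cf\<close>;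
  the factor 72 is 2 times 36.\<close>

definition kap :: int where "kap = 72 * 415065672 ^ 2 * 177885288"

text \<open>The right sides are integers in the ideals generated by the dehomogenised
  \<open>Qf\<close>, \<open>Rf\<close> and by \<open>Cf\<close>, \<open>Rf\<close>; they control the
  common divisors of the values.\<close>

lemma bezout_eqs:
 "pexp_eq (PAdd (PMul (PAdd (PAdd (PAdd (PC 303555) (PMul (PC 121422) PX)) (PMul (PC (- 6776)) (PPow PX 2))) (PMul (PC (- 13)) (PPow PX 3)))
    (PAdd (PSub (PPow PX 2) (PMul (PC 231) PX)) (PC 735)))
   (PMul (PAdd (PC (- 2961)) (PMul (PC 13) PX))
    (PSub (PAdd (PSub (PAdd (PPow PX 4) (PMul (PC 518) (PPow PX 3))) (PMul (PC 11025) (PPow PX 2))) (PMul (PC 6174) PX)) (PC 64827))))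
  (PC 415065672)"
 "pexp_eq (PAdd (PMul (PAdd (PAdd (PAdd (PC 27625563) (PMul (PC (- 20484450)) PX)) (PMul (PC 911232) (PPow PX 2))) (PMul (PC 1763) (PPow PX 3)))
    (PAdd (PAdd (PPow PX 2) PX) (PC 7)))
   (PMul (PAdd (PC 239) (PMul (PC (- 1763)) PX))
    (PSub (PAdd (PSub (PAdd (PPow PX 4) (PMul (PC 518) (PPow PX 3))) (PMul (PC 11025) (PPow PX 2))) (PMul (PC 6174) PX)) (PC 64827))))
  (PC 177885288)"
 by code_simp+

lemma bezout_forms:
 fixes t :: int
 obtains u v u' v' where "u * Qf t 1 + v * Rf t 1 = 415065672" "u' * Cf t 1 + v' * Rf t 1 = 177885288"
proof (rule that)
 show "(303555 + 121422 * t - 6776 * t ^ 2 - 13 * t ^ 3) * Qf t 1 + (- 2961 + 13 * t) * Rf t 1 = 415065672"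
  using pexp_eq[OF bezout_eqs(1), of t t] by (simp add: Qf_def Rf_def)
 show "(27625563 - 20484450 * t + 911232 * t ^ 2 + 1763 * t ^ 3) * Cf t 1 + (239 - 1763 * t) * Rf t 1 = 177885288"
  using pexp_eq[OF bezout_eqs(2), of t t] by (simp add: Cf_def Rf_def)
qed

text \<open>Eliminating between \<open>C Q\<close> and \<open>C R\<close> gives that
  \<open>n ^ 2\<close> divides a multiple of \<open>C\<close>. Its square shows that
  \<open>n ^ 3\<close> divides a multiple of \<open>C ^ 2\<close>, and eliminating between
  \<open>C ^ 2\<close> and \<open>C R\<close> brings this down to a multiple of
  \<open>C\<close>.\<close>

lemma cube_dvd_Cf:
 fixes n t :: int
 assumes "n ^ 2 dvd Af t 1" "n ^ 3 dvd Bf t 1"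
 shows "n ^ 3 dvd kap * Cf t 1"
proof -
 obtain u v u' v' where b: "u * Qf t 1 + v * Rf t 1 = 415065672" "u' * Cf t 1 + v' * Rf t 1 = 177885288"
  by (rule bezout_forms)
 define C Q R where "C = Cf t 1" "Q = Qf t 1" "R = Rf t 1"
 note b = b[folded C_Q_R_def]
 have A: "n ^ 2 dvd 3 * C * Q" and B: "n ^ 3 dvd 2 * C * R" using assms by (simp_all add: Af_def Bf_def C_Q_R_def)
 have "n ^ 2 dvd n ^ 3" by (simp add: le_imp_power_dvd)
 then have B2: "n ^ 2 dvd 2 * C * R" using B by (rule dvd_trans)
 have "6 * 415065672 * C = 2 * u * (3 * C * Q) + 3 * v * (2 * C * R)" unfolding b(1)[symmetric] by (simp add: algebra_simps)
 then have "n ^ 2 dvd 6 * 415065672 * C" using A B2 by (metis dvd_add dvd_mult)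
 then have "(n ^ 2) ^ 2 dvd (6 * 415065672 * C) ^ 2" by (rule dvd_power_same)
 moreover have "n ^ 3 dvd (n ^ 2) ^ 2" by (simp add: le_imp_power_dvd flip: power_mult)
 ultimately have D: "n ^ 3 dvd (6 * 415065672 * C) ^ 2" by (rule dvd_trans[rotated])
 have "kap * C = 2 * u' * (6 * 415065672 * C) ^ 2 + 36 * 415065672 ^ 2 * v' * (2 * C * R)"
  unfolding kap_def b(2)[symmetric] by (simp add: power_mult_distrib power2_eq_square algebra_simps)
 then show ?thesis using D B unfolding C_Q_R_def by (metis dvd_add dvd_mult)
qed

lemma kap_pos: "kap > 0" by (simp add: kap_def)

definition TS :: "nat \<Rightarrow> int set" where
 "TS n = {t. t \<in> {0..<int n ^ 3} \<and> int n ^ 2 dvd Af t 1 \<and> int n ^ 3 dvd Bf t 1}"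

lemma f7_Af: "f7 t = Af t 1" and g7_Bf: "g7 t = Bf t 1"
 by (simp_all only: f7_def g7_def Af_def Bf_def Cf_def Qf_def Rf_def mult_minus_left mult_1_right power_one)

lemma T7_TS: "T7 n = card (TS n)"
 by (simp add: T7_def TS_def f7_Af g7_Bf)

lemma finite_TS [simp]: "finite (TS n)"
 by (rule finite_subset[of _ "{0..<int n ^ 3}"]) (auto simp: TS_def)

text \<open>With \<open>t0\<close> the least element, \<open>c * (t - t0) / m\<close> is an integer
  in \<open>{0..<c}\<close> that determines \<open>t\<close>.\<close>

lemma card_close_residues:
 fixes S :: "int set"
 assumes S: "S \<subseteq> {0..<m}" and m: "m > 0" and c: "c > 0" and d: "\<And>t t'. t \<in> S \<Longrightarrow> t' \<in> S \<Longrightarrow> m dvd c * (t - t')"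
 shows "card S \<le> nat c"
proof (cases "S = {}")
 case False
 have fin: "finite S" using S finite_subset by blast
 define t0 where "t0 = Min S"
 have t0: "t0 \<in> S" "\<And>t. t \<in> S \<Longrightarrow> t0 \<le> t" using Min_in[OF fin False] Min_le[OF fin] by (auto simp: t0_def)
 define h where "h t = c * (t - t0) div m" for t
 have hm: "h t * m = c * (t - t0)" if "t \<in> S" for t using d[OF that t0(1)] by (simp add: h_def)
 have inj: "inj_on h S"
 proof (rule inj_onI)
  fix t t' assume tt: "t \<in> S" "t' \<in> S" "h t = h t'"
  then have "c * (t - t0) = c * (t' - t0)" using hm by metis
  then show "t = t'" using c by simp
 qed
 have "h ` S \<subseteq> {0..<c}"
 proof
  fix y assume "y \<in> h ` S"
  then obtain t where t: "t \<in> S" "y = h t" by blast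
  have "0 \<le> c * (t - t0)" using t0(2)[OF t(1)] c by simp
  then have "0 \<le> h t * m" using hm[OF t(1)] by simp
  moreover have "t - t0 < m" using subsetD[OF S t(1)] subsetD[OF S t0(1)] by simp
  then have "h t * m < c * m" using hm[OF t(1)] c by simp
  ultimately show "y \<in> {0..<c}" using m t(2) by (auto simp: zero_le_mult_iff)
 qed
 then have "card (h ` S) \<le> card {0..<c}" by (intro card_mono) auto
 then show ?thesis using card_image[OF inj] by simp
qed simp

text \<open>The product of \<open>108 * kap ^ 3\<close>, which bounds an overlap of divisors, of
  \<open>kap\<close> from the congruences, and of 2 from the substitution
  \<open>s = 2 t + 1\<close>.\<close>

definition kap2 :: int where "kap2 = 216 * kap ^ 4"

text \<open>Two solutions \<open>s, s\<^sub>0\<close> of \<open>s\<^sup>2 \<equiv> -27\<close> modulo \<open>m\<close> satisfy \<open>m | (s - s\<^sub>0)(s + s\<^sub>0)\<close>, and the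
 divisor \<open>gcd(m, s - s\<^sub>0)\<close> determines \<open>s\<close> up to boundedly many choices.\<close>

lemma T7_bound: assumes n: "n > 0" shows "T7 n \<le> nat kap2 * card {g::nat. g dvd n ^ 3}"
proof (cases "TS n = {}")
 case False
 then obtain t0 where t0: "t0 \<in> TS n" by blast
 define m where "m = int n ^ 3"
 have m: "m > 0" using n by (simp add: m_def)
 \<comment> \<open>Completing the square: four times \<open>t ^ 2 + t + 7\<close> is
   \<open>(2 t + 1) ^ 2 + 27\<close>.\<close>
 define s where "s t = 2 * t + 1" for t :: int
 have mC: "m dvd kap * Cf t 1" if "t \<in> TS n" for t
  using that cube_dvd_Cf[of "int n" t] by (simp add: TS_def m_def)
 have s4: "s t ^ 2 + 27 = 4 * Cf t 1" for t by (simp add: s_def Cf_def power2_eq_square algebra_simps)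
 have ms: "m dvd kap * (s t ^ 2 + 27)" if "t \<in> TS n" for t
  using dvd_mult[OF mC[OF that], of 4] unfolding s4 by (simp only: mult.left_commute)
 define S where "S g = {t \<in> TS n. gcd m (s t - s t0) = g}" for g
 have cS: "card (S g) \<le> nat kap2" for g
 proof (rule card_close_residues[of _ m])
  show "S g \<subseteq> {0..<m}" by (auto simp: S_def TS_def m_def)
  show "kap2 > 0" using kap_pos by (simp add: kap2_def)
  fix t t' assume tt: "t \<in> S g" "t' \<in> S g"
  have g0: "g > 0" using tt(1) m by (auto simp: S_def)
  have "g dvd m" using tt(1) by (auto simp: S_def)
  then obtain m1 where m1: "m = g * m1" by (rule dvdE)
  have half: "g dvd s x - s t0 \<and> m1 dvd kap * (s x + s t0)" if x: "x \<in> S g" for x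
  proof -
   have gx: "gcd m (s x - s t0) = g" and xT: "x \<in> TS n" using x by (auto simp: S_def)
   have "g dvd s x - s t0" using gx gcd_dvd2[of m "s x - s t0"] by simp
   then obtain s1 where s1: "s x - s t0 = g * s1" by (rule dvdE)
   have "gcd (g * m1) (g * s1) = g * 1" using gx m1 s1 by simp
   then have cop: "coprime m1 s1" using g0 unfolding gcd_mult_left by (simp add: coprime_iff_gcd_eq_1)
   have "m dvd kap * (s x ^ 2 + 27) - kap * (s t0 ^ 2 + 27)" using ms[OF xT] ms[OF t0] by (rule dvd_diff)
   also have "kap * (s x ^ 2 + 27) - kap * (s t0 ^ 2 + 27) = g * (s1 * (kap * (s x + s t0)))"
   proof -
    have "kap * (s x ^ 2 + 27) - kap * (s t0 ^ 2 + 27) = kap * (s x + s t0) * (s x - s t0)"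
     by (simp add: power2_eq_square algebra_simps)
    then show ?thesis unfolding s1 by (simp add: mult_ac)
   qed
   finally have "m1 dvd s1 * (kap * (s x + s t0))" using g0 m1 by simp
   then have "m1 dvd kap * (s x + s t0)" using cop by (simp add: coprime_dvd_mult_right_iff)
   then show ?thesis using s1 by simp
  qed
  note ht = half[OF tt(1)] and ht' = half[OF tt(2)]
  \<comment> \<open>\<open>g\<close> and \<open>m1\<close> may share a factor. This factor divides
    \<open>2 * kap * s t0\<close>, and its square divides \<open>m\<close>, hence
    \<open>kap * (s t0 ^ 2 + 27)\<close>; together these bound it by
    \<open>108 * kap ^ 3\<close>.\<close>
  define h where "h = gcd g m1"
  have hh: "h dvd s t - s t0" "h dvd kap * (s t + s t0)"
  proof -
   have "h dvd g" "h dvd m1" by (simp_all add: h_def)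
   then show "h dvd s t - s t0" "h dvd kap * (s t + s t0)" using ht by (auto intro: dvd_trans)
  qed
  then have "h dvd kap * (s t + s t0) - kap * (s t - s t0)" by (intro dvd_diff[OF hh(2) dvd_mult[OF hh(1)]])
  also have "\<dots> = 2 * kap * s t0" by (simp add: algebra_simps)
  finally have "h ^ 2 dvd (2 * kap * s t0) ^ 2" by (rule dvd_power_same)
  then have a: "h ^ 2 dvd kap * (2 * kap * s t0) ^ 2" by (rule dvd_mult)
  have "h ^ 2 dvd m" unfolding m1 h_def power2_eq_square by (intro mult_dvd_mono) auto
  then have b: "h ^ 2 dvd 4 * kap ^ 2 * (kap * (s t0 ^ 2 + 27))" by (rule dvd_mult[OF dvd_trans[OF _ ms[OF t0]]])
  have "h ^ 2 dvd 4 * kap ^ 2 * (kap * (s t0 ^ 2 + 27)) - kap * (2 * kap * s t0) ^ 2" using b a by (rule dvd_diff)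
  also have "\<dots> = 108 * kap ^ 3" by (simp add: power2_eq_square power3_eq_cube algebra_simps)
  finally have "h dvd 108 * kap ^ 3" by (metis dvd_mult_left power2_eq_square)
  then obtain k where k: "108 * kap ^ 3 = h * k" by (rule dvdE)
  have "g dvd (s t - s t0) - (s t' - s t0)" by (rule dvd_diff[OF conjunct1[OF ht] conjunct1[OF ht']])
  then have "g dvd kap * (s t - s t')" by simp
  moreover have "m1 dvd kap * (s t + s t0) - kap * (s t' + s t0)" by (rule dvd_diff[OF conjunct2[OF ht] conjunct2[OF ht']])
  then have "m1 dvd kap * (s t - s t')" by (simp add: algebra_simps)
  ultimately have "lcm g m1 dvd kap * (s t - s t')" by (rule lcm_least)
  then have "h * lcm g m1 dvd h * (kap * (s t - s t'))" by simp
  moreover have "\<bar>h * lcm g m1\<bar> = \<bar>m\<bar>" unfolding h_def m1 by (simp add: abs_mult flip: prod_gcd_lcm_int)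
  ultimately have "m dvd h * (kap * (s t - s t'))" by (metis abs_dvd_iff)
  then have "m dvd k * (h * (kap * (s t - s t')))" by (rule dvd_mult)
  also have "k * (h * (kap * (s t - s t'))) = kap2 * (t - t')"
  proof -
   have "k * (h * (kap * (s t - s t'))) = (h * k) * kap * (s t - s t')" by (simp add: mult_ac)
   also have "\<dots> = kap2 * (t - t')" unfolding k[symmetric] kap2_def s_def by (simp add: eval_nat_numeral algebra_simps)
   finally show ?thesis .
  qed
  finally show "m dvd kap2 * (t - t')" .
 qed (rule m)
 have "TS n \<subseteq> (\<Union>g\<in>{g. g dvd n ^ 3}. S (int g))"
 proof
  fix t assume t: "t \<in> TS n"
  define g where "g = nat (gcd m (s t - s t0))"
  have g: "int g = gcd m (s t - s t0)" by (simp add: g_def)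
  have "int g dvd int (n ^ 3)" unfolding g m_def by simp
  then have "g dvd n ^ 3" by (simp only: int_dvd_int_iff)
  moreover have "t \<in> S (int g)" using t g by (simp add: S_def)
  ultimately show "t \<in> (\<Union>g\<in>{g. g dvd n ^ 3}. S (int g))" by blast
 qed
 moreover have fd: "finite {g. g dvd n ^ 3}" using n by (intro finite_divisors_nat) simp
 ultimately have "card (TS n) \<le> card (\<Union>g\<in>{g. g dvd n ^ 3}. S (int g))"
  by (intro card_mono) (auto simp: S_def)
 also have "\<dots> \<le> (\<Sum>g\<in>{g. g dvd n ^ 3}. card (S (int g)))" by (rule card_UN_le[OF fd])
 also have "\<dots> \<le> (\<Sum>g\<in>{g. g dvd n ^ 3}. nat kap2)" by (intro sum_mono cS)
 finally show ?thesis unfolding T7_TS by (simp add: mult.commute)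
qed (simp add: T7_TS)

subsection \<open>The twist minimality defect\<close>

lemma lcm_power_dvd:
 fixes A :: int and x y :: nat
 assumes "int x ^ k dvd A" "int y ^ k dvd A" "x > 0"
 shows "int (lcm x y) ^ k dvd A"
proof -
 define g where "g = gcd x y"
 have g0: "g > 0" using assms(3) by (simp add: g_def)
 have "g dvd x" "g dvd y" by (simp_all add: g_def)
 then obtain x' y' where xy: "x = g * x'" "y = g * y'" by (elim dvdE) (rule that)
 have "g * gcd x' y' = g * 1" unfolding gcd_mult_distrib_nat xy[symmetric] by (simp add: g_def)
 then have cop: "coprime x' y'" unfolding coprime_iff_gcd_eq_1 by (rule nat_mult_eq_cancel1[OF g0, THEN iffD1])
 have l: "lcm x y = g * x' * y'"
 proof -
  have "g * lcm x y = x * y" by (simp add: g_def)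
  also have "x * y = g * (g * x' * y')" by (subst xy(1), subst xy(2)) (simp only: mult_ac)
  finally show ?thesis using g0 by simp
 qed
 have "int g ^ k dvd A" using assms(1) unfolding xy(1) by (simp add: power_mult_distrib dvd_mult_left)
 then obtain B where B: "A = int g ^ k * B" by (rule dvdE)
 have "int x' ^ k dvd B" "int y' ^ k dvd B" using assms(1,2) g0 unfolding xy B by (simp_all add: power_mult_distrib)
 moreover have "coprime (int x' ^ k) (int y' ^ k)" using cop by simp
 ultimately have "int x' ^ k * int y' ^ k dvd B" by (simp add: divides_mult)
 then show ?thesis unfolding B l by (simp add: power_mult_distrib mult.assoc)
qed

lemma tmd_set:
 assumes "A \<noteq> 0 \<or> B \<noteq> 0"
 shows "finite {e. e > 0 \<and> int e ^ 2 dvd A \<and> int e ^ 3 dvd B}"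
  "tmd A B > 0" "int (tmd A B) ^ 2 dvd A" "int (tmd A B) ^ 3 dvd B"
proof -
 let ?S = "{e. e > 0 \<and> int e ^ 2 dvd A \<and> int e ^ 3 dvd B}"
 have "e \<le> nat (\<bar>A\<bar> + \<bar>B\<bar>)" if "e \<in> ?S" for e
 proof -
  have e: "e > 0" "int e ^ 2 dvd A" "int e ^ 3 dvd B" using that by auto
  have "int e \<le> \<bar>A\<bar> \<or> int e \<le> \<bar>B\<bar>"
  proof (cases "A = 0")
   case True
   then have "int e ^ 3 \<le> \<bar>B\<bar>" using e assms by (intro zdvd_imp_le) auto
   moreover have "int e \<le> int e ^ 3" using e by (intro self_le_power) auto
   ultimately show ?thesis by linarith
  next
   case False
   then have "int e ^ 2 \<le> \<bar>A\<bar>" using e by (intro zdvd_imp_le) auto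
   moreover have "int e \<le> int e ^ 2" using e by (intro self_le_power) auto
   ultimately show ?thesis by linarith
  qed
  then show ?thesis by linarith
 qed
 then show fin: "finite ?S" by (meson finite_nat_set_iff_bounded_le)
 have "1 \<in> ?S" by simp
 then have "?S \<noteq> {}" by blast
 then have "tmd A B \<in> ?S" unfolding tmd_def by (rule Max_in[OF fin])
 then show "tmd A B > 0" "int (tmd A B) ^ 2 dvd A" "int (tmd A B) ^ 3 dvd B" by auto
qed

lemma dvd_tmd_iff:
 assumes nz: "A \<noteq> 0 \<or> B \<noteq> 0" and n: "n > 0"
 shows "n dvd tmd A B \<longleftrightarrow> int n ^ 2 dvd A \<and> int n ^ 3 dvd B"
proof
 assume "n dvd tmd A B"
 then have "int n dvd int (tmd A B)" by simp
 then have "int n ^ k dvd int (tmd A B) ^ k" for k by (rule dvd_power_same)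
 then show "int n ^ 2 dvd A \<and> int n ^ 3 dvd B" using tmd_set[OF nz] by (meson dvd_trans)
next
 assume h: "int n ^ 2 dvd A \<and> int n ^ 3 dvd B"
 let ?l = "lcm n (tmd A B)"
 have "?l \<in> {e. e > 0 \<and> int e ^ 2 dvd A \<and> int e ^ 3 dvd B}"
  using lcm_power_dvd[of n 2 A "tmd A B"] lcm_power_dvd[of n 3 B "tmd A B"] h n tmd_set[OF nz] by (simp add: lcm_pos_nat)
 then have "?l \<le> tmd A B" unfolding tmd_def using tmd_set(1)[OF nz] by (intro Max_ge) auto
 moreover have "tmd A B dvd ?l" by simp
 ultimately have "?l = tmd A B" using tmd_set(2)[OF nz] n by (metis dvd_imp_le lcm_pos_nat le_antisym)
 then show "n dvd tmd A B" by (metis dvd_lcm1)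
qed

lemma AB_not_both_zero:
 fixes a b :: int
 assumes "(a, b) \<noteq> (0, 0)" shows "Af a b \<noteq> 0 \<or> Bf a b \<noteq> 0"
proof (rule ccontr)
 assume "\<not> ?thesis"
 then have "Af a b = 0" "Bf a b = 0" by auto
 moreover have "Af (real_of_int a) (real_of_int b) = of_int (Af a b)" "Bf (real_of_int a) (real_of_int b) = of_int (Bf a b)"
  by (simp_all add: Af_def Bf_def Cf_def Qf_def Rf_def)
 ultimately have "Mh a b = 0" by (simp add: Mh_def HH_def A7_Af B7_Bf)
 then show False using Mh_zero[of a b] assms by simp
qed

lemma dvd_forms_cong:
 fixes m a t b :: int
 assumes "m dvd a - t * b"
 shows "m dvd Af a b - b ^ 4 * Af t 1" "m dvd Bf a b - b ^ 6 * Bf t 1" "m dvd Cf a b - b ^ 2 * Cf t 1"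
proof -
 have c: "[a = t * b] (mod m)" using assms by (simp add: cong_iff_dvd_diff)
 have C: "[Cf a b = Cf (t * b) b] (mod m)" and Q: "[Qf a b = Qf (t * b) b] (mod m)" and R: "[Rf a b = Rf (t * b) b] (mod m)"
  unfolding Cf_def Qf_def Rf_def by (intro cong_add cong_diff cong_mult cong_pow cong_refl c)+
 have A: "[Af a b = Af (t * b) b] (mod m)" and B: "[Bf a b = Bf (t * b) b] (mod m)"
  unfolding Af_def Bf_def minus_mult_left by (intro cong_mult cong_refl C Q R cong_minus_minus_iff[THEN iffD2])+
 have e: "Af (t * b) b = b ^ 4 * Af t 1" "Bf (t * b) b = b ^ 6 * Bf t 1" "Cf (t * b) b = b ^ 2 * Cf t 1"
  by (simp_all add: Af_def Bf_def Cf_def Qf_def Rf_def algebra_simps power_mult_distrib eval_nat_numeral)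
 show "m dvd Af a b - b ^ 4 * Af t 1" "m dvd Bf a b - b ^ 6 * Bf t 1" "m dvd Cf a b - b ^ 2 * Cf t 1"
  using A B C unfolding e cong_iff_dvd_diff by auto
qed

text \<open>A common divisor of \<open>b\<close> and \<open>n\<close> divides both values, which are
  \<open>- 3 a ^ 4\<close> and \<open>2 a ^ 6\<close> modulo \<open>b\<close>, hence it divides
  \<open>a ^ 6\<close> and is a unit. So \<open>b\<close> is invertible and \<open>a / b\<close> is
  the only candidate residue modulo \<open>n ^ 3\<close>.\<close>

lemma tmd_residues:
 fixes a b :: int
 assumes cop: "coprime a b" and n: "n > 0"
 shows "card {t \<in> TS n. int n ^ 3 dvd a - t * b} = of_bool (n dvd tmd (Af a b) (Bf a b))"
proof -
 define m where "m = int n ^ 3"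
 have m: "m > 0" using n by (simp add: m_def)
 have "(a, b) \<noteq> (0, 0)" using cop by auto
 note tm = dvd_tmd_iff[OF AB_not_both_zero[OF this] n]
 have n2: "int n ^ 2 dvd m" unfolding m_def by (simp add: le_imp_power_dvd)
 have nm: "int n dvd m" unfolding m_def by simp
 have bm: "coprime b m" if "coprime b (int n)" using that by (simp add: m_def)
 have from_t: "int n ^ 2 dvd Af a b \<and> int n ^ 3 dvd Bf a b" if t: "t \<in> TS n" "m dvd a - t * b" for t
 proof -
  note fc = dvd_forms_cong[OF t(2)]
  have tT: "int n ^ 2 dvd Af t 1" "m dvd Bf t 1" using t(1) by (simp_all add: TS_def m_def)
  have "int n ^ 2 dvd (Af a b - b ^ 4 * Af t 1) + b ^ 4 * Af t 1" "m dvd (Bf a b - b ^ 6 * Bf t 1) + b ^ 6 * Bf t 1"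
   by (rule dvd_add[OF dvd_trans[OF n2 fc(1)] dvd_mult[OF tT(1)]], rule dvd_add[OF fc(2) dvd_mult[OF tT(2)]])
  then show ?thesis by (simp add: m_def)
 qed
 have cop_t: "coprime b (int n)" if "m dvd a - t * b" for t
 proof (rule coprimeI)
  fix c assume c: "c dvd b" "c dvd int n"
  have "c dvd (a - t * b) + t * b"
   using dvd_add[OF dvd_trans[OF dvd_trans[OF c(2) nm] that] dvd_mult[OF c(1), of t]] .
  then have "c dvd a" by simp
  then show "is_unit c" by (rule coprime_common_divisor[OF cop _ c(1)])
 qed
 have uniq: "t = t'" if "t \<in> TS n" "t' \<in> TS n" "m dvd a - t * b" "m dvd a - t' * b" for t t'
 proof -
  have "m dvd (a - t' * b) - (a - t * b)" by (rule dvd_diff[OF that(4) that(3)])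
  also have "(a - t' * b) - (a - t * b) = (t - t') * b" by (simp add: algebra_simps)
  finally have "m dvd t - t'"
   by (rule coprime_dvd_mult_left_iff[OF bm[OF cop_t[OF that(3)], THEN coprime_commute[THEN iffD1]], THEN iffD1])
  moreover have "\<bar>t - t'\<bar> < m" using that(1,2) by (auto simp: TS_def m_def)
  ultimately show ?thesis using dvd_imp_le_int[of "t - t'" m] m by force
 qed
 show ?thesis
 proof (cases "n dvd tmd (Af a b) (Bf a b)")
  case False
  then have "{t \<in> TS n. m dvd a - t * b} = {}" using from_t tm by blast
  then show ?thesis using False unfolding m_def by simp
 next
  case True
  then have h: "int n ^ 2 dvd Af a b" "int n ^ 3 dvd Bf a b" using tm by auto
  have cb: "coprime b (int n)"
  proof -
   define g where "g = gcd b (int n)"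
   have gb: "g dvd b" and gn: "g dvd int n" by (simp_all add: g_def)
   have gA: "g dvd Af a b" and gB: "g dvd Bf a b"

    by (rule dvd_trans[OF dvd_trans[OF gn] h(1)], simp, rule dvd_trans[OF dvd_trans[OF gn] h(2)], simp)
   have bA: "b dvd Af a b + 3 * a ^ 4" and bB: "b dvd Bf a b - 2 * a ^ 6"
   proof -
    have "Af a b + 3 * a ^ 4 = b * (- 3 * (- 230 * a ^ 3 + 511 * a ^ 2 * b - 882 * a * b ^ 2 + 5145 * b ^ 3))"
     by (simp add: Af_def Cf_def Qf_def eval_nat_numeral algebra_simps)
    then show "b dvd Af a b + 3 * a ^ 4" by simp
    have "[Cf a b = a ^ 2] (mod b)" "[Rf a b = a ^ 4] (mod b)"
     by (simp_all add: cong_iff_dvd_diff Cf_def Rf_def power2_eq_square eval_nat_numeral)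
    then have "[2 * Cf a b * Rf a b = 2 * a ^ 2 * a ^ 4] (mod b)" by (intro cong_mult cong_refl)
    then show "b dvd Bf a b - 2 * a ^ 6" by (simp add: Bf_def cong_iff_dvd_diff eval_nat_numeral mult_ac)
   qed
   have "g dvd (Af a b + 3 * a ^ 4) - Af a b" "g dvd Bf a b - (Bf a b - 2 * a ^ 6)"
    by (rule dvd_diff[OF dvd_trans[OF gb bA] gA], rule dvd_diff[OF gB dvd_trans[OF gb bB]])
   then have g3: "g dvd 3 * a ^ 4" and g2: "g dvd 2 * a ^ 6" by simp_all
   have "g dvd a ^ 2 * (3 * a ^ 4) - 2 * a ^ 6" by (rule dvd_diff[OF dvd_mult[OF g3] g2])
   also have "\<dots> = a ^ 6" by (simp add: eval_nat_numeral)
   finally have "g dvd a ^ 6" .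
   moreover have "coprime g (a ^ 6)" using cop gb coprime_divisors[OF dvd_refl gb, of a] by (simp add: coprime_commute)
   ultimately have "is_unit g" by (metis coprime_absorb_left)
   then show ?thesis unfolding g_def by (simp add: coprime_iff_gcd_eq_1 is_unit_gcd)
  qed
  obtain b' where b': "[b * b' = 1] (mod m)" using cong_solve_coprime_int[OF bm[OF cb]] by blast
  define t where "t = (a * b') mod m"
  have tm': "[t = a * b'] (mod m)" by (simp add: t_def)
  have "[t * b = a * b' * b] (mod m)" using tm' by (rule cong_mult) simp
  also have "a * b' * b = a * (b * b')" by (simp add: mult_ac)
  also have "[a * (b * b') = a * 1] (mod m)" using b' by (intro cong_mult cong_refl)
  finally have "[a = t * b] (mod m)" by (simp add: cong_sym)
  then have td: "m dvd a - t * b" by (simp add: cong_iff_dvd_diff)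
  have tT: "t \<in> TS n"
  proof -
   note fc = dvd_forms_cong[OF td]
   have "int n ^ 2 dvd Af a b - (Af a b - b ^ 4 * Af t 1)" "m dvd Bf a b - (Bf a b - b ^ 6 * Bf t 1)"
    by (rule dvd_diff[OF h(1) dvd_trans[OF n2 fc(1)]], rule dvd_diff[OF h(2)[folded m_def] fc(2)])
   then have "int n ^ 2 dvd b ^ 4 * Af t 1" "m dvd b ^ 6 * Bf t 1" by simp_all
   moreover have "coprime (int n ^ 2) (b ^ 4)" "coprime m (b ^ 6)" using cb by (simp_all add: m_def coprime_commute)
   ultimately have "int n ^ 2 dvd Af t 1" "m dvd Bf t 1" by (simp_all add: coprime_dvd_mult_right_iff)
   then show ?thesis using m by (simp add: TS_def t_def m_def)
  qed
  have "{t \<in> TS n. m dvd a - t * b} = {t}"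
  proof (intro equalityI subsetI)
   fix x assume "x \<in> {t \<in> TS n. m dvd a - t * b}"
   then show "x \<in> {t}" using uniq[of x t] tT td by simp
  qed (use tT td in simp)
  then show ?thesis using True unfolding m_def by simp
 qed
qed

subsection \<open>The sublattices\<close>

definition Lt :: "int \<Rightarrow> nat \<Rightarrow> nat \<Rightarrow> (int \<times> int) set" where
 "Lt t n d = {(a, b). int d dvd a \<and> int d dvd b \<and> int n ^ 3 dvd a - t * b}"

text \<open>After division of \<open>a\<close> and \<open>b\<close> by \<open>d\<close>, the
  congruence modulo \<open>n ^ 3\<close> becomes one modulo \<open>m\<close>, whence the determinant
  \<open>d ^ 2 * m\<close>. For the last claim \<open>m\<close> divides \<open>kap * Cf\<close> at
  the divided vector, which is positive, so it is at most that value.\<close>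

lemma Lt_lat:
 assumes n: "n > 0" and d: "d > 0"
 defines "m \<equiv> n ^ 3 div gcd (n ^ 3) d"
 shows "Lt t n d = lat (int (d * m), 0) (int d * t, int d)" "m > 0"
  "ldet (int (d * m), 0) (int d * t, int d) = int (d ^ 2 * m)"
  "\<And>w. w \<in> Lt t n d \<Longrightarrow> t \<in> TS n \<Longrightarrow> w \<noteq> (0, 0) \<Longrightarrow> int (d ^ 2 * m) \<le> kap * Cv w"
proof -
 define g where "g = gcd (n ^ 3) d"
 have g0: "g > 0" using d by (simp add: g_def)
 have mg: "n ^ 3 = g * m" by (simp add: m_def g_def)
 obtain d1 where d1: "d = g * d1" using g_def by (metis dvdE gcd_dvd2)
 show m0: "m > 0" using mg n by (metis gr0I mult_0_right power_eq_0_iff less_not_refl)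
 have "g * gcd m d1 = g * 1" unfolding gcd_mult_distrib_nat mg[symmetric] d1[symmetric] by (simp add: g_def)
 then have "coprime m d1" unfolding coprime_iff_gcd_eq_1 by (rule nat_mult_eq_cancel1[OF g0, THEN iffD1])
 then have cop: "coprime (int m) (int d1)" by simp
 have cond: "int n ^ 3 dvd int d * y \<longleftrightarrow> int m dvd y" for y
 proof -
  have "int n ^ 3 = int g * int m" using mg by (metis of_nat_mult of_nat_power)
  then have "int n ^ 3 dvd int d * y \<longleftrightarrow> int g * int m dvd int g * (int d1 * y)" using d1 by (simp add: mult.assoc)
  also have "\<dots> \<longleftrightarrow> int m dvd int d1 * y" using g0 by simp
  also have "\<dots> \<longleftrightarrow> int m dvd y" using cop by (simp add: coprime_dvd_mult_right_iff)
  finally show ?thesis .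
 qed
 have L: "(a, b) \<in> Lt t n d \<longleftrightarrow> (\<exists>a' b'. a = int d * a' \<and> b = int d * b' \<and> int m dvd a' - t * b')" for a b
 proof
  assume "(a, b) \<in> Lt t n d"
  then have h: "int d dvd a" "int d dvd b" "int n ^ 3 dvd a - t * b" by (auto simp: Lt_def)
  obtain a' b' where ab: "a = int d * a'" "b = int d * b'" using h by (auto elim!: dvdE)
  have "a - t * b = int d * (a' - t * b')" unfolding ab by (simp add: algebra_simps)
  then show "\<exists>a' b'. a = int d * a' \<and> b = int d * b' \<and> int m dvd a' - t * b'" using h(3) cond ab by auto
 next
  assume "\<exists>a' b'. a = int d * a' \<and> b = int d * b' \<and> int m dvd a' - t * b'"
  then obtain a' b' where ab: "a = int d * a'" "b = int d * b'" "int m dvd a' - t * b'" by blast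
  have "a - t * b = int d * (a' - t * b')" unfolding ab by (simp add: algebra_simps)
  then show "(a, b) \<in> Lt t n d" using ab cond by (simp add: Lt_def)
 qed
 show "Lt t n d = lat (int (d * m), 0) (int d * t, int d)"
 proof (intro equalityI subsetI)
  fix w assume w: "w \<in> Lt t n d"
  obtain a b where ab: "w = (a, b)" by fastforce
  obtain a' b' where *: "a = int d * a'" "b = int d * b'" "int m dvd a' - t * b'" using w L unfolding ab by blast
  obtain x where x: "a' - t * b' = int m * x" using *(3) by (rule dvdE)
  then have "a' = int m * x + t * b'" by simp
  then have "w = (x * int (d * m) + b' * (int d * t), x * 0 + b' * int d)" using * ab by (simp add: algebra_simps)
  then show "w \<in> lat (int (d * m), 0) (int d * t, int d)" unfolding lat_def by (intro image_eqI[of _ _ "(x, b')"]) auto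
 next
  fix w assume "w \<in> lat (int (d * m), 0) (int d * t, int d)"
  then obtain x y where w: "w = (x * int (d * m) + y * (int d * t), y * int d)" by (auto simp: lat_def)
  have "x * int (d * m) + y * (int d * t) = int d * (int m * x + t * y)" by (simp add: algebra_simps)
  moreover have "y * int d = int d * y" by simp
  moreover have "int m dvd (int m * x + t * y) - t * y" by simp
  ultimately show "w \<in> Lt t n d" unfolding w L by blast
 qed
 show "ldet (int (d * m), 0) (int d * t, int d) = int (d ^ 2 * m)" by (simp add: ldet_def power2_eq_square)
 show "int (d ^ 2 * m) \<le> kap * Cv w" if w: "w \<in> Lt t n d" and t: "t \<in> TS n" and nz: "w \<noteq> (0, 0)" for w
 proof -
  obtain a b where ab: "w = (a, b)" by fastforce
  obtain a' b' where *: "a = int d * a'" "b = int d * b'" "int m dvd a' - t * b'" using w L unfolding ab by blast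
  have "int n ^ 3 dvd kap * Cf t 1" by (rule cube_dvd_Cf) (use t in \<open>simp_all add: TS_def\<close>)
  moreover have "m dvd n ^ 3" unfolding mg by simp
  then have "int m dvd int n ^ 3" using int_dvd_int_iff[of m "n ^ 3"] by simp
  ultimately have "int m dvd kap * Cf t 1" by (rule dvd_trans[rotated])
  then have "int m dvd b' ^ 2 * (kap * Cf t 1)" by (rule dvd_mult)
  moreover have "int m dvd kap * (Cf a' b' - b' ^ 2 * Cf t 1)" using dvd_forms_cong(3)[OF *(3)] by (rule dvd_mult)
  ultimately have "int m dvd kap * (Cf a' b' - b' ^ 2 * Cf t 1) + b' ^ 2 * (kap * Cf t 1)" by (rule dvd_add[rotated])
  also have "kap * (Cf a' b' - b' ^ 2 * Cf t 1) + b' ^ 2 * (kap * Cf t 1) = kap * Cf a' b'" by (simp add: algebra_simps)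
  finally have "int m dvd kap * Cf a' b'" .
  moreover have "Cf a' b' > 0"
  proof -
   have "Cf a' b' \<ge> 0" using Cv_nonneg[of "(a', b')"] by simp
   moreover have "Cf a' b' \<noteq> 0"
   proof
    assume "Cf a' b' = 0"
    moreover have "Cf (real_of_int a') (real_of_int b') = of_int (Cf a' b')" by (simp add: Cf_def)
    ultimately have "Cf (real_of_int a') (real_of_int b') = 0" by simp
    then have "a' = 0 \<and> b' = 0" using Cf_zero[of "real_of_int a'" "real_of_int b'"] by simp
    then show False using nz * ab by simp
   qed
   ultimately show ?thesis by simp
  qed
  ultimately have "int m \<le> kap * Cf a' b'" using kap_pos by (intro zdvd_imp_le) auto
  then have "int d ^ 2 * int m \<le> int d ^ 2 * (kap * Cf a' b')" by (intro mult_left_mono) auto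
  moreover have "Cv w = int d ^ 2 * Cf a' b'" unfolding ab * by (simp add: Cf_def power2_eq_square algebra_simps)
  ultimately show ?thesis by (simp add: mult_ac)
 qed
qed

text \<open>Only squarefree \<open>d\<close> carry a nonzero Moebius weight, and for them the
  determinant can be written with \<open>gcd n d\<close>.\<close>

lemma gcd_cube_squarefree:
 fixes n d :: nat
 assumes "squarefree d"
 shows "gcd (n ^ 3) d = gcd n d"
proof (cases "n = 0")
 case False
 show ?thesis
 proof (rule dvd_antisym)
  have d0: "d \<noteq> 0" using assms by (metis not_squarefree_0)
  show "gcd (n ^ 3) d dvd gcd n d"
  proof (rule gcd_greatest)
   show "gcd (n ^ 3) d dvd n"
   proof (rule multiplicity_le_imp_dvd)
    fix p :: nat assume p: "prime p"
    have "multiplicity p (gcd (n ^ 3) d) \<le> multiplicity p d"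
     using d0 by (intro dvd_imp_multiplicity_le) auto
    also have "\<dots> \<le> 1" using assms p by (metis squarefree_factorial_semiring'' d0 not_prime_unit)
    finally have 1: "multiplicity p (gcd (n ^ 3) d) \<le> 1" .
    show "multiplicity p (gcd (n ^ 3) d) \<le> multiplicity p n"
    proof (cases "p dvd gcd (n ^ 3) d")
     case True
     then have "p dvd n ^ 3" by (meson dvd_trans gcd_dvd1)
     then have "p dvd n" by (rule prime_dvd_power[OF p])
     then have "multiplicity p n \<ge> 1" using False p by (metis One_nat_def Suc_leI multiplicity_gt_zero_iff prime_gt_1_nat nat_neq_iff not_prime_unit)
     then show ?thesis using 1 by simp
    qed (simp add: not_dvd_imp_multiplicity_0)
   qed (use False d0 in auto)
  qed simp
  show "gcd n d dvd gcd (n ^ 3) d" by (intro gcd_greatest) (auto intro: dvd_trans[OF gcd_dvd1] simp: dvd_power)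
 qed
qed simp

subsection \<open>The Moebius function\<close>

definition mu :: "nat \<Rightarrow> int" where
 "mu n = (if squarefree n then (- 1) ^ card (prime_factors n) else 0)"

lemma mu_1 [simp]: "mu (Suc 0) = 1" by (simp add: mu_def)

lemma mu_abs: "\<bar>mu n\<bar> \<le> 1" by (simp add: mu_def power_abs)

lemma mu_prime_mult:
 assumes p: "prime p" and d: "\<not> p dvd d"
 shows "mu (p * d) = - mu d"
proof -
 have c: "coprime p d" using p d by (simp add: prime_imp_coprime)
 have d0: "d \<noteq> 0" using d by (metis dvd_0_right)
 have "squarefree p" using p by (rule squarefree_prime)
 then have "squarefree (p * d) \<longleftrightarrow> squarefree d"
  using c by (metis squarefree_mult_coprime squarefree_multD(2))
 moreover have "prime_factors (p * d) = insert p (prime_factors d)"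
  using p d0 by (simp add: prime_factors_product prime_prime_factors)
 moreover have "card (insert p (prime_factors d)) = Suc (card (prime_factors d))"
  using d by (subst card_insert_disjoint) auto
 ultimately show ?thesis by (simp add: mu_def)
qed

lemma mu_prime_square:
 assumes p: "prime p" and d: "p dvd d"
 shows "mu (p * d) = 0"
proof -
 have "p ^ 2 dvd p * d" using d by (simp add: power2_eq_square)
 then have "\<not> squarefree (p * d)" using p by (metis not_prime_unit squarefreeD)
 then show ?thesis by (simp add: mu_def)
qed

text \<open>For a prime \<open>p\<close> dividing \<open>n\<close>, each divisor prime to
  \<open>p\<close> cancels against its multiple by \<open>p\<close>, and the multiples by higher
  powers have weight zero.\<close>

lemma sum_mu_divisors:
 assumes n: "n > 0"
 shows "(\<Sum>d | d dvd n. mu d) = of_bool (n = 1)"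
proof (cases "n = 1")
 case False
 then obtain p where p: "prime p" "p dvd n" by (metis prime_factor_nat)
 have fin: "finite {d. d dvd n}" using n by simp
 define A where "A = {d. d dvd n \<and> \<not> p dvd d}"
 define B where "B = {d. d dvd n \<and> p dvd d}"
 have p0: "p > 0" using p by (simp add: prime_gt_0_nat)
 have "(\<Sum>d\<in>B. mu d) = (\<Sum>d\<in>{d. p * d dvd n}. mu (p * d))"
  using p0 by (intro sum.reindex_bij_witness[where i = "\<lambda>d. p * d" and j = "\<lambda>d. d div p"]) (auto simp: B_def)
 also have "\<dots> = (\<Sum>d\<in>A. mu (p * d))"
 proof (rule sum.mono_neutral_right)
  show "finite {d. p * d dvd n}" by (rule finite_subset[OF _ fin]) (auto intro: dvd_mult_right)
  show "A \<subseteq> {d. p * d dvd n}" using p by (auto simp: A_def intro!: divides_mult prime_imp_coprime)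
  show "\<forall>d\<in>{d. p * d dvd n} - A. mu (p * d) = 0"
   using p(1) by (auto simp: A_def intro!: mu_prime_square intro: dvd_mult_right)
 qed
 also have "\<dots> = - (\<Sum>d\<in>A. mu d)" using p(1) by (simp add: A_def mu_prime_mult sum_negf)
 finally have B: "(\<Sum>d\<in>B. mu d) = - (\<Sum>d\<in>A. mu d)" .
 have "{d. d dvd n} = A \<union> B" "A \<inter> B = {}" by (auto simp: A_def B_def)
 moreover have "finite A" "finite B" using fin by (auto simp: A_def B_def)
 ultimately have "(\<Sum>d | d dvd n. mu d) = (\<Sum>d\<in>A. mu d) + (\<Sum>d\<in>B. mu d)" by (simp add: sum.union_disjoint)
 then show ?thesis using B False by simp
qed simp

lemma card_multiples:
 assumes "d > 0"
 shows "card {k \<in> {0<..n}. d dvd k} = n div (d :: nat)"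
proof -
 have "card {k \<in> {0<..n}. d dvd k} = card {0<..n div d}"
 proof (rule bij_betw_same_card[of "\<lambda>k. k div d"], rule bij_betwI[where g = "\<lambda>j. d * j"])
  show "(\<lambda>k. k div d) \<in> {k \<in> {0<..n}. d dvd k} \<rightarrow> {0<..n div d}"
   using assms by (auto simp: less_eq_div_iff_mult_less_eq mult.commute elim!: dvdE)
  show "(\<lambda>j. d * j) \<in> {0<..n div d} \<rightarrow> {k \<in> {0<..n}. d dvd k}"
   using assms by (auto simp: less_eq_div_iff_mult_less_eq mult.commute)
 qed (use assms in auto)
 then show ?thesis by simp
qed

lemma sum_of_bool_filter:
 assumes "finite A"
 shows "(\<Sum>k\<in>A. of_bool (P k)) = (of_nat (card {k \<in> A. P k}) :: 'a :: semiring_1)"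
 unfolding of_bool_def using assms by (subst sum.inter_filter[symmetric]) auto

text \<open>Serves to recognise the totient of \<open>Q7\<close> in the sum over \<open>f\<close>
  with \<open>n = k * f\<close>.\<close>

lemma totient_mu:
 assumes n: "n > 0"
 shows "int (totient n) = (\<Sum>d | d dvd n. mu d * int (n div d))"
proof -
 have "int (totient n) = (\<Sum>k\<in>{0<..n}. of_bool (coprime k n))"
  unfolding totient_def totatives_def by (subst sum_of_bool_filter) simp_all
 also have "\<dots> = (\<Sum>k\<in>{0<..n}. \<Sum>d | d dvd gcd k n. mu d)"
 proof (rule sum.cong)
  fix k assume "k \<in> {0<..n}"
  then have "gcd k n > 0" by simp
  then show "of_bool (coprime k n) = (\<Sum>d | d dvd gcd k n. mu d)"
   by (simp only: sum_mu_divisors coprime_iff_gcd_eq_1)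
 qed simp
 also have "\<dots> = (\<Sum>k\<in>{0<..n}. \<Sum>d | d dvd n. mu d * of_bool (d dvd k))"
  using n by (intro sum.cong refl sum.mono_neutral_cong_left) auto
 also have "\<dots> = (\<Sum>d | d dvd n. \<Sum>k\<in>{0<..n}. mu d * of_bool (d dvd k))" by (rule sum.swap)
 also have "\<dots> = (\<Sum>d | d dvd n. mu d * int (n div d))"
 proof (rule sum.cong)
  fix d assume "d \<in> {d. d dvd n}"
  then have d: "d > 0" using n by (auto intro: Nat.gr0I)
  have "(\<Sum>k\<in>{0<..n}. mu d * of_bool (d dvd k)) = mu d * (\<Sum>k\<in>{0<..n}. of_bool (d dvd k))"
   by (simp add: sum_distrib_left)
  also have "(\<Sum>k\<in>{0<..n}. of_bool (d dvd k)) = int (card {k \<in> {0<..n}. d dvd k})"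
   by (rule sum_of_bool_filter) simp
  finally show "(\<Sum>k\<in>{0<..n}. mu d * of_bool (d dvd k)) = mu d * int (n div d)"
   by (simp only: card_multiples[OF d])
 qed simp
 finally show ?thesis .
qed

subsection \<open>Divisor sums\<close>

text \<open>Comparison with the integral of the power function, as a telescoping sum; each step
  rests on \<open>1 + x \<le> exp x\<close>.\<close>

lemma zeta_partial:
 fixes \<sigma> :: real
 assumes s: "\<sigma> > 1"
 shows "(\<Sum>m=1..Y. real m powr - \<sigma>) \<le> 1 + 1 / (\<sigma> - 1)"
proof -
 have step: "real (Suc m) powr - \<sigma> \<le> (real m powr (1 - \<sigma>) - real (Suc m) powr (1 - \<sigma>)) / (\<sigma> - 1)" if m: "m \<ge> 1" for m
 proof -
  define x where "x = 1 / real (Suc m)"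
  have x: "0 < x" "x < 1" using m by (auto simp: x_def)
  have "1 + (\<sigma> - 1) * x \<le> exp ((\<sigma> - 1) * x)" by (rule exp_ge_add_one_self)
  also have "\<dots> \<le> exp ((1 - \<sigma>) * ln (1 - x))"
  proof -
   have "ln (1 - x) \<le> - x" using ln_add_one_self_le_self2[of "- x"] x by simp
   then have "(\<sigma> - 1) * ln (1 - x) \<le> (\<sigma> - 1) * - x" using s by (intro mult_left_mono) auto
   then show ?thesis by (simp add: algebra_simps)
  qed
  also have "\<dots> = (1 - x) powr (1 - \<sigma>)" using x by (simp add: powr_def)
  finally have b: "1 + (\<sigma> - 1) * x \<le> (1 - x) powr (1 - \<sigma>)" .
  have "real m = real (Suc m) * (1 - x)" using m by (simp add: x_def field_simps)
  then have "real m powr (1 - \<sigma>) = real (Suc m) powr (1 - \<sigma>) * (1 - x) powr (1 - \<sigma>)"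
   using x by (simp add: powr_mult del: of_nat_Suc)
  also have "\<dots> \<ge> real (Suc m) powr (1 - \<sigma>) * (1 + (\<sigma> - 1) * x)"
   using b by (intro mult_left_mono) auto
  finally have "real m powr (1 - \<sigma>) - real (Suc m) powr (1 - \<sigma>) \<ge> (\<sigma> - 1) * (real (Suc m) powr (1 - \<sigma>) * x)"
   by (simp add: algebra_simps)
  also have "real (Suc m) powr (1 - \<sigma>) * x = real (Suc m) powr - \<sigma>"
   using powr_add[of "real (Suc m)" "1" "- \<sigma>"] by (simp add: x_def field_simps del: of_nat_Suc)
  finally show ?thesis using s by (simp add: field_simps)
 qed
 have "(\<Sum>m=1..Suc Y. real m powr - \<sigma>) \<le> 1 + (1 - real (Suc Y) powr (1 - \<sigma>)) / (\<sigma> - 1)" for Y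
 proof (induction Y)
  case (Suc Y)
  have "(\<Sum>m=1..Suc (Suc Y). real m powr - \<sigma>) = (\<Sum>m=1..Suc Y. real m powr - \<sigma>) + real (Suc (Suc Y)) powr - \<sigma>" by simp
  also have "\<dots> \<le> 1 + (1 - real (Suc Y) powr (1 - \<sigma>)) / (\<sigma> - 1) + (real (Suc Y) powr (1 - \<sigma>) - real (Suc (Suc Y)) powr (1 - \<sigma>)) / (\<sigma> - 1)"
   using Suc step[of "Suc Y"] by (intro add_mono) auto
  also have "\<dots> = 1 + (1 - real (Suc (Suc Y)) powr (1 - \<sigma>)) / (\<sigma> - 1)"
   by (simp add: diff_divide_distrib del: of_nat_Suc)
  finally show ?case .
 qed simp
 moreover have "1 + (1 - real (Suc Y) powr (1 - \<sigma>)) / (\<sigma> - 1) \<le> 1 + 1 / (\<sigma> - 1)" for Y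
  using s by (simp add: divide_right_mono)
 ultimately have "(\<Sum>m=1..Suc Y. real m powr - \<sigma>) \<le> 1 + 1 / (\<sigma> - 1)" for Y by (rule order_trans)
 moreover have "(\<Sum>m=1..Y. real m powr - \<sigma>) \<le> (\<Sum>m=1..Suc Y. real m powr - \<sigma>)" by simp
 ultimately show ?thesis by (rule order_trans[rotated])
qed

text \<open>With both numbers divided by their gcd the quotients are coprime, so the quotient of
  \<open>x\<close> can only divide the power of the gcd.\<close>

lemma dvd_power_div_gcd:
 fixes x n :: nat
 assumes n: "n > 0" and x: "x dvd n ^ Suc j"
 shows "x div gcd x n dvd gcd x n ^ j"
proof -
 define g where "g = gcd x n"
 have g0: "g > 0" using n by (simp add: g_def)
 obtain x' n' where e: "x = x' * g" "n = n' * g" "coprime x' n'"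
  using gcd_coprime_exists[of x n] n unfolding g_def by auto
 have "x' dvd n' * n ^ j" using x g0 unfolding e(1) by (simp add: e(2) mult_ac)
 then have "x' dvd n ^ j" using e(3) by (simp add: coprime_dvd_mult_right_iff)
 then have "x' dvd n' ^ j * g ^ j" by (simp add: e(2) power_mult_distrib)
 then have "x' dvd g ^ j" using e(3) by (simp add: coprime_dvd_mult_right_iff)
 moreover have "x div g = x'" using g0 e(1) by simp
 ultimately show ?thesis by (simp add: g_def)
qed

text \<open>A pair of \<open>n\<close> and a divisor \<open>x\<close> of \<open>n ^ Suc j\<close> is
  determined by \<open>n / g\<close>, \<open>g\<close> and \<open>x / g\<close> with
  \<open>g = gcd x n\<close>, and \<open>x / g\<close> divides \<open>g ^ j\<close>. So each further
  exponent costs one factor of the zeta sum.\<close>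

lemma divisor_power_sum:
 fixes \<sigma> :: real
 shows "(\<Sum>n=1..Y. real (card {x. x dvd n ^ j}) * real n powr - \<sigma>) \<le> (\<Sum>n=1..Y. real n powr - \<sigma>) ^ Suc j"
proof (induction j)
 case 0
 show ?case by simp
next
 case (Suc j)
 define S where "S = (SIGMA n:{1..Y}. {x. x dvd n ^ Suc j})"
 define T where "T = {1..Y} \<times> (SIGMA n:{1..Y}. {x. x dvd n ^ j})"
 define h where "h = (\<lambda>(n :: nat, x :: nat). (n div gcd x n, gcd x n, x div gcd x n))"
 have fin: "finite {x::nat. x dvd n ^ i}" if "n \<in> {1..Y}" for n i using that by simp
 have "(\<Sum>n=1..Y. real (card {x. x dvd n ^ Suc j}) * real n powr - \<sigma>) = (\<Sum>(n, x)\<in>S. real n powr - \<sigma>)"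
  unfolding S_def by (subst sum.Sigma[symmetric]) (use fin in auto)
 also have "\<dots> = (\<Sum>(n, x)\<in>S. (\<lambda>(m, g, y). real m powr - \<sigma> * real g powr - \<sigma>) (h (n, x)))"
 proof (rule sum.cong, simp, safe)
  fix n x assume "(n, x) \<in> S"
  have "real n = real (n div gcd x n) * real (gcd x n)" by (simp flip: of_nat_mult)
  then show "real n powr - \<sigma> = (\<lambda>(m, g, y). real m powr - \<sigma> * real g powr - \<sigma>) (h (n, x))"
   by (simp add: h_def flip: powr_mult)
 qed
 also have "\<dots> = (\<Sum>(m, g, y)\<in>h ` S. real m powr - \<sigma> * real g powr - \<sigma>)"
 proof (subst sum.reindex)
  show "inj_on h S"
  proof (rule inj_onI, safe)
   fix n x n' x' assume e: "h (n, x) = h (n', x')"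
   have e': "n div gcd x n = n' div gcd x' n' \<and> gcd x n = gcd x' n' \<and> x div gcd x n = x' div gcd x' n'"
    using e unfolding h_def prod.case prod.inject .
   note a = e'[THEN conjunct1] and g = e'[THEN conjunct2, THEN conjunct1] and b = e'[THEN conjunct2, THEN conjunct2]
   have "n = n div gcd x n * gcd x n" by simp
   also have "\<dots> = n' div gcd x' n' * gcd x' n'" by (rule arg_cong2[where f = times, OF a g])
   also have "\<dots> = n'" by simp
   finally show "n = n'" .
   have "x = x div gcd x n * gcd x n" by simp
   also have "\<dots> = x' div gcd x' n' * gcd x' n'" by (rule arg_cong2[where f = times, OF b g])
   also have "\<dots> = x'" by simp
   finally show "x = x'" .
  qed
 qed (simp add: case_prod_beta)
 also have "\<dots> \<le> (\<Sum>(m, g, y)\<in>T. real m powr - \<sigma> * real g powr - \<sigma>)"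
 proof (rule sum_mono2)
  show "finite T" unfolding T_def by (intro finite_cartesian_product finite_SigmaI) (use fin in auto)
  show "h ` S \<subseteq> T"
  proof
   fix z assume "z \<in> h ` S"
   then obtain n x where z: "z = h (n, x)" and "(n, x) \<in> S" by auto
   then have n: "n > 0" "n \<le> Y" "x dvd n ^ Suc j" by (auto simp: S_def)
   have gp: "gcd x n > 0" "gcd x n \<le> n" using n by (auto intro: gcd_le2_nat)
   then have "Suc 0 \<le> gcd x n" by linarith
   moreover have "n div gcd x n > 0" using n by (simp add: div_greater_zero_iff gcd_le2_nat)
   moreover have "n div gcd x n \<le> Y" "gcd x n \<le> Y"
    using n div_le_dividend[of n "gcd x n"] \<open>gcd x n \<le> n\<close> by linarith+
   ultimately show "z \<in> T" using n dvd_power_div_gcd[OF n(1,3)] by (auto simp: z h_def T_def)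
  qed
 qed auto
 also have "\<dots> = (\<Sum>m=1..Y. real m powr - \<sigma>) * (\<Sum>n=1..Y. real (card {x. x dvd n ^ j}) * real n powr - \<sigma>)"
 proof -
  have "(\<Sum>(m, g, y)\<in>T. real m powr - \<sigma> * real g powr - \<sigma>) =
   (\<Sum>m=1..Y. real m powr - \<sigma>) * (\<Sum>z\<in>(SIGMA n:{1..Y}. {x. x dvd n ^ j}). real (fst z) powr - \<sigma>)"
   unfolding T_def sum_product sum.cartesian_product by (intro sum.cong) auto
  also have "(\<Sum>z\<in>(SIGMA n:{1..Y}. {x. x dvd n ^ j}). real (fst z) powr - \<sigma>) = (\<Sum>n=1..Y. \<Sum>x | x dvd n ^ j. real n powr - \<sigma>)"
   by (subst sum.Sigma) (use fin in \<open>simp_all add: case_prod_beta\<close>)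
  finally show ?thesis by simp
 qed
 also have "\<dots> \<le> (\<Sum>m=1..Y. real m powr - \<sigma>) * (\<Sum>n=1..Y. real n powr - \<sigma>) ^ Suc j"
  by (intro mult_left_mono Suc sum_nonneg) auto
 finally show ?case by simp
qed

lemma divisors_mult:
 "{x::nat. x dvd a * b} = (\<lambda>(x, y). x * y) ` ({x. x dvd a} \<times> {y. y dvd b})"
proof (intro equalityI subsetI)
 fix x assume "x \<in> {x. x dvd a * b}"
 then obtain y z where "x = y * z" "y dvd a" "z dvd b" using division_decomp[of x a b] by blast
 then show "x \<in> (\<lambda>(x, y). x * y) ` ({x. x dvd a} \<times> {y. y dvd b})" by (intro image_eqI[of _ _ "(y, z)"]) auto
qed (auto intro: mult_dvd_mono)

lemma divisor_sum_submult:
 fixes s :: real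
 assumes "a > 0" "b > 0"
 shows "(\<Sum>x | x dvd a * b. real x powr s) \<le> (\<Sum>x | x dvd a. real x powr s) * (\<Sum>x | x dvd b. real x powr s)"
proof -
 have "(\<Sum>x | x dvd a * b. real x powr s) \<le> (\<Sum>z\<in>{x. x dvd a} \<times> {y. y dvd b}. real (fst z * snd z) powr s)"
  unfolding divisors_mult using assms sum_image_le[of "{x. x dvd a} \<times> {y. y dvd b}" "\<lambda>x. real x powr s" "\<lambda>(x, y). x * y"]
  by (simp add: case_prod_beta o_def)
 also have "\<dots> = (\<Sum>x | x dvd a. real x powr s) * (\<Sum>x | x dvd b. real x powr s)"
  by (simp add: sum_product sum.cartesian_product case_prod_beta powr_mult)
 finally show ?thesis .
qed

abbreviation tau3 :: "nat \<Rightarrow> nat" where "tau3 n \<equiv> card {g. g dvd n ^ 3}"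

lemma tau3_submult:
 assumes "a > 0" "b > 0" shows "tau3 (a * b) \<le> tau3 a * tau3 b"
proof -
 have "tau3 (a * b) \<le> card ({x. x dvd a ^ 3} \<times> {y. y dvd b ^ 3})"
  unfolding power_mult_distrib divisors_mult using assms by (intro card_image_le) auto
 then show ?thesis by (simp add: card_cartesian_product)
qed

text \<open>The fourth power here accounts for four of the five logarithms in the final
  error.\<close>

lemma tau3_sum:
 assumes s: "\<sigma> > 1"
 shows "(\<Sum>n=1..Y. real (tau3 n) * real n powr - \<sigma>) \<le> (1 + 1 / (\<sigma> - 1)) ^ 4"
proof -
 have "(\<Sum>n=1..Y. real (tau3 n) * real n powr - \<sigma>) \<le> (\<Sum>n=1..Y. real n powr - \<sigma>) ^ 4"
  using divisor_power_sum[where j = 3] by simp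
 also have "\<dots> \<le> (1 + 1 / (\<sigma> - 1)) ^ 4" by (intro power_mono zeta_partial s sum_nonneg) auto
 finally show ?thesis .
qed

text \<open>Writing \<open>k = g * l\<close> and using submultiplicativity of \<open>tau3\<close>
  separates the divisor sum into a factor with the larger exponent
  \<open>s + \<sigma>\<close>.\<close>

lemma tau3_sigma_sum:
 fixes \<sigma> s :: real
 shows "(\<Sum>k=1..Y. real (tau3 k) * (\<Sum>g | g dvd k. real g powr - s) * real k powr - \<sigma>) \<le>
  (\<Sum>g=1..Y. real (tau3 g) * real g powr - (s + \<sigma>)) * (\<Sum>k=1..Y. real (tau3 k) * real k powr - \<sigma>)"
proof -
 define S where "S = (SIGMA k:{1..Y}. {g. g dvd k})"
 define h where "h = (\<lambda>(k, g). (g, k div g :: nat))"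
 define F where "F = (\<lambda>(g, k). (real (tau3 g) * real g powr - (s + \<sigma>)) * (real (tau3 k) * real k powr - \<sigma>))"
 have "(\<Sum>k=1..Y. real (tau3 k) * (\<Sum>g | g dvd k. real g powr - s) * real k powr - \<sigma>) =
  (\<Sum>(k, g)\<in>S. real (tau3 k) * real g powr - s * real k powr - \<sigma>)"
  unfolding S_def by (subst sum.Sigma[symmetric]) (auto simp: sum_distrib_left sum_distrib_right)
 also have "\<dots> \<le> (\<Sum>z\<in>S. F (h z))"
 proof (rule sum_mono, safe)
  fix k g assume "(k, g) \<in> S"
  then have kg: "k > 0" "g dvd k" by (auto simp: S_def)
  then obtain l where l: "k = g * l" by blast
  have gl: "g > 0" "l > 0" using kg l by auto
  have "real (tau3 k) \<le> real (tau3 g * tau3 l)" unfolding l of_nat_le_iff by (rule tau3_submult[OF gl])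
  then have "real (tau3 k) * (real g powr - (s + \<sigma>) * real l powr - \<sigma>) \<le> real (tau3 g * tau3 l) * (real g powr - (s + \<sigma>) * real l powr - \<sigma>)"
   by (intro mult_right_mono) auto
  moreover have e: "real g powr - s * real k powr - \<sigma> = real g powr - (s + \<sigma>) * real l powr - \<sigma>"
   using gl by (simp add: l powr_mult powr_diff powr_minus_divide powr_add divide_simps)
  moreover have "real (tau3 g * tau3 l) * (real g powr - (s + \<sigma>) * real l powr - \<sigma>) = F (h (k, g))"
   using gl by (simp add: F_def h_def l)
  ultimately show "real (tau3 k) * real g powr - s * real k powr - \<sigma> \<le> F (h (k, g))"
   by (simp only: mult.assoc e)
 qed
 also have "\<dots> = (\<Sum>z\<in>h ` S. F z)"
 proof (subst sum.reindex)
  show "inj_on h S" by (rule inj_onI) (auto simp: h_def S_def elim!: dvdE)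
 qed simp
 also have "\<dots> \<le> (\<Sum>z\<in>{1..Y} \<times> {1..Y}. F z)"
 proof (rule sum_mono2)
  show "h ` S \<subseteq> {1..Y} \<times> {1..Y}"
  proof
   fix z assume "z \<in> h ` S"
   then obtain k g where z: "z = h (k, g)" and "(k, g) \<in> S" by auto
   then have kg: "k > 0" "k \<le> Y" "g dvd k" by (auto simp: S_def)
   have "g > 0" "g \<le> k" using kg by (auto intro: dvd_imp_le Nat.gr0I)
   moreover have "k div g > 0" using \<open>g > 0\<close> \<open>g \<le> k\<close> by (auto simp: div_greater_zero_iff)
   moreover have "k div g \<le> Y" using kg div_le_dividend[of k g] by linarith
   ultimately show "z \<in> {1..Y} \<times> {1..Y}" using kg by (simp add: z h_def)
  qed
 qed (auto simp: F_def)
 also have "\<dots> = (\<Sum>g=1..Y. real (tau3 g) * real g powr - (s + \<sigma>)) * (\<Sum>k=1..Y. real (tau3 k) * real k powr - \<sigma>)"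
  unfolding F_def by (simp only: sum.cartesian_product[symmetric] sum_product)
 finally show ?thesis .
qed

text \<open>The power of the gcd is bounded by the sum of the powers of all common divisors
  \<open>g\<close>; interchanging the sums and writing \<open>d = g * m\<close> factors the
  result.\<close>

lemma gcd_powr_sum:
 fixes s :: real
 assumes n: "n > 0" and s: "s > 0"
 shows "(\<Sum>d=1..Y. real (gcd n d) powr s * real d powr - (2 * s)) \<le>
  (\<Sum>m=1..Y. real m powr - (2 * s)) * (\<Sum>g | g dvd n. real g powr - s)"
proof -
 have fin: "finite {g. g dvd n}" using n by simp
 have "(\<Sum>d=1..Y. real (gcd n d) powr s * real d powr - (2 * s)) \<le>
  (\<Sum>d=1..Y. \<Sum>g | g dvd n. of_bool (g dvd d) * (real g powr s * real d powr - (2 * s)))"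
 proof (rule sum_mono)
  fix d assume "d \<in> {1..Y}"
  have "of_bool (gcd n d dvd d) * (real (gcd n d) powr s * real d powr - (2 * s)) \<le> (\<Sum>g | g dvd n. of_bool (g dvd d) * (real g powr s * real d powr - (2 * s)))"
   by (rule member_le_sum) (use fin in auto)
  then show "real (gcd n d) powr s * real d powr - (2 * s) \<le> (\<Sum>g | g dvd n. of_bool (g dvd d) * (real g powr s * real d powr - (2 * s)))" by simp
 qed
 also have "\<dots> = (\<Sum>g | g dvd n. \<Sum>d=1..Y. of_bool (g dvd d) * (real g powr s * real d powr - (2 * s)))" by (rule sum.swap)
 also have "\<dots> \<le> (\<Sum>g | g dvd n. real g powr - s * (\<Sum>m=1..Y. real m powr - (2 * s)))"
 proof (rule sum_mono)
  fix g assume "g \<in> {g. g dvd n}"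
  then have g: "g > 0" using n by (auto intro: Nat.gr0I)
  have "(\<Sum>d=1..Y. of_bool (g dvd d) * (real g powr s * real d powr - (2 * s))) =
    (\<Sum>d\<in>{d \<in> {1..Y}. g dvd d}. real g powr s * real d powr - (2 * s))"
   by (intro sum.mono_neutral_cong_right) auto
  also have "\<dots> = (\<Sum>d\<in>{d \<in> {1..Y}. g dvd d}. real g powr - s * real (d div g) powr - (2 * s))"
  proof (rule sum.cong, simp)
   fix d assume "d \<in> {d \<in> {1..Y}. g dvd d}"
   then obtain l where l: "d = g * l" by auto
   have "real g powr s * real g powr - (2 * s) = real g powr - s" by (simp flip: powr_add)
   then show "real g powr s * real d powr - (2 * s) = real g powr - s * real (d div g) powr - (2 * s)"
    using g by (simp add: l powr_mult)
  qed
  also have "\<dots> = (\<Sum>m\<in>(\<lambda>d. d div g) ` {d \<in> {1..Y}. g dvd d}. real g powr - s * real m powr - (2 * s))"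
  proof (subst sum.reindex)
   show "inj_on (\<lambda>d. d div g) {d \<in> {1..Y}. g dvd d}" using g by (intro inj_onI) (auto elim!: dvdE)
  qed simp
  also have "\<dots> \<le> (\<Sum>m=1..Y. real g powr - s * real m powr - (2 * s))"
  proof (rule sum_mono2)
   show "(\<lambda>d. d div g) ` {d \<in> {1..Y}. g dvd d} \<subseteq> {1..Y}"
   proof safe
    fix d assume d: "d \<in> {1..Y}" "g dvd d"
    then have "g \<le> d" by (auto intro: dvd_imp_le)
    then have "d div g > 0" using g by (simp add: div_greater_zero_iff)
    moreover have "d div g \<le> Y" using d div_le_dividend[of d g] by (simp only: atLeastAtMost_iff) linarith
    ultimately show "d div g \<in> {1..Y}" using d by simp
   qed
  qed auto
  also have "\<dots> = real g powr - s * (\<Sum>m=1..Y. real m powr - (2 * s))" by (simp add: sum_distrib_left)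
  finally show "(\<Sum>d=1..Y. of_bool (g dvd d) * (real g powr s * real d powr - (2 * s))) \<le> real g powr - s * (\<Sum>m=1..Y. real m powr - (2 * s))" .
 qed
 also have "\<dots> = (\<Sum>m=1..Y. real m powr - (2 * s)) * (\<Sum>g | g dvd n. real g powr - s)"
  by (simp add: sum_distrib_right mult.commute)
 finally show ?thesis .
qed

lemma power_powr: "x > 0 \<Longrightarrow> (x ^ n) powr s = x powr (real n * s)" for x :: real
 by (simp add: powr_powr flip: powr_realpow)

lemma sum_box: "(\<Sum>z\<in>A \<times> B. g z) = (\<Sum>x\<in>A. \<Sum>y\<in>B. g (x, y))"
 by (simp add: sum.cartesian_product)

section \<open>Convergence of the sum over all lattices\<close>

text \<open>For \<open>n = k * f\<close> and squarefree \<open>d\<close> the lattice has determinant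
  \<open>d ^ 2 * n ^ 3 / gcd n d\<close>, and height \<open>X * k ^ 6\<close> gives area
  proportional to \<open>X powr (1 / 6) * k\<close>. The base of the power is their quotient without
  the \<open>X\<close> part, and \<open>T7\<close> counts the lattices. \<open>s = 1\<close> belongs
  to main terms, \<open>s = 1 / 2 + \<delta>\<close> to errors.\<close>

definition trm :: "real \<Rightarrow> (nat \<times> nat) \<times> nat \<Rightarrow> real" where
 "trm s = (\<lambda>((k, f), d). real (T7 (k * f)) * (real (gcd (k * f) d) / (real k ^ 2 * real f ^ 3 * real d ^ 2)) powr s)"

abbreviation box3 :: "nat \<Rightarrow> ((nat \<times> nat) \<times> nat) set" where
 "box3 Y \<equiv> ({1..Y} \<times> {1..Y}) \<times> {1..Y}"

lemma kap2_pos: "kap2 > 0" using kap_pos by (simp add: kap2_def)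

text \<open>The sum over \<open>d\<close> gives one zeta factor at \<open>1 + 2 * \<delta>\<close>
  and the sum over \<open>k\<close> four. The sum over \<open>f\<close> and both divisor sums run at
  exponents at least 3/2, where each is at most \<open>3 ^ 4\<close>; this gives the constant
  \<open>3 ^ 12\<close> and the fifth power.\<close>

lemma trm_sum:
 assumes \<delta>: "0 < \<delta>"
 shows "(\<Sum>z\<in>box3 Y. trm (1 / 2 + \<delta>) z) \<le> of_int kap2 * 3 ^ 12 * (1 + 1 / (2 * \<delta>)) ^ 5"
proof -
 define s where "s = 1 / 2 + \<delta>"
 have s: "s > 1 / 2" using \<delta> by (simp add: s_def)
 define Zs where "Zs = (\<Sum>m=1..Y. real m powr - (2 * s))"
 define h where "h n = (\<Sum>g | g dvd n. real g powr - s)" for n :: nat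
 define D where "D \<sigma> = (\<Sum>k=1..Y. real (tau3 k) * real k powr - \<sigma>)" for \<sigma>
 define H where "H \<sigma> = (\<Sum>k=1..Y. real (tau3 k) * h k * real k powr - \<sigma>)" for \<sigma>
 define c where "c = real_of_int kap2"
 have c0: "c \<ge> 0" using kap2_pos by (simp add: c_def)
 have h0: "h n \<ge> 0" for n unfolding h_def by (intro sum_nonneg) auto
 have Z0: "Zs \<ge> 0" unfolding Zs_def by (intro sum_nonneg) auto
 have one: "(\<Sum>d=1..Y. trm s ((k, f), d)) \<le> c * Zs * ((real (tau3 k) * h k * real k powr - (2 * s)) * (real (tau3 f) * h f * real f powr - (3 * s)))"
  if "k \<in> {1..Y}" "f \<in> {1..Y}" for k f
 proof -
  have kf: "k > 0" "f > 0" using that by auto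
  have "trm s ((k, f), d) = real (T7 (k * f)) * (real k powr - (2 * s) * real f powr - (3 * s)) * (real (gcd (k * f) d) powr s * real d powr - (2 * s))"
   if "d \<in> {1..Y}" for d
  proof -
   have d0: "d > 0" using that by simp
   have "(real k ^ 2 * real f ^ 3 * real d ^ 2) powr s = real k powr (2 * s) * real f powr (3 * s) * real d powr (2 * s)"
    using kf d0 power_powr[of "real k" 2 s] power_powr[of "real f" 3 s] power_powr[of "real d" 2 s] by (simp add: powr_mult)
   then have "(real (gcd (k * f) d) / (real k ^ 2 * real f ^ 3 * real d ^ 2)) powr s =
     real (gcd (k * f) d) powr s / (real k powr (2 * s) * real f powr (3 * s) * real d powr (2 * s))"
    by (subst powr_divide) auto
   then show ?thesis unfolding trm_def prod.case by (simp add: powr_minus divide_inverse)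
  qed
  then have "(\<Sum>d=1..Y. trm s ((k, f), d)) = real (T7 (k * f)) * (real k powr - (2 * s) * real f powr - (3 * s)) * (\<Sum>d=1..Y. real (gcd (k * f) d) powr s * real d powr - (2 * s))"
   unfolding sum_distrib_left by (intro sum.cong) auto
  also have "\<dots> \<le> (c * (real (tau3 k) * real (tau3 f))) * (real k powr - (2 * s) * real f powr - (3 * s)) * (Zs * (h k * h f))"
  proof (intro mult_mono mult_right_mono)
   have "T7 (k * f) \<le> nat kap2 * (tau3 k * tau3 f)"
    using T7_bound[of "k * f"] tau3_submult[of k f] kf by (meson le_trans mult_le_mono2 nat_0_less_mult_iff)
   then have "real (T7 (k * f)) \<le> real (nat kap2 * (tau3 k * tau3 f))" by (simp only: of_nat_le_iff)
   also have "\<dots> = c * (real (tau3 k) * real (tau3 f))" using kap2_pos by (simp add: c_def)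
   finally show "real (T7 (k * f)) \<le> c * (real (tau3 k) * real (tau3 f))" .
   have "(\<Sum>d=1..Y. real (gcd (k * f) d) powr s * real d powr - (2 * s)) \<le> Zs * h (k * f)"
    unfolding Zs_def h_def using kf s by (intro gcd_powr_sum) auto
   also have "\<dots> \<le> Zs * (h k * h f)" unfolding h_def using kf Z0 by (intro mult_left_mono divisor_sum_submult) auto
   finally show "(\<Sum>d=1..Y. real (gcd (k * f) d) powr s * real d powr - (2 * s)) \<le> Zs * (h k * h f)" .
  qed (use c0 in \<open>auto intro!: sum_nonneg mult_nonneg_nonneg\<close>)
  finally show ?thesis by (simp add: mult_ac)
 qed
 have "(\<Sum>z\<in>box3 Y. trm s z) = (\<Sum>k=1..Y. \<Sum>f=1..Y. \<Sum>d=1..Y. trm s ((k, f), d))"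
  unfolding sum_box ..
 also have "\<dots> \<le> (\<Sum>k=1..Y. \<Sum>f=1..Y. c * Zs * ((real (tau3 k) * h k * real k powr - (2 * s)) * (real (tau3 f) * h f * real f powr - (3 * s))))"
  by (intro sum_mono one)
 also have "\<dots> = c * Zs * (H (2 * s) * H (3 * s))"
  unfolding H_def sum_product by (simp only: sum_distrib_left)
 also have "\<dots> \<le> c * (1 + 1 / (2 * \<delta>)) * ((3 ^ 4 * (1 + 1 / (2 * \<delta>)) ^ 4) * (3 ^ 4 * 3 ^ 4))"
 proof -
  have HD: "H \<sigma> \<le> D (s + \<sigma>) * D \<sigma>" for \<sigma> unfolding H_def D_def h_def by (rule tau3_sigma_sum)
  have D0: "D \<sigma> \<ge> 0" for \<sigma> unfolding D_def by (intro sum_nonneg) auto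
  have D3: "D \<sigma> \<le> 3 ^ 4" if "\<sigma> \<ge> 3 / 2" for \<sigma>
  proof -
   have "D \<sigma> \<le> (1 + 1 / (\<sigma> - 1)) ^ 4" unfolding D_def using that by (intro tau3_sum) auto
   also have "\<dots> \<le> 3 ^ 4" using that by (intro power_mono) (auto simp: field_simps)
   finally show ?thesis .
  qed
  have D2: "D (2 * s) \<le> (1 + 1 / (2 * \<delta>)) ^ 4"
   using tau3_sum[of "2 * s" Y] s unfolding D_def by (simp add: s_def)
  have "H (2 * s) \<le> D (s + 2 * s) * D (2 * s)" by (rule HD)
  also have "\<dots> \<le> 3 ^ 4 * (1 + 1 / (2 * \<delta>)) ^ 4" using s D0 D2 by (intro mult_mono D3) auto
  finally have 1: "H (2 * s) \<le> 3 ^ 4 * (1 + 1 / (2 * \<delta>)) ^ 4" .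
  have "H (3 * s) \<le> D (s + 3 * s) * D (3 * s)" by (rule HD)
  also have "\<dots> \<le> 3 ^ 4 * 3 ^ 4" using s D0 by (intro mult_mono D3) auto
  finally have 2: "H (3 * s) \<le> 3 ^ 4 * 3 ^ 4" .
  have "Zs \<le> 1 + 1 / (2 * s - 1)" unfolding Zs_def using s by (intro zeta_partial) auto
  then have 3: "Zs \<le> 1 + 1 / (2 * \<delta>)" by (simp add: s_def)
  have H0: "H \<sigma> \<ge> 0" for \<sigma> unfolding H_def using h0 by (intro sum_nonneg) auto
  show ?thesis using 1 2 3 H0 c0 Z0 \<delta> by (intro mult_mono mult_left_mono) auto
 qed
 also have "\<dots> = c * 3 ^ 12 * (1 + 1 / (2 * \<delta>)) ^ 5" by (simp add: eval_nat_numeral mult_ac)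
 finally show ?thesis unfolding s_def c_def .
qed

lemma summable_exhaust:
 fixes f :: "'a \<Rightarrow> real"
 assumes "\<And>z. z \<in> A \<Longrightarrow> f z \<ge> 0" "\<And>Y. finite (Bx Y)" "\<And>Y. Bx Y \<subseteq> A"
  "\<And>F. finite F \<Longrightarrow> F \<subseteq> A \<Longrightarrow> \<exists>Y. F \<subseteq> Bx Y" "\<And>Y. sum f (Bx Y) \<le> c"
 shows "f summable_on A"
proof (rule nonneg_bdd_above_summable_on)
 show "bdd_above (sum f ` {F. F \<subseteq> A \<and> finite F})"
 proof (rule bdd_aboveI2)
  fix F assume F: "F \<in> {F. F \<subseteq> A \<and> finite F}"
  then obtain Y where "F \<subseteq> Bx Y" using assms(4)[of F] by auto
  then have "sum f F \<le> sum f (Bx Y)"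
  proof (rule sum_mono2[OF assms(2)])
   fix b assume "b \<in> Bx Y - F"
   then have "b \<in> A" using assms(3)[of Y] by blast
   then show "f b \<ge> 0" by (rule assms(1))
  qed
  also have "\<dots> \<le> c" by (rule assms(5))
  finally show "sum f F \<le> c" .
 qed
qed (rule assms(1))

lemma box_exhaust:
 fixes F :: "((nat \<times> nat) \<times> nat) set"
 assumes F: "finite F" "F \<subseteq> ({1..} \<times> {1..}) \<times> {1..}"
 shows "\<exists>Y0. \<forall>Y\<ge>Y0. F \<subseteq> box3 Y"
proof (intro exI allI impI subsetI)
 fix Y z assume Y: "(\<Sum>((k, f), d)\<in>F. k + f + d) \<le> Y" and z: "z \<in> F"
 obtain k f d where kfd: "z = ((k, f), d)" by (metis surj_pair)
 have "(\<lambda>((k, f), d). k + f + d) z \<le> (\<Sum>z\<in>F. (\<lambda>((k, f), d). k + f + d) z)"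
  by (rule member_le_sum[OF z]) (use F in auto)
 then have "k + f + d \<le> Y" using Y kfd by simp
 then show "z \<in> box3 Y" using z F(2) kfd by auto
qed

lemma inverse_squares_summable: "(\<lambda>d. 1 / real d ^ 2) summable_on A"
proof -
 have "(\<lambda>d. norm (1 / real d ^ 2)) = (\<lambda>d. inverse (real d ^ 2))" by (rule ext) (simp add: inverse_eq_divide)
 then have "summable (\<lambda>d. norm (1 / real d ^ 2))" using inverse_power_summable[OF order_refl, where ?'a = real] by (simp only:)
 then have "(\<lambda>d. 1 / real d ^ 2) summable_on UNIV" by (rule norm_summable_imp_summable_on)
 then show ?thesis by (rule summable_on_subset) simp
qed

text \<open>The main terms with their Moebius signs: \<open>f\<close> detects the exact twist defect
  and \<open>d\<close> coprimality.\<close>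

definition msum :: "(nat \<times> nat) \<times> nat \<Rightarrow> real" where
 "msum = (\<lambda>((k, f), d). of_int (mu f * mu d) * trm 1 ((k, f), d))"

lemma trm_nonneg: "trm s z \<ge> 0" by (simp add: trm_def case_prod_beta)

lemma trm_1_summable: "trm 1 summable_on ({1..} \<times> {1..}) \<times> {1..}"
proof (rule summable_exhaust[where Bx = box3])
 show "\<exists>Y. F \<subseteq> box3 Y" if "finite F" "F \<subseteq> ({1..} \<times> {1..}) \<times> {1..}" for F
  using box_exhaust[OF that] by blast
 show "sum (trm 1) (box3 Y) \<le> of_int kap2 * 3 ^ 12 * (1 + 1 / (2 * (1 / 2))) ^ 5" for Y
  using trm_sum[of "1 / 2" Y] by simp
qed (auto simp: trm_nonneg)

lemma msum_summable: "msum summable_on ({1..} \<times> {1..}) \<times> {1..}"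
proof -
 have "norm (msum z) \<le> trm 1 z" for z
 proof -
  obtain k f d where z: "z = ((k, f), d)" by (metis surj_pair)
  have "\<bar>real_of_int (mu f)\<bar> \<le> 1" "\<bar>real_of_int (mu d)\<bar> \<le> 1" using mu_abs[of f] mu_abs[of d] by linarith+
  then have "\<bar>real_of_int (mu f)\<bar> * \<bar>real_of_int (mu d)\<bar> \<le> 1 * 1" by (intro mult_mono) auto
  then have "\<bar>real_of_int (mu f)\<bar> * \<bar>real_of_int (mu d)\<bar> * trm 1 z \<le> 1 * trm 1 z" by (intro mult_right_mono) (auto simp: trm_nonneg)
  then show ?thesis using trm_nonneg[of 1 z] by (simp add: msum_def z abs_mult)
 qed
 then have "(\<lambda>z. norm (msum z)) summable_on ({1..} \<times> {1..}) \<times> {1..}"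
  by (intro Infinite_Sum.abs_summable_on_comparison_test'[OF trm_1_summable])
 then show ?thesis by (rule summable_on_iff_abs_summable_on_real[THEN iffD2])
qed

text \<open>The boxes eventually contain every finite set of indices, so unconditional summability
  gives convergence along them.\<close>

lemma msum_limit: "(\<lambda>Y. sum msum (box3 Y)) \<longlonglongrightarrow> infsum msum (({1..} \<times> {1..}) \<times> {1..})"
proof -
 have "(sum msum \<longlongrightarrow> infsum msum (({1..} \<times> {1..}) \<times> {1..})) (finite_subsets_at_top (({1..} \<times> {1..}) \<times> {1..}))"
  using has_sum_infsum[OF msum_summable] by (simp add: has_sum_def)
 moreover have "filterlim box3 (finite_subsets_at_top (({1..} \<times> {1..}) \<times> {1..})) sequentially"
  unfolding filterlim_finite_subsets_at_top
 proof (intro allI impI)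
  fix F :: "((nat \<times> nat) \<times> nat) set" assume "finite F \<and> F \<subseteq> ({1..} \<times> {1..}) \<times> {1..}"
  then obtain Y0 where "\<forall>Y\<ge>Y0. F \<subseteq> box3 Y" using box_exhaust by blast
  then show "eventually (\<lambda>Y. finite (box3 Y) \<and> F \<subseteq> box3 Y \<and> box3 Y \<subseteq> ({1..} \<times> {1..}) \<times> {1..}) sequentially"
   by (intro eventually_sequentiallyI[of Y0]) auto
 qed
 ultimately show ?thesis by (rule filterlim_compose)
qed

lemma infsum_divisors:
 fixes g :: "nat \<times> nat \<Rightarrow> real"
 assumes g: "g summable_on {1..} \<times> {1..}"
 shows "infsum g ({1..} \<times> {1..}) = infsum (\<lambda>n. \<Sum>f | f dvd n. g (n div f, f)) {1..}"
proof -
 let ?S = "SIGMA n:{1..}. {f :: nat. f dvd n}"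
 define h where "h = (\<lambda>(n :: nat, f :: nat). (n div f, f))"
 have bij: "bij_betw h ?S ({1..} \<times> {1..})"
 proof (rule bij_betwI[where g = "\<lambda>(k, f). (k * f, f)"])
  show "h \<in> ?S \<rightarrow> {1..} \<times> {1..}"
  proof
   fix z assume zS: "z \<in> ?S"
   obtain n f where z: "z = (n, f)" by (rule prod.exhaust)
   have n: "n > 0" "f dvd n" using zS unfolding z by simp_all
   have "f > 0" by (rule dvd_pos_nat[OF n])
   moreover have "f \<le> n" by (rule dvd_imp_le[OF n(2,1)])
   ultimately have "n div f > 0" by (simp add: div_greater_zero_iff)
   then show "h z \<in> {1..} \<times> {1..}" using \<open>f > 0\<close> by (simp add: h_def z)
  qed
 next
  show "(\<lambda>(k, f). (k * f, f)) \<in> {1..} \<times> {1..} \<rightarrow> ?S"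
  proof
   fix z :: "nat \<times> nat" assume z: "z \<in> {1..} \<times> {1..}"
   obtain k f where kf: "z = (k, f)" by (rule prod.exhaust)
   show "(case z of (k, f) \<Rightarrow> (k * f, f)) \<in> ?S" using z unfolding kf by simp
  qed
 next
  fix z assume z: "z \<in> ?S"
  obtain n f where nf: "z = (n, f)" by (rule prod.exhaust)
  show "(case h z of (k, f) \<Rightarrow> (k * f, f)) = z" using z unfolding nf h_def by simp
 next
  fix z :: "nat \<times> nat" assume z: "z \<in> {1..} \<times> {1..}"
  obtain k f where kf: "z = (k, f)" by (rule prod.exhaust)
  show "h (case z of (k, f) \<Rightarrow> (k * f, f)) = z" using z unfolding kf h_def by simp
 qed
 have s: "(\<lambda>z. g (h z)) summable_on ?S" by (rule summable_on_reindex_bij_betw[OF bij, THEN iffD2, OF g])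
 have "infsum g ({1..} \<times> {1..}) = infsum (\<lambda>z. g (h z)) ?S" by (rule infsum_reindex_bij_betw[OF bij, symmetric])
 also have "\<dots> = infsum (\<lambda>n. infsum (\<lambda>f. g (h (n, f))) {f. f dvd n}) {1..}" by (rule infsum_Sigma_banach[OF s, symmetric])
 also have "\<dots> = infsum (\<lambda>n. \<Sum>f | f dvd n. g (n div f, f)) {1..}"
 proof (rule infsum_cong)
  fix n :: nat assume "n \<in> {1..}"
  then have "finite {f. f dvd n}" by simp
  then show "infsum (\<lambda>f. g (h (n, f))) {f. f dvd n} = (\<Sum>f | f dvd n. g (n div f, f))" by (simp add: h_def)
 qed
 finally show ?thesis .
qed

section \<open>Evaluation of the leading constant\<close>

text \<open>The coprimality factor attached to level \<open>n\<close>. As an Euler product it has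
  the factor \<open>1 - 1 / p ^ 2\<close> at primes not dividing \<open>n\<close> and
  \<open>1 - 1 / p\<close> at those dividing \<open>n\<close>.\<close>

definition Fn :: "nat \<Rightarrow> real" where
 "Fn n = infsum (\<lambda>d. of_int (mu d) * real (gcd n d) / real d ^ 2) {1..}"

lemma mu_summable:
 assumes n: "n > 0"
 shows "(\<lambda>d. of_int (mu d) * real (gcd n d) / real d ^ 2) summable_on A"
proof -
 have "norm (of_int (mu d) * real (gcd n d) / real d ^ 2) \<le> real n * (1 / real d ^ 2)" for d
 proof -
  have "\<bar>real_of_int (mu d)\<bar> \<le> 1" using mu_abs[of d] by linarith
  moreover have "real (gcd n d) \<le> real n" using n by simp
  ultimately have "\<bar>real_of_int (mu d)\<bar> * real (gcd n d) \<le> 1 * real n" by (intro mult_mono) auto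
  then have "\<bar>real_of_int (mu d)\<bar> * real (gcd n d) / real d ^ 2 \<le> 1 * real n / real d ^ 2" by (rule divide_right_mono) simp
  then show ?thesis by (simp add: abs_mult)
 qed
 note nb = this
 have "(\<lambda>d. norm (of_int (mu d) * real (gcd n d) / real d ^ 2)) summable_on A"
 proof (rule Infinite_Sum.abs_summable_on_comparison_test'[where g = "\<lambda>d. real n * (1 / real d ^ 2)"])
  show "(\<lambda>d. real n * (1 / real d ^ 2)) summable_on A" by (rule summable_on_cmult_right[OF inverse_squares_summable])
  show "norm (of_int (mu d) * real (gcd n d) / real d ^ 2) \<le> real n * (1 / real d ^ 2)" for d by (rule nb)
 qed
 then show ?thesis by (rule summable_on_iff_abs_summable_on_real[THEN iffD2])
qed

text \<open>The product of the two absolutely convergent series, regrouped by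
  \<open>n = m * d\<close>, keeps only \<open>n = 1\<close>.\<close>

lemma Fn_1: "Fn 1 * zeta2 = 1"
proof -
 define g where "g = (\<lambda>(m, d). 1 / real m ^ 2 * (of_int (mu d) / real d ^ 2))"
 have gs: "g summable_on {1..} \<times> {1..}"
 proof -
  have "(\<lambda>z. 1 / real (fst z) ^ 2 * (1 / real (snd z) ^ 2)) summable_on {1..} \<times> {1..}"
  proof (rule summable_exhaust[where Bx = "\<lambda>Y. {1..Y} \<times> {1..Y}"])
   fix F :: "(nat \<times> nat) set" assume F: "finite F" "F \<subseteq> {1..} \<times> {1..}"
   have fin: "finite ((\<lambda>z. (z, 1 :: nat)) ` F)" using F(1) by (rule finite_imageI)
   have "(\<lambda>z. (z, 1 :: nat)) ` F \<subseteq> ({1..} \<times> {1..}) \<times> {1..}"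
    by (intro image_subsetI SigmaI subsetD[OF F(2)]) simp_all
   from box_exhaust[OF fin this] obtain Y where Y0: "\<forall>Y'\<ge>Y. (\<lambda>z. (z, 1 :: nat)) ` F \<subseteq> box3 Y'" by (elim exE) (rule that)
   have Y: "(\<lambda>z. (z, 1 :: nat)) ` F \<subseteq> box3 Y" by (rule Y0[rule_format, OF order_refl])
   show "\<exists>Y. F \<subseteq> {1..Y} \<times> {1..Y}"
   proof (intro exI subsetI)
    fix z assume "z \<in> F"
    then have "(z, 1) \<in> box3 Y" using Y by (rule subsetD[OF _ imageI, rotated])
    then show "z \<in> {1..Y} \<times> {1..Y}" by (simp only: mem_Sigma_iff)
   qed
  next
   fix Y
   have b: "(\<Sum>m=1..Y. 1 / real m ^ 2) \<le> 2"
   proof -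
    have "(\<Sum>m=1..Y. 1 / real m ^ 2) = (\<Sum>m=1..Y. real m powr - 2)"
     by (intro sum.cong) (auto simp: powr_minus divide_inverse)
    also have "\<dots> \<le> 1 + 1 / (2 - 1)" by (rule zeta_partial) simp
    finally show ?thesis by simp
   qed
   have "(\<Sum>z\<in>{1..Y} \<times> {1..Y}. 1 / real (fst z) ^ 2 * (1 / real (snd z) ^ 2)) = (\<Sum>m=1..Y. 1 / real m ^ 2) * (\<Sum>m=1..Y. 1 / real m ^ 2)"
    unfolding sum_box sum_product by simp
   also have "\<dots> \<le> 2 * 2" using b by (intro mult_mono) (auto intro: sum_nonneg)
   finally show "(\<Sum>z\<in>{1..Y} \<times> {1..Y}. 1 / real (fst z) ^ 2 * (1 / real (snd z) ^ 2)) \<le> 4" by simp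
  qed auto
  then have "(\<lambda>z. norm (g z)) summable_on {1..} \<times> {1..}"
  proof (rule Infinite_Sum.abs_summable_on_comparison_test')
   fix z :: "nat \<times> nat"
   have "\<bar>real_of_int (mu (snd z))\<bar> \<le> 1" using mu_abs[of "snd z"] by linarith
   then have "\<bar>real_of_int (mu (snd z))\<bar> / real (snd z) ^ 2 \<le> 1 / real (snd z) ^ 2" by (rule divide_right_mono) simp
   then have "1 / real (fst z) ^ 2 * (\<bar>real_of_int (mu (snd z))\<bar> / real (snd z) ^ 2) \<le> 1 / real (fst z) ^ 2 * (1 / real (snd z) ^ 2)"
    by (rule mult_left_mono) simp
   then show "norm (g z) \<le> 1 / real (fst z) ^ 2 * (1 / real (snd z) ^ 2)"
    unfolding g_def by (simp only: case_prod_beta real_norm_def abs_mult abs_divide abs_power2 abs_of_nat power_abs abs_one)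
  qed
  then show ?thesis by (rule summable_on_iff_abs_summable_on_real[THEN iffD2])
 qed
 have "infsum g ({1..} \<times> {1..}) = infsum (\<lambda>m. infsum (\<lambda>d. g (m, d)) {1..}) {1..}"
  by (rule infsum_Sigma_banach[OF gs, symmetric])
 also have "\<dots> = infsum (\<lambda>m. 1 / real m ^ 2 * Fn 1) {1..}"
 proof -
  have "gcd 1 d = 1" for d :: nat by simp
  then show ?thesis unfolding g_def Fn_def by (simp only: prod.case infsum_cmult_right' of_nat_1 mult_1_right)
 qed
 also have "\<dots> = zeta2 * Fn 1" unfolding zeta2_def by (simp only: infsum_cmult_left')
 finally have 1: "infsum g ({1..} \<times> {1..}) = zeta2 * Fn 1" .
 have "infsum g ({1..} \<times> {1..}) = infsum (\<lambda>n. \<Sum>f | f dvd n. g (n div f, f)) {1..}" by (rule infsum_divisors[OF gs])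
 also have "\<dots> = infsum (\<lambda>n. 1) {1 :: nat}"
 proof (rule infsum_cong_neutral)
  have e: "(\<Sum>f | f dvd n. g (n div f, f)) = of_bool (n = 1) / real n ^ 2" if n: "n \<ge> 1" for n :: nat
  proof -
   have "(\<Sum>f | f dvd n. g (n div f, f)) = (\<Sum>f | f dvd n. of_int (mu f) / real n ^ 2)"
   proof (rule sum.cong)
    fix f assume "f \<in> {f. f dvd n}"
    then have "real n = real (n div f) * real f" by (simp flip: of_nat_mult)
    then show "g (n div f, f) = of_int (mu f) / real n ^ 2" by (simp add: g_def power_mult_distrib)
   qed simp
   also have "\<dots> = of_int (\<Sum>f | f dvd n. mu f) / real n ^ 2" by (simp add: sum_divide_distrib)
   finally show ?thesis using n by (simp add: sum_mu_divisors)
  qed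
  show "(\<Sum>f | f dvd n. g (n div f, f)) = 0" if "n \<in> {1..} - {1}" for n using e[of n] that by auto
  show "(\<Sum>f | f dvd n. g (n div f, f)) = 1" if "n \<in> {1..} \<inter> {1}" for n using e[of n] that by auto
 qed auto
 finally show ?thesis using 1 by (simp add: mult.commute)
qed

text \<open>If \<open>p\<close> divides \<open>n\<close>, the gcd with a squarefree \<open>d\<close>
  does not notice another factor \<open>p\<close>. Otherwise let \<open>U\<close> be the part over
  \<open>d\<close> prime to \<open>p\<close>; pairing \<open>d\<close> with \<open>p * d\<close>
  gives \<open>(1 - 1 / p ^ 2) * U\<close> for \<open>n\<close> and \<open>(1 - 1 / p) * U\<close>
  for \<open>p * n\<close>.\<close>

lemma Fn_prime:
 assumes p: "prime p" and n: "n > 0"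
 shows "Fn (p * n) = (if p dvd n then Fn n else Fn n / (1 + 1 / real p))"
proof (cases "p dvd n")
 case True
 have "gcd (p * n) d = gcd n d" if sf: "squarefree d" for d
 proof (rule dvd_antisym)
  define g where "g = gcd (p * n) d"
  have gd: "g dvd d" "g dvd p * n" by (simp_all add: g_def)
  have "g dvd n"
  proof (cases "p dvd g")
   case True
   then obtain g' where g': "g = p * g'" by (rule dvdE)
   have p0: "p \<noteq> 0" using p by auto
   have "g' dvd n" using gd(2) p0 unfolding g' by simp
   moreover have "\<not> p dvd g'"
   proof
    assume "p dvd g'"
    then have "p ^ 2 dvd d" using gd(1) unfolding g' power2_eq_square by (meson dvd_trans mult_dvd_mono dvd_refl)
    then show False using sf p by (metis not_prime_unit squarefreeD)
   qed
   then have "coprime p g'" using p by (simp add: prime_imp_coprime)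
   ultimately show ?thesis unfolding g' using \<open>p dvd n\<close> by (intro divides_mult)
  next
   case False
   then have "coprime g p" using p by (metis coprime_commute prime_imp_coprime)
   then show ?thesis using gd(2) by (simp add: coprime_dvd_mult_right_iff)
  qed
  then show "gcd (p * n) d dvd gcd n d" using gd(1) by (simp add: g_def)
  show "gcd n d dvd gcd (p * n) d" by (intro gcd_greatest) (auto intro: dvd_mult)
 qed
 then have feq: "of_int (mu d) * real (gcd (p * n) d) = of_int (mu d) * real (gcd n d)" for d
  by (cases "squarefree d") (simp_all add: mu_def)
 have "Fn (p * n) = Fn n" unfolding Fn_def by (simp only: feq)
 then show ?thesis using True by simp
next
 case False
 define u where "u n d = of_int (mu d) * real (gcd n d) / real d ^ 2" for n d
 define B where "B = {d :: nat. d \<ge> 1 \<and> \<not> p dvd d}"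
 define C where "C = {d :: nat. d \<ge> 1 \<and> p dvd d}"
 have p2: "p \<ge> 2" using p by (rule prime_ge_2_nat)
 have split: "Fn m = infsum (u m) B + infsum (\<lambda>d. u m (p * d)) B" if m: "m > 0" for m
 proof -
  have us: "u m summable_on S" for S unfolding u_def by (rule mu_summable[OF m])
  have e: "{1..} = B \<union> C" "B \<inter> C = {}" by (auto simp: B_def C_def)
  have "Fn m = infsum (u m) B + infsum (u m) C"
   unfolding Fn_def u_def[symmetric] e(1) by (rule infsum_Un_disjoint[OF us us e(2)])
  also have "infsum (u m) C = infsum (\<lambda>d. u m (p * d)) {1..}"
  proof (rule infsum_reindex_bij_betw[symmetric])
   show "bij_betw ((*) p) {1..} C"
    using p2 by (intro bij_betwI[where g = "\<lambda>d. d div p"]) (auto simp: C_def elim!: dvdE)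
  qed
  also have "\<dots> = infsum (\<lambda>d. u m (p * d)) B"
   by (rule infsum_cong_neutral) (auto simp: B_def u_def mu_prime_square[OF p])
  finally show ?thesis .
 qed
 define U where "U = infsum (u n) B"
 have cop: "coprime p n" using p False by (simp add: prime_imp_coprime)
 have g1: "gcd n (p * d) = gcd n d" for d using cop by (simp add: gcd_mult_right_left_cancel coprime_commute)
 have "Fn n = U + infsum (\<lambda>d. - (1 / real p ^ 2) * u n d) B"
  unfolding split[OF n] U_def
  by (intro arg_cong2[where f = "(+)"] refl infsum_cong) (auto simp: B_def u_def mu_prime_mult[OF p] g1 power_mult_distrib)
 then have 1: "Fn n = U - 1 / real p ^ 2 * U" unfolding infsum_cmult_right' U_def[symmetric] by simp
 have pn: "p * n > 0" using n p2 by simp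
 have g2: "gcd (p * n) d = gcd n d" if "d \<in> B" for d
 proof -
  have "coprime p d" using that p by (simp add: B_def prime_imp_coprime)
  then show ?thesis by (simp add: gcd_mult_left_left_cancel coprime_commute)
 qed
 have "Fn (p * n) = infsum (u n) B + infsum (\<lambda>d. - (1 / real p) * u n d) B"
  unfolding split[OF pn]
 proof (intro arg_cong2[where f = "(+)"] infsum_cong)
  fix d assume d: "d \<in> B"
  show "u (p * n) d = u n d" by (simp add: u_def g2[OF d])
  have "gcd (p * n) (p * d) = p * gcd n d" by (simp only: gcd_mult_distrib_nat)
  then show "u (p * n) (p * d) = - (1 / real p) * u n d"
   using d p2 by (simp add: u_def B_def mu_prime_mult[OF p] power_mult_distrib power2_eq_square)
 qed
 then have 2: "Fn (p * n) = U - 1 / real p * U" unfolding infsum_cmult_right' U_def[symmetric] by simp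
 have "(1 + 1 / real p) * Fn (p * n) = Fn n"
  unfolding 1 2 using p2 by (simp add: field_simps power2_eq_square)
 moreover have "1 + 1 / real p \<noteq> 0" by (rule less_imp_neq[THEN not_sym]) (simp add: add_pos_nonneg)
 ultimately have "Fn (p * n) = Fn n / (1 + 1 / real p)" by (metis nonzero_mult_div_cancel_left)
 then show ?thesis using False by simp
qed

lemma zeta2_nonzero: "zeta2 \<noteq> 0" using Fn_1 by auto

lemma Fn_eq: "n > 0 \<Longrightarrow> Fn n = 1 / (zeta2 * (\<Prod>l\<in>prime_factors n. 1 + 1 / real l))"
proof (induction n rule: prime_divisors_induct)
 case (unit x)
 then have "x = 1" by simp
 then show ?case using Fn_1 zeta2_nonzero by (simp add: eq_divide_eq)
next
 case (factor p n)
 then have n: "n > 0" and p: "prime p" by auto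
 note IH = factor(2)[OF n]
 have pf: "prime_factors (p * n) = insert p (prime_factors n)"
  using p n by (simp add: prime_factors_product prime_prime_factors)
 show ?case
 proof (cases "p dvd n")
  case True
  then have "p \<in> prime_factors n" using p n by (simp add: in_prime_factors_iff)
  then show ?thesis using True IH Fn_prime[OF p n] pf by (simp add: insert_absorb)
 next
  case False
  then have "p \<notin> prime_factors n" by auto
  then have "(\<Prod>l\<in>prime_factors (p * n). 1 + 1 / real l) = (1 + 1 / real p) * (\<Prod>l\<in>prime_factors n. 1 + 1 / real l)"
   unfolding pf by (subst prod.insert) auto
  then show ?thesis using False IH Fn_prime[OF p n] by (simp add: mult_ac)
 qed
qed simp

text \<open>Summing over \<open>d\<close> first produces \<open>Fn (k * f)\<close>. Regrouping by
  \<open>n = k * f\<close> leaves the sum of \<open>mu f * (n / f)\<close>, which is the totient,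
  and the product in \<open>Fn_eq\<close> supplies the remaining factor.\<close>

lemma msum_total: "infsum msum (({1..} \<times> {1..}) \<times> {1..}) = Q7 / zeta2"
proof -
 define g where "g = (\<lambda>(k, f). of_int (mu f) * real (T7 (k * f)) / (real k ^ 2 * real f ^ 3) * Fn (k * f))"
 have inner: "infsum (\<lambda>d. msum (z, d)) {1..} = g z" for z
 proof -
  obtain k f where z: "z = (k, f)" by fastforce
  have "msum (z, d) = (of_int (mu f) * real (T7 (k * f)) / (real k ^ 2 * real f ^ 3)) * (of_int (mu d) * real (gcd (k * f) d) / real d ^ 2)" for d
   by (simp add: msum_def trm_def z)
  then show ?thesis unfolding z g_def Fn_def by (simp only: infsum_cmult_right' prod.case)
 qed
 have "(\<lambda>z. infsum (\<lambda>d. msum (z, d)) {1..}) summable_on {1..} \<times> {1..}"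
  by (rule summable_on_Sigma_banach) (use msum_summable in \<open>simp add: case_prod_eta\<close>)
 then have gs: "g summable_on {1..} \<times> {1..}" unfolding inner .
 have "infsum msum (({1..} \<times> {1..}) \<times> {1..}) = infsum g ({1..} \<times> {1..})"
  unfolding inner[symmetric] by (rule infsum_Sigma_banach[OF msum_summable, symmetric])
 also have "\<dots> = infsum (\<lambda>n. \<Sum>f | f dvd n. g (n div f, f)) {1..}" by (rule infsum_divisors[OF gs])
 also have "\<dots> = infsum (\<lambda>n. real (totient n) * real (T7 n) / (real n ^ 3 * (\<Prod>l\<in>prime_factors n. 1 + 1 / real l)) * (1 / zeta2)) {1..}"
 proof (rule infsum_cong)
  fix n :: nat assume "n \<in> {1..}"
  then have n: "n > 0" by simp
  have "(\<Sum>f | f dvd n. g (n div f, f)) = (\<Sum>f | f dvd n. of_int (mu f * int (n div f)) * (real (T7 n) / real n ^ 3 * Fn n))"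
  proof (rule sum.cong)
   fix f assume "f \<in> {f. f dvd n}"
   then obtain k where k: "n = k * f" by (metis dvdE mem_Collect_eq mult.commute)
   then have kf: "k > 0" "f > 0" using n by auto
   then show "g (n div f, f) = of_int (mu f * int (n div f)) * (real (T7 n) / real n ^ 3 * Fn n)"
    by (simp add: g_def k field_simps eval_nat_numeral)
  qed simp
  also have "\<dots> = of_int (\<Sum>f | f dvd n. mu f * int (n div f)) * (real (T7 n) / real n ^ 3 * Fn n)"
   by (simp only: of_int_sum sum_distrib_right)
  also have "(\<Sum>f | f dvd n. mu f * int (n div f)) = int (totient n)" by (rule totient_mu[OF n, symmetric])
  also have "of_int (int (totient n)) * (real (T7 n) / real n ^ 3 * Fn n) =
    real (totient n) * real (T7 n) / (real n ^ 3 * (\<Prod>l\<in>prime_factors n. 1 + 1 / real l)) * (1 / zeta2)"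
   unfolding Fn_eq[OF n] by simp
  finally show "(\<Sum>f | f dvd n. g (n div f, f)) = \<dots>" .
 qed
 also have "\<dots> = Q7 * (1 / zeta2)" unfolding Q7_def by (simp only: infsum_cmult_left')
 finally show ?thesis by simp
qed

subsection \<open>Counting coprime pairs\<close>

text \<open>The cusps \<open>(1, 0)\<close>, \<open>(- 1, 0)\<close> and \<open>(- 7, 1)\<close> are
  not excluded here, so that the lattice count needs no case distinction.\<close>

definition Pf :: "real \<Rightarrow> (int \<times> int) set" where
 "Pf X = {(a, b). coprime a b \<and> b \<ge> 0 \<and> Mh (of_int a) (of_int b) \<le> X * real (tmd (Af a b) (Bf a b)) ^ 6}"

lemma coprime_not_zero: "coprime a b \<Longrightarrow> (a, b) \<noteq> (0, 0 :: int)" by auto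

text \<open>With \<open>e\<close> the defect, the pair lies in one of the lattices
  \<open>Lt t e 1\<close>, whose determinant is \<open>e ^ 3\<close>, and the lower bound for the
  form applies.\<close>

lemma tmd_cube:
 fixes a b :: int
 assumes cop: "coprime a b"
 shows "int (tmd (Af a b) (Bf a b)) ^ 3 \<le> kap * Cf a b" "tmd (Af a b) (Bf a b) > 0"
proof -
 define e where "e = tmd (Af a b) (Bf a b)"
 have nz: "Af a b \<noteq> 0 \<or> Bf a b \<noteq> 0" by (rule AB_not_both_zero[OF coprime_not_zero[OF cop]])
 show e0: "tmd (Af a b) (Bf a b) > 0" by (rule tmd_set(2)[OF nz])
 then have e0: "e > 0" by (simp add: e_def)
 have "card {t \<in> TS e. int e ^ 3 dvd a - t * b} = 1"
  using tmd_residues[OF cop e0] by (simp add: e_def)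
 then have "{t \<in> TS e. int e ^ 3 dvd a - t * b} \<noteq> {}" by (metis card.empty zero_neq_one)
 then obtain t where t: "t \<in> TS e" "int e ^ 3 dvd a - t * b" by blast
 then have "(a, b) \<in> Lt t e 1" by (simp add: Lt_def)
 from Lt_lat(4)[OF e0 _ this t(1) coprime_not_zero[OF cop]] show "int (tmd (Af a b) (Bf a b)) ^ 3 \<le> kap * Cf a b"
  by (simp add: e_def)
qed

lemma root6_scale: "X > 0 \<Longrightarrow> (X * real k ^ 6) powr (1 / 6) = X powr (1 / 6) * real k"
proof (cases "k = 0")
 case False
 assume "X > 0"
 moreover have "(real k ^ 6) powr (1 / 6) = real k"
  using False power_powr[of "real k" 6 "1 / 6"] by simp
 ultimately show ?thesis by (simp add: powr_mult)
qed simp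

lemma size_bounds:
 fixes a b :: int
 assumes X: "X > 0" and k: "k > 0" and M: "Mh (of_int a) (of_int b) \<le> X * real k ^ 6"
 shows "real_of_int (a ^ 2 + b ^ 2) \<le> Bd * X powr (1 / 6) * real k"
  "real_of_int (kap * Cf a b) \<le> 8 * of_int kap * Bd * X powr (1 / 6) * real k"
proof -
 have "(of_int a) ^ 2 + (of_int b) ^ 2 \<le> Bd * (X * real k ^ 6) powr (1 / 6)"
  using M X k by (intro Bd(2)) auto
 then show 1: "real_of_int (a ^ 2 + b ^ 2) \<le> Bd * X powr (1 / 6) * real k"
  by (simp add: root6_scale[OF X] mult_ac)
 have "real_of_int (Cf a b) = Cf (of_int a) (of_int b)" by (simp add: Cf_def)
 also have "\<dots> \<le> 8 * ((of_int a) ^ 2 + (of_int b) ^ 2)" by (rule Cf_upper)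
 also have "\<dots> \<le> 8 * (Bd * X powr (1 / 6) * real k)" using 1 by simp
 finally have "of_int kap * real_of_int (Cf a b) \<le> of_int kap * (8 * (Bd * X powr (1 / 6) * real k))"
  using kap_pos by (intro mult_left_mono) auto
 then show "real_of_int (kap * Cf a b) \<le> 8 * of_int kap * Bd * X powr (1 / 6) * real k" by (simp add: mult_ac)
qed

lemma cube_le_imp:
 fixes e :: nat and V :: real
 assumes "e > 0" "real e ^ 3 \<le> V * real e"
 shows "real e ^ 2 \<le> V"
proof -
 have "real e ^ 2 * real e \<le> V * real e" using assms(2) by (simp add: power3_eq_cube power2_eq_square)
 then show ?thesis using assms(1) by simp
qed

text \<open>The height bound gives a form value of order \<open>X powr (1 / 6) * e\<close>, while
  \<open>e ^ 3\<close> is at most a constant times that value; so one power of \<open>e\<close>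
  cancels.\<close>

lemma Pf_tmd:
 assumes X: "X > 0" and z: "(a, b) \<in> Pf X"
 shows "real (tmd (Af a b) (Bf a b)) ^ 2 \<le> 8 * of_int kap * Bd * X powr (1 / 6)"
proof -
 have cop: "coprime a b" and M: "Mh (of_int a) (of_int b) \<le> X * real (tmd (Af a b) (Bf a b)) ^ 6"
  using z by (auto simp: Pf_def)
 note t = tmd_cube[OF cop]
 have "real (tmd (Af a b) (Bf a b)) ^ 3 = of_int (int (tmd (Af a b) (Bf a b)) ^ 3)" by simp
 also have "\<dots> \<le> of_int (kap * Cf a b)" using t(1) by (simp only: of_int_le_iff)
 also have "\<dots> \<le> 8 * of_int kap * Bd * X powr (1 / 6) * real (tmd (Af a b) (Bf a b))"
  by (rule size_bounds(2)[OF X t(2) M])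
 finally show ?thesis by (rule cube_le_imp[OF t(2)])
qed

lemma box_finite: "finite {(a :: int, b :: int). real_of_int (a ^ 2 + b ^ 2) \<le> B}"
proof -
 have "{(a :: int, b :: int). real_of_int (a ^ 2 + b ^ 2) \<le> B} \<subseteq> {- \<lceil>B\<rceil>..\<lceil>B\<rceil>} \<times> {- \<lceil>B\<rceil>..\<lceil>B\<rceil>}"
 proof safe
  fix a b :: int assume h: "real_of_int (a ^ 2 + b ^ 2) \<le> B"
  have sq: "\<bar>x\<bar> \<le> x ^ 2" for x :: int
   using self_le_power[of "\<bar>x\<bar>" 2] by (cases "x = 0") auto
  have "a ^ 2 + b ^ 2 \<le> \<lceil>B\<rceil>" using h by linarith
  moreover have "\<bar>a\<bar> \<le> a ^ 2" "\<bar>b\<bar> \<le> b ^ 2" "a ^ 2 \<ge> 0" "b ^ 2 \<ge> 0" using sq by simp_all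
  ultimately have "\<bar>a\<bar> \<le> \<lceil>B\<rceil>" "\<bar>b\<bar> \<le> \<lceil>B\<rceil>" by linarith+
  then show "a \<in> {- \<lceil>B\<rceil>..\<lceil>B\<rceil>}" "b \<in> {- \<lceil>B\<rceil>..\<lceil>B\<rceil>}" by auto
 qed
 then show ?thesis by (rule finite_subset) simp
qed

lemma sum_mu_multiples:
 assumes e: "e > 0" "e \<le> Y" and k: "k > 0"
 shows "(\<Sum>f=1..Y. mu f * of_bool (k * f dvd e)) = of_bool (k = e)"
proof (cases "k dvd e")
 case True
 then obtain l where l: "e = k * l" by (rule dvdE)
 have l0: "l > 0" using e l by auto
 have "l \<le> Y" using e l k by (metis le_trans mult_le_mono1 nat_mult_1 Suc_leI One_nat_def)
 have "(\<Sum>f=1..Y. mu f * of_bool (k * f dvd e)) = (\<Sum>f | f dvd l. mu f)"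
 proof (rule sum.mono_neutral_cong_right)
  show "{f. f dvd l} \<subseteq> {1..Y}"
  proof
   fix f assume "f \<in> {f. f dvd l}"
   then have "f dvd l" by simp
   then have "f \<le> l" "f > 0" using l0 by (auto intro: dvd_imp_le Nat.gr0I)
   then show "f \<in> {1..Y}" using \<open>l \<le> Y\<close> by simp
  qed
 qed (use k in \<open>auto simp: l\<close>)
 also have "\<dots> = of_bool (l = 1)" by (rule sum_mu_divisors[OF l0])
 also have "(l = 1) = (k = e)" using k by (auto simp: l)
 finally show ?thesis .
next
 case False
 then have "\<not> k * f dvd e" for f by (meson dvd_mult_left)
 moreover have "k \<noteq> e" using False by auto
 ultimately show ?thesis by simp
qed

lemma sum_mu_gcd:
 fixes a b :: int
 assumes z: "(a, b) \<noteq> (0, 0)" and Y: "gcd a b \<le> int Y"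
 shows "(\<Sum>d=1..Y. mu d * of_bool (int d dvd a \<and> int d dvd b)) = of_bool (coprime a b)"
proof -
 define g where "g = nat (gcd a b)"
 have g: "int g = gcd a b" by (simp add: g_def)
 have "gcd a b > 0" using z by (auto simp: less_le)
 then have g0: "g > 0" using g by linarith
 have gY: "g \<le> Y" using Y g by linarith
 have "(\<Sum>d=1..Y. mu d * of_bool (int d dvd a \<and> int d dvd b)) = (\<Sum>d=1..Y. mu d * of_bool (1 * d dvd g))"
 proof (rule sum.cong)
  fix d
  have "int d dvd a \<and> int d dvd b \<longleftrightarrow> int d dvd int g" unfolding g by simp
  then show "mu d * of_bool (int d dvd a \<and> int d dvd b) = mu d * of_bool (1 * d dvd g)" by simp
 qed simp
 also have "\<dots> = of_bool (1 = g)" by (rule sum_mu_multiples[OF g0 gY]) simp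
 also have "(1 = g) = coprime a b" unfolding coprime_iff_gcd_eq_1 using g by linarith
 finally show ?thesis .
qed

text \<open>The condition \<open>tmd = k\<close> is detected by summing \<open>mu f\<close> over \<open>k f | tmd\<close>, and coprimality by
 summing \<open>mu d\<close> over common divisors \<open>d\<close>.\<close>

lemma count_identity:
 assumes X: "X > 0" and Y: "Y \<ge> 1" "real Y \<ge> 8 * of_int kap * Bd * X powr (1 / 6)"
 shows "finite (Pf X)"
  "int (card (Pf X)) = (\<Sum>((k, f), d)\<in>box3 Y. mu f * mu d * (\<Sum>t\<in>TS (k * f). int (lcount (Lt t (k * f) d) (X * real k ^ 6))))"
proof -
 define V where "V = 8 * of_int kap * Bd * X powr (1 / 6)"
 \<comment> \<open>A finite set that contains \<open>Pf X\<close> and all lattice points counted for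
   \<open>k \<le> Y\<close>, so that the summations can be interchanged.\<close>
 define U where "U = {(a, b). (a, b) \<noteq> (0, 0) \<and> (real_of_int a, real_of_int b) \<in> Rg (X * real Y ^ 6)}"
 have V: "V \<le> real Y" using Y by (simp add: V_def)
 have BV: "Bd * X powr (1 / 6) \<le> V"
 proof -
  have "1 * (Bd * X powr (1 / 6)) \<le> 8 * of_int kap * (Bd * X powr (1 / 6))"
   using kap_pos Bd(1) by (intro mult_right_mono) auto
  then show ?thesis by (simp add: V_def mult_ac)
 qed
 have UM: "b \<ge> 0" "Mh (of_int a) (of_int b) \<le> X * real Y ^ 6" "(a, b) \<noteq> (0, 0)" if "(a, b) \<in> U" for a b
  using that by (auto simp: U_def Rg_def)
 have Y0: "Y > 0" using Y by simp
 have finU: "finite U"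
 proof (rule finite_subset[OF _ box_finite[of "Bd * X powr (1 / 6) * real Y"]], safe)
  fix a b assume "(a, b) \<in> U"
  from size_bounds(1)[OF X Y0 UM(2)[OF this]] show "real_of_int (a ^ 2 + b ^ 2) \<le> Bd * X powr (1 / 6) * real Y" .
 qed
 have PU: "Pf X \<subseteq> U"
 proof safe
  fix a b assume z: "(a, b) \<in> Pf X"
  define e where "e = tmd (Af a b) (Bf a b)"
  have cop: "coprime a b" and b: "b \<ge> 0" and M: "Mh (of_int a) (of_int b) \<le> X * real e ^ 6"
   using z by (auto simp: Pf_def e_def)
  have "real e ^ 2 \<le> real Y" using Pf_tmd[OF X z] V unfolding e_def V_def by linarith
  also have "\<dots> \<le> real Y ^ 2" using Y by (intro self_le_power) auto
  finally have "real e \<le> real Y" by (rule power2_le_imp_le) simp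
  then have "X * real e ^ 6 \<le> X * real Y ^ 6" using X by (intro mult_left_mono power_mono) auto
  then show "(a, b) \<in> U" using M b coprime_not_zero[OF cop] by (simp add: U_def Rg_def)
 qed
 show "finite (Pf X)" by (rule finite_subset[OF PU finU])
 have ind: "of_bool (z \<in> Pf X) =
   (\<Sum>((k, f), d)\<in>box3 Y. mu f * mu d * (\<Sum>t\<in>TS (k * f). of_bool (z \<in> Lt t (k * f) d \<and> (real_of_int (fst z), real_of_int (snd z)) \<in> Rg (X * real k ^ 6))))"
  if z: "z \<in> U" for z
 proof -
  obtain a b where ab: "z = (a, b)" by fastforce
  note um = UM[OF z[unfolded ab]]
  note sb = size_bounds[OF X Y0 um(2)]
  define G where "G = (gcd a b)"
  \<comment> \<open>The square of the gcd is at most \<open>a ^ 2 + b ^ 2\<close>, hence at most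
    \<open>Y ^ 2\<close>; so the Moebius sum over \<open>d \<le> Y\<close> sees all common
    divisors.\<close>
  have gY: "gcd a b \<le> int Y"
  proof -
   have "G ^ 2 \<le> a ^ 2 + b ^ 2"
   proof (cases "a = 0")
    case True
    then show ?thesis by (simp add: G_def)
   next
    case False
    have "G ^ 2 dvd a ^ 2" unfolding G_def by (intro dvd_power_same) simp
    then have "G ^ 2 \<le> a ^ 2" using False by (intro zdvd_imp_le) auto
    then show ?thesis by (meson add_increasing2 zero_le_power2)
   qed
   then have "real_of_int (G ^ 2) \<le> real_of_int (a ^ 2 + b ^ 2)" by (simp only: of_int_le_iff)
   also have "\<dots> \<le> Bd * X powr (1 / 6) * real Y" by (rule sb(1))
   also have "\<dots> \<le> real Y * real Y" using BV V by (intro mult_right_mono) auto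
   finally have "real_of_int G ^ 2 \<le> real Y ^ 2" by (simp add: power2_eq_square)
   then have "real_of_int G \<le> real Y" by (rule power2_le_imp_le) simp
   then show ?thesis unfolding G_def by linarith
  qed
  define w where "w k = (of_bool (Mh (of_int a) (of_int b) \<le> X * real k ^ 6) :: int)" for k :: nat
  have "(\<Sum>((k, f), d)\<in>box3 Y. mu f * mu d * (\<Sum>t\<in>TS (k * f). of_bool (z \<in> Lt t (k * f) d \<and> (real_of_int (fst z), real_of_int (snd z)) \<in> Rg (X * real k ^ 6))))
   = (\<Sum>k=1..Y. \<Sum>f=1..Y. \<Sum>d=1..Y. (mu f * w k * int (card {t \<in> TS (k * f). int (k * f) ^ 3 dvd a - t * b})) * (mu d * of_bool (int d dvd a \<and> int d dvd b)))"
   unfolding sum_box prod.case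
  proof (intro sum.cong refl)
   fix k f d
   have "(\<Sum>t\<in>TS (k * f). of_bool (z \<in> Lt t (k * f) d \<and> (real_of_int (fst z), real_of_int (snd z)) \<in> Rg (X * real k ^ 6)) :: int)
    = (\<Sum>t\<in>TS (k * f). w k * of_bool (int d dvd a \<and> int d dvd b) * of_bool (int (k * f) ^ 3 dvd a - t * b))"
    by (intro sum.cong refl) (use um(1) in \<open>auto simp: ab Lt_def Rg_def w_def\<close>)
   also have "\<dots> = w k * of_bool (int d dvd a \<and> int d dvd b) * int (card {t \<in> TS (k * f). int (k * f) ^ 3 dvd a - t * b})"
    unfolding sum_distrib_left[symmetric] by (subst sum_of_bool_filter) auto
   finally show "mu f * mu d * (\<Sum>t\<in>TS (k * f). of_bool (z \<in> Lt t (k * f) d \<and> (real_of_int (fst z), real_of_int (snd z)) \<in> Rg (X * real k ^ 6)))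
    = (mu f * w k * int (card {t \<in> TS (k * f). int (k * f) ^ 3 dvd a - t * b})) * (mu d * of_bool (int d dvd a \<and> int d dvd b))"
    by (simp only: mult_ac)
  qed
  also have "\<dots> = (\<Sum>k=1..Y. \<Sum>f=1..Y. (mu f * w k * int (card {t \<in> TS (k * f). int (k * f) ^ 3 dvd a - t * b})) * of_bool (coprime a b))"
   unfolding sum_distrib_left[symmetric] sum_mu_gcd[OF um(3) gY] ..
  also have "\<dots> = of_bool (z \<in> Pf X)"
  proof (cases "coprime a b")
   case True
   define e where "e = tmd (Af a b) (Bf a b)"
   have e0: "e > 0" using tmd_cube(2)[OF True] by (simp add: e_def)
   \<comment> \<open>The defect is at most \<open>Y\<close>, since its cube is at most
     \<open>Y ^ 2\<close>; so the sums over \<open>k\<close> and \<open>f\<close> are not truncated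
     either.\<close>
   have "real e ^ 3 = of_int (int e ^ 3)" by simp
   also have "\<dots> \<le> of_int (kap * Cf a b)" using tmd_cube(1)[OF True] unfolding e_def by (simp only: of_int_le_iff)
   also have "\<dots> \<le> V * real Y" using sb(2) by (simp add: V_def)
   also have "\<dots> \<le> real Y * real Y" using V by (intro mult_right_mono) auto
   also have "\<dots> \<le> real Y ^ 3"
    using Y by (simp add: power3_eq_cube)
   finally have eY: "e \<le> Y" by simp
   have "(\<Sum>k=1..Y. \<Sum>f=1..Y. (mu f * w k * int (card {t \<in> TS (k * f). int (k * f) ^ 3 dvd a - t * b})) * of_bool (coprime a b))
    = (\<Sum>k=1..Y. w k * (\<Sum>f=1..Y. mu f * of_bool (k * f dvd e)))"
    unfolding sum_distrib_left
   proof (intro sum.cong refl)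
    fix k f assume "k \<in> {1..Y}" "f \<in> {1..Y}"
    then have "k * f > 0" by simp
    from tmd_residues[OF True this] show "(mu f * w k * int (card {t \<in> TS (k * f). int (k * f) ^ 3 dvd a - t * b})) * of_bool (coprime a b) = w k * (mu f * of_bool (k * f dvd e))"
     using True by (simp add: e_def)
   qed
   also have "\<dots> = (\<Sum>k=1..Y. w k * of_bool (k = e))"
    by (intro sum.cong refl arg_cong2[where f = "(*)"] sum_mu_multiples[OF e0 eY]) simp
   also have "\<dots> = (\<Sum>k\<in>{e}. w k)"
    by (rule sum.mono_neutral_cong_right) (use e0 eY in auto)
   also have "\<dots> = of_bool (z \<in> Pf X)"
    using True um(1) by (simp add: w_def Pf_def ab e_def)
   finally show ?thesis .
  qed (simp add: Pf_def ab)
  finally show ?thesis ..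
 qed
 have "int (card (Pf X)) = (\<Sum>z\<in>U. of_bool (z \<in> Pf X))"
 proof -
  have "{z \<in> U. z \<in> Pf X} = Pf X" using PU by blast
  then show ?thesis using sum_of_bool_filter[OF finU, of "\<lambda>z. z \<in> Pf X", where ?'a = int] by simp
 qed
 also have "\<dots> = (\<Sum>z\<in>U. \<Sum>((k, f), d)\<in>box3 Y. mu f * mu d * (\<Sum>t\<in>TS (k * f). of_bool (z \<in> Lt t (k * f) d \<and> (real_of_int (fst z), real_of_int (snd z)) \<in> Rg (X * real k ^ 6))))"
  by (intro sum.cong refl ind)
 also have "\<dots> = (\<Sum>x\<in>box3 Y. \<Sum>z\<in>U. (\<lambda>((k, f), d). mu f * mu d * (\<Sum>t\<in>TS (k * f). of_bool (z \<in> Lt t (k * f) d \<and> (real_of_int (fst z), real_of_int (snd z)) \<in> Rg (X * real k ^ 6)))) x)"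
  by (rule sum.swap)
 also have "\<dots> = (\<Sum>((k, f), d)\<in>box3 Y. mu f * mu d * (\<Sum>t\<in>TS (k * f). int (lcount (Lt t (k * f) d) (X * real k ^ 6))))"
 proof (rule sum.cong, rule refl)
  fix x assume x: "x \<in> box3 Y"
  obtain k f d where kfd: "x = ((k, f), d)" by (metis surj_pair)
  have k: "k \<le> Y" using x kfd by simp
  have RR: "Rg (X * real k ^ 6) \<subseteq> Rg (X * real Y ^ 6)"
  proof -
   have "X * real k ^ 6 \<le> X * real Y ^ 6" using X k by (intro mult_left_mono power_mono) auto
   then show ?thesis by (auto simp: Rg_def)
  qed
  have lc: "(\<Sum>z\<in>U. of_bool (z \<in> Lt t (k * f) d \<and> (real_of_int (fst z), real_of_int (snd z)) \<in> Rg (X * real k ^ 6))) = int (lcount (Lt t (k * f) d) (X * real k ^ 6))" for t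
  proof -
   have "{z \<in> U. z \<in> Lt t (k * f) d \<and> (real_of_int (fst z), real_of_int (snd z)) \<in> Rg (X * real k ^ 6)} =
    {(a, b). (a, b) \<in> Lt t (k * f) d \<and> (a, b) \<noteq> (0, 0) \<and> (of_int a, of_int b) \<in> Rg (X * real k ^ 6)}"
    using RR by (auto simp: U_def)
   then show ?thesis unfolding lcount_def by (subst sum_of_bool_filter[OF finU]) simp
  qed
  have "(\<Sum>z\<in>U. mu f * mu d * (\<Sum>t\<in>TS (k * f). of_bool (z \<in> Lt t (k * f) d \<and> (real_of_int (fst z), real_of_int (snd z)) \<in> Rg (X * real k ^ 6))))
   = mu f * mu d * (\<Sum>t\<in>TS (k * f). \<Sum>z\<in>U. of_bool (z \<in> Lt t (k * f) d \<and> (real_of_int (fst z), real_of_int (snd z)) \<in> Rg (X * real k ^ 6)))"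
   unfolding sum_distrib_left[symmetric] by (subst sum.swap) (rule refl)
  then show "(\<Sum>z\<in>U. (\<lambda>((k, f), d). mu f * mu d * (\<Sum>t\<in>TS (k * f). of_bool (z \<in> Lt t (k * f) d \<and> (real_of_int (fst z), real_of_int (snd z)) \<in> Rg (X * real k ^ 6)))) x)
   = (\<lambda>((k, f), d). mu f * mu d * (\<Sum>t\<in>TS (k * f). int (lcount (Lt t (k * f) d) (X * real k ^ 6)))) x"
   unfolding kfd prod.case lc .
 qed
 finally show "int (card (Pf X)) = (\<Sum>((k, f), d)\<in>box3 Y. mu f * mu d * (\<Sum>t\<in>TS (k * f). int (lcount (Lt t (k * f) d) (X * real k ^ 6))))" .
qed

text \<open>The error of each term is a square root of its main term. Weakening the exponent to
 \<open>1 / 2 + \<delta>\<close> makes the sum of the errors converge, at the price of a power of \<open>1 / \<delta>\<close>; the choice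
 \<open>\<delta> = log 2 / (2 log X)\<close> then yields the fifth power of the logarithm.\<close>

lemma Pf_error:
 obtains K where "K \<ge> 0" "\<And>X \<delta>. X > 0 \<Longrightarrow> 0 < \<delta> \<Longrightarrow> \<delta> \<le> 1 / 2 \<Longrightarrow>
  \<bar>real (card (Pf X)) - R7 * X powr (1 / 6) * (Q7 / zeta2)\<bar> \<le>
   K * (X powr (1 / 6)) powr (1 / 2 + \<delta>) * (1 + 1 / (2 * \<delta>)) ^ 5"
proof -
 have "real_of_int kap \<ge> 1" using kap_pos by simp
 from lattice_count[OF this] obtain K where K: "K \<ge> 0" and LC: "\<forall>u v Z \<delta>. ldet u v \<noteq> 0 \<longrightarrow> Z > 0 \<longrightarrow> 0 \<le> \<delta> \<longrightarrow> \<delta> \<le> 1 / 2 \<longrightarrow>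
   (\<forall>w \<in> lat u v. w \<noteq> (0, 0) \<longrightarrow> \<bar>real_of_int (ldet u v)\<bar> \<le> real_of_int kap * real_of_int (Cv w)) \<longrightarrow>
   \<bar>real (lcount (lat u v) Z) - R7 * (Z powr (1 / 6) / \<bar>of_int (ldet u v)\<bar>)\<bar> \<le>
    K * (Z powr (1 / 6) / \<bar>of_int (ldet u v)\<bar>) powr (1 / 2 + \<delta>)" by (elim exE conjE) (rule that)
 define K' where "K' = K * (of_int kap2 * 3 ^ 12)"
 have K'0: "K' \<ge> 0" using K kap2_pos by (simp add: K'_def)
 show ?thesis
 proof (rule that[OF K'0])
  fix X \<delta> :: real assume X: "X > 0" and \<delta>: "0 < \<delta>" "\<delta> \<le> 1 / 2"
  define x where "x = X powr (1 / 6)"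
  have x: "x > 0" using X by (simp add: x_def)
  \<comment> \<open>The identity holds for every sufficiently large \<open>Y\<close> with an error
    bound independent of \<open>Y\<close>. Letting \<open>Y\<close> grow turns the partial sum of
    main terms into its limit.\<close>
  have step: "\<bar>real (card (Pf X)) - R7 * x * sum msum (box3 Y)\<bar> \<le> K' * x powr (1 / 2 + \<delta>) * (1 + 1 / (2 * \<delta>)) ^ 5"
   if Y: "Y \<ge> 1" "real Y \<ge> 8 * of_int kap * Bd * X powr (1 / 6)" for Y
  proof -
   define L where "L = (\<lambda>((k, f), d). real_of_int (mu f * mu d) * (\<Sum>t\<in>TS (k * f). real (lcount (Lt t (k * f) d) (X * real k ^ 6))))"
   have "real (card (Pf X)) = real_of_int (int (card (Pf X)))" by simp
   also have "\<dots> = sum L (box3 Y)" unfolding count_identity(2)[OF X Y] L_def of_int_sum by (intro sum.cong) auto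
   finally have c: "real (card (Pf X)) = sum L (box3 Y)" .
   have pt: "\<bar>L z - R7 * x * msum z\<bar> \<le> K * x powr (1 / 2 + \<delta>) * trm (1 / 2 + \<delta>) z" if z: "z \<in> box3 Y" for z
   proof -
    obtain k f d where kfd: "z = ((k, f), d)" by (metis surj_pair)
    have pos: "k > 0" "f > 0" "d > 0" using z kfd by auto
    define n where "n = k * f"
    have n: "n > 0" using pos by (simp add: n_def)
    show ?thesis
    \<comment> \<open>Other \<open>d\<close> have Moebius weight zero, and squarefreeness gives the
      determinant the shape used in \<open>trm\<close>.\<close>
    proof (cases "squarefree d")
     case False
     then have "mu d = 0" by (simp add: mu_def)
     then show ?thesis using K x trm_nonneg[of "1 / 2 + \<delta>" z] by (simp add: L_def msum_def kfd mult_nonneg_nonneg)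
    next
     case True
     define m where "m = n ^ 3 div gcd (n ^ 3) d"
     define q where "q = real (gcd n d) / (real k ^ 2 * real f ^ 3 * real d ^ 2)"
     note Ltl = Lt_lat[OF n pos(3), folded m_def]
     have gm: "n ^ 3 = gcd n d * m" unfolding m_def gcd_cube_squarefree[OF True]
      by (metis dvd_mult_div_cancel gcd_cube_squarefree[OF True] gcd_dvd1)
     have g0: "gcd n d > 0" using n by simp
     have gmr: "real n ^ 3 = real (gcd n d) * real m" using gm by (metis of_nat_mult of_nat_power)
     have ratio: "(X * real k ^ 6) powr (1 / 6) / real (d ^ 2 * m) = x * q"
     proof -
      define r where "r = real (gcd n d)"
      have r: "r \<noteq> 0" using g0 by (simp add: r_def)
      have m: "real m = (real k * real f) ^ 3 / r" using gmr[folded r_def] r by (simp add: n_def nonzero_eq_divide_eq)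
      have "x * real k / (real d ^ 2 * ((real k * real f) ^ 3 / r)) = x * (r / (real k ^ 2 * real f ^ 3 * real d ^ 2))"
       using pos r by (simp add: field_simps eval_nat_numeral)
      then show ?thesis unfolding root6_scale[OF X] x_def[symmetric] of_nat_mult of_nat_power m q_def r_def[symmetric] .
     qed
     have each: "\<bar>real (lcount (Lt t n d) (X * real k ^ 6)) - R7 * (x * q)\<bar> \<le> K * (x * q) powr (1 / 2 + \<delta>)" if t: "t \<in> TS n" for t
     proof -
      have ld: "\<bar>real_of_int (ldet (int (d * m), 0) (int d * t, int d))\<bar> = real (d ^ 2 * m)"
       unfolding Ltl(3) by simp
      have "\<bar>real (lcount (lat (int (d * m), 0) (int d * t, int d)) (X * real k ^ 6)) - R7 * ((X * real k ^ 6) powr (1 / 6) / \<bar>of_int (ldet (int (d * m), 0) (int d * t, int d))\<bar>)\<bar> \<le>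
        K * ((X * real k ^ 6) powr (1 / 6) / \<bar>of_int (ldet (int (d * m), 0) (int d * t, int d))\<bar>) powr (1 / 2 + \<delta>)"
      proof (rule LC[rule_format])
       show "ldet (int (d * m), 0) (int d * t, int d) \<noteq> 0" unfolding Ltl(3) using pos Ltl(2) by simp
       show "X * real k ^ 6 > 0" using X pos by simp
       show "\<bar>real_of_int (ldet (int (d * m), 0) (int d * t, int d))\<bar> \<le> of_int kap * of_int (Cv w)"
        if w: "w \<in> lat (int (d * m), 0) (int d * t, int d)" "w \<noteq> (0, 0)" for w
       proof -
        have "int (d ^ 2 * m) \<le> kap * Cv w" by (rule Ltl(4)[OF w(1)[folded Ltl(1)] t w(2)])
        then have "real_of_int (int (d ^ 2 * m)) \<le> real_of_int (kap * Cv w)" by (simp only: of_int_le_iff)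
        then show "\<bar>real_of_int (ldet (int (d * m), 0) (int d * t, int d))\<bar> \<le> of_int kap * of_int (Cv w)" unfolding ld by simp
       qed
      qed (use \<delta> in auto)
      then show ?thesis unfolding ld ratio Ltl(1)[symmetric] .
     qed
     have mm: "\<bar>real_of_int (mu f * mu d)\<bar> \<le> 1"
     proof -
      have "\<bar>mu f * mu d\<bar> \<le> 1 * 1" unfolding abs_mult by (intro mult_mono mu_abs) auto
      then show ?thesis by linarith
     qed
     have ms: "msum z = real_of_int (mu f * mu d) * (real (T7 n) * q)"
      by (simp add: msum_def trm_def kfd q_def n_def)
     have Lz: "L z = real_of_int (mu f * mu d) * (\<Sum>t\<in>TS n. real (lcount (Lt t n d) (X * real k ^ 6)))"
      by (simp only: L_def kfd prod.case n_def)
     have Lm: "L z - R7 * x * msum z = real_of_int (mu f * mu d) * (\<Sum>t\<in>TS n. real (lcount (Lt t n d) (X * real k ^ 6)) - R7 * (x * q))"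
     proof -
      have su: "(\<Sum>t\<in>TS n. real (lcount (Lt t n d) (X * real k ^ 6)) - R7 * (x * q)) =
        (\<Sum>t\<in>TS n. real (lcount (Lt t n d) (X * real k ^ 6))) - real (T7 n) * (R7 * (x * q))"
       by (simp only: sum_subtractf sum_constant T7_TS)
      have gen: "c * S - R7 * x * (c * (T * q)) = c * (S - T * (R7 * (x * q)))" for c S T :: real
       by (simp add: algebra_simps)
      show ?thesis unfolding Lz ms su by (rule gen)
     qed
     have "\<bar>L z - R7 * x * msum z\<bar> \<le> 1 * \<bar>\<Sum>t\<in>TS n. real (lcount (Lt t n d) (X * real k ^ 6)) - R7 * (x * q)\<bar>"
      unfolding Lm abs_mult[of "real_of_int (mu f * mu d)"] by (rule mult_right_mono[OF mm abs_ge_zero])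
     also have "\<dots> \<le> (\<Sum>t\<in>TS n. \<bar>real (lcount (Lt t n d) (X * real k ^ 6)) - R7 * (x * q)\<bar>)" by simp
     also have "\<dots> \<le> (\<Sum>t\<in>TS n. K * (x * q) powr (1 / 2 + \<delta>))" by (intro sum_mono each)
     also have "\<dots> = K * x powr (1 / 2 + \<delta>) * trm (1 / 2 + \<delta>) z"
     proof -
      have tz: "trm (1 / 2 + \<delta>) z = real (T7 n) * q powr (1 / 2 + \<delta>)"
       by (simp only: trm_def kfd prod.case n_def q_def)
      have xq: "(x * q) powr (1 / 2 + \<delta>) = x powr (1 / 2 + \<delta>) * q powr (1 / 2 + \<delta>)"
       by (rule powr_mult)
      show ?thesis unfolding tz xq sum_constant T7_TS by (simp only: mult_ac)
     qed
     finally show ?thesis .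
    qed
   qed
   have "\<bar>real (card (Pf X)) - R7 * x * sum msum (box3 Y)\<bar> = \<bar>\<Sum>z\<in>box3 Y. L z - R7 * x * msum z\<bar>"
    unfolding c by (simp only: sum_subtractf sum_distrib_left)
   also have "\<dots> \<le> (\<Sum>z\<in>box3 Y. K * x powr (1 / 2 + \<delta>) * trm (1 / 2 + \<delta>) z)"
    by (rule order_trans[OF sum_abs sum_mono[OF pt]])
   also have "\<dots> = K * x powr (1 / 2 + \<delta>) * sum (trm (1 / 2 + \<delta>)) (box3 Y)" by (simp only: sum_distrib_left)
   also have "\<dots> \<le> K * x powr (1 / 2 + \<delta>) * (of_int kap2 * 3 ^ 12 * (1 + 1 / (2 * \<delta>)) ^ 5)"
    using K by (intro mult_left_mono trm_sum \<delta>(1)) auto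
   also have "\<dots> = K' * x powr (1 / 2 + \<delta>) * (1 + 1 / (2 * \<delta>)) ^ 5" by (simp add: K'_def mult_ac)
   finally show ?thesis .
  qed
  have "(\<lambda>Y. \<bar>real (card (Pf X)) - R7 * x * sum msum (box3 Y)\<bar>) \<longlonglongrightarrow> \<bar>real (card (Pf X)) - R7 * x * (Q7 / zeta2)\<bar>"
   unfolding msum_total[symmetric] by (intro tendsto_intros msum_limit)
  then show "\<bar>real (card (Pf X)) - R7 * X powr (1 / 6) * (Q7 / zeta2)\<bar> \<le> K' * (X powr (1 / 6)) powr (1 / 2 + \<delta>) * (1 + 1 / (2 * \<delta>)) ^ 5"
   unfolding x_def[symmetric]
  proof (rule LIMSEQ_le_const2)
   define N where "N = max 1 (nat \<lceil>8 * of_int kap * Bd * x\<rceil>)"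
   have YN: "Y \<ge> 1 \<and> real Y \<ge> 8 * of_int kap * Bd * x" if "Y \<ge> N" for Y
   proof
    show "Y \<ge> 1" using that by (simp add: N_def)
    have "nat \<lceil>8 * of_int kap * Bd * x\<rceil> \<le> Y" using that by (simp add: N_def)
    then show "real Y \<ge> 8 * of_int kap * Bd * x" by linarith
   qed
   show "\<exists>N. \<forall>Y\<ge>N. \<bar>real (card (Pf X)) - R7 * x * sum msum (box3 Y)\<bar> \<le> K' * x powr (1 / 2 + \<delta>) * (1 + 1 / (2 * \<delta>)) ^ 5"
   proof (intro exI[of _ N] allI impI)
    fix Y assume Y: "Y \<ge> N"
    show "\<bar>real (card (Pf X)) - R7 * x * sum msum (box3 Y)\<bar> \<le> K' * x powr (1 / 2 + \<delta>) * (1 + 1 / (2 * \<delta>)) ^ 5"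
     by (rule step[OF conjunct1[OF YN[OF Y]] conjunct2[OF YN[OF Y], unfolded x_def]])
   qed
  qed
 qed
qed

lemma Pf_count:
 obtains K where "K \<ge> 0" "\<And>X. X \<ge> 2 \<Longrightarrow>
  \<bar>real (card (Pf X)) - c7_tw * X powr (1 / 6)\<bar> \<le> K * (X powr (1 / 12) * ln X ^ 5)"
proof -
 obtain K where K: "K \<ge> 0" and E: "\<And>X \<delta>. X > 0 \<Longrightarrow> 0 < \<delta> \<Longrightarrow> \<delta> \<le> 1 / 2 \<Longrightarrow>
  \<bar>real (card (Pf X)) - R7 * X powr (1 / 6) * (Q7 / zeta2)\<bar> \<le>
   K * (X powr (1 / 6)) powr (1 / 2 + \<delta>) * (1 + 1 / (2 * \<delta>)) ^ 5" by (rule Pf_error) (rule that)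
 show ?thesis
 proof (rule that[of "K * 2 * 4 ^ 5"])
  show "K * 2 * 4 ^ 5 \<ge> 0" using K by simp
  fix X :: real assume X: "X \<ge> 2"
  \<comment> \<open>At \<open>X = 2\<close> this is the largest admissible value 1/2, and
    \<open>X powr \<delta>\<close> is always the square root of 2.\<close>
  define \<delta> where "\<delta> = ln 2 / (2 * ln X)"
  have lX: "ln X \<ge> ln 2" using X by simp
  have l2: "ln (2 :: real) > 0" by simp
  have lX0: "ln X > 0" using lX l2 by linarith
  have d: "0 < \<delta>" "\<delta> \<le> 1 / 2" using lX l2 lX0 unfolding \<delta>_def by (simp_all add: divide_le_eq)
  have "exp (1 / 2) \<le> (2 :: real)" using exp_bound[of "1 / 2"] by (simp add: power2_eq_square)
  then have l2': "ln (2 :: real) \<ge> 1 / 2" by (rule ln_ge_iff[THEN iffD2, rotated]) simp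
  have "1 + 1 / (2 * \<delta>) = 1 + ln X / ln 2" using lX l2 by (simp add: \<delta>_def)
  also have "\<dots> \<le> ln X / ln 2 + ln X / ln 2" using lX l2 by (simp add: field_simps)
  also have "\<dots> \<le> 4 * ln X"
  proof -
   have "ln X \<le> 2 * ln 2 * ln X" using lX l2 l2' mult_right_mono[of 1 "2 * ln 2" "ln X"] by simp
   then have "ln X / ln 2 \<le> 2 * ln X" using l2 by (simp add: field_simps)
   then show ?thesis by simp
  qed
  finally have "(1 + 1 / (2 * \<delta>)) ^ 5 \<le> (4 * ln X) ^ 5" using d by (intro power_mono) auto
  then have 1: "(1 + 1 / (2 * \<delta>)) ^ 5 \<le> 4 ^ 5 * ln X ^ 5" by (simp only: power_mult_distrib)
  have "(X powr (1 / 6)) powr (1 / 2 + \<delta>) = X powr (1 / 12) * X powr (\<delta> / 6)"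
   by (simp add: powr_powr powr_add[symmetric] field_simps)
  then have x1: "(X powr (1 / 6)) powr (1 / 2 + \<delta>) = X powr (1 / 12) * X powr (\<delta> / 6)" .
  have "X powr (\<delta> / 6) = exp (ln 2 / 12)" using X lX0 by (simp add: powr_def \<delta>_def)
  also have "\<dots> \<le> exp (ln (2 :: real))" using l2 by (simp only: exp_le_cancel_iff)
  also have "exp (ln (2 :: real)) = 2" by simp
  finally have 2: "(X powr (1 / 6)) powr (1 / 2 + \<delta>) \<le> X powr (1 / 12) * 2"
   unfolding x1 by (rule mult_left_mono) simp
  have "\<bar>real (card (Pf X)) - R7 * X powr (1 / 6) * (Q7 / zeta2)\<bar> \<le> K * (X powr (1 / 6)) powr (1 / 2 + \<delta>) * (1 + 1 / (2 * \<delta>)) ^ 5"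
   using X by (intro E d) auto
  also have "\<dots> \<le> K * (X powr (1 / 12) * 2) * (4 ^ 5 * ln X ^ 5)"
   using K 1 2 d by (intro mult_mono mult_left_mono) auto
  also have "\<dots> = K * 2 * 4 ^ 5 * (X powr (1 / 12) * ln X ^ 5)" by (simp add: mult_ac)
  also have "R7 * X powr (1 / 6) * (Q7 / zeta2) = c7_tw * X powr (1 / 6)" by (simp add: c7_tw_def)
  finally show "\<bar>real (card (Pf X)) - c7_tw * X powr (1 / 6)\<bar> \<le> K * 2 * 4 ^ 5 * (X powr (1 / 12) * ln X ^ 5)" .
 qed
qed

subsection \<open>Twist classes and the twist height\<close>

lemma curve_scale_disc:
 fixes A B c :: rat
 shows "4 * (c ^ 2 * A) ^ 3 + 27 * (c ^ 3 * B) ^ 2 = c ^ 6 * (4 * A ^ 3 + 27 * B ^ 2)"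
 by (simp add: power_mult_distrib distrib_left flip: power_mult)

text \<open>The scaling by \<open>u ^ 4\<close> and \<open>u ^ 6\<close> of an isomorphism is a
  twist by \<open>u ^ 2\<close> and merges with the twisting factor.\<close>

lemma twist_equivalence_iff:
 "(E, E') \<in> twist_equivalence \<longleftrightarrow> E \<in> elliptic_curves \<and> E' \<in> elliptic_curves \<and>
   (\<exists>c. c \<noteq> 0 \<and> fst E' = c ^ 2 * fst E \<and> snd E' = c ^ 3 * snd E)"
proof -
 obtain A B where E: "E = (A, B)" by (rule prod.exhaust)
 have "(\<exists>c. c \<noteq> 0 \<and> isomorphic_over_Q E' (quadratic_twist c E)) \<longleftrightarrow>
   (\<exists>c. c \<noteq> 0 \<and> fst E' = c ^ 2 * A \<and> snd E' = c ^ 3 * B)" if E': "E' \<in> elliptic_curves"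
 proof
  assume "\<exists>c. c \<noteq> 0 \<and> isomorphic_over_Q E' (quadratic_twist c E)"
  then obtain c where c: "c \<noteq> 0" and iso: "isomorphic_over_Q E' (quadratic_twist c E)" by (elim exE conjE) (rule that)
  obtain u where u: "u \<noteq> 0" "c ^ 2 * A = u ^ 4 * fst E'" "c ^ 3 * B = u ^ 6 * snd E'"
   using iso unfolding isomorphic_over_Q_iff[OF E'] E quadratic_twist.simps fst_conv snd_conv by (elim exE conjE) (rule that)
  have "fst E' = (c / u ^ 2) ^ 2 * A"
   using u(1,2) by (simp add: field_simps flip: power_mult)
  moreover have "snd E' = (c / u ^ 2) ^ 3 * B"
   using u(1,3) by (simp add: field_simps flip: power_mult)
  moreover have "c / u ^ 2 \<noteq> 0" using c u by simp
  ultimately show "\<exists>c. c \<noteq> 0 \<and> fst E' = c ^ 2 * A \<and> snd E' = c ^ 3 * B" by (intro exI[of _ "c / u ^ 2"] conjI)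
 next
  assume "\<exists>c. c \<noteq> 0 \<and> fst E' = c ^ 2 * A \<and> snd E' = c ^ 3 * B"
  then obtain c where c: "c \<noteq> 0" "fst E' = c ^ 2 * A" "snd E' = c ^ 3 * B" by (elim exE conjE) (rule that)
  have "isomorphic_over_Q E' (quadratic_twist c E)"
   unfolding isomorphic_over_Q_iff[OF E'] using c by (intro exI[of _ 1]) (simp add: E)
  then show "\<exists>c. c \<noteq> 0 \<and> isomorphic_over_Q E' (quadratic_twist c E)" using c(1) by (intro exI[of _ c] conjI)
 qed
 then show ?thesis unfolding twist_equivalence_def by (simp add: E cong: conj_cong)
qed

lemma twist_class_equiv: "equiv elliptic_curves twist_equivalence"
proof (rule equivI)
 show "twist_equivalence \<subseteq> elliptic_curves \<times> elliptic_curves" by (auto simp: twist_equivalence_def)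
 show "refl_on elliptic_curves twist_equivalence"
  by (rule refl_onI) (simp add: twist_equivalence_iff, intro exI[of _ 1], simp)
 show "sym twist_equivalence"
 proof (rule symI)
  fix E E' assume "(E, E') \<in> twist_equivalence"
  then obtain c where c: "E \<in> elliptic_curves" "E' \<in> elliptic_curves" "c \<noteq> 0" "fst E' = c ^ 2 * fst E" "snd E' = c ^ 3 * snd E"
   unfolding twist_equivalence_iff by (elim exE conjE) (rule that)
  then show "(E', E) \<in> twist_equivalence" unfolding twist_equivalence_iff
   by (intro conjI exI[of _ "1 / c"]) (simp_all add: field_simps)
 qed
 show "trans twist_equivalence"
 proof (rule transI)
  fix E F G assume "(E, F) \<in> twist_equivalence" "(F, G) \<in> twist_equivalence"
  then obtain c d where c: "E \<in> elliptic_curves" "G \<in> elliptic_curves" "c \<noteq> 0" "fst F = c ^ 2 * fst E" "snd F = c ^ 3 * snd E"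
   "d \<noteq> 0" "fst G = d ^ 2 * fst F" "snd G = d ^ 3 * snd F"
   unfolding twist_equivalence_iff by (elim exE conjE) (rule that)
  then show "(E, G) \<in> twist_equivalence" unfolding twist_equivalence_iff
   by (intro conjI exI[of _ "d * c"]) (simp_all add: power_mult_distrib)
 qed
qed

lemma tmd_scale:
 assumes nz: "A \<noteq> 0 \<or> B \<noteq> 0" and p: "p > 0"
 shows "tmd (int p ^ 2 * A) (int p ^ 3 * B) = p * tmd A B"
proof (rule dvd_antisym)
 have nz': "int p ^ 2 * A \<noteq> 0 \<or> int p ^ 3 * B \<noteq> 0" using nz p by simp
 have pt: "p * tmd A B > 0" using p tmd_set(2)[OF nz] by simp
 show "p * tmd A B dvd tmd (int p ^ 2 * A) (int p ^ 3 * B)"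
  unfolding dvd_tmd_iff[OF nz' pt] using tmd_set(3,4)[OF nz] by (simp add: power_mult_distrib mult_dvd_mono)
 let ?t = "tmd (int p ^ 2 * A) (int p ^ 3 * B)"
 have "p dvd ?t" unfolding dvd_tmd_iff[OF nz' p] by simp
 then obtain r where r: "?t = p * r" by (rule dvdE)
 have r0: "r > 0" using tmd_set(2)[OF nz'] r by (cases r) auto
 have "int r ^ 2 dvd A" "int r ^ 3 dvd B"
  using tmd_set(3,4)[OF nz'] p unfolding r by (simp_all add: power_mult_distrib)
 then have "r dvd tmd A B" unfolding dvd_tmd_iff[OF nz r0] by simp
 then show "?t dvd p * tmd A B" unfolding r by simp
qed

lemma tmd_minus: "tmd A (- B) = tmd A B" by (simp add: tmd_def)

lemma HH_scale: "HH (c ^ 2 * A) (c ^ 3 * B) = \<bar>c\<bar> ^ 6 * HH A B" for c :: int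
proof -
 have "\<bar>4 * (c ^ 2 * A) ^ 3\<bar> = \<bar>c\<bar> ^ 6 * \<bar>4 * A ^ 3\<bar>" "\<bar>27 * (c ^ 3 * B) ^ 2\<bar> = \<bar>c\<bar> ^ 6 * \<bar>27 * B ^ 2\<bar>"
  by (simp_all add: abs_mult power_mult_distrib power_abs flip: power_mult)
 then show ?thesis by (simp add: HH_def max_mult_distrib_left)
qed

lemma twht_scale:
 fixes c :: int
 assumes nz: "A \<noteq> 0 \<or> B \<noteq> 0" and c: "c \<noteq> 0"
 shows "twht (c ^ 2 * A) (c ^ 3 * B) = twht A B"
proof -
 define p where "p = nat \<bar>c\<bar>"
 have p: "p > 0" "int p = \<bar>c\<bar>" using c by (simp_all add: p_def)
 have "c ^ 2 * A = int p ^ 2 * A" "c ^ 3 * B = int p ^ 3 * B \<or> c ^ 3 * B = - (int p ^ 3 * B)"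
  unfolding p(2) by (simp_all add: abs_if)
 then have "tmd (c ^ 2 * A) (c ^ 3 * B) = p * tmd A B"
  using tmd_scale[OF nz p(1)] by (auto simp: tmd_minus)
 then have t: "real (tmd (c ^ 2 * A) (c ^ 3 * B)) ^ 6 = real p ^ 6 * real (tmd A B) ^ 6" by (simp add: power_mult_distrib)
 have "real_of_int (HH (c ^ 2 * A) (c ^ 3 * B)) = real p ^ 6 * real_of_int (HH A B)"
  unfolding HH_scale p(2)[symmetric] by simp
 then show ?thesis unfolding twht_def t using p by simp
qed

text \<open>Writing \<open>c = p / q\<close> makes both models integral twists of a common one, and
  integral twists multiply the height and the sixth power of the defect alike.\<close>

lemma twht_twist:
 fixes c :: rat
 assumes nz: "A \<noteq> 0 \<or> B \<noteq> 0" and c: "c \<noteq> 0"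
  and e: "of_int A' = c ^ 2 * of_int A" "of_int B' = c ^ 3 * of_int B"
 shows "twht A' B' = twht A B"
proof -
 obtain p q where pq: "c = of_int p / of_int q" "q \<noteq> 0" by (metis Rat_cases Fract_of_int_quotient less_numeral_extra(3))
 have p: "p \<noteq> 0" using c pq by auto
 have "of_int q ^ 2 * of_int A' = (of_int p ^ 2 * of_int A :: rat)" "of_int q ^ 3 * of_int B' = (of_int p ^ 3 * of_int B :: rat)"
  unfolding e pq(1) using pq(2) by (simp_all add: power_divide)
 then have "of_int (q ^ 2 * A') = (of_int (p ^ 2 * A) :: rat)" "of_int (q ^ 3 * B') = (of_int (p ^ 3 * B) :: rat)" by simp_all
 then have eq: "q ^ 2 * A' = p ^ 2 * A" "q ^ 3 * B' = p ^ 3 * B" by (simp_all only: of_int_eq_iff)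
 have nz': "A' \<noteq> 0 \<or> B' \<noteq> 0" using eq nz p pq(2) by auto
 have "twht A' B' = twht (q ^ 2 * A') (q ^ 3 * B')" by (rule twht_scale[OF nz' pq(2), symmetric])
 also have "\<dots> = twht A B" unfolding eq by (rule twht_scale[OF nz p])
 finally show ?thesis .
qed

text \<open>The definition refers to integral models isomorphic to \<open>E\<close>; this allows any
  integral quadratic twist to be used for computing the height.\<close>

lemma twist_height_eq:
 fixes c :: rat
 assumes E: "E \<in> elliptic_curves" and c: "c \<noteq> 0"
  and e: "of_int A = c ^ 2 * fst E" "of_int B = c ^ 3 * snd E"
 shows "twist_height E = twht A B"
proof -
 have nE: "fst E \<noteq> 0 \<or> snd E \<noteq> 0" using E unfolding elliptic_curves_def by (cases E) auto
 have nz: "A \<noteq> 0 \<or> B \<noteq> 0"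
 proof -
  have "(of_int A :: rat) \<noteq> 0 \<or> (of_int B :: rat) \<noteq> 0" unfolding e using nE c by simp
  then show ?thesis by simp
 qed
 have all: "twht A' B' = twht A B" if iso: "isomorphic_over_Q E (of_int A', of_int B')" for A' B'
 proof -
  obtain u where u: "u \<noteq> 0" "of_int A' = u ^ 4 * fst E" "of_int B' = u ^ 6 * snd E"
   using iso unfolding isomorphic_over_Q_iff[OF E] fst_conv snd_conv by (elim exE conjE) (rule that)
  show ?thesis
  proof (rule twht_twist[OF nz, of "u ^ 2 / c"])
   show "u ^ 2 / c \<noteq> 0" using u c by simp
   show "of_int A' = (u ^ 2 / c) ^ 2 * of_int A" "of_int B' = (u ^ 2 / c) ^ 3 * of_int B"
    unfolding u(2,3) e using c by (simp_all add: power_divide flip: power_mult)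
  qed
 qed
 have ex: "\<exists>A' B'. isomorphic_over_Q E (of_int A', of_int B')"
 proof -
  obtain a1 b1 where a: "fst E = of_int a1 / of_int b1" "b1 \<noteq> 0" by (metis Rat_cases Fract_of_int_quotient less_numeral_extra(3))
  obtain a2 b2 where b: "snd E = of_int a2 / of_int b2" "b2 \<noteq> 0" by (metis Rat_cases Fract_of_int_quotient less_numeral_extra(3))
  define N where "N = b1 * b2"
  have "isomorphic_over_Q E (of_int (N ^ 3 * b2 * a1), of_int (N ^ 5 * b1 * a2))"
   unfolding isomorphic_over_Q_iff[OF E]
  proof (intro exI[of _ "of_int N"] conjI)
   show "of_int N \<noteq> (0 :: rat)" using a b by (simp add: N_def)
   show "fst (of_int (N ^ 3 * b2 * a1), of_int (N ^ 5 * b1 * a2)) = of_int N ^ 4 * fst E"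
    unfolding a(1) N_def using a(2) by (simp add: eval_nat_numeral)
   show "snd (of_int (N ^ 3 * b2 * a1), of_int (N ^ 5 * b1 * a2)) = of_int N ^ 6 * snd E"
    unfolding b(1) N_def using b(2) by (simp add: eval_nat_numeral)
  qed
  then show ?thesis by (intro exI)
 qed
 show ?thesis unfolding twist_height_def
 proof (rule the_equality)
  obtain A' B' where "isomorphic_over_Q E (of_int A', of_int B')" using ex by (elim exE) (rule that)
  then show "\<exists>A' B'. isomorphic_over_Q E (of_int A', of_int B') \<and> twht A B = twht A' B'"
   using all by (intro exI[of _ A'] exI[of _ B'] conjI) (auto simp: all)
  fix h assume "\<exists>A B. isomorphic_over_Q E (rat_of_int A, rat_of_int B) \<and> h = twht A B"
  then show "h = twht A B" by (elim exE conjE) (simp only: all)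
 qed
qed

subsection \<open>The family by coprime pairs\<close>

definition Ecur :: "int \<times> int \<Rightarrow> curve" where
 "Ecur z = (of_int (Af (fst z) (snd z)), of_int (Bf (fst z) (snd z)))"

text \<open>The change of coordinate between the two descriptions:
  \<open>s = (8 t + 7) / (t + 7)\<close> with \<open>t = a / b\<close>. Clearing denominators turns
  \<open>sC\<close>, \<open>sQ\<close>, \<open>sR\<close> into \<open>49 * Cf\<close>,
  \<open>Qf\<close> and \<open>- 7 * Rf\<close>, which determines the twisting factor.\<close>

lemma Ecur_sAB:
 fixes a b s :: rat
 assumes w: "a + 7 * b \<noteq> 0" and s: "s = (8 * a + 7 * b) / (a + 7 * b)"
 shows "Af a b = (- ((a + 7 * b) ^ 2) / 7) ^ 2 * sA s" "Bf a b = (- ((a + 7 * b) ^ 2) / 7) ^ 3 * sB s"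
proof -
 define w where "w = a + 7 * b"
 have sw: "s * w = 8 * a + 7 * b" unfolding s w_def using assms(1) by (rule nonzero_eq_divide_eq[THEN iffD1, OF _ refl])
 have "w ^ 2 * sC s = (s * w) ^ 2 - 3 * (s * w) * w + 9 * w ^ 2" by (simp add: sC_def power2_eq_square algebra_simps)
 then have C: "w ^ 2 * sC s = 49 * Cf a b" unfolding sw by (simp add: w_def Cf_def power2_eq_square algebra_simps)
 have "w ^ 2 * sQ s = (s * w) ^ 2 - 11 * (s * w) * w + 25 * w ^ 2" by (simp add: sQ_def power2_eq_square algebra_simps)
 then have Q: "w ^ 2 * sQ s = Qf a b" unfolding sw by (simp add: w_def Qf_def power2_eq_square algebra_simps)
 have "w ^ 4 * sR s = (s * w) ^ 4 - 18 * (s * w) ^ 3 * w + 111 * (s * w) ^ 2 * w ^ 2 - 298 * (s * w) * w ^ 3 + 393 * w ^ 4"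
  by (simp add: sR_def eval_nat_numeral algebra_simps)
 then have R: "w ^ 4 * sR s = - 7 * Rf a b" unfolding sw by (simp add: w_def Rf_def eval_nat_numeral algebra_simps)
 have "(- (w ^ 2) / 7) ^ 2 * sA s = - (3 / 49) * ((w ^ 2 * sC s) * (w ^ 2 * sQ s))"
  by (simp add: sA_def power2_eq_square)
 also have "\<dots> = Af a b" unfolding C Q by (simp add: Af_def)
 finally show "Af a b = (- ((a + 7 * b) ^ 2) / 7) ^ 2 * sA s" by (simp add: w_def)
 have "(- (w ^ 2) / 7) ^ 3 * sB s = - (2 / 343) * ((w ^ 2 * sC s) * (w ^ 4 * sR s))"
  by (simp add: sB_def eval_nat_numeral)
 also have "\<dots> = Bf a b" unfolding C R by (simp add: Bf_def)
 finally show "Bf a b = (- ((a + 7 * b) ^ 2) / 7) ^ 3 * sB s" by (simp add: w_def)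
qed

text \<open>The excluded pairs are the cusps: \<open>b = 0\<close> corresponds to
  \<open>s = 8\<close> and \<open>a = - 7 b\<close> to an infinite \<open>s\<close>.\<close>

lemma Ecur_family:
 assumes w: "a + 7 * b \<noteq> 0" and b: "b \<noteq> 0"
 obtains s :: rat where "s = (8 * of_int a + 7 * of_int b) / (of_int a + 7 * of_int b)" "s \<noteq> 8"
  "Ecur (a, b) \<in> elliptic_curves" "((sA s, sB s), Ecur (a, b)) \<in> twist_equivalence"
proof -
 define s :: rat where "s = (8 * of_int a + 7 * of_int b) / (of_int a + 7 * of_int b)"
 have "of_int (a + 7 * b) \<noteq> (0 :: rat)" unfolding of_int_eq_0_iff by (rule w)
 then have w': "of_int a + 7 * of_int b \<noteq> (0 :: rat)" by simp
 have s8: "s \<noteq> 8"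
 proof
  assume "s = 8"
  then have "8 * of_int a + 7 * of_int b = 8 * (of_int a + 7 * of_int b :: rat)" using w' by (simp add: s_def divide_eq_eq)
  then show False using b by simp
 qed
 define c :: rat where "c = - ((of_int a + 7 * of_int b) ^ 2) / 7"
 have c: "c \<noteq> 0" using w' by (simp add: c_def)
 have f: "fst (Ecur (a, b)) = c ^ 2 * sA s" "snd (Ecur (a, b)) = c ^ 3 * sB s"
  using Ecur_sAB[OF w' s_def] unfolding c_def
  by (simp_all add: Ecur_def Af_def Bf_def Cf_def Qf_def Rf_def)
 have eS: "(sA s, sB s) \<in> elliptic_curves" by (rule family_admits_isogeny(1)[OF s8])
 have eE: "Ecur (a, b) \<in> elliptic_curves"
 proof -
  have "4 * (fst (Ecur (a, b))) ^ 3 + 27 * (snd (Ecur (a, b))) ^ 2 \<noteq> 0"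
   unfolding f curve_scale_disc using eS c by (simp add: elliptic_curves_def)
  then show ?thesis unfolding elliptic_curves_def by (simp add: case_prod_beta)
 qed
 have "((sA s, sB s), Ecur (a, b)) \<in> twist_equivalence"
  unfolding twist_equivalence_iff using eS eE c f by (intro conjI exI[of _ c]) simp_all
 then show ?thesis using s8 eE s_def by (intro that)
qed

lemma twist_height_twist:
 assumes "(E, E') \<in> twist_equivalence"
 shows "twist_height E = twist_height E'"
proof -
 obtain c where c: "E \<in> elliptic_curves" "E' \<in> elliptic_curves" "c \<noteq> 0" "fst E' = c ^ 2 * fst E" "snd E' = c ^ 3 * snd E"
  using assms unfolding twist_equivalence_iff by (elim exE conjE) (rule that)
 obtain a1 b1 where a: "fst E' = of_int a1 / of_int b1" "b1 \<noteq> 0" by (metis Rat_cases Fract_of_int_quotient less_numeral_extra(3))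
 obtain a2 b2 where b: "snd E' = of_int a2 / of_int b2" "b2 \<noteq> 0" by (metis Rat_cases Fract_of_int_quotient less_numeral_extra(3))
 define N where "N = b1 * b2"
 have N: "of_int N \<noteq> (0 :: rat)" using a b by (simp add: N_def)
 have 1: "of_int (N * b2 * a1) = of_int N ^ 2 * fst E'" unfolding a(1) N_def using a(2) by (simp add: eval_nat_numeral)
 have 2: "of_int (N ^ 2 * b1 * a2) = of_int N ^ 3 * snd E'" unfolding b(1) N_def using b(2) by (simp add: eval_nat_numeral)
 have "twist_height E' = twht (N * b2 * a1) (N ^ 2 * b1 * a2)" by (rule twist_height_eq[OF c(2) N 1 2])
 moreover have "twist_height E = twht (N * b2 * a1) (N ^ 2 * b1 * a2)"
 proof (rule twist_height_eq[OF c(1)])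
  show "of_int N * c \<noteq> 0" using N c(3) by simp
  show "of_int (N * b2 * a1) = (of_int N * c) ^ 2 * fst E" "of_int (N ^ 2 * b1 * a2) = (of_int N * c) ^ 3 * snd E"
   unfolding 1 2 c(4,5) by (simp_all add: power_mult_distrib)
 qed
 ultimately show ?thesis by simp
qed

lemma twist_height_Ecur:
 assumes "Ecur (a, b) \<in> elliptic_curves"
 shows "twist_height (Ecur (a, b)) = Mh (of_int a) (of_int b) / real (tmd (Af a b) (Bf a b)) ^ 6"
proof -
 have "twist_height (Ecur (a, b)) = twht (Af a b) (Bf a b)"
  by (rule twist_height_eq[OF assms, of 1]) (simp_all add: Ecur_def)
 moreover have "Mh (of_int a) (of_int b) = of_int (HH (Af a b) (Bf a b))"
 proof -
  have "Af (real_of_int a) (real_of_int b) = of_int (Af a b)" "Bf (real_of_int a) (real_of_int b) = of_int (Bf a b)"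
   by (simp_all add: Af_def Bf_def Cf_def Qf_def Rf_def)
  then show ?thesis by (simp add: Mh_def HH_def A7_Af B7_Bf of_int_max)
 qed
 ultimately show ?thesis by (simp add: twht_def)
qed

subsection \<open>Pairs with equal \<open>j\<close>-invariant\<close>

lemma dvd_gcd_power:
 fixes g :: int
 assumes "g dvd P" "g dvd w ^ n"
 shows "g dvd gcd P w ^ n"
 using assms
proof (induction n arbitrary: g)
 case (Suc n)
 from division_decomp[OF Suc.prems(2)[unfolded power_Suc]]
 obtain g1 g2 where g: "g = g1 * g2" "g1 dvd w" "g2 dvd w ^ n" by (elim exE conjE) (rule that)
 have P: "g1 dvd P" "g2 dvd P" using Suc.prems(1) unfolding g(1) by (rule dvd_mult_left, rule dvd_mult_right)
 show ?case unfolding g(1) power_Suc by (rule mult_dvd_mono[OF gcd_greatest[OF P(1) g(2)] Suc.IH[OF P(2) g(3)]])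
qed simp

text \<open>The j-invariant of the curve is \<open>- Pw / Dw\<close>.\<close>

definition Pw :: "int \<Rightarrow> int \<Rightarrow> int" where "Pw a b = Cf a b * Qf a b ^ 3"
definition Dw :: "int \<Rightarrow> int \<Rightarrow> int" where "Dw a b = b * (a + 7 * b) ^ 7"

text \<open>Modulo \<open>b\<close> the numerator is \<open>a ^ 8\<close>, so only
  \<open>w = a + 7 * b\<close> can share factors with it. Modulo \<open>w\<close> it is
  \<open>7 ^ 14 * b ^ 8\<close>, and the seventh power of \<open>w\<close> raises the bound to
  \<open>7 ^ 98\<close>.\<close>

lemma gcd_Pw_Dw:
 assumes cop: "coprime a b"
 shows "gcd (Pw a b) (Dw a b) dvd 7 ^ 98"
proof -
 define w where "w = a + 7 * b"
 define g where "g = gcd (Pw a b) (Dw a b)"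
 define q where "q = gcd (Pw a b) w"
 have gP: "g dvd Pw a b" and gD: "g dvd b * w ^ 7" unfolding g_def w_def Dw_def by (rule gcd_dvd1, rule gcd_dvd2)
 have qP: "q dvd Pw a b" and qw: "q dvd w" unfolding q_def by (rule gcd_dvd1, rule gcd_dvd2)
 have cPb: "coprime (Pw a b) b"
 proof (rule coprimeI)
  fix c assume c: "c dvd Pw a b" "c dvd b"
  have "Cf a b - a ^ 2 = b * (a + 7 * b)" "Qf a b - a ^ 2 = b * (735 * b - 231 * a)"
   by (simp_all add: Cf_def Qf_def power2_eq_square algebra_simps)
  then have "[Cf a b = a ^ 2] (mod b)" "[Qf a b = a ^ 2] (mod b)" by (simp_all add: cong_iff_dvd_diff)
  then have "[Pw a b = a ^ 2 * (a ^ 2) ^ 3] (mod b)" unfolding Pw_def by (intro cong_mult cong_pow)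
  then have "b dvd Pw a b - a ^ 8" by (simp add: cong_iff_dvd_diff flip: power_mult power_add)
  then have "c dvd Pw a b - a ^ 8" by (rule dvd_trans[OF c(2)])
  then have "c dvd Pw a b - (Pw a b - a ^ 8)" by (rule dvd_diff[OF c(1)])
  then have ca: "c dvd a ^ 8" by simp
  have "coprime (a ^ 8) b" using cop by simp
  then show "is_unit c" by (rule coprime_common_divisor[OF _ ca c(2)])
 qed
 have "coprime g b" by (rule coprime_divisors[OF gP dvd_refl cPb])
 then have "g dvd w ^ 7" using gD by (simp only: coprime_dvd_mult_right_iff)
 then have 1: "g dvd q ^ 7" unfolding q_def by (rule dvd_gcd_power[OF gP])
 have "Cf a b - 49 * b ^ 2 = w * (w - 13 * b)" "Qf a b - 2401 * b ^ 2 = w * (w - 245 * b)"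
  by (simp_all add: w_def Cf_def Qf_def power2_eq_square algebra_simps)
 then have "[Cf a b = 49 * b ^ 2] (mod w)" "[Qf a b = 2401 * b ^ 2] (mod w)" by (simp_all add: cong_iff_dvd_diff)
 then have "[Pw a b = 49 * b ^ 2 * (2401 * b ^ 2) ^ 3] (mod w)" unfolding Pw_def by (intro cong_mult cong_pow)
 also have "49 * b ^ 2 * (2401 * b ^ 2) ^ 3 = 7 ^ 14 * b ^ 8" by (simp add: power_mult_distrib flip: power_mult power_add)
 finally have "w dvd Pw a b - 7 ^ 14 * b ^ 8" by (simp only: cong_iff_dvd_diff)
 then have "q dvd Pw a b - 7 ^ 14 * b ^ 8" by (rule dvd_trans[OF qw])
 then have "q dvd Pw a b - (Pw a b - 7 ^ 14 * b ^ 8)" by (rule dvd_diff[OF qP])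
 moreover have "Pw a b - (Pw a b - 7 ^ 14 * b ^ 8) = 7 ^ 14 * b ^ 8" by (rule diff_diff_eq2[THEN trans]) simp
 ultimately have "q dvd 7 ^ 14 * b ^ 8" by (simp only:)
 moreover have "coprime q b"
 proof (rule coprimeI)
  fix c assume c: "c dvd q" "c dvd b"
  have "c dvd w - 7 * b" by (rule dvd_diff[OF dvd_trans[OF c(1) qw] dvd_mult[OF c(2)]])
  then have "c dvd a" by (simp add: w_def)
  then show "is_unit c" by (rule coprime_common_divisor[OF cop _ c(2)])
 qed
 then have "coprime q (b ^ 8)" by simp
 ultimately have "q dvd 7 ^ 14" by (simp only: coprime_dvd_mult_left_iff)
 then have "q ^ 7 dvd (7 ^ 14) ^ 7" by (rule dvd_power_same)
 also have "(7 ^ 14) ^ 7 = (7 :: int) ^ 98" by (simp only: power_mult[symmetric]) simp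
 finally show ?thesis using 1 unfolding g_def by (rule dvd_trans[rotated])
qed

text \<open>For \<open>\<tau> = a / b + 7\<close> the \<open>j\<close>-invariant is a quotient \<open>P(\<tau>) / \<tau>\<^sup>7\<close> with \<open>P\<close> monic of degree 8 and
 \<open>P(0)\<close> a power of 7. Comparing denominators of equal values shows that \<open>\<tau>' / \<tau>\<close> is, up to a power
 of 7, the eighth power of a rational number of small height.\<close>

lemma collision_ratio:
 assumes cop: "coprime a b" "coprime a' b'" and b: "b > 0" "b' > 0"
  and w: "a + 7 * b \<noteq> 0" "a' + 7 * b' \<noteq> 0" and eq: "Pw a b * Dw a' b' = Pw a' b' * Dw a b"
 obtains x y g g' :: int where "x > 0" "y > 0" "g dvd 7 ^ 98" "g' dvd 7 ^ 98" "x ^ 7 dvd b' * g" "y ^ 7 dvd b * g'"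
  "(of_int (a' + 7 * b') / of_int b' :: rat) = of_int (y ^ 8 * g) / of_int (x ^ 8 * g') * (of_int (a + 7 * b) / of_int b)"
proof -
 define w where "w = a + 7 * b"
 define w' where "w' = a' + 7 * b'"
 have w0: "w \<noteq> 0" "w' \<noteq> 0" unfolding w_def w'_def by fact+
 define G where "G = gcd (Pw a b) (Dw a b)"
 define g2 where "g2 = gcd (Pw a' b') (Dw a' b')"
 have D0: "Dw a b \<noteq> 0" "Dw a' b' \<noteq> 0" using b w by (simp_all add: Dw_def)
 have G0: "G \<noteq> 0" "g2 \<noteq> 0" using D0 by (simp_all add: G_def g2_def)
 \<comment> \<open>Equal fractions in lowest terms have the same denominator up to a sign
   \<open>e\<close>, which is then absorbed into the second gcd.\<close>
 from gcd_coprime_exists[OF G0(1)[unfolded G_def]] obtain P1 D1 where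
  1: "Pw a b = P1 * G" "Dw a b = D1 * G" "coprime P1 D1" unfolding G_def[symmetric] by (elim exE conjE) (rule that)
 from gcd_coprime_exists[OF G0(2)[unfolded g2_def]] obtain P2 D2 where
  2: "Pw a' b' = P2 * g2" "Dw a' b' = D2 * g2" "coprime P2 D2" unfolding g2_def[symmetric] by (elim exE conjE) (rule that)
 have "(P1 * D2) * (G * g2) = (P2 * D1) * (G * g2)" using eq unfolding 1(1,2) 2(1,2) by (simp only: mult_ac)
 then have PD: "P1 * D2 = P2 * D1" using G0 by simp
 have "D1 dvd P1 * D2" unfolding PD by simp
 then have d12: "D1 dvd D2" using 1(3) by (simp only: coprime_dvd_mult_right_iff coprime_commute[of P1])
 have "D2 dvd P2 * D1" unfolding PD[symmetric] by simp
 then have d21: "D2 dvd D1" using 2(3) by (simp only: coprime_dvd_mult_right_iff coprime_commute[of P2])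
 have "\<bar>D2\<bar> = \<bar>D1\<bar>" by (rule zdvd_antisym_abs[OF d21 d12])
 then obtain e where e: "D2 = e * D1" "e = 1 \<or> e = - 1" by (cases "D2 = D1") (auto simp: abs_eq_iff intro: that[of 1] that[of "- 1"])
 define G' where "G' = e * g2"
 have G'0: "G' \<noteq> 0" using e G0 by (auto simp: G'_def)
 have gd: "G dvd 7 ^ 98" "G' dvd 7 ^ 98"
  using gcd_Pw_Dw[OF cop(1)] gcd_Pw_Dw[OF cop(2)] e(2) unfolding G_def[symmetric] g2_def[symmetric] G'_def by auto
 have "Dw a' b' * G = G' * Dw a b" unfolding 1(2) 2(2) e(1) G'_def by (simp only: mult_ac)
 then have E: "b' * w' ^ 7 * G = G' * (b * w ^ 7)" unfolding Dw_def w_def w'_def .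
 have "gcd w w' \<noteq> 0" using w0 by simp
 from gcd_coprime_exists[OF this] obtain x1 y1 where
  xy: "w = x1 * gcd w w'" "w' = y1 * gcd w w'" "coprime x1 y1" by (elim exE conjE) (rule that)
 define h where "h = gcd w w'"
 have h0: "h \<noteq> 0" using w0 by (simp add: h_def)
 have wh: "w = x1 * h" "w' = y1 * h" using xy(1,2) unfolding h_def by simp_all
 have x0: "x1 \<noteq> 0" "y1 \<noteq> 0" using w0 wh by auto
 have "(b' * y1 ^ 7 * G) * h ^ 7 = (G' * b * x1 ^ 7) * h ^ 7" using E unfolding wh power_mult_distrib by (simp only: mult_ac)
 then have F: "b' * y1 ^ 7 * G = G' * b * x1 ^ 7" using h0 by simp
 have c7: "coprime (x1 ^ 7) (y1 ^ 7)" using xy(3) by simp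
 have "x1 ^ 7 dvd y1 ^ 7 * (b' * G)"
 proof -
  have "y1 ^ 7 * (b' * G) = G' * b * x1 ^ 7" using F by (simp only: mult_ac)
  then show ?thesis by simp
 qed
 then have xd: "x1 ^ 7 dvd b' * G" using c7 by (simp only: coprime_dvd_mult_right_iff)
 have "y1 ^ 7 dvd x1 ^ 7 * (b * G')"
 proof -
  have "x1 ^ 7 * (b * G') = b' * y1 ^ 7 * G" using F by (simp only: mult_ac)
  then show ?thesis by simp
 qed
 then have yd: "y1 ^ 7 dvd b * G'" using c7 by (simp only: coprime_dvd_mult_right_iff coprime_commute[of "x1 ^ 7"])
 \<comment> \<open>The quotient \<open>b / b'\<close> supplies seventh powers of
   \<open>y1 / x1\<close>, and \<open>w' / w\<close> one further factor, which makes the eighth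
   power.\<close>
 have "w' * (\<bar>x1\<bar> ^ 8 * G' * b) = (\<bar>y1\<bar> ^ 8 * G * w) * b'"
 proof -
  have "w' * (x1 ^ 8 * G' * b) = (G' * b * x1 ^ 7) * (x1 * y1 * h)" by (simp add: wh eval_nat_numeral)
  also have "\<dots> = (y1 ^ 8 * G * w) * b'" unfolding F[symmetric] by (simp add: wh eval_nat_numeral)
  finally show ?thesis by (simp add: power_even_abs)
 qed
 then have fe: "of_int w' * of_int (\<bar>x1\<bar> ^ 8 * G' * b) = (of_int (\<bar>y1\<bar> ^ 8 * G * w) * of_int b' :: rat)"
  by (simp only: of_int_mult[symmetric])
 have fb: "of_int b' \<noteq> (0 :: rat)" using b by simp
 have "\<bar>x1\<bar> ^ 8 * G' * b \<noteq> 0" using x0 G'0 b by simp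
 then have fx: "of_int (\<bar>x1\<bar> ^ 8 * G' * b) \<noteq> (0 :: rat)" by (simp del: of_int_add of_int_mult of_int_power)
 have "(of_int w' / of_int b' :: rat) = of_int (\<bar>y1\<bar> ^ 8 * G * w) / of_int (\<bar>x1\<bar> ^ 8 * G' * b)"
  by (rule frac_eq_eq[OF fb fx, THEN iffD2, OF fe])
 then have R: "(of_int w' / of_int b' :: rat) = of_int (\<bar>y1\<bar> ^ 8 * G) / of_int (\<bar>x1\<bar> ^ 8 * G') * (of_int w / of_int b)" by simp
 show ?thesis
 proof (rule that[of "\<bar>x1\<bar>" "\<bar>y1\<bar>" G G'])
  show "\<bar>x1\<bar> ^ 7 dvd b' * G" "\<bar>y1\<bar> ^ 7 dvd b * G'" using xd yd by (simp_all flip: power_abs)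
 qed (use x0 gd R[unfolded w_def w'_def] in simp_all)
qed

text \<open>In the coordinate \<open>tau\<close> the j-invariant is
  \<open>- pj t / t ^ 7\<close>.\<close>

definition pj :: "rat \<Rightarrow> rat" where "pj t = (t ^ 2 - 13 * t + 49) * (t ^ 2 - 245 * t + 2401) ^ 3"

text \<open>The equation expresses that \<open>t\<close> and \<open>\<kappa> * t\<close> have the
  same j-invariant, and has degree at most 8. Its constant term is
  \<open>(\<kappa> ^ 7 - 1) * 7 ^ 14\<close>, which is nonzero because 1 is the only rational
  seventh root of 1.\<close>

lemma ratio_roots:
 assumes k: "\<kappa> \<noteq> 1"
 shows "finite {t. \<kappa> ^ 7 * pj t = pj (\<kappa> * t)}" "card {t. \<kappa> ^ 7 * pj t = pj (\<kappa> * t)} \<le> 8"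
proof -
 define p :: "rat poly" where "p = [:49, - 13, 1:] * [:2401, - 245, 1:] ^ 3"
 define q where "q = Polynomial.smult (\<kappa> ^ 7) p - pcompose p [:0, \<kappa>:]"
 have pp: "poly p t = pj t" for t by (simp add: p_def pj_def power2_eq_square algebra_simps)
 have qq: "poly q t = \<kappa> ^ 7 * pj t - pj (\<kappa> * t)" for t by (simp add: q_def poly_pcompose pp mult.commute)
 have "degree p \<le> 8"
 proof -
  have "degree p \<le> degree [:49, - 13, 1 :: rat:] + degree ([:2401, - 245, 1 :: rat:] ^ 3)" unfolding p_def by (rule degree_mult_le)
  also have "\<dots> \<le> 2 + 2 * 3" using degree_power_le[of "[:2401, - 245, 1 :: rat:]" 3] by simp
  finally show ?thesis by simp
 qed
 moreover have "degree (pcompose p [:0, \<kappa>:]) \<le> degree p * 1"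
  by (rule order_trans[OF degree_pcompose_le]) (intro mult_le_mono, auto)
 ultimately have dq: "degree q \<le> 8" unfolding q_def by (intro degree_diff_le order_trans[OF degree_smult_le]) auto
 have "q \<noteq> 0"
 proof
  assume "q = 0"
  then have "\<kappa> ^ 7 * pj 0 - pj (\<kappa> * 0) = 0" using qq[of 0] by simp
  then have k7: "\<kappa> ^ 7 = 1" by (simp add: pj_def)
  have "\<kappa> \<ge> 0"
  proof (rule ccontr)
   assume "\<not> \<kappa> \<ge> 0"
   then have "\<kappa> ^ 7 < 0" by (simp add: power_less_zero_eq)
   then show False using k7 by simp
  qed
  moreover have "\<kappa> ^ Suc 6 = 1 ^ Suc 6" using k7 by simp
  ultimately have "\<kappa> = 1" by (intro power_inject_base[of \<kappa> 6 1]) auto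
  then show False using k by simp
 qed
 then have "finite {t. poly q t = 0}" "card {t. poly q t = 0} \<le> 8"
  using poly_roots_finite card_poly_roots_bound dq le_trans by blast+
 then show "finite {t. \<kappa> ^ 7 * pj t = pj (\<kappa> * t)}" "card {t. \<kappa> ^ 7 * pj t = pj (\<kappa> * t)} \<le> 8"
  unfolding qq by simp_all
qed

definition tau :: "int \<times> int \<Rightarrow> rat" where "tau z = of_int (fst z + 7 * snd z) / of_int (snd z)"

lemma tau_inj:
 assumes cop: "coprime a b" "coprime a' b'" and b: "b > 0" "b' > 0" and t: "tau (a, b) = tau (a', b')"
 shows "a = a'" "b = b'"
proof -
 have "of_int (a + 7 * b) * of_int b' = (of_int (a' + 7 * b') * of_int b :: rat)"
  using t b by (simp add: tau_def frac_eq_eq del: of_int_add of_int_mult)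
 then have "(a + 7 * b) * b' = (a' + 7 * b') * b" by (simp only: of_int_mult[symmetric] of_int_eq_iff)
 then have e: "a * b' = a' * b" by (simp add: algebra_simps)
 have "b dvd a * b'" unfolding e by simp
 then have 1: "b dvd b'" using cop(1) by (simp only: coprime_dvd_mult_right_iff coprime_commute[of a])
 have "b' dvd a' * b" unfolding e[symmetric] by simp
 then have 2: "b' dvd b" using cop(2) by (simp only: coprime_dvd_mult_right_iff coprime_commute[of a'])
 show "b = b'" using zdvd_antisym_nonneg[OF _ _ 1 2] b by simp
 then show "a = a'" using e b by simp
qed

lemma Pw_pj: "b \<noteq> 0 \<Longrightarrow> of_int (Pw a b) = (of_int b ^ 8 * pj (tau (a, b)) :: rat)"
 and Dw_tau: "b \<noteq> 0 \<Longrightarrow> of_int (Dw a b) = (of_int b ^ 8 * tau (a, b) ^ 7 :: rat)"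
proof -
 assume b: "b \<noteq> 0"
 define t where "t = tau (a, b)"
 have bt: "of_int b * t = of_int a + 7 * of_int b" using b by (simp add: t_def tau_def)
 have "of_int b ^ 2 * (t ^ 2 - 13 * t + 49) = (of_int b * t) ^ 2 - 13 * (of_int b * t) * of_int b + 49 * of_int b ^ 2"
  by (simp add: power2_eq_square algebra_simps)
 then have C: "of_int b ^ 2 * (t ^ 2 - 13 * t + 49) = of_int (Cf a b)" unfolding bt by (simp add: Cf_def power2_eq_square algebra_simps)
 have "of_int b ^ 2 * (t ^ 2 - 245 * t + 2401) = (of_int b * t) ^ 2 - 245 * (of_int b * t) * of_int b + 2401 * of_int b ^ 2"
  by (simp add: power2_eq_square algebra_simps)
 then have Q: "of_int b ^ 2 * (t ^ 2 - 245 * t + 2401) = of_int (Qf a b)" unfolding bt by (simp add: Qf_def power2_eq_square algebra_simps)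
 have "of_int b ^ 8 * pj t = (of_int b ^ 2 * (t ^ 2 - 13 * t + 49)) * (of_int b ^ 2 * (t ^ 2 - 245 * t + 2401)) ^ 3"
  unfolding pj_def power_mult_distrib by (simp add: mult_ac flip: power_mult power_add)
 then show "of_int (Pw a b) = (of_int b ^ 8 * pj (tau (a, b)) :: rat)" unfolding C Q t_def[symmetric] by (simp add: Pw_def)
 have "of_int b ^ 8 * t ^ 7 = of_int b * (of_int b * t) ^ 7" unfolding power_mult_distrib by (simp add: eval_nat_numeral)
 then show "of_int (Dw a b) = (of_int b ^ 8 * tau (a, b) ^ 7 :: rat)" unfolding bt t_def[symmetric] by (simp add: Dw_def)
qed

definition Col :: "real \<Rightarrow> (int \<times> int) set" where
 "Col B = {(a, b). coprime a b \<and> b > 0 \<and> a + 7 * b \<noteq> 0 \<and> of_int b \<le> B \<and>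
   (\<exists>a' b'. coprime a' b' \<and> b' > 0 \<and> a' + 7 * b' \<noteq> 0 \<and> of_int b' \<le> B \<and> (a', b') \<noteq> (a, b) \<and>
    Pw a b * Dw a' b' = Pw a' b' * Dw a b)}"

text \<open>A collision is described by its ratio, which is determined by \<open>x\<close>,
  \<open>y\<close> up to \<open>N\<close> and two divisors of \<open>7 ^ 98\<close>. Each ratio
  admits at most eight parameters, and the parameter determines the coprime pair.\<close>

lemma card_Col:
 fixes B :: real
 assumes N: "\<And>x :: int. x > 0 \<Longrightarrow> of_int x ^ 7 \<le> B * 7 ^ 98 \<Longrightarrow> x \<le> int N"
 shows "finite (Col B)" "card (Col B) \<le> 8 * (N ^ 2 * card {g :: int. g dvd 7 ^ 98} ^ 2)"
proof -
 define D where "D = {g :: int. g dvd 7 ^ 98}"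
 have finD: "finite D" unfolding D_def by (rule finite_divisors_int) simp
 define Q where "Q = {1..int N} \<times> {1..int N} \<times> D \<times> D"
 define K where "K = (\<lambda>(x, y, g, g'). (of_int (y ^ 8 * g) / of_int (x ^ 8 * g') :: rat)) ` Q - {1}"
 have finQ: "finite Q" using finD by (simp add: Q_def)
 have finK: "finite K" unfolding K_def using finQ by simp
 have cK: "card K \<le> N ^ 2 * card D ^ 2"
 proof -
  have "card K \<le> card Q" unfolding K_def
   by (rule order_trans[OF card_mono[OF finite_imageI[OF finQ] Diff_subset] card_image_le[OF finQ]])
  also have "card Q = N ^ 2 * card D ^ 2" by (simp add: Q_def card_cartesian_product power2_eq_square)
  finally show ?thesis .
 qed
 define Rt where "Rt \<kappa> = {t. \<kappa> ^ 7 * pj t = pj (\<kappa> * t)}" for \<kappa>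
 have Rt: "finite (Rt \<kappa>)" "card (Rt \<kappa>) \<le> 8" if "\<kappa> \<in> K" for \<kappa>
  using ratio_roots[of \<kappa>] that by (auto simp: Rt_def K_def)
 have sub: "tau ` Col B \<subseteq> (\<Union>\<kappa>\<in>K. Rt \<kappa>)"
 proof
  fix t assume "t \<in> tau ` Col B"
  then obtain z where z: "z \<in> Col B" "t = tau z" by (elim imageE) (rule that)
  obtain a b where ab: "z = (a, b)" by (rule prod.exhaust)
  from z(1)[unfolded ab Col_def] have h: "coprime a b" "b > 0" "a + 7 * b \<noteq> 0" "of_int b \<le> B"
   "\<exists>a' b'. coprime a' b' \<and> b' > 0 \<and> a' + 7 * b' \<noteq> 0 \<and> of_int b' \<le> B \<and> (a', b') \<noteq> (a, b) \<and> Pw a b * Dw a' b' = Pw a' b' * Dw a b"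
   by simp_all
  from h(5) obtain a' b' where h': "coprime a' b'" "b' > 0" "a' + 7 * b' \<noteq> 0" "of_int b' \<le> B" "(a', b') \<noteq> (a, b)"
   "Pw a b * Dw a' b' = Pw a' b' * Dw a b" by (elim exE conjE) (rule that)
  obtain x y g g' where c: "x > 0" "y > 0" "g dvd 7 ^ 98" "g' dvd 7 ^ 98" "x ^ 7 dvd b' * g" "y ^ 7 dvd b * g'"
   "(of_int (a' + 7 * b') / of_int b' :: rat) = of_int (y ^ 8 * g) / of_int (x ^ 8 * g') * (of_int (a + 7 * b) / of_int b)"
   by (rule collision_ratio[OF h(1) h'(1) h(2) h'(2) h(3) h'(3) h'(6)]) (rule that)
  define \<kappa> :: rat where "\<kappa> = of_int (y ^ 8 * g) / of_int (x ^ 8 * g')"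
  have t': "tau (a', b') = \<kappa> * t" using c(7) by (simp add: tau_def z(2) ab \<kappa>_def)
  have le: "x \<le> int N" if x: "x > 0" and d: "x ^ 7 dvd \<beta> * g" and \<beta>: "\<beta> > 0" "of_int \<beta> \<le> B" and g: "g dvd 7 ^ 98" for x \<beta> g :: int
  proof (rule N[OF x])
   have "g \<noteq> 0" using g by auto
   then have "\<beta> * \<bar>g\<bar> > 0" using \<beta> by simp
   moreover have "x ^ 7 dvd \<beta> * \<bar>g\<bar>" using d by (cases "g \<ge> 0") simp_all
   ultimately have "x ^ 7 \<le> \<beta> * \<bar>g\<bar>" by (rule zdvd_imp_le[rotated])
   also have "\<bar>g\<bar> \<le> 7 ^ 98" using dvd_imp_le_int[OF _ g] by simp
   then have "\<beta> * \<bar>g\<bar> \<le> \<beta> * 7 ^ 98" using \<beta> by (intro mult_left_mono) auto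
   finally have "real_of_int (x ^ 7) \<le> real_of_int (\<beta> * 7 ^ 98)" by (simp only: of_int_le_iff)
   also have "\<dots> = real_of_int \<beta> * 7 ^ 98" by simp
   also have "\<dots> \<le> B * 7 ^ 98" using \<beta>(2) by (rule mult_right_mono) simp
   finally show "of_int x ^ 7 \<le> B * 7 ^ 98" by simp
  qed
  have xN: "x \<le> int N" by (rule le[OF c(1) c(5) h'(2) h'(4) c(3)])
  have yN: "y \<le> int N" by (rule le[OF c(2) c(6) h(2) h(4) c(4)])
  have k1: "\<kappa> \<noteq> 1"
  proof
   assume "\<kappa> = 1"
   then have "tau (a', b') = tau (a, b)" using t' by (simp add: z(2) ab)
   from tau_inj[OF h'(1) h(1) h'(2) h(2) this] show False using h'(5) by simp
  qed
  have "(x, y, g, g') \<in> Q" using c xN yN by (simp add: Q_def D_def)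
  then have kK: "\<kappa> \<in> K" unfolding K_def \<kappa>_def using k1[unfolded \<kappa>_def] by (intro DiffI image_eqI[of _ _ "(x, y, g, g')"]) simp_all
  have b0: "b \<noteq> 0" "b' \<noteq> 0" using h(2) h'(2) by auto
  have t0: "t \<noteq> 0"
  proof -
   have "of_int (a + 7 * b) \<noteq> (0 :: rat)" using h(3) by (simp del: of_int_add of_int_mult of_int_power)
   then show ?thesis using b0 by (simp add: z(2) ab tau_def del: of_int_add of_int_mult)
  qed
  have "of_int (Pw a b) * of_int (Dw a' b') = (of_int (Pw a' b') * of_int (Dw a b) :: rat)"
   using h'(6) by (simp only: of_int_mult[symmetric])
  then have "(of_int b ^ 8 * of_int b' ^ 8 * t ^ 7) * (\<kappa> ^ 7 * pj t) = (of_int b ^ 8 * of_int b' ^ 8 * t ^ 7) * pj (\<kappa> * t)"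
   unfolding Pw_pj[OF b0(1)] Pw_pj[OF b0(2)] Dw_tau[OF b0(1)] Dw_tau[OF b0(2)] t' z(2)[unfolded ab, symmetric] power_mult_distrib
   by (simp only: mult_ac)
  then have "\<kappa> ^ 7 * pj t = pj (\<kappa> * t)" using t0 b0 by simp
  then show "t \<in> (\<Union>\<kappa>\<in>K. Rt \<kappa>)" using kK by (intro UN_I[of \<kappa>]) (simp_all add: Rt_def)
 qed
 have inj: "inj_on tau (Col B)"
 proof (rule inj_onI)
  fix z z' assume z: "z \<in> Col B" "z' \<in> Col B" "tau z = tau z'"
  obtain a b where ab: "z = (a, b)" by (rule prod.exhaust)
  obtain a' b' where ab': "z' = (a', b')" by (rule prod.exhaust)
  have "coprime a b" "b > 0" "coprime a' b'" "b' > 0" using z(1,2) unfolding ab ab' Col_def by simp_all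
  from tau_inj[OF this(1,3,2,4) z(3)[unfolded ab ab']] show "z = z'" by (simp add: ab ab')
 qed
 have finU: "finite (\<Union>\<kappa>\<in>K. Rt \<kappa>)" using finK Rt(1) by (rule finite_UN_I)
 show "finite (Col B)" by (rule finite_imageD[OF finite_subset[OF sub finU] inj])
 have "card (Col B) = card (tau ` Col B)" by (rule card_image[OF inj, symmetric])
 also have "\<dots> \<le> card (\<Union>\<kappa>\<in>K. Rt \<kappa>)" by (rule card_mono[OF finU sub])
 also have "\<dots> \<le> (\<Sum>\<kappa>\<in>K. card (Rt \<kappa>))" by (rule card_UN_le[OF finK])
 also have "\<dots> \<le> (\<Sum>\<kappa>\<in>K. 8)" by (intro sum_mono Rt(2))
 also have "\<dots> = 8 * card K" by simp
 also have "\<dots> \<le> 8 * (N ^ 2 * card D ^ 2)" using cK by simp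
 finally show "card (Col B) \<le> 8 * (N ^ 2 * card {g :: int. g dvd 7 ^ 98} ^ 2)" unfolding D_def .
qed

subsection \<open>Counting twist classes\<close>

text \<open>A twist preserves the ratio of \<open>A ^ 3\<close> to \<open>B ^ 2\<close>. After the
  nonzero factors \<open>Cf\<close> are cancelled, \<open>forms_disc\<close> replaces
  \<open>Rf ^ 2\<close> by a combination of \<open>Pw\<close> and \<open>Dw\<close>.\<close>

lemma twist_Pw:
 assumes tw: "(Ecur (a, b), Ecur (a', b')) \<in> twist_equivalence" and nz: "(a, b) \<noteq> (0, 0)" "(a', b') \<noteq> (0, 0)"
 shows "Pw a b * Dw a' b' = Pw a' b' * Dw a b"
proof -
 obtain c where c: "c \<noteq> 0" "rat_of_int (Af a' b') = c ^ 2 * of_int (Af a b)" "rat_of_int (Bf a' b') = c ^ 3 * of_int (Bf a b)"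
  using tw unfolding twist_equivalence_iff Ecur_def fst_conv snd_conv by (elim exE conjE) (rule that)
 have "(of_int (Af a b) ^ 3 * of_int (Bf a' b') ^ 2 :: rat) = of_int (Af a' b') ^ 3 * of_int (Bf a b) ^ 2"
  unfolding c(2,3) by (simp add: power_mult_distrib flip: power_mult)
 then have "of_int (Af a b ^ 3 * Bf a' b' ^ 2) = (of_int (Af a' b' ^ 3 * Bf a b ^ 2) :: rat)" by simp
 then have e: "Af a b ^ 3 * Bf a' b' ^ 2 = Af a' b' ^ 3 * Bf a b ^ 2" by (simp only: of_int_eq_iff)
 have C0: "Cf a b \<noteq> 0" if "(a, b) \<noteq> (0, 0)" for a b :: int
 proof
  assume h: "Cf a b = 0"
  have "Cf (real_of_int a) (real_of_int b) = of_int (Cf a b)" by (simp add: Cf_def)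
  then have "Cf (real_of_int a) (real_of_int b) = 0" using h by simp
  then show False using Cf_zero[of "real_of_int a" "real_of_int b"] that by simp
 qed
 have "(- 108 * Cf a b ^ 2 * Cf a' b' ^ 2) * (Pw a b * Rf a' b' ^ 2) = Af a b ^ 3 * Bf a' b' ^ 2"
  by (simp add: Af_def Bf_def Pw_def power_mult_distrib eval_nat_numeral)
 also have "\<dots> = (- 108 * Cf a b ^ 2 * Cf a' b' ^ 2) * (Pw a' b' * Rf a b ^ 2)"
  unfolding e by (simp add: Af_def Bf_def Pw_def power_mult_distrib eval_nat_numeral)
 finally have "Pw a b * Rf a' b' ^ 2 = Pw a' b' * Rf a b ^ 2" using C0[OF nz(1)] C0[OF nz(2)] by simp
 moreover have "Rf a b ^ 2 = Pw a b + 1728 * Dw a b" for a b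
  using forms_disc[of a b] by (simp add: Pw_def Dw_def)
 ultimately show ?thesis by (simp add: algebra_simps)
qed

lemma Pf_finite: "X > 0 \<Longrightarrow> finite (Pf X)"
proof -
 assume X: "X > 0"
 define N where "N = max 1 (nat \<lceil>8 * of_int kap * Bd * X powr (1 / 6)\<rceil>)"
 have "N \<ge> 1" by (simp add: N_def)
 moreover have "nat \<lceil>8 * of_int kap * Bd * X powr (1 / 6)\<rceil> \<le> N" by (simp add: N_def)
 then have "real N \<ge> 8 * of_int kap * Bd * X powr (1 / 6)" by linarith
 ultimately show "finite (Pf X)" by (rule count_identity(1)[OF X])
qed

definition Pp :: "real \<Rightarrow> (int \<times> int) set" where
 "Pp X = {z \<in> Pf X. snd z > 0 \<and> fst z + 7 * snd z \<noteq> 0}"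

abbreviation cls :: "curve \<Rightarrow> curve set" where "cls E \<equiv> twist_equivalence `` {E}"

lemma Pp_height:
 assumes cop: "coprime a b" and b: "b > 0" and w: "a + 7 * b \<noteq> 0"
 shows "(a, b) \<in> Pp X \<longleftrightarrow> twist_height (Ecur (a, b)) \<le> X"
proof -
 have b0: "b \<noteq> 0" using b by simp
 have E: "Ecur (a, b) \<in> elliptic_curves" by (rule Ecur_family[OF w b0])
 have "real (tmd (Af a b) (Bf a b)) ^ 6 > 0" using tmd_cube(2)[OF cop] by simp
 then show ?thesis unfolding twist_height_Ecur[OF E] using cop b w by (simp add: Pp_def Pf_def divide_le_eq)
qed

text \<open>Every class in question contains a family member, whose parameter corresponds to a
  rational number in lowest terms, hence to a coprime pair. Twist invariance of the height carries
  the height condition along.\<close>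

lemma quotient_Pp:
 "{E \<in> elliptic_curves. twist_height E \<le> X \<and> admits_cyclic_isogeny 7 E} // twist_equivalence = (\<lambda>z. cls (Ecur z)) ` Pp X"
proof (intro equalityI subsetI)
 fix T assume "T \<in> {E \<in> elliptic_curves. twist_height E \<le> X \<and> admits_cyclic_isogeny 7 E} // twist_equivalence"
 then obtain E where E: "E \<in> elliptic_curves" "twist_height E \<le> X" "admits_cyclic_isogeny 7 E" and T: "T = cls E"
  unfolding quotient_def by auto
 obtain s c where sc: "s \<noteq> 8" "c \<noteq> 0" "fst E = c ^ 2 * sA s" "snd E = c ^ 3 * sB s"
  using isogeny7_family[OF E(3)] by (elim exE conjE) (rule that)
 have 1: "((sA s, sB s), E) \<in> twist_equivalence"
  unfolding twist_equivalence_iff fst_conv snd_conv using sc E(1) family_admits_isogeny(1)[OF sc(1)]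
  by (intro conjI exI[of _ c]) simp_all
 \<comment> \<open>The inverse of \<open>s = (8 t + 7) / (t + 7)\<close>.\<close>
 define t where "t = - 7 - 49 / (s - 8)"
 obtain a b where ab: "quotient_of t = (a, b)" by (rule prod.exhaust)
 have b: "b > 0" and cop: "coprime a b" and tab: "t = of_int a / of_int b"
  using quotient_of_denom_pos[OF ab] quotient_of_coprime[OF ab] quotient_of_div[OF ab] by simp_all
 have b0: "of_int b \<noteq> (0 :: rat)" "b \<noteq> 0" using b by simp_all
 have s8: "s - 8 \<noteq> 0" using sc(1) by simp
 have wb: "(of_int a + 7 * of_int b) * (s - 8) = - 49 * of_int b"
 proof -
  have "t + 7 = - (49 / (s - 8))" by (simp add: t_def)
  moreover have "49 / (s - 8) * (s - 8) = 49" by (rule nonzero_eq_divide_eq[OF s8, THEN iffD1, OF refl])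
  ultimately have "(t + 7) * (s - 8) = - 49" by (simp only: mult_minus_left)
  then have "(of_int a / of_int b + 7) * (s - 8) * of_int b = - 49 * of_int b" unfolding tab by simp
  moreover have "(of_int a / of_int b + 7) * of_int b = of_int a + 7 * (of_int b :: rat)" using b0 by (simp add: distrib_right)
  ultimately show ?thesis by (metis mult.assoc mult.commute)
 qed
 have w': "of_int a + 7 * of_int b \<noteq> (0 :: rat)" using wb b0 by auto
 have w: "a + 7 * b \<noteq> 0"
 proof
  assume "a + 7 * b = 0"
  then have "of_int (a + 7 * b) = (0 :: rat)" by simp
  then show False using w' by simp
 qed
 obtain s' :: rat where s': "s' = (8 * of_int a + 7 * of_int b) / (of_int a + 7 * of_int b)"
  and Ec: "Ecur (a, b) \<in> elliptic_curves" "((sA s', sB s'), Ecur (a, b)) \<in> twist_equivalence"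
  by (rule Ecur_family[OF w b0(2)]) (rule that)
 have "s * (of_int a + 7 * of_int b) = 8 * of_int a + 7 * of_int b" using wb by (simp add: algebra_simps)
 then have "s = s'" unfolding s' using w' by (simp add: eq_divide_eq)
 then have 2: "((sA s, sB s), Ecur (a, b)) \<in> twist_equivalence" using Ec(2) by simp
 have "twist_height (Ecur (a, b)) \<le> X" using E(2) twist_height_twist[OF 1] twist_height_twist[OF 2] by simp
 then have "(a, b) \<in> Pp X" by (rule Pp_height[OF cop b w, THEN iffD2])
 moreover have "T = cls (Ecur (a, b))"
  unfolding T equiv_class_eq[OF twist_class_equiv 1, symmetric] by (rule equiv_class_eq[OF twist_class_equiv 2])
 ultimately show "T \<in> (\<lambda>z. cls (Ecur z)) ` Pp X" by (intro image_eqI[of _ _ "(a, b)"])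
next
 fix T assume "T \<in> (\<lambda>z. cls (Ecur z)) ` Pp X"
 then obtain z where zP: "z \<in> Pp X" "T = cls (Ecur z)" by (elim imageE) (rule that)
 obtain a b where z: "z = (a, b)" by (rule prod.exhaust)
 have h: "coprime a b" "b > 0" "a + 7 * b \<noteq> 0" using zP(1) unfolding z Pp_def Pf_def by simp_all
 have b0: "b \<noteq> 0" using h(2) by simp
 have th: "twist_height (Ecur (a, b)) \<le> X" by (rule Pp_height[OF h, THEN iffD1]) (use zP(1) z in simp)
 obtain s :: rat where s: "s \<noteq> 8" "((sA s, sB s), Ecur (a, b)) \<in> twist_equivalence"
  by (rule Ecur_family[OF h(3) b0]) (rule that)
 have "(sA s, sB s) \<in> {E \<in> elliptic_curves. twist_height E \<le> X \<and> admits_cyclic_isogeny 7 E}"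
  using family_admits_isogeny[OF s(1)] th twist_height_twist[OF s(2)] by simp
 moreover have "T = cls (sA s, sB s)"
  unfolding zP(2) z by (rule equiv_class_eq[OF twist_class_equiv s(2), symmetric])
 ultimately show "T \<in> {E \<in> elliptic_curves. twist_height E \<le> X \<and> admits_cyclic_isogeny 7 E} // twist_equivalence"
  by (simp only: quotientI)
qed

lemma card_Pf_Pp:
 assumes X: "X > 0"
 shows "card (Pf X) \<le> card (Pp X) + 3" "card (Pp X) \<le> card (Pf X)"
proof -
 have fin: "finite (Pf X)" by (rule Pf_finite[OF X])
 have sub: "Pp X \<subseteq> Pf X" by (auto simp: Pp_def)
 show "card (Pp X) \<le> card (Pf X)" by (rule card_mono[OF fin sub])
 have "Pf X \<subseteq> Pp X \<union> {(1, 0), (- 1, 0), (- 7, 1)}"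
 proof
  fix z assume z: "z \<in> Pf X"
  obtain a b where ab: "z = (a, b)" by (rule prod.exhaust)
  have h: "coprime a b" "b \<ge> 0" using z unfolding ab Pf_def by simp_all
  show "z \<in> Pp X \<union> {(1, 0), (- 1, 0), (- 7, 1)}"
  proof (cases "b = 0")
   case True
   then have "\<bar>a\<bar> = 1" using h(1) by simp
   then have "a = 1 \<or> a = - 1" by linarith
   then show ?thesis using True ab by auto
  next
   case b0: False
   show ?thesis
   proof (cases "a + 7 * b = 0")
    case True
    then have a: "a = b * - 7" by simp
    then have "b dvd a" by simp
    then have "is_unit b" by (rule coprime_common_divisor[OF h(1) _ dvd_refl])
    then have "b = 1" using h(2) by simp
    then show ?thesis using a ab by simp
   next
    case False
    then show ?thesis using z b0 h(2) by (simp add: Pp_def ab)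
   qed
  qed
 qed
 then have "card (Pf X) \<le> card (Pp X \<union> {(1, 0), (- 1, 0), (- 7, 1)})"
  by (intro card_mono) (use finite_subset[OF sub fin] in auto)
 also have "\<dots> \<le> card (Pp X) + card {(1, 0), (- 1, 0), (- 7, 1 :: int) :: int \<times> int}" by (rule card_Un_le)
 also have "\<dots> \<le> card (Pp X) + 3" by (simp add: card_insert_if)
 finally show "card (Pf X) \<le> card (Pp X) + 3" .
qed

text \<open>The crude estimate of \<open>b\<close> by \<open>b ^ 2\<close> gives order
  \<open>X powr (1 / 4)\<close>. Collisions number about the power 2/7 of this bound, that is
  \<open>X powr (1 / 14)\<close>, which is still below the error term.\<close>

lemma Pf_bound:
 assumes X: "X > 0" and z: "(a, b) \<in> Pf X"
 shows "of_int b \<le> (8 * of_int kap * Bd * X powr (1 / 6)) powr (3 / 2)"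
proof -
 define V where "V = 8 * of_int kap * Bd * X powr (1 / 6)"
 define e where "e = tmd (Af a b) (Bf a b)"
 have cop: "coprime a b" and M: "Mh (of_int a) (of_int b) \<le> X * real e ^ 6" using z by (auto simp: Pf_def e_def)
 have e0: "e > 0" using tmd_cube(2)[OF cop] by (simp add: e_def)
 have V0: "V > 0" using kap_pos Bd(1) X by (simp add: V_def)
 have BV: "Bd * X powr (1 / 6) \<le> V"
 proof -
  have "1 * (Bd * X powr (1 / 6)) \<le> 8 * of_int kap * (Bd * X powr (1 / 6))"
   using kap_pos Bd(1) by (intro mult_right_mono) auto
  then show ?thesis by (simp add: V_def mult_ac)
 qed
 have "real e ^ 2 \<le> V" using Pf_tmd[OF X z] by (simp add: V_def e_def)
 then have "real e \<le> sqrt V" by (rule real_le_rsqrt)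
 have "\<bar>b\<bar> \<le> b ^ 2" using self_le_power[of "\<bar>b\<bar>" 2] by (cases "b = 0") auto
 moreover have "a ^ 2 \<ge> 0" by simp
 ultimately have "b \<le> a ^ 2 + b ^ 2" by linarith
 then have "real_of_int b \<le> real_of_int (a ^ 2 + b ^ 2)" by (simp only: of_int_le_iff)
 also have "\<dots> \<le> Bd * X powr (1 / 6) * real e" by (rule size_bounds(1)[OF X e0 M])
 also have "\<dots> \<le> V * sqrt V" using BV V0 \<open>real e \<le> sqrt V\<close> by (intro mult_mono) auto
 also have "\<dots> = V powr (3 / 2)" using V0 powr_add[of V 1 "1 / 2"] by (simp add: powr_half_sqrt)
 finally show ?thesis unfolding V_def .
qed

lemma collisions:
 assumes X: "X > 0"
 defines "B \<equiv> (8 * of_int kap * Bd * X powr (1 / 6)) powr (3 / 2)"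
 assumes fin: "finite (Col B)"
 shows "card (Pp X) \<le> card ((\<lambda>z. cls (Ecur z)) ` Pp X) + card (Col B)"
proof -
 let ?f = "\<lambda>z. cls (Ecur z)"
 have finP: "finite (Pp X)" by (rule finite_subset[OF _ Pf_finite[OF X]]) (auto simp: Pp_def)
 have P: "coprime a b" "b > 0" "a + 7 * b \<noteq> 0" "of_int b \<le> B" "Ecur (a, b) \<in> elliptic_curves" if z: "(a, b) \<in> Pp X" for a b
 proof -
  have zP: "(a, b) \<in> Pf X" using z by (simp add: Pp_def)
  show h: "coprime a b" "b > 0" "a + 7 * b \<noteq> 0" using z unfolding Pp_def Pf_def by simp_all
  show "of_int b \<le> B" unfolding B_def by (rule Pf_bound[OF X zP])
  have "b \<noteq> 0" using h(2) by simp
  then show "Ecur (a, b) \<in> elliptic_curves" by (rule Ecur_family[OF h(3)])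
 qed
 have "inj_on ?f (Pp X - Col B)"
 proof (rule inj_onI, rule ccontr)
  fix z z' assume z: "z \<in> Pp X - Col B" "z' \<in> Pp X - Col B" and e: "cls (Ecur z) = cls (Ecur z')" and ne: "z \<noteq> z'"
  obtain a b where ab: "z = (a, b)" by (rule prod.exhaust)
  obtain a' b' where ab': "z' = (a', b')" by (rule prod.exhaust)
  have zP: "(a, b) \<in> Pp X" "(a', b') \<in> Pp X" using z ab ab' by simp_all
  note p = P[OF zP(1)] and p' = P[OF zP(2)]
  have "(Ecur (a, b), Ecur (a', b')) \<in> twist_equivalence"
   by (rule eq_equiv_class[OF e[unfolded ab ab'] twist_class_equiv p'(5)])
  then have pe: "Pw a b * Dw a' b' = Pw a' b' * Dw a b" by (rule twist_Pw) (use p(2) p'(2) in simp_all)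
  have ne': "(a', b') \<noteq> (a, b)" using ne ab ab' by metis
  have "\<exists>a' b'. coprime a' b' \<and> b' > 0 \<and> a' + 7 * b' \<noteq> 0 \<and> of_int b' \<le> B \<and> (a', b') \<noteq> (a, b) \<and> Pw a b * Dw a' b' = Pw a' b' * Dw a b"
   by (rule exI[of _ a'], rule exI[of _ b'], intro conjI p'(1) p'(2) p'(3) p'(4) ne' pe)
  then have "(a, b) \<in> Col B" using p(1-4) unfolding Col_def by simp
  then show False using z(1) ab by simp
 qed
 then have "card (Pp X - Col B) = card (?f ` (Pp X - Col B))" by (rule card_image[symmetric])
 also have "\<dots> \<le> card (?f ` Pp X)" by (rule card_mono) (use finP in auto)
 finally have "card (Pp X - Col B) \<le> card (?f ` Pp X)" .
 moreover have "card (Pp X) \<le> card (Pp X - Col B) + card (Col B)"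
  using diff_card_le_card_Diff[OF fin, of "Pp X"] by linarith
 ultimately show ?thesis by linarith
qed

lemma N_tw_Pf:
 obtains K where "K \<ge> 0" "\<And>X. X \<ge> 2 \<Longrightarrow> \<bar>real (N_tw 7 X) - real (card (Pf X))\<bar> \<le> 3 + K * X powr (1 / 12)"
proof -
 define V0 where "V0 = 8 * real_of_int kap * Bd"
 have V0: "V0 > 0" using kap_pos Bd(1) by (simp add: V0_def)
 define c where "c = card {g :: int. g dvd 7 ^ 98}"
 define K where "K = 8 * ((7 ^ 14) ^ 2 * V0 powr (3 / 7) * real c ^ 2)"
 show ?thesis
 proof (rule that[of K])
  show "K \<ge> 0" by (simp add: K_def)
  fix X :: real assume X2: "X \<ge> 2"
  then have X: "X > 0" by simp
  define B where "B = (8 * of_int kap * Bd * X powr (1 / 6)) powr (3 / 2)"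
  have B: "B = (V0 * X powr (1 / 6)) powr (3 / 2)" by (simp add: B_def V0_def)
  have B0: "B > 0" unfolding B using V0 X by simp
  \<comment> \<open>The seventh root of \<open>B * 7 ^ 98\<close>, the largest size of a possible
    \<open>x\<close> or \<open>y\<close> in a collision ratio.\<close>
  define N where "N = nat \<lfloor>7 ^ 14 * B powr (1 / 7)\<rfloor>"
  have N: "x \<le> int N" if x: "x > 0" "of_int x ^ 7 \<le> B * 7 ^ 98" for x :: int
  proof -
   have "real_of_int x = (of_int x ^ 7) powr (1 / 7)" using x(1) power_powr[of "real_of_int x" 7 "1 / 7"] by simp
   also have "\<dots> \<le> (B * 7 ^ 98) powr (1 / 7)" using x by (intro powr_mono2) auto
   also have "\<dots> = B powr (1 / 7) * 7 ^ 14"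
   proof -
    have "(7 ^ 98 :: real) = (7 ^ 14) ^ 7" by (simp only: power_mult[symmetric]) simp
    moreover have "((7 ^ 14) ^ 7) powr (1 / 7) = (7 ^ 14 :: real)" using power_powr[of "7 ^ 14 :: real" 7 "1 / 7"] by simp
    ultimately show ?thesis using B0 by (simp only: powr_mult)
   qed
   finally have "real_of_int x \<le> 7 ^ 14 * B powr (1 / 7)" by (simp only: mult.commute)
   then show ?thesis unfolding N_def using x(1) by linarith
  qed
  note col = card_Col[OF N]
  have "real N \<le> 7 ^ 14 * B powr (1 / 7)" unfolding N_def using B0 by (intro of_nat_floor) auto
  then have "real N ^ 2 \<le> (7 ^ 14 * B powr (1 / 7)) ^ 2" by (rule power_mono) simp
  also have "\<dots> = (7 ^ 14) ^ 2 * (B powr (1 / 7)) ^ 2" by (simp only: power_mult_distrib)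
  also have "(B powr (1 / 7)) ^ 2 = V0 powr (3 / 7) * X powr (1 / 14)"
  proof -
   have "(B powr (1 / 7)) ^ 2 = (V0 * X powr (1 / 6)) powr (3 / 7)"
    unfolding B by (simp add: powr_powr power2_eq_square flip: powr_add)
   also have "\<dots> = V0 powr (3 / 7) * X powr (1 / 14)" using V0 by (simp add: powr_mult powr_powr)
   finally show ?thesis .
  qed
  also have "X powr (1 / 14) \<le> X powr (1 / 12)" using X2 by (intro powr_mono) auto
  finally have N2: "real N ^ 2 \<le> (7 ^ 14) ^ 2 * (V0 powr (3 / 7) * X powr (1 / 12))" by (simp add: mult_left_mono)
  have "real (card (Col B)) \<le> real (8 * (N ^ 2 * c ^ 2))" using col(2) unfolding c_def by (simp only: of_nat_le_iff)
  also have "\<dots> = 8 * (real N ^ 2 * real c ^ 2)" by simp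
  also have "\<dots> \<le> 8 * ((7 ^ 14) ^ 2 * (V0 powr (3 / 7) * X powr (1 / 12)) * real c ^ 2)"
   by (intro mult_left_mono mult_right_mono N2) auto
  also have "\<dots> = K * X powr (1 / 12)" by (simp add: K_def mult_ac)
  finally have cc: "real (card (Col B)) \<le> K * X powr (1 / 12)" .
  have Nt: "N_tw 7 X = card ((\<lambda>z. cls (Ecur z)) ` Pp X)" unfolding N_tw_def quotient_Pp ..
  have finP: "finite (Pp X)" by (rule finite_subset[OF _ Pf_finite[OF X]]) (auto simp: Pp_def)
  have "N_tw 7 X \<le> card (Pf X)" unfolding Nt using card_image_le[OF finP] card_Pf_Pp(2)[OF X] by (rule le_trans)
  moreover have "card (Pf X) \<le> N_tw 7 X + card (Col B) + 3"
   using collisions[OF X, folded B_def, OF col(1)] card_Pf_Pp(1)[OF X] unfolding Nt by linarith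
  ultimately show "\<bar>real (N_tw 7 X) - real (card (Pf X))\<bar> \<le> 3 + K * X powr (1 / 12)" using cc by linarith
 qed
qed

theorem theorem4p3p4:
  "\<exists>C. \<forall>X\<ge>2. \<bar>real (N_tw 7 X) - c7_tw * X powr (1 / 6)\<bar>
      \<le> C * (X powr (1 / 12) * ln X ^ 5)"
proof -
 obtain K where K: "K \<ge> 0" "\<And>X. X \<ge> 2 \<Longrightarrow> \<bar>real (card (Pf X)) - c7_tw * X powr (1 / 6)\<bar> \<le> K * (X powr (1 / 12) * ln X ^ 5)"
  by (rule Pf_count) (rule that)
 obtain K' where K': "K' \<ge> 0" "\<And>X. X \<ge> 2 \<Longrightarrow> \<bar>real (N_tw 7 X) - real (card (Pf X))\<bar> \<le> 3 + K' * X powr (1 / 12)"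
  by (rule N_tw_Pf) (rule that)
 show ?thesis
 proof (rule exI[of _ "(3 + K') * 32 + K"], intro allI impI)
  fix X :: real assume X: "X \<ge> 2"
  \<comment> \<open>For \<open>X \<ge> 2\<close> the logarithm is at least 1/2, so
    \<open>32 * ln X ^ 5\<close> is at least 1 and absorbs the cusps and collisions.\<close>
  have "exp (1 / 2) \<le> (2 :: real)" using exp_bound[of "1 / 2"] by (simp add: power2_eq_square)
  then have "exp (1 / 2) \<le> X" using X by linarith
  then have "1 / 2 \<le> ln X" by (rule ln_ge_iff[THEN iffD2, rotated]) (use X in simp)
  then have "(1 / 2) ^ 5 \<le> ln X ^ 5" by (rule power_mono) simp
  then have l: "1 \<le> 32 * ln X ^ 5" by (simp add: power_divide)
  have p1: "1 \<le> X powr (1 / 12)" using X by (intro ge_one_powr_ge_zero) auto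
  have "3 * 1 \<le> 3 * X powr (1 / 12)" by (rule mult_left_mono[OF p1]) simp
  then have "3 + K' * X powr (1 / 12) \<le> (3 + K') * X powr (1 / 12)" by (simp add: distrib_right)
  also have "\<dots> = (3 + K') * X powr (1 / 12) * 1" by simp
  also have "\<dots> \<le> (3 + K') * X powr (1 / 12) * (32 * ln X ^ 5)" using K'(1) by (intro mult_left_mono l) auto
  finally have "3 + K' * X powr (1 / 12) \<le> (3 + K') * 32 * (X powr (1 / 12) * ln X ^ 5)" by (simp only: mult_ac)
  moreover have "\<bar>real (N_tw 7 X) - c7_tw * X powr (1 / 6)\<bar> \<le> (3 + K' * X powr (1 / 12)) + K * (X powr (1 / 12) * ln X ^ 5)"
   using K(2)[OF X] K'(2)[OF X] by linarith
  ultimately have "\<bar>real (N_tw 7 X) - c7_tw * X powr (1 / 6)\<bar> \<le> (3 + K') * 32 * (X powr (1 / 12) * ln X ^ 5) + K * (X powr (1 / 12) * ln X ^ 5)"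
   by linarith
  then show "\<bar>real (N_tw 7 X) - c7_tw * X powr (1 / 6)\<bar> \<le> ((3 + K') * 32 + K) * (X powr (1 / 12) * ln X ^ 5)"
   by (simp only: distrib_right)
 qed
qed

end
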